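(* Let $H$ be a separable Hilbert space, let $\phi=\{\phi_t\}_{t\ge 0}$ and $\theta=\{\theta_t\}_{t\ge0}$ be strongly commuting CP$_0$-semigroups on $B(H)$, and let $\alpha,\beta$ be the commuting E$_0$-semigroups on $B(K)$, $K\supseteq H$, which form the product-system E$_0$-dilation of $(\phi,\theta)$ described in the context. If $\phi$ is not a semigroup of automorphisms (i.e. not every $\phi_t$ is a $*$-automorphism of $B(H)$), then $\alpha$ is cocycle conjugate to the minimal E$_0$-dilation of $\phi$.
   Context: **Semigroups.** A CP$_0$-semigroup on $B(H)$ is a family $\phi=\{\phi_t\}_{t\ge0}$ of contractive, normal, unital, completely positive maps on $B(H)$ with $\phi_0=\mathrm{id}$, $\phi_{s+t}=\phi_s\circ\phi_t$, and $t\mapsto\langle\phi_t(A)h,g\rangle$ continuous for all $A\in B(H)$, $h,g\in H$. It is an E$_0$-semigroup if each $\phi_t$ is a $*$-endomorphism. **Minimal E$_0$-dilation.** An E$_0$-dilation of $\phi$ is an E$_0$-semigroup $\sigma$ on $B(G)$, $G\supseteq H$, with $\phi_t(P_HAP_H)=P_H\sigma_t(A)P_H$ for all $t\ge0$, $A\in B(G)$. It is minimal if the von Neumann algebra generated by $\bigcup_{t\ge0}\sigma_t(P_HB(G)P_H)$ is $B(G)$. By Bhat's theorem every CP$_0$-semigroup has a minimal E$_0$-dilation, unique up to conjugacy. **Cocycle conjugacy.** E$_0$-semigroups $\gamma$ on $B(G)$ and $\gamma'$ on $B(G')$ are conjugate if there is a $*$-isomorphism $\pi:B(G)\to B(G')$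 with $\pi\circ\gamma_t=\gamma'_t\circ\pi$ for all $t$. A $\gamma$-cocycle is a strongly continuous family of unitaries $U_t\in B(G)$, $t\ge0$, with $U_{s+t}=U_s\gamma_s(U_t)$. $\gamma$ and $\gamma'$ are cocycle conjugate if $\gamma'$ is conjugate to $A\mapsto U_t\gamma_t(A)U_t^*$ for some $\gamma$-cocycle $U$. **Strong commutation.** For normal unital CP maps $\Phi,\Theta$ on $B(H)$ let $B(H)\otimes_\Phi B(H)\otimes_\Theta H$ be the Hausdorff completion of the algebraic tensor product with respect to $\langle a\otimes b\otimes h,\,c\otimes d\otimes k\rangle=\langle h,\Theta(b^*\Phi(a^*c)d)k\rangle$. $\Phi$ and $\Theta$ commute strongly if they commute and there is a unitary $u:B(H)\otimes_\Phi B(H)\otimes_\Theta H\to B(H)\otimes_\Theta B(H)\otimes_\Phi H$ with $u(a\otimes I\otimes h)=a\otimes I\otimes h$ and $u(ca\otimes b\otimes h)=(c\otimes I\otimes I)u(a\otimes b\otimes h)$ for all $a,b,c\in B(H)$, $h\in H$. Semigroups $\phi,\theta$ commute strongly if $\phi_s$ and $\theta_t$ commute strongly for all $s,t\ge 0$. **Product systems of Hilbert spaces and representations.** A product system over a commutative additive semigroup $\mathcal S$ with unit $0$ is a family $X=\{X(s)\}_{s\in\mathcal S}$ of Hilbert spaces with $X(0)=\mathbb C$ and unitaries $X(s)\otimes X(t)\to X(s+t)$ that are associative and are given by scalar multiplication when $s=0$ or $t=0$; one identifies $X(s)\otimes X(t)$ with $X(s+t)$. A (completely contractive) representation $T$ of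 $X$ on a Hilbert space $H$ is a family of completely contractive linear maps $T_s:X(s)\to B(H)$ with $T_0(c)=cI$ and $T_{s+t}(x\otimes y)=T_s(x)T_t(y)$. Write $\widetilde T_s:X(s)\otimes H\to H$ for the contraction $\widetilde T_s(x\otimes h)=T_s(x)h$. $T$ is isometric (resp. fully-coisometric) if all $\widetilde T_s$ are isometries (resp. coisometries). An isometric dilation of $T$ is an isometric representation $V$ of $X$ on some $K\supseteq H$ with $P_HV_s(x)|_H=T_s(x)$ and $P_HV_s(x)|_{K\ominus H}=0$ for all $s$, $x\in X(s)$. It is minimal if $K=\bigvee_{s}V_s(X(s))H$. **The Muhly–Solel product system of a CP$_0$-semigroup $\phi$ on $B(H)$.** For $t>0$ and a partition $P=\{0=t_0<t_1<\dots<t_n=t\}$, with $\tau_i=t_i-t_{i-1}$, let $H_P$ be the Hausdorff completion of $B(H)^{\otimes n}\otimes H$ for $\langle a_1\otimes\cdots\otimes a_n\otimes h,\,b_1\otimes\cdots\otimes b_n\otimes k\rangle=\langle h,\phi_{\tau_n}(a_n^*\phi_{\tau_{n-1}}(\cdots\phi_{\tau_1}(a_1^*b_1)\cdots)b_n)k\rangle$. $B(H)$ acts on $H_P$ by left multiplication on the first factor. Subdividing the $i$-th interval gives an isometric embedding of $H_P$ into the space of the refined partition by inserting $I$ right after $a_i$. Let $H_t$ be the Hilbert space direct limit over partitions, and $\iota_t:H\to H_t$ the isometry $h\mapsto I\otimes\cdots\otimes I\otimes h$. Put $E(t)=\{X\in B(H,H_t): XA=A\cdot X\ \ \forall A\in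 B(H)\}$, a Hilbert space with $\langle X,Y\rangle I=X^*Y$, $E(0)=\mathbb C$, with multiplication $E(t)\otimes E(s)\to E(t+s)$, $X\otimes Y\mapsto(I\otimes X)Y$, where $I\otimes X:H_s\to H_{s+t}$ maps $a_1\otimes\cdots\otimes a_n\otimes h$ to $a_1\otimes\cdots\otimes a_n\otimes Xh$. Let $T^E_t(X)=\iota_t^*X$ and $T^E_0(c)=cI$. Then $T^E$ is a fully-coisometric representation of $E$ on $H$ and $\phi_t(A)=\widetilde{T^E_t}(I\otimes A)\widetilde{T^E_t}^{*}$. **The product-system E$_0$-dilation of $(\phi,\theta)$.** Let $(E,T^E)$ and $(F,T^F)$ be the Muhly–Solel product systems and representations of $\phi$ and $\theta$. By strong commutation (known result of Shalit) there is a product system $X$ over $\mathbb R_+^2$ with $X(s,t)=E(s)\otimes F(t)$, whose multiplication restricts to those of $E=\{X(s,0)\}$ and $F=\{X(0,t)\}$, with $X(s,0)\otimes X(0,t)\to X(s,t)$ the identity map, and with $X(0,t)\otimes X(s,0)\to X(s,t)$ given by unitaries $F(t)\otimes E(s)\to E(s)\otimes F(t)$ arising from the strong-commutation unitaries, such that $T_{(s,t)}(x\otimes y)=T^E_s(x)T^F_t(y)$ is a fully-coisometric representation of $X$ on $H$. There are also a separable Hilbert space $K\supseteq H$ and an isometric and fully-coisometric representation $V$ of $X$ on $K$ which is a minimal isometric dilation of $T$, such that, with $V^E_t(x)=V_{(t,0)}(x\otimes1)$ for $x\in E(t)$ and $V^F_t(y)=V_{(0,t)}(1\otimes y)$ for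 $y\in F(t)$, the formulas $$\alpha_t(A)=\widetilde{V^E_t}(I\otimes A)\widetilde{V^E_t}^{*},\qquad \beta_t(A)=\widetilde{V^F_t}(I\otimes A)\widetilde{V^F_t}^{*}\qquad(A\in B(K))$$ define commuting E$_0$-semigroups on $B(K)$ satisfying $\phi_s\circ\theta_t(P_HAP_H)=P_H\,\alpha_s\circ\beta_t(A)\,P_H$ for all $s,t\ge0$, $A\in B(K)$. Fix such $X,V,K$; $\alpha$ and $\beta$ always denote the resulting semigroups. *)

theory Defs
  imports "HOL-Analysis.Analysis" "HOL-Library.Poly_Mapping"
begin

section \<open>Hilbert spaces on a carrier set\<close>

text \<open>
  Fibres of product systems depend on a real parameter, so Hilbert spaces are records with an
  explicit carrier.  All inner products are linear in the \<^emph>\<open>second\<close> variable.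
\<close>

record 'a hilb =
  carr :: "'a set"
  hadd :: "'a \<Rightarrow> 'a \<Rightarrow> 'a"
  hzero :: 'a
  hscale :: "complex \<Rightarrow> 'a \<Rightarrow> 'a"
  hinner :: "'a \<Rightarrow> 'a \<Rightarrow> complex"

definition hnorm :: "'a hilb \<Rightarrow> 'a \<Rightarrow> real" where
  "hnorm H x = sqrt (Re (hinner H x x))"

text \<open>The value off the carrier only serves to meet the global premises of the library
  locale \<open>Metric_space\<close>.\<close>

definition hdist :: "'a hilb \<Rightarrow> 'a \<Rightarrow> 'a \<Rightarrow> real" where
  "hdist H x y =
     (if x \<in> carr H \<and> y \<in> carr H then hnorm H (hadd H x (hscale H (-1) y)) else 0)"

definition htop :: "'a hilb \<Rightarrow> 'a topology" where
  "htop H = Metric_space.mtopology (carr H) (hdist H)"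

locale hilbert_space =
  fixes H :: "'a hilb"
  assumes add_closed: "x \<in> carr H \<Longrightarrow> y \<in> carr H \<Longrightarrow> hadd H x y \<in> carr H"
    and zero_closed: "hzero H \<in> carr H"
    and scale_closed: "x \<in> carr H \<Longrightarrow> hscale H c x \<in> carr H"
    and add_assoc: "x \<in> carr H \<Longrightarrow> y \<in> carr H \<Longrightarrow> z \<in> carr H \<Longrightarrow>
      hadd H (hadd H x y) z = hadd H x (hadd H y z)"
    and add_commute: "x \<in> carr H \<Longrightarrow> y \<in> carr H \<Longrightarrow> hadd H x y = hadd H y x"
    and add_zero: "x \<in> carr H \<Longrightarrow> hadd H x (hzero H) = x"
    and add_inverse: "x \<in> carr H \<Longrightarrow> hadd H x (hscale H (-1) x) = hzero H"
    and scale_one: "x \<in> carr H \<Longrightarrow> hscale H 1 x = x"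
    and scale_scale: "x \<in> carr H \<Longrightarrow> hscale H c (hscale H d x) = hscale H (c * d) x"
    and scale_add_right: "x \<in> carr H \<Longrightarrow> y \<in> carr H \<Longrightarrow>
      hscale H c (hadd H x y) = hadd H (hscale H c x) (hscale H c y)"
    and scale_add_left: "x \<in> carr H \<Longrightarrow>
      hscale H (c + d) x = hadd H (hscale H c x) (hscale H d x)"
    and inner_commute: "x \<in> carr H \<Longrightarrow> y \<in> carr H \<Longrightarrow> hinner H y x = cnj (hinner H x y)"
    and inner_add: "x \<in> carr H \<Longrightarrow> y \<in> carr H \<Longrightarrow> z \<in> carr H \<Longrightarrow>
      hinner H x (hadd H y z) = hinner H x y + hinner H x z"
    and inner_scale: "x \<in> carr H \<Longrightarrow> y \<in> carr H \<Longrightarrow>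
      hinner H x (hscale H c y) = c * hinner H x y"
    and inner_nonneg: "x \<in> carr H \<Longrightarrow> 0 \<le> Re (hinner H x x)"
    and inner_definite: "x \<in> carr H \<Longrightarrow> hinner H x x = 0 \<Longrightarrow> x = hzero H"
    and complete: "Metric_space.mcomplete (carr H) (hdist H)"

definition separable_hilbert_space :: "'a hilb \<Rightarrow> bool" where
  "separable_hilbert_space H \<longleftrightarrow> hilbert_space H \<and> separable_space (htop H)"

definition hsum :: "'a hilb \<Rightarrow> (nat \<Rightarrow> 'a) \<Rightarrow> nat \<Rightarrow> 'a" where
  "hsum H x n = foldr (hadd H) (map x [0..<n]) (hzero H)"

definition closed_subspace :: "'a hilb \<Rightarrow> 'a set \<Rightarrow> bool" where
  "closed_subspace H L \<longleftrightarrow> closedin (htop H) L \<and> hzero H \<in> L \<and>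
     (\<forall>x\<in>L. \<forall>y\<in>L. hadd H x y \<in> L) \<and> (\<forall>c. \<forall>x\<in>L. hscale H c x \<in> L)"

definition closed_span :: "'a hilb \<Rightarrow> 'a set \<Rightarrow> 'a set" where
  "closed_span H S = \<Inter>{L. closed_subspace H L \<and> S \<subseteq> L}"

section \<open>Bounded operators\<close>

text \<open>Operators are extensional on the carrier of their domain, so that equality of operators
  is equality of functions.\<close>

definition bop :: "'a hilb \<Rightarrow> 'b hilb \<Rightarrow> ('a \<Rightarrow> 'b) set" where
  "bop H K = {f \<in> carr H \<rightarrow>\<^sub>E carr K.
     (\<forall>x\<in>carr H. \<forall>y\<in>carr H. f (hadd H x y) = hadd K (f x) (f y)) \<and>
     (\<forall>c. \<forall>x\<in>carr H. f (hscale H c x) = hscale K c (f x)) \<and>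
     (\<exists>c. \<forall>x\<in>carr H. hnorm K (f x) \<le> c * hnorm H x)}"

abbreviation BH :: "'a hilb \<Rightarrow> ('a \<Rightarrow> 'a) set" where
  "BH H \<equiv> bop H H"

abbreviation comp_on :: "('b \<Rightarrow> 'c) \<Rightarrow> 'a hilb \<Rightarrow> ('a \<Rightarrow> 'b) \<Rightarrow> 'a \<Rightarrow> 'c"
    ("(_ \<circ>\<^bsub>_\<^esub> _)" [56, 0, 55] 55) where
  "g \<circ>\<^bsub>H\<^esub> f \<equiv> compose (carr H) g f"

definition op_id :: "'a hilb \<Rightarrow> 'a \<Rightarrow> 'a" where
  "op_id H = (\<lambda>x\<in>carr H. x)"

definition op_zero :: "'a hilb \<Rightarrow> 'b hilb \<Rightarrow> 'a \<Rightarrow> 'b" where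
  "op_zero H K = (\<lambda>x\<in>carr H. hzero K)"

definition op_add :: "'a hilb \<Rightarrow> 'b hilb \<Rightarrow> ('a \<Rightarrow> 'b) \<Rightarrow> ('a \<Rightarrow> 'b) \<Rightarrow> 'a \<Rightarrow> 'b" where
  "op_add H K f g = (\<lambda>x\<in>carr H. hadd K (f x) (g x))"

definition op_scale :: "'a hilb \<Rightarrow> 'b hilb \<Rightarrow> complex \<Rightarrow> ('a \<Rightarrow> 'b) \<Rightarrow> 'a \<Rightarrow> 'b" where
  "op_scale H K c f = (\<lambda>x\<in>carr H. hscale K c (f x))"

definition op_norm :: "'a hilb \<Rightarrow> 'b hilb \<Rightarrow> ('a \<Rightarrow> 'b) \<Rightarrow> real" where
  "op_norm H K f = Sup {hnorm K (f x) | x. x \<in> carr H \<and> hnorm H x \<le> 1}"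

definition adj :: "'a hilb \<Rightarrow> 'b hilb \<Rightarrow> ('a \<Rightarrow> 'b) \<Rightarrow> 'b \<Rightarrow> 'a" where
  "adj H K f =
     (THE g. g \<in> bop K H \<and> (\<forall>x\<in>carr H. \<forall>y\<in>carr K. hinner K (f x) y = hinner H x (g y)))"

abbreviation star :: "'a hilb \<Rightarrow> ('a \<Rightarrow> 'a) \<Rightarrow> 'a \<Rightarrow> 'a" where
  "star H A \<equiv> adj H H A"

definition isometry :: "'a hilb \<Rightarrow> 'b hilb \<Rightarrow> ('a \<Rightarrow> 'b) \<Rightarrow> bool" where
  "isometry H K f \<longleftrightarrow> f \<in> bop H K \<and> adj H K f \<circ>\<^bsub>H\<^esub> f = op_id H"

definition coisometry :: "'a hilb \<Rightarrow> 'b hilb \<Rightarrow> ('a \<Rightarrow> 'b) \<Rightarrow> bool" where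
  "coisometry H K f \<longleftrightarrow> f \<in> bop H K \<and> f \<circ>\<^bsub>K\<^esub> adj H K f = op_id K"

definition unitary_op :: "'a hilb \<Rightarrow> 'b hilb \<Rightarrow> ('a \<Rightarrow> 'b) \<Rightarrow> bool" where
  "unitary_op H K f \<longleftrightarrow> isometry H K f \<and> coisometry H K f"

text \<open>The bounded operator prescribed on a family of vectors \<open>g x\<close>, \<open>x \<in> S\<close>, with dense span.\<close>

definition ext_op :: "'a hilb \<Rightarrow> 'b hilb \<Rightarrow> 'i set \<Rightarrow> ('i \<Rightarrow> 'a) \<Rightarrow> ('i \<Rightarrow> 'b) \<Rightarrow> 'a \<Rightarrow> 'b" where
  "ext_op L L' S g f = (THE T. T \<in> bop L L' \<and> (\<forall>x\<in>S. T (g x) = f x))"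

section \<open>Hausdorff completions and tensor products\<close>

text \<open>
  \<open>hcompl S k\<close> is the Hausdorff completion of the free complex vector space on \<open>S\<close> with respect
  to the sesquilinear form given on the basis by a positive semidefinite kernel \<open>k\<close>: Cauchy
  sequences modulo null sequences.  For a multilinear kernel on tuples, the relations defining
  the algebraic tensor product lie in the kernel of the form, so that this is also the Hausdorff
  completion of the algebraic tensor product; \<open>hc_elt S k x\<close> is the class of the elementary
  tensor \<open>x\<close>.
\<close>

type_synonym 'i hc = "(nat \<Rightarrow> 'i \<Rightarrow>\<^sub>0 complex) set"

definition hc_form :: "('i \<Rightarrow> 'i \<Rightarrow> complex) \<Rightarrow> ('i \<Rightarrow>\<^sub>0 complex) \<Rightarrow> ('i \<Rightarrow>\<^sub>0 complex) \<Rightarrow> complex" where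
  "hc_form k c d = (\<Sum>x\<in>Poly_Mapping.keys c. \<Sum>y\<in>Poly_Mapping.keys d.
     cnj (Poly_Mapping.lookup c x) * Poly_Mapping.lookup d y * k x y)"

definition hc_cauchy :: "'i set \<Rightarrow> ('i \<Rightarrow> 'i \<Rightarrow> complex) \<Rightarrow> (nat \<Rightarrow> 'i \<Rightarrow>\<^sub>0 complex) set" where
  "hc_cauchy S k = {c. (\<forall>n. Poly_Mapping.keys (c n) \<subseteq> S) \<and>
     (\<forall>e>0. \<exists>N. \<forall>m\<ge>N. \<forall>n\<ge>N. Re (hc_form k (c m - c n) (c m - c n)) < e)}"

definition hc_class :: "'i set \<Rightarrow> ('i \<Rightarrow> 'i \<Rightarrow> complex) \<Rightarrow> (nat \<Rightarrow> 'i \<Rightarrow>\<^sub>0 complex) \<Rightarrow> 'i hc" where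
  "hc_class S k c = {d \<in> hc_cauchy S k. (\<lambda>n. hc_form k (c n - d n) (c n - d n)) \<longlonglongrightarrow> 0}"

definition hcompl :: "'i set \<Rightarrow> ('i \<Rightarrow> 'i \<Rightarrow> complex) \<Rightarrow> 'i hc hilb" where
  "hcompl S k = \<lparr>
     carr = hc_class S k ` hc_cauchy S k,
     hadd = (\<lambda>v w. \<Union>c\<in>v. \<Union>d\<in>w. hc_class S k (\<lambda>n. c n + d n)),
     hzero = hc_class S k (\<lambda>n. 0),
     hscale = (\<lambda>z v. \<Union>c\<in>v. hc_class S k (\<lambda>n. Poly_Mapping.map ((*) z) (c n))),
     hinner = (\<lambda>v w. THE z. \<forall>c\<in>v. \<forall>d\<in>w. (\<lambda>n. hc_form k (c n) (d n)) \<longlonglongrightarrow> z)\<rparr>"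

definition hc_elt :: "'i set \<Rightarrow> ('i \<Rightarrow> 'i \<Rightarrow> complex) \<Rightarrow> 'i \<Rightarrow> 'i hc" where
  "hc_elt S k x = hc_class S k (\<lambda>n. Poly_Mapping.single x 1)"

type_synonym ('a, 'b) tens = "('a \<times> 'b) hc"

definition tensor_form :: "'a hilb \<Rightarrow> 'b hilb \<Rightarrow> 'a \<times> 'b \<Rightarrow> 'a \<times> 'b \<Rightarrow> complex" where
  "tensor_form X Y = (\<lambda>(x, y) (x', y'). hinner X x x' * hinner Y y y')"

definition tensor :: "'a hilb \<Rightarrow> 'b hilb \<Rightarrow> ('a, 'b) tens hilb" where
  "tensor X Y = hcompl (carr X \<times> carr Y) (tensor_form X Y)"

definition pt :: "'a hilb \<Rightarrow> 'b hilb \<Rightarrow> 'a \<Rightarrow> 'b \<Rightarrow> ('a, 'b) tens" where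
  "pt X Y x y = hc_elt (carr X \<times> carr Y) (tensor_form X Y) (x, y)"

definition ampl :: "'a hilb \<Rightarrow> 'b hilb \<Rightarrow> ('b \<Rightarrow> 'b) \<Rightarrow> ('a, 'b) tens \<Rightarrow> ('a, 'b) tens" where
  "ampl X Y A = ext_op (tensor X Y) (tensor X Y) (carr X \<times> carr Y)
     (\<lambda>(x, y). pt X Y x y) (\<lambda>(x, y). pt X Y x (A y))"

section \<open>Maps on \<open>B(H)\<close> and semigroups\<close>

definition op_linear :: "'a hilb \<Rightarrow> 'b hilb \<Rightarrow> (('a \<Rightarrow> 'a) \<Rightarrow> 'b \<Rightarrow> 'b) \<Rightarrow> bool" where
  "op_linear H K \<Phi> \<longleftrightarrow> \<Phi> ` BH H \<subseteq> BH K \<and>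
     (\<forall>A\<in>BH H. \<forall>B\<in>BH H. \<Phi> (op_add H H A B) = op_add K K (\<Phi> A) (\<Phi> B)) \<and>
     (\<forall>c. \<forall>A\<in>BH H. \<Phi> (op_scale H H c A) = op_scale K K c (\<Phi> A))"

definition star_hom :: "'a hilb \<Rightarrow> 'b hilb \<Rightarrow> (('a \<Rightarrow> 'a) \<Rightarrow> 'b \<Rightarrow> 'b) \<Rightarrow> bool" where
  "star_hom H K \<Phi> \<longleftrightarrow> op_linear H K \<Phi> \<and>
     (\<forall>A\<in>BH H. \<forall>B\<in>BH H. \<Phi> (A \<circ>\<^bsub>H\<^esub> B) = \<Phi> A \<circ>\<^bsub>K\<^esub> \<Phi> B) \<and>
     (\<forall>A\<in>BH H. \<Phi> (star H A) = star K (\<Phi> A))"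

definition star_iso :: "'a hilb \<Rightarrow> 'b hilb \<Rightarrow> (('a \<Rightarrow> 'a) \<Rightarrow> 'b \<Rightarrow> 'b) \<Rightarrow> bool" where
  "star_iso H K \<Phi> \<longleftrightarrow> star_hom H K \<Phi> \<and> bij_betw \<Phi> (BH H) (BH K)"

definition star_automorphism :: "'a hilb \<Rightarrow> (('a \<Rightarrow> 'a) \<Rightarrow> 'a \<Rightarrow> 'a) \<Rightarrow> bool" where
  "star_automorphism H \<Phi> \<longleftrightarrow> star_iso H H \<Phi>"

text \<open>Positivity of every inflation \<open>\<Phi> \<otimes> id\<close> on \<open>M\<^sub>n(B(H)) = B(H\<^sup>n)\<close>.\<close>

definition op_matrix_pos :: "'a hilb \<Rightarrow> nat \<Rightarrow> (nat \<Rightarrow> nat \<Rightarrow> 'a \<Rightarrow> 'a) \<Rightarrow> bool" where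
  "op_matrix_pos H n A \<longleftrightarrow> (\<forall>h. (\<forall>i<n. h i \<in> carr H) \<longrightarrow>
     (\<Sum>i<n. \<Sum>j<n. hinner H (h i) (A i j (h j))) \<in> \<real> \<and>
     0 \<le> Re (\<Sum>i<n. \<Sum>j<n. hinner H (h i) (A i j (h j))))"

definition completely_positive :: "'a hilb \<Rightarrow> (('a \<Rightarrow> 'a) \<Rightarrow> 'a \<Rightarrow> 'a) \<Rightarrow> bool" where
  "completely_positive H \<Phi> \<longleftrightarrow> op_linear H H \<Phi> \<and>
     (\<forall>n A. (\<forall>i<n. \<forall>j<n. A i j \<in> BH H) \<and> op_matrix_pos H n A \<longrightarrow>
        op_matrix_pos H n (\<lambda>i j. \<Phi> (A i j)))"

definition self_adjoint :: "'a hilb \<Rightarrow> ('a \<Rightarrow> 'a) set" where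
  "self_adjoint H = {A \<in> BH H. star H A = A}"

definition op_le :: "'a hilb \<Rightarrow> ('a \<Rightarrow> 'a) \<Rightarrow> ('a \<Rightarrow> 'a) \<Rightarrow> bool" where
  "op_le H A B \<longleftrightarrow> (\<forall>x\<in>carr H. Re (hinner H x (A x)) \<le> Re (hinner H x (B x)))"

definition op_is_sup :: "'a hilb \<Rightarrow> ('a \<Rightarrow> 'a) set \<Rightarrow> ('a \<Rightarrow> 'a) \<Rightarrow> bool" where
  "op_is_sup H D S \<longleftrightarrow> S \<in> self_adjoint H \<and> (\<forall>A\<in>D. op_le H A S) \<and>
     (\<forall>B\<in>self_adjoint H. (\<forall>A\<in>D. op_le H A B) \<longrightarrow> op_le H S B)"

text \<open>Normality of a positive map: suprema of upward directed families of self-adjoint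
  operators are preserved.\<close>

definition normal_map :: "'a hilb \<Rightarrow> (('a \<Rightarrow> 'a) \<Rightarrow> 'a \<Rightarrow> 'a) \<Rightarrow> bool" where
  "normal_map H \<Phi> \<longleftrightarrow> (\<forall>D S. D \<noteq> {} \<and> D \<subseteq> self_adjoint H \<and>
     (\<forall>A\<in>D. \<forall>B\<in>D. \<exists>C\<in>D. op_le H A C \<and> op_le H B C) \<and> op_is_sup H D S \<longrightarrow>
     op_is_sup H (\<Phi> ` D) (\<Phi> S))"

text \<open>Semigroups are functions on \<^typ>\<open>real\<close> of which only the values at \<open>t \<ge> 0\<close> matter.\<close>

type_synonym 'a semigrp = "real \<Rightarrow> ('a \<Rightarrow> 'a) \<Rightarrow> 'a \<Rightarrow> 'a"

definition cp0_semigroup :: "'a hilb \<Rightarrow> 'a semigrp \<Rightarrow> bool" where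
  "cp0_semigroup H \<phi> \<longleftrightarrow>
     (\<forall>t\<ge>0. completely_positive H (\<phi> t) \<and> normal_map H (\<phi> t) \<and> \<phi> t (op_id H) = op_id H \<and>
        (\<forall>A\<in>BH H. op_norm H H (\<phi> t A) \<le> op_norm H H A)) \<and>
     (\<forall>A\<in>BH H. \<phi> 0 A = A) \<and>
     (\<forall>s\<ge>0. \<forall>t\<ge>0. \<forall>A\<in>BH H. \<phi> (s + t) A = \<phi> s (\<phi> t A)) \<and>
     (\<forall>A\<in>BH H. \<forall>h\<in>carr H. \<forall>g\<in>carr H. continuous_on {0..} (\<lambda>t. hinner H (\<phi> t A h) g))"

definition e0_semigroup :: "'a hilb \<Rightarrow> 'a semigrp \<Rightarrow> bool" where
  "e0_semigroup H \<phi> \<longleftrightarrow> cp0_semigroup H \<phi> \<and> (\<forall>t\<ge>0. star_hom H H (\<phi> t))"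

definition commutant :: "'a hilb \<Rightarrow> ('a \<Rightarrow> 'a) set \<Rightarrow> ('a \<Rightarrow> 'a) set" where
  "commutant H M = {B \<in> BH H. \<forall>A\<in>M. A \<circ>\<^bsub>H\<^esub> B = B \<circ>\<^bsub>H\<^esub> A}"

definition von_neumann_algebra :: "'a hilb \<Rightarrow> ('a \<Rightarrow> 'a) set \<Rightarrow> bool" where
  "von_neumann_algebra H M \<longleftrightarrow>
     M \<subseteq> BH H \<and> (\<forall>A\<in>M. star H A \<in> M) \<and> commutant H (commutant H M) = M"

definition vn_generated :: "'a hilb \<Rightarrow> ('a \<Rightarrow> 'a) set \<Rightarrow> ('a \<Rightarrow> 'a) set" where
  "vn_generated H S = \<Inter>{M. von_neumann_algebra H M \<and> S \<subseteq> M}"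

text \<open>
  An inclusion of Hilbert spaces \<open>H \<subseteq> G\<close> is given by an isometry \<open>J : H \<rightarrow> G\<close>, so that
  \<open>P\<^sub>H = J J\<^sup>*\<close>.  Then \<open>P\<^sub>H A P\<^sub>H\<close>, as an operator on \<open>H\<close>, is the compression \<open>J\<^sup>* A J\<close>.
\<close>

definition compr :: "'a hilb \<Rightarrow> 'b hilb \<Rightarrow> ('a \<Rightarrow> 'b) \<Rightarrow> ('b \<Rightarrow> 'b) \<Rightarrow> 'a \<Rightarrow> 'a" where
  "compr H G J A = adj H G J \<circ>\<^bsub>H\<^esub> (A \<circ>\<^bsub>H\<^esub> J)"

definition e0_dilation :: "'a hilb \<Rightarrow> 'a semigrp \<Rightarrow> 'b hilb \<Rightarrow> ('a \<Rightarrow> 'b) \<Rightarrow> 'b semigrp \<Rightarrow> bool" where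
  "e0_dilation H \<phi> G J \<sigma> \<longleftrightarrow> hilbert_space G \<and> isometry H G J \<and> e0_semigroup G \<sigma> \<and>
     (\<forall>t\<ge>0. \<forall>A\<in>BH G. \<phi> t (compr H G J A) = compr H G J (\<sigma> t A))"

definition minimal_e0_dilation ::
    "'a hilb \<Rightarrow> 'a semigrp \<Rightarrow> 'b hilb \<Rightarrow> ('a \<Rightarrow> 'b) \<Rightarrow> 'b semigrp \<Rightarrow> bool" where
  "minimal_e0_dilation H \<phi> G J \<sigma> \<longleftrightarrow> e0_dilation H \<phi> G J \<sigma> \<and>
     (let P = J \<circ>\<^bsub>G\<^esub> adj H G J in
      vn_generated G (\<Union>t\<in>{0..}. {\<sigma> t (P \<circ>\<^bsub>G\<^esub> (A \<circ>\<^bsub>G\<^esub> P)) | A. A \<in> BH G}) = BH G)"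

definition conjugate :: "'a hilb \<Rightarrow> 'a semigrp \<Rightarrow> 'b hilb \<Rightarrow> 'b semigrp \<Rightarrow> bool" where
  "conjugate G \<gamma> G' \<gamma>' \<longleftrightarrow>
     (\<exists>\<pi>. star_iso G G' \<pi> \<and> (\<forall>t\<ge>0. \<forall>A\<in>BH G. \<pi> (\<gamma> t A) = \<gamma>' t (\<pi> A)))"

definition cocycle :: "'a hilb \<Rightarrow> 'a semigrp \<Rightarrow> (real \<Rightarrow> 'a \<Rightarrow> 'a) \<Rightarrow> bool" where
  "cocycle G \<gamma> U \<longleftrightarrow> (\<forall>t\<ge>0. unitary_op G G (U t)) \<and>
     (\<forall>g\<in>carr G. continuous_map (top_of_set {0..}) (htop G) (\<lambda>t. U t g)) \<and>
     (\<forall>s\<ge>0. \<forall>t\<ge>0. U (s + t) = U s \<circ>\<^bsub>G\<^esub> \<gamma> s (U t))"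

definition cocycle_conjugate :: "'a hilb \<Rightarrow> 'a semigrp \<Rightarrow> 'b hilb \<Rightarrow> 'b semigrp \<Rightarrow> bool" where
  "cocycle_conjugate G \<gamma> G' \<gamma>' \<longleftrightarrow> (\<exists>U. cocycle G \<gamma> U \<and>
     conjugate G' \<gamma>' G (\<lambda>t A. U t \<circ>\<^bsub>G\<^esub> (\<gamma> t A \<circ>\<^bsub>G\<^esub> star G (U t))))"

section \<open>Strong commutation\<close>

text \<open>\<open>sc_space H \<Phi> \<Theta>\<close> is the space \<open>B(H) \<otimes>\<^sub>\<Phi> B(H) \<otimes>\<^sub>\<Theta> H\<close>, and
  \<open>sc_act H \<Phi> \<Theta> c\<close> is the operator \<open>c \<otimes> I \<otimes> I\<close> on it.\<close>

type_synonym 'a scvec = "(('a \<Rightarrow> 'a) \<times> ('a \<Rightarrow> 'a) \<times> 'a) hc"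

definition sc_form where
  "sc_form H \<Phi> \<Theta> = (\<lambda>(a, b, h) (c, d, k).
     hinner H h (\<Theta> (star H b \<circ>\<^bsub>H\<^esub> (\<Phi> (star H a \<circ>\<^bsub>H\<^esub> c) \<circ>\<^bsub>H\<^esub> d)) k))"

definition sc_idx :: "'a hilb \<Rightarrow> (('a \<Rightarrow> 'a) \<times> ('a \<Rightarrow> 'a) \<times> 'a) set" where
  "sc_idx H = BH H \<times> BH H \<times> carr H"

definition sc_space ::
    "'a hilb \<Rightarrow> (('a \<Rightarrow> 'a) \<Rightarrow> 'a \<Rightarrow> 'a) \<Rightarrow> (('a \<Rightarrow> 'a) \<Rightarrow> 'a \<Rightarrow> 'a) \<Rightarrow> 'a scvec hilb" where
  "sc_space H \<Phi> \<Theta> = hcompl (sc_idx H) (sc_form H \<Phi> \<Theta>)"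

definition sc_vec ::
    "'a hilb \<Rightarrow> (('a \<Rightarrow> 'a) \<Rightarrow> 'a \<Rightarrow> 'a) \<Rightarrow> (('a \<Rightarrow> 'a) \<Rightarrow> 'a \<Rightarrow> 'a) \<Rightarrow>
     (('a \<Rightarrow> 'a) \<times> ('a \<Rightarrow> 'a) \<times> 'a) \<Rightarrow> 'a scvec" where
  "sc_vec H \<Phi> \<Theta> = hc_elt (sc_idx H) (sc_form H \<Phi> \<Theta>)"

definition sc_act where
  "sc_act H \<Phi> \<Theta> c = ext_op (sc_space H \<Phi> \<Theta>) (sc_space H \<Phi> \<Theta>) (sc_idx H)
     (sc_vec H \<Phi> \<Theta>) (\<lambda>(a, b, h). sc_vec H \<Phi> \<Theta> (c \<circ>\<^bsub>H\<^esub> a, b, h))"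

definition strong_comm_unitary ::
    "'a hilb \<Rightarrow> (('a \<Rightarrow> 'a) \<Rightarrow> 'a \<Rightarrow> 'a) \<Rightarrow> (('a \<Rightarrow> 'a) \<Rightarrow> 'a \<Rightarrow> 'a) \<Rightarrow>
     ('a scvec \<Rightarrow> 'a scvec) \<Rightarrow> bool" where
  "strong_comm_unitary H \<Phi> \<Theta> u \<longleftrightarrow> unitary_op (sc_space H \<Phi> \<Theta>) (sc_space H \<Theta> \<Phi>) u \<and>
     (\<forall>a\<in>BH H. \<forall>h\<in>carr H. u (sc_vec H \<Phi> \<Theta> (a, op_id H, h)) = sc_vec H \<Theta> \<Phi> (a, op_id H, h)) \<and>
     (\<forall>a\<in>BH H. \<forall>b\<in>BH H. \<forall>c\<in>BH H. \<forall>h\<in>carr H.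
        u (sc_vec H \<Phi> \<Theta> (c \<circ>\<^bsub>H\<^esub> a, b, h)) = sc_act H \<Theta> \<Phi> c (u (sc_vec H \<Phi> \<Theta> (a, b, h))))"

definition commute_strongly ::
    "'a hilb \<Rightarrow> (('a \<Rightarrow> 'a) \<Rightarrow> 'a \<Rightarrow> 'a) \<Rightarrow> (('a \<Rightarrow> 'a) \<Rightarrow> 'a \<Rightarrow> 'a) \<Rightarrow> bool" where
  "commute_strongly H \<Phi> \<Theta> \<longleftrightarrow> (\<forall>A\<in>BH H. \<Phi> (\<Theta> A) = \<Theta> (\<Phi> A)) \<and>
     (\<exists>u. strong_comm_unitary H \<Phi> \<Theta> u)"

definition strongly_commuting_semigroups :: "'a hilb \<Rightarrow> 'a semigrp \<Rightarrow> 'a semigrp \<Rightarrow> bool" where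
  "strongly_commuting_semigroups H \<phi> \<theta> \<longleftrightarrow>
     (\<forall>s\<ge>0. \<forall>t\<ge>0. commute_strongly H (\<phi> s) (\<theta> t))"

section \<open>Product systems and representations\<close>

text \<open>
  A product system over the submonoid \<open>S\<close>.  The identification \<open>X(0) = \<complex>\<close> is recorded by the
  unit vector \<open>e \<in> X(0)\<close> corresponding to \<open>1 \<in> \<complex>\<close>; \<open>m s t x y \<in> X(s + t)\<close> is the image of
  \<open>x \<otimes> y \<in> X(s) \<otimes> X(t)\<close>.
\<close>

definition product_system ::
    "'s::comm_monoid_add set \<Rightarrow> ('s \<Rightarrow> 'x hilb) \<Rightarrow> 'x \<Rightarrow> ('s \<Rightarrow> 's \<Rightarrow> 'x \<Rightarrow> 'x \<Rightarrow> 'x) \<Rightarrow> bool" where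
  "product_system S X e m \<longleftrightarrow>
     0 \<in> S \<and> (\<forall>s\<in>S. \<forall>t\<in>S. s + t \<in> S) \<and>
     (\<forall>s\<in>S. hilbert_space (X s)) \<and>
     e \<in> carr (X 0) \<and> hinner (X 0) e e = 1 \<and> carr (X 0) = {hscale (X 0) c e | c. True} \<and>
     (\<forall>s\<in>S. \<forall>t\<in>S. \<exists>U. unitary_op (tensor (X s) (X t)) (X (s + t)) U \<and>
        (\<forall>x\<in>carr (X s). \<forall>y\<in>carr (X t). U (pt (X s) (X t) x y) = m s t x y)) \<and>
     (\<forall>r\<in>S. \<forall>s\<in>S. \<forall>t\<in>S. \<forall>x\<in>carr (X r). \<forall>y\<in>carr (X s). \<forall>z\<in>carr (X t).
        m (r + s) t (m r s x y) z = m r (s + t) x (m s t y z)) \<and>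
     (\<forall>t\<in>S. \<forall>c. \<forall>x\<in>carr (X t). m 0 t (hscale (X 0) c e) x = hscale (X t) c x \<and>
        m t 0 x (hscale (X 0) c e) = hscale (X t) c x)"

text \<open>
  Complete contractivity of \<open>T : X \<rightarrow> B(H)\<close>, where the Hilbert space \<open>X\<close>, being a Hilbert module
  over \<open>\<complex>\<close>, carries its column structure \<open>M\<^sub>n(X) = B(\<complex>\<^sup>n, X\<^sup>n)\<close>: every bound \<open>C\<close> for the norm of
  a matrix over \<open>X\<close> is a bound for the norm of its image in \<open>M\<^sub>n(B(H)) = B(H\<^sup>n)\<close>.
\<close>

definition completely_contractive :: "'x hilb \<Rightarrow> 'a hilb \<Rightarrow> ('x \<Rightarrow> 'a \<Rightarrow> 'a) \<Rightarrow> bool" where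
  "completely_contractive X H T \<longleftrightarrow>
     (\<forall>n x C. (\<forall>i<n. \<forall>j<n. x i j \<in> carr X) \<and> 0 \<le> C \<and>
        (\<forall>\<xi>. (\<Sum>i<n. (hnorm X (hsum X (\<lambda>j. hscale X (\<xi> j) (x i j)) n))\<^sup>2)
               \<le> C\<^sup>2 * (\<Sum>j<n. (cmod (\<xi> j))\<^sup>2)) \<longrightarrow>
        (\<forall>h. (\<forall>j<n. h j \<in> carr H) \<longrightarrow>
             (\<Sum>i<n. (hnorm H (hsum H (\<lambda>j. T (x i j) (h j)) n))\<^sup>2)
               \<le> C\<^sup>2 * (\<Sum>j<n. (hnorm H (h j))\<^sup>2)))"

definition ps_representation ::
    "'s::comm_monoid_add set \<Rightarrow> ('s \<Rightarrow> 'x hilb) \<Rightarrow> 'x \<Rightarrow> ('s \<Rightarrow> 's \<Rightarrow> 'x \<Rightarrow> 'x \<Rightarrow> 'x) \<Rightarrow>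
     'a hilb \<Rightarrow> ('s \<Rightarrow> 'x \<Rightarrow> 'a \<Rightarrow> 'a) \<Rightarrow> bool" where
  "ps_representation S X e m H T \<longleftrightarrow>
     (\<forall>s\<in>S. T s ` carr (X s) \<subseteq> BH H \<and>
        (\<forall>x\<in>carr (X s). \<forall>y\<in>carr (X s). T s (hadd (X s) x y) = op_add H H (T s x) (T s y)) \<and>
        (\<forall>c. \<forall>x\<in>carr (X s). T s (hscale (X s) c x) = op_scale H H c (T s x)) \<and>
        completely_contractive (X s) H (T s)) \<and>
     (\<forall>c. T 0 (hscale (X 0) c e) = op_scale H H c (op_id H)) \<and>
     (\<forall>s\<in>S. \<forall>t\<in>S. \<forall>x\<in>carr (X s). \<forall>y\<in>carr (X t).
        T (s + t) (m s t x y) = T s x \<circ>\<^bsub>H\<^esub> T t y)"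

text \<open>The operator \<open>X \<otimes> H \<rightarrow> H\<close>, \<open>x \<otimes> h \<mapsto> T(x)h\<close>.\<close>

definition tilde :: "'x hilb \<Rightarrow> 'a hilb \<Rightarrow> ('x \<Rightarrow> 'a \<Rightarrow> 'a) \<Rightarrow> ('x, 'a) tens \<Rightarrow> 'a" where
  "tilde X H T = ext_op (tensor X H) H (carr X \<times> carr H)
     (\<lambda>(x, h). pt X H x h) (\<lambda>(x, h). T x h)"

definition rep_isometric :: "'s set \<Rightarrow> ('s \<Rightarrow> 'x hilb) \<Rightarrow> 'a hilb \<Rightarrow> ('s \<Rightarrow> 'x \<Rightarrow> 'a \<Rightarrow> 'a) \<Rightarrow> bool" where
  "rep_isometric S X H T \<longleftrightarrow> (\<forall>s\<in>S. isometry (tensor (X s) H) H (tilde (X s) H (T s)))"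

definition rep_fully_coisometric ::
    "'s set \<Rightarrow> ('s \<Rightarrow> 'x hilb) \<Rightarrow> 'a hilb \<Rightarrow> ('s \<Rightarrow> 'x \<Rightarrow> 'a \<Rightarrow> 'a) \<Rightarrow> bool" where
  "rep_fully_coisometric S X H T \<longleftrightarrow>
     (\<forall>s\<in>S. coisometry (tensor (X s) H) H (tilde (X s) H (T s)))"

definition minimal_isometric_dilation ::
    "'s::comm_monoid_add set \<Rightarrow> ('s \<Rightarrow> 'x hilb) \<Rightarrow> 'x \<Rightarrow> ('s \<Rightarrow> 's \<Rightarrow> 'x \<Rightarrow> 'x \<Rightarrow> 'x) \<Rightarrow>
     'a hilb \<Rightarrow> ('s \<Rightarrow> 'x \<Rightarrow> 'a \<Rightarrow> 'a) \<Rightarrow> 'b hilb \<Rightarrow> ('a \<Rightarrow> 'b) \<Rightarrow> ('s \<Rightarrow> 'x \<Rightarrow> 'b \<Rightarrow> 'b) \<Rightarrow> bool" where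
  "minimal_isometric_dilation S X e m H T K J V \<longleftrightarrow>
     hilbert_space K \<and> isometry H K J \<and>
     ps_representation S X e m K V \<and> rep_isometric S X K V \<and>
     (\<forall>s\<in>S. \<forall>x\<in>carr (X s). compr H K J (V s x) = T s x) \<and>
     (\<forall>s\<in>S. \<forall>x\<in>carr (X s). \<forall>k\<in>carr K. (\<forall>h\<in>carr H. hinner K (J h) k = 0) \<longrightarrow>
        adj H K J (V s x k) = hzero H) \<and>
     closed_span K (\<Union>s\<in>S. {V s x (J h) | x h. x \<in> carr (X s) \<and> h \<in> carr H}) = carr K"

section \<open>The product system of intertwiners of a CP semigroup\<close>

text \<open>
  For a Hilbert space \<open>L\<close> on which \<open>B(H)\<close> acts by \<open>act\<close>, the Hilbert space of all
  \<open>X \<in> B(H, L)\<close> with \<open>X A = act A X\<close>, with inner product \<open>\<langle>X, Y\<rangle> I = X\<^sup>* Y\<close>.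
\<close>

definition intertwiners ::
    "'a hilb \<Rightarrow> 'l hilb \<Rightarrow> (('a \<Rightarrow> 'a) \<Rightarrow> 'l \<Rightarrow> 'l) \<Rightarrow> ('a \<Rightarrow> 'l) hilb" where
  "intertwiners H L act = \<lparr>
     carr = {X \<in> bop H L. \<forall>A\<in>BH H. X \<circ>\<^bsub>H\<^esub> A = act A \<circ>\<^bsub>H\<^esub> X},
     hadd = op_add H L,
     hzero = op_zero H L,
     hscale = op_scale H L,
     hinner = (\<lambda>X Y. THE c. op_scale H H c (op_id H) = adj H L X \<circ>\<^bsub>H\<^esub> Y)\<rparr>"

text \<open>
  A partition \<open>0 = t\<^sub>0 < \<dots> < t\<^sub>n = t\<close> is the finite set of its points (for \<open>t = 0\<close> this is
  \<open>{0}\<close>, and the space attached to it is \<open>H\<close>).  An elementary tensor \<open>a\<^sub>1 \<otimes> \<dots> \<otimes> a\<^sub>n \<otimes> h\<close> is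
  given by a function on the left endpoints, \<open>a\<^sub>i\<close> being its value at \<open>t\<^bsub>i-1\<^esub>\<close>, and the
  vector \<open>h\<close>.
\<close>

definition partitions :: "real \<Rightarrow> real set set" where
  "partitions t = {P. finite P \<and> {0, t} \<subseteq> P \<and> P \<subseteq> {0..t}}"

definition left_ends :: "real set \<Rightarrow> real set" where
  "left_ends P = P - {Max P}"

type_synonym 'a etens = "(real \<Rightarrow> 'a \<Rightarrow> 'a) \<times> 'a"
type_synonym 'a pvec = "'a etens hc"
type_synonym 'a msvec = "(real set \<times> 'a pvec) hc"
type_synonym 'a fib = "'a \<Rightarrow> 'a msvec"
type_synonym 'a fib2 = "('a fib, 'a fib) tens"

definition P_idx :: "'a hilb \<Rightarrow> real set \<Rightarrow> 'a etens set" where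
  "P_idx H P = (left_ends P \<rightarrow>\<^sub>E BH H) \<times> carr H"

text \<open>\<open>ms_fold H \<phi> a b [t\<^sub>0,\<dots>,t\<^sub>n] I = \<phi>\<^bsub>\<tau>\<^sub>n\<^esub>(a\<^sub>n\<^sup>* \<phi>\<^bsub>\<tau>\<^sub>n\<^sub>-\<^sub>1\<^esub>(\<dots> \<phi>\<^bsub>\<tau>\<^sub>1\<^esub>(a\<^sub>1\<^sup>* b\<^sub>1) \<dots>) b\<^sub>n)\<close>, where
  \<open>\<tau>\<^sub>i = t\<^sub>i - t\<^bsub>i-1\<^esub>\<close>.\<close>

fun ms_fold ::
    "'a hilb \<Rightarrow> 'a semigrp \<Rightarrow> (real \<Rightarrow> 'a \<Rightarrow> 'a) \<Rightarrow> (real \<Rightarrow> 'a \<Rightarrow> 'a) \<Rightarrow> real list \<Rightarrow>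
     ('a \<Rightarrow> 'a) \<Rightarrow> 'a \<Rightarrow> 'a" where
  "ms_fold H \<phi> a b (r # s # ts) Z =
     ms_fold H \<phi> a b (s # ts) (\<phi> (s - r) (star H (a r) \<circ>\<^bsub>H\<^esub> (Z \<circ>\<^bsub>H\<^esub> b r)))"
| "ms_fold H \<phi> a b [s] Z = Z"
| "ms_fold H \<phi> a b [] Z = Z"

definition P_form :: "'a hilb \<Rightarrow> 'a semigrp \<Rightarrow> real set \<Rightarrow> 'a etens \<Rightarrow> 'a etens \<Rightarrow> complex" where
  "P_form H \<phi> P = (\<lambda>(a, h) (b, k).
     hinner H h (ms_fold H \<phi> a b (sorted_list_of_set P) (op_id H) k))"

definition P_space :: "'a hilb \<Rightarrow> 'a semigrp \<Rightarrow> real set \<Rightarrow> 'a pvec hilb" where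
  "P_space H \<phi> P = hcompl (P_idx H P) (P_form H \<phi> P)"

definition P_vec :: "'a hilb \<Rightarrow> 'a semigrp \<Rightarrow> real set \<Rightarrow> 'a etens \<Rightarrow> 'a pvec" where
  "P_vec H \<phi> P = hc_elt (P_idx H P) (P_form H \<phi> P)"

text \<open>The embedding for a refinement \<open>P \<subseteq> Q\<close>: every new point becomes the left endpoint of a new
  interval, which gets the factor \<open>I\<close>.\<close>

definition refine_op :: "'a hilb \<Rightarrow> 'a semigrp \<Rightarrow> real set \<Rightarrow> real set \<Rightarrow> 'a pvec \<Rightarrow> 'a pvec" where
  "refine_op H \<phi> P Q = ext_op (P_space H \<phi> P) (P_space H \<phi> Q) (P_idx H P) (P_vec H \<phi> P)
     (\<lambda>(a, h). P_vec H \<phi> Q (\<lambda>r\<in>left_ends Q. if r \<in> P then a r else op_id H, h))"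

text \<open>The direct limit \<open>H\<^sub>t\<close>: the completion of the disjoint union of the spaces \<open>H\<^sub>P\<close>, vectors of
  different spaces being compared in the common refinement.\<close>

definition ms_form :: "'a hilb \<Rightarrow> 'a semigrp \<Rightarrow> real set \<times> 'a pvec \<Rightarrow> real set \<times> 'a pvec \<Rightarrow> complex" where
  "ms_form H \<phi> = (\<lambda>(P, v) (Q, w).
     hinner (P_space H \<phi> (P \<union> Q)) (refine_op H \<phi> P (P \<union> Q) v) (refine_op H \<phi> Q (P \<union> Q) w))"

definition ms_space :: "'a hilb \<Rightarrow> 'a semigrp \<Rightarrow> real \<Rightarrow> 'a msvec hilb" where
  "ms_space H \<phi> t = hcompl (SIGMA P:partitions t. carr (P_space H \<phi> P)) (ms_form H \<phi>)"

definition ms_idx :: "'a hilb \<Rightarrow> real \<Rightarrow> (real set \<times> 'a etens) set" where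
  "ms_idx H t = (SIGMA P:partitions t. P_idx H P)"

definition ms_vec :: "'a hilb \<Rightarrow> 'a semigrp \<Rightarrow> real \<Rightarrow> real set \<times> 'a etens \<Rightarrow> 'a msvec" where
  "ms_vec H \<phi> t = (\<lambda>(P, x).
     hc_elt (SIGMA P:partitions t. carr (P_space H \<phi> P)) (ms_form H \<phi>) (P, P_vec H \<phi> P x))"

definition ms_act :: "'a hilb \<Rightarrow> 'a semigrp \<Rightarrow> real \<Rightarrow> ('a \<Rightarrow> 'a) \<Rightarrow> 'a msvec \<Rightarrow> 'a msvec" where
  "ms_act H \<phi> t A = ext_op (ms_space H \<phi> t) (ms_space H \<phi> t) (ms_idx H t) (ms_vec H \<phi> t)
     (\<lambda>(P, a, h). if t = 0 then ms_vec H \<phi> t (P, a, A h)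
        else ms_vec H \<phi> t (P, a(0 := A \<circ>\<^bsub>H\<^esub> a 0), h))"

definition ms_iota :: "'a hilb \<Rightarrow> 'a semigrp \<Rightarrow> real \<Rightarrow> 'a fib" where
  "ms_iota H \<phi> t = (\<lambda>h\<in>carr H. ms_vec H \<phi> t ({0, t}, \<lambda>r\<in>left_ends {0, t}. op_id H, h))"

text \<open>The fibre \<open>E(t)\<close>; here \<open>E(0) = B(H)' \<iota>\<^sub>0 = \<complex> \<iota>\<^sub>0\<close>, and \<open>\<iota>\<^sub>0\<close> plays the role of \<open>1 \<in> \<complex>\<close>.\<close>

definition ms_fibre :: "'a hilb \<Rightarrow> 'a semigrp \<Rightarrow> real \<Rightarrow> 'a fib hilb" where
  "ms_fibre H \<phi> t = intertwiners H (ms_space H \<phi> t) (ms_act H \<phi> t)"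

text \<open>\<open>ms_concat H \<phi> s t P a : H\<^sub>t \<rightarrow> H\<^bsub>s+t\<^esub>\<close> maps \<open>b\<^sub>1 \<otimes> \<dots> \<otimes> b\<^sub>m \<otimes> k\<close> to
  \<open>a\<^sub>1 \<otimes> \<dots> \<otimes> a\<^sub>n \<otimes> b\<^sub>1 \<otimes> \<dots> \<otimes> b\<^sub>m \<otimes> k\<close>, the partition \<open>Q\<close> of \<open>[0,t]\<close> being shifted to \<open>[s,s+t]\<close>.\<close>

definition ms_concat ::
    "'a hilb \<Rightarrow> 'a semigrp \<Rightarrow> real \<Rightarrow> real \<Rightarrow> real set \<Rightarrow> (real \<Rightarrow> 'a \<Rightarrow> 'a) \<Rightarrow> 'a msvec \<Rightarrow> 'a msvec" where
  "ms_concat H \<phi> s t P a =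
     ext_op (ms_space H \<phi> t) (ms_space H \<phi> (s + t)) (ms_idx H t) (ms_vec H \<phi> t)
       (\<lambda>(Q, b, k). ms_vec H \<phi> (s + t)
          (P \<union> (+) s ` Q,
           \<lambda>r\<in>left_ends (P \<union> (+) s ` Q). if r < s then a r else b (r - s),
           k))"

text \<open>\<open>I \<otimes> X : H\<^sub>s \<rightarrow> H\<^bsub>s+t\<^esub>\<close> for \<open>X \<in> E(t)\<close>, and the product of \<open>X \<in> E(t)\<close> and \<open>Y \<in> E(s)\<close>.\<close>

definition ms_id_tensor ::
    "'a hilb \<Rightarrow> 'a semigrp \<Rightarrow> real \<Rightarrow> real \<Rightarrow> 'a fib \<Rightarrow> 'a msvec \<Rightarrow> 'a msvec" where
  "ms_id_tensor H \<phi> s t X =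
     ext_op (ms_space H \<phi> s) (ms_space H \<phi> (s + t)) (ms_idx H s) (ms_vec H \<phi> s)
       (\<lambda>(P, a, h). ms_concat H \<phi> s t P a (X h))"

definition ms_mult :: "'a hilb \<Rightarrow> 'a semigrp \<Rightarrow> real \<Rightarrow> real \<Rightarrow> 'a fib \<Rightarrow> 'a fib \<Rightarrow> 'a fib" where
  "ms_mult H \<phi> t s X Y = ms_id_tensor H \<phi> s t X \<circ>\<^bsub>H\<^esub> Y"

definition ms_rep :: "'a hilb \<Rightarrow> 'a semigrp \<Rightarrow> real \<Rightarrow> 'a fib \<Rightarrow> 'a \<Rightarrow> 'a" where
  "ms_rep H \<phi> t X = adj H (ms_space H \<phi> t) (ms_iota H \<phi> t) \<circ>\<^bsub>H\<^esub> X"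

section \<open>The flip induced by the strong commutation unitaries\<close>

text \<open>
  For a normal unital CP map \<open>\<Phi>\<close> let \<open>gns H \<Phi> = B(H) \<otimes>\<^sub>\<Phi> H\<close> and let \<open>gns_fibre H \<Phi>\<close> be its space of
  intertwiners \<open>E\<^sub>\<Phi>\<close>.  There is a unitary from \<open>E\<^sub>\<Phi> \<otimes> E\<^sub>\<Theta>\<close> onto the intertwiners from \<open>H\<close> to
  \<open>B(H) \<otimes>\<^sub>\<Theta> B(H) \<otimes>\<^sub>\<Phi> H\<close>, mapping \<open>X \<otimes> Y\<close> to \<open>(I \<otimes> X) Y\<close>.
\<close>

type_synonym 'a gvec = "(('a \<Rightarrow> 'a) \<times> 'a) hc"

definition gns_form where
  "gns_form H \<Phi> = (\<lambda>(a, h) (b, k). hinner H h (\<Phi> (star H a \<circ>\<^bsub>H\<^esub> b) k))"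

definition gns :: "'a hilb \<Rightarrow> (('a \<Rightarrow> 'a) \<Rightarrow> 'a \<Rightarrow> 'a) \<Rightarrow> 'a gvec hilb" where
  "gns H \<Phi> = hcompl (BH H \<times> carr H) (gns_form H \<Phi>)"

definition gns_vec :: "'a hilb \<Rightarrow> (('a \<Rightarrow> 'a) \<Rightarrow> 'a \<Rightarrow> 'a) \<Rightarrow> ('a \<Rightarrow> 'a) \<times> 'a \<Rightarrow> 'a gvec" where
  "gns_vec H \<Phi> = hc_elt (BH H \<times> carr H) (gns_form H \<Phi>)"

definition gns_act where
  "gns_act H \<Phi> c = ext_op (gns H \<Phi>) (gns H \<Phi>) (BH H \<times> carr H) (gns_vec H \<Phi>)
     (\<lambda>(a, h). gns_vec H \<Phi> (c \<circ>\<^bsub>H\<^esub> a, h))"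

definition gns_fibre :: "'a hilb \<Rightarrow> (('a \<Rightarrow> 'a) \<Rightarrow> 'a \<Rightarrow> 'a) \<Rightarrow> ('a \<Rightarrow> 'a gvec) hilb" where
  "gns_fibre H \<Phi> = intertwiners H (gns H \<Phi>) (gns_act H \<Phi>)"

text \<open>For \<open>a \<in> B(H)\<close>, the operator \<open>v \<mapsto> a \<otimes> v\<close> from \<open>B(H) \<otimes>\<^sub>\<Phi> H\<close> to \<open>B(H) \<otimes>\<^sub>\<Theta> B(H) \<otimes>\<^sub>\<Phi> H\<close>.\<close>

definition gns_left where
  "gns_left H \<Phi> \<Theta> a = ext_op (gns H \<Phi>) (sc_space H \<Theta> \<Phi>) (BH H \<times> carr H) (gns_vec H \<Phi>)
     (\<lambda>(b, k). sc_vec H \<Theta> \<Phi> (a, b, k))"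

definition gns_mult ::
    "'a hilb \<Rightarrow> (('a \<Rightarrow> 'a) \<Rightarrow> 'a \<Rightarrow> 'a) \<Rightarrow> (('a \<Rightarrow> 'a) \<Rightarrow> 'a \<Rightarrow> 'a) \<Rightarrow>
     ('a \<Rightarrow> 'a gvec) \<Rightarrow> ('a \<Rightarrow> 'a gvec) \<Rightarrow> 'a \<Rightarrow> 'a scvec" where
  "gns_mult H \<Phi> \<Theta> X Y =
     ext_op (gns H \<Theta>) (sc_space H \<Theta> \<Phi>) (BH H \<times> carr H) (gns_vec H \<Theta>)
       (\<lambda>(a, h). gns_left H \<Phi> \<Theta> a (X h)) \<circ>\<^bsub>H\<^esub> Y"

definition gns_mult_op where
  "gns_mult_op H \<Phi> \<Theta> =
     ext_op (tensor (gns_fibre H \<Phi>) (gns_fibre H \<Theta>))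
       (intertwiners H (sc_space H \<Theta> \<Phi>) (sc_act H \<Theta> \<Phi>))
       (carr (gns_fibre H \<Phi>) \<times> carr (gns_fibre H \<Theta>))
       (\<lambda>(X, Y). pt (gns_fibre H \<Phi>) (gns_fibre H \<Theta>) X Y)
       (\<lambda>(X, Y). gns_mult H \<Phi> \<Theta> X Y)"

text \<open>The embedding of \<open>E\<^bsub>\<phi>\<^sub>t\<^esub>\<close> into \<open>E(t)\<close>, \<open>t > 0\<close>, through the trivial partition \<open>{0, t}\<close>.\<close>

definition gns_embed :: "'a hilb \<Rightarrow> 'a semigrp \<Rightarrow> real \<Rightarrow> ('a \<Rightarrow> 'a gvec) \<Rightarrow> 'a fib" where
  "gns_embed H \<phi> t X =
     ext_op (gns H (\<phi> t)) (ms_space H \<phi> t) (BH H \<times> carr H) (gns_vec H (\<phi> t))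
       (\<lambda>(a, h). ms_vec H \<phi> t ({0, t}, \<lambda>r\<in>left_ends {0, t}. a, h)) \<circ>\<^bsub>H\<^esub> X"

definition fibre2 :: "'a hilb \<Rightarrow> 'a semigrp \<Rightarrow> 'a semigrp \<Rightarrow> real \<times> real \<Rightarrow> 'a fib2 hilb" where
  "fibre2 H \<phi> \<theta> = (\<lambda>(s, t). tensor (ms_fibre H \<phi> s) (ms_fibre H \<theta> t))"

definition pt2 ::
    "'a hilb \<Rightarrow> 'a semigrp \<Rightarrow> 'a semigrp \<Rightarrow> real \<Rightarrow> real \<Rightarrow> 'a fib \<Rightarrow> 'a fib \<Rightarrow> 'a fib2" where
  "pt2 H \<phi> \<theta> s t x y = pt (ms_fibre H \<phi> s) (ms_fibre H \<theta> t) x y"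

definition inE :: "'a hilb \<Rightarrow> 'a semigrp \<Rightarrow> 'a semigrp \<Rightarrow> real \<Rightarrow> 'a fib \<Rightarrow> 'a fib2" where
  "inE H \<phi> \<theta> s x = pt2 H \<phi> \<theta> s 0 x (ms_iota H \<theta> 0)"

definition inF :: "'a hilb \<Rightarrow> 'a semigrp \<Rightarrow> 'a semigrp \<Rightarrow> real \<Rightarrow> 'a fib \<Rightarrow> 'a fib2" where
  "inF H \<phi> \<theta> t y = pt2 H \<phi> \<theta> 0 t (ms_iota H \<phi> 0) y"

text \<open>
  A strong commutation unitary \<open>u\<close> for \<open>\<phi>\<^sub>s\<close> and \<open>\<theta>\<^sub>t\<close> induces the unitary
  \<open>F\<^bsub>\<theta>\<^sub>t\<^esub> \<otimes> E\<^bsub>\<phi>\<^sub>s\<^esub> \<rightarrow> E\<^bsub>\<phi>\<^sub>s\<^esub> \<otimes> F\<^bsub>\<theta>\<^sub>t\<^esub>\<close>, \<open>y \<otimes> x \<mapsto> z\<close>, where \<open>z\<close> corresponds to \<open>u (I \<otimes> y) x\<close>.  The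
  multiplication \<open>m : X(0,t) \<otimes> X(s,0) \<rightarrow> X(s,t)\<close> is required to extend this unitary, for all
  \<open>s, t > 0\<close>.  Since \<open>E(s)\<close> and \<open>F(t)\<close> are densely spanned by products of vectors coming from
  trivial partitions of smaller intervals, an associative \<open>m\<close> is determined by this.
\<close>

definition flip_from_strong_commutation ::
    "'a hilb \<Rightarrow> 'a semigrp \<Rightarrow> 'a semigrp \<Rightarrow>
     (real \<times> real \<Rightarrow> real \<times> real \<Rightarrow> 'a fib2 \<Rightarrow> 'a fib2 \<Rightarrow> 'a fib2) \<Rightarrow> bool" where
  "flip_from_strong_commutation H \<phi> \<theta> m \<longleftrightarrow>
     (\<forall>s>0. \<forall>t>0. \<exists>u. strong_comm_unitary H (\<phi> s) (\<theta> t) u \<and>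
        (\<forall>x\<in>carr (gns_fibre H (\<phi> s)). \<forall>y\<in>carr (gns_fibre H (\<theta> t)).
           \<exists>z\<in>carr (tensor (gns_fibre H (\<phi> s)) (gns_fibre H (\<theta> t))).
             gns_mult_op H (\<phi> s) (\<theta> t) z = u \<circ>\<^bsub>H\<^esub> gns_mult H (\<theta> t) (\<phi> s) y x \<and>
             m (0, t) (s, 0) (inF H \<phi> \<theta> t (gns_embed H \<theta> t y)) (inE H \<phi> \<theta> s (gns_embed H \<phi> s x)) =
             ext_op (tensor (gns_fibre H (\<phi> s)) (gns_fibre H (\<theta> t))) (fibre2 H \<phi> \<theta> (s, t))
               (carr (gns_fibre H (\<phi> s)) \<times> carr (gns_fibre H (\<theta> t)))
               (\<lambda>(x', y'). pt (gns_fibre H (\<phi> s)) (gns_fibre H (\<theta> t)) x' y')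
               (\<lambda>(x', y'). pt2 H \<phi> \<theta> s t (gns_embed H \<phi> s x') (gns_embed H \<theta> t y')) z))"

section \<open>The product-system dilation\<close>

abbreviation Rplus2 :: "(real \<times> real) set" where
  "Rplus2 \<equiv> {0..} \<times> {0..}"

definition two_param_product_system ::
    "'a hilb \<Rightarrow> 'a semigrp \<Rightarrow> 'a semigrp \<Rightarrow>
     (real \<times> real \<Rightarrow> real \<times> real \<Rightarrow> 'a fib2 \<Rightarrow> 'a fib2 \<Rightarrow> 'a fib2) \<Rightarrow> bool" where
  "two_param_product_system H \<phi> \<theta> m \<longleftrightarrow>
     product_system Rplus2 (fibre2 H \<phi> \<theta>) (pt2 H \<phi> \<theta> 0 0 (ms_iota H \<phi> 0) (ms_iota H \<theta> 0)) m \<and>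
     (\<forall>s\<ge>0. \<forall>s'\<ge>0. \<forall>x\<in>carr (ms_fibre H \<phi> s). \<forall>x'\<in>carr (ms_fibre H \<phi> s').
        m (s, 0) (s', 0) (inE H \<phi> \<theta> s x) (inE H \<phi> \<theta> s' x') =
        inE H \<phi> \<theta> (s + s') (ms_mult H \<phi> s s' x x')) \<and>
     (\<forall>t\<ge>0. \<forall>t'\<ge>0. \<forall>y\<in>carr (ms_fibre H \<theta> t). \<forall>y'\<in>carr (ms_fibre H \<theta> t').
        m (0, t) (0, t') (inF H \<phi> \<theta> t y) (inF H \<phi> \<theta> t' y') =
        inF H \<phi> \<theta> (t + t') (ms_mult H \<theta> t t' y y')) \<and>
     (\<forall>s\<ge>0. \<forall>t\<ge>0. \<forall>x\<in>carr (ms_fibre H \<phi> s). \<forall>y\<in>carr (ms_fibre H \<theta> t).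
        m (s, 0) (0, t) (inE H \<phi> \<theta> s x) (inF H \<phi> \<theta> t y) = pt2 H \<phi> \<theta> s t x y) \<and>
     flip_from_strong_commutation H \<phi> \<theta> m"

definition conj_semigroup :: "(real \<Rightarrow> 'x hilb) \<Rightarrow> 'b hilb \<Rightarrow> (real \<Rightarrow> 'x \<Rightarrow> 'b \<Rightarrow> 'b) \<Rightarrow> 'b semigrp" where
  "conj_semigroup X K W = (\<lambda>t A.
     tilde (X t) K (W t) \<circ>\<^bsub>K\<^esub>
       (ampl (X t) K A \<circ>\<^bsub>K\<^esub> adj (tensor (X t) K) K (tilde (X t) K (W t))))"

text \<open>\<open>\<alpha>\<close> and \<open>\<beta>\<close> form the \<open>E\<^sub>0\<close>-dilation of \<open>(\<phi>, \<theta>)\<close> on \<open>K \<supseteq> H\<close> obtained from the multiplication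
  \<open>m\<close> on the fibres \<open>E(s) \<otimes> F(t)\<close>, the representation \<open>T\<close> and its isometric dilation \<open>V\<close>.\<close>

definition product_system_e0_dilation ::
    "'a hilb \<Rightarrow> 'a semigrp \<Rightarrow> 'a semigrp \<Rightarrow>
     (real \<times> real \<Rightarrow> real \<times> real \<Rightarrow> 'a fib2 \<Rightarrow> 'a fib2 \<Rightarrow> 'a fib2) \<Rightarrow>
     (real \<times> real \<Rightarrow> 'a fib2 \<Rightarrow> 'a \<Rightarrow> 'a) \<Rightarrow>
     'b hilb \<Rightarrow> ('a \<Rightarrow> 'b) \<Rightarrow> (real \<times> real \<Rightarrow> 'a fib2 \<Rightarrow> 'b \<Rightarrow> 'b) \<Rightarrow>
     'b semigrp \<Rightarrow> 'b semigrp \<Rightarrow> bool" where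
  "product_system_e0_dilation H \<phi> \<theta> m T K J V \<alpha> \<beta> \<longleftrightarrow>
     (let X = fibre2 H \<phi> \<theta>; e = pt2 H \<phi> \<theta> 0 0 (ms_iota H \<phi> 0) (ms_iota H \<theta> 0) in
      two_param_product_system H \<phi> \<theta> m \<and>
      ps_representation Rplus2 X e m H T \<and> rep_fully_coisometric Rplus2 X H T \<and>
      (\<forall>s\<ge>0. \<forall>t\<ge>0. \<forall>x\<in>carr (ms_fibre H \<phi> s). \<forall>y\<in>carr (ms_fibre H \<theta> t).
         T (s, t) (pt2 H \<phi> \<theta> s t x y) = ms_rep H \<phi> s x \<circ>\<^bsub>H\<^esub> ms_rep H \<theta> t y) \<and>
      separable_hilbert_space K \<and>
      minimal_isometric_dilation Rplus2 X e m H T K J V \<and> rep_fully_coisometric Rplus2 X K V) \<and>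
     (\<forall>t\<ge>0. \<forall>A\<in>BH K.
        \<alpha> t A = conj_semigroup (ms_fibre H \<phi>) K (\<lambda>t x. V (t, 0) (inE H \<phi> \<theta> t x)) t A) \<and>
     (\<forall>t\<ge>0. \<forall>A\<in>BH K.
        \<beta> t A = conj_semigroup (ms_fibre H \<theta>) K (\<lambda>t y. V (0, t) (inF H \<phi> \<theta> t y)) t A) \<and>
     e0_semigroup K \<alpha> \<and> e0_semigroup K \<beta> \<and>
     (\<forall>s\<ge>0. \<forall>t\<ge>0. \<forall>A\<in>BH K. \<alpha> s (\<beta> t A) = \<beta> t (\<alpha> s A)) \<and>
     (\<forall>s\<ge>0. \<forall>t\<ge>0. \<forall>A\<in>BH K. \<phi> s (\<theta> t (compr H K J A)) = compr H K J (\<alpha> s (\<beta> t A)))"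

end

theory Submission
  imports Defs
begin

text \<open>
  Both \<open>\<alpha>\<close> and \<open>\<sigma>\<close> dilate \<open>\<phi>\<close>, and both are implemented by the product system \<open>E\<close> of \<open>\<phi>\<close>.
  For any dilation \<open>\<sigma>\<close> on \<open>G \<supseteq> H\<close> the words
  \<open>a\<^sub>1 \<otimes> \<dots> \<otimes> a\<^sub>n \<otimes> h \<mapsto> \<sigma>\<^bsub>t\<^esub>(a\<^sub>1) \<sigma>\<^bsub>t - t\<^sub>1\<^esub>(a\<^sub>2) \<cdots> h\<close> embed the Muhly--Solel space
  \<open>H\<^sub>t\<close> isometrically into \<open>G\<close>, and an intertwiner \<open>X \<in> E(t)\<close> extends to an operator \<open>S\<^sub>t(X)\<close> on \<open>G\<close> with
  \<open>\<sigma>\<^sub>t(A) S\<^sub>t(X) = S\<^sub>t(X) A\<close>.  If \<open>\<sigma>\<close> is minimal, normality of \<open>\<sigma>\<^sub>t\<close> shows that these operators have total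
  range, so \<open>S\<close> implements \<open>\<sigma>\<close>.  On the other side \<open>W\<^sub>t(x) = V\<^bsub>(t, 0)\<^esub>(x \<otimes> 1)\<close> implements \<open>\<alpha>\<close>.
  As \<open>\<phi>\<close> is not automorphic, \<open>K\<close> and \<open>G\<close> are infinite dimensional and separable; for a unitary
  \<open>\<Omega> : K \<rightarrow> G\<close> the formula \<open>U\<^sub>t W\<^sub>t(x) k = \<Omega>\<^sup>* S\<^sub>t(x) \<Omega> k\<close> defines the cocycle.  It is strongly continuous
  because there are \<open>e\<^sub>t \<in> E(t)\<close> such that both \<open>W\<^sub>t(e\<^sub>t)\<close> and \<open>S\<^sub>t(e\<^sub>t)\<close> tend strongly to \<open>I\<close> as \<open>t \<rightarrow> 0\<close>.
\<close>

section \<open>Inner product spaces on a carrier\<close>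

text \<open>Positivity shapes the construction: every fibre is a Hausdorff completion, a Hilbert
  space only if its kernel is positive semidefinite. Instead of deriving this from complete
  positivity, each kernel is exhibited as the Gram kernel of explicit vectors in \<open>K\<close> or
  \<open>G\<close>; the completion is then isometric to a closed subspace of a known Hilbert space,
  and operators on it are restrictions of known operators. The hypothesis on \<phi> decides the
  dimensions. For finite-dimensional \<open>H\<close> and automorphic \<phi> the minimal dilation is
  \<phi> itself, while \<theta> may force \<open>K\<close> to be infinite-dimensional, and then no
  unitary from \<open>K\<close> to \<open>G\<close> exists. Strong continuity is proved directly
  from the weak continuity of \<alpha> and \<sigma>, without measurability arguments. The vectors
  \<open>e\<close> near the identity come from \<open>\<sigma> t\<close> applied to the projection
  onto a unit vector of \<open>H\<close>; the estimate passes from \<open>G\<close> to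
  \<open>K\<close> through compressions to \<open>H\<close>, which depend on \<phi> alone.\<close>

locale inner_space =
  fixes H :: "'a hilb"
  assumes add_closed [simp]: "x \<in> carr H \<Longrightarrow> y \<in> carr H \<Longrightarrow> hadd H x y \<in> carr H"
    and zero_closed [simp]: "hzero H \<in> carr H"
    and scale_closed [simp]: "x \<in> carr H \<Longrightarrow> hscale H c x \<in> carr H"
    and inner_commute: "x \<in> carr H \<Longrightarrow> y \<in> carr H \<Longrightarrow> hinner H y x = cnj (hinner H x y)"
    and inner_add [simp]: "x \<in> carr H \<Longrightarrow> y \<in> carr H \<Longrightarrow> z \<in> carr H \<Longrightarrow>
      hinner H x (hadd H y z) = hinner H x y + hinner H x z"
    and inner_scale [simp]: "x \<in> carr H \<Longrightarrow> y \<in> carr H \<Longrightarrow>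
      hinner H x (hscale H c y) = c * hinner H x y"
    and inner_zero [simp]: "x \<in> carr H \<Longrightarrow> hinner H x (hzero H) = 0"
    and inner_nonneg: "x \<in> carr H \<Longrightarrow> 0 \<le> Re (hinner H x x)"
    and vec_eqI: "x \<in> carr H \<Longrightarrow> y \<in> carr H \<Longrightarrow>
      (\<And>z. z \<in> carr H \<Longrightarrow> hinner H z x = hinner H z y) \<Longrightarrow> x = y"
begin

abbreviation hsub :: "'a \<Rightarrow> 'a \<Rightarrow> 'a" where
  "hsub x y \<equiv> hadd H x (hscale H (-1) y)"

lemma inner_add_left [simp]: "x \<in> carr H \<Longrightarrow> y \<in> carr H \<Longrightarrow> z \<in> carr H \<Longrightarrow>
    hinner H (hadd H x y) z = hinner H x z + hinner H y z"
  by (metis add_closed complex_cnj_add inner_add inner_commute)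

lemma inner_scale_left [simp]: "x \<in> carr H \<Longrightarrow> y \<in> carr H \<Longrightarrow>
    hinner H (hscale H c x) y = cnj c * hinner H x y"
  by (metis complex_cnj_mult inner_commute inner_scale scale_closed)

lemma inner_zero_left [simp]: "x \<in> carr H \<Longrightarrow> hinner H (hzero H) x = 0"
  by (metis complex_cnj_zero inner_commute inner_zero zero_closed)

lemma inner_self: "x \<in> carr H \<Longrightarrow> hinner H x x = of_real ((hnorm H x)\<^sup>2)"
proof -
  assume x: "x \<in> carr H"
  have "Im (hinner H x x) = 0"
    using inner_commute[OF x x] by (metis cnj.simps(2) neg_equal_zero)
  then show ?thesis
    using inner_nonneg[OF x] by (simp add: hnorm_def complex_eq_iff)
qed

lemma norm_sq: "x \<in> carr H \<Longrightarrow> (hnorm H x)\<^sup>2 = Re (hinner H x x)"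
  by (simp add: inner_self)

lemma norm_nonneg [simp]: "x \<in> carr H \<Longrightarrow> 0 \<le> hnorm H x"
  by (simp add: hnorm_def inner_nonneg)

lemma norm_scale [simp]: "x \<in> carr H \<Longrightarrow> hnorm H (hscale H c x) = cmod c * hnorm H x"
proof -
  assume x: "x \<in> carr H"
  have "(hnorm H (hscale H c x))\<^sup>2 = (cmod c * hnorm H x)\<^sup>2"
  proof -
    have "cnj c * (c * of_real ((hnorm H x)\<^sup>2)) = of_real ((cmod c)\<^sup>2 * (hnorm H x)\<^sup>2)"
      by (metis complex_norm_square mult.assoc mult.commute of_real_mult of_real_power)
    then have "hinner H (hscale H c x) (hscale H c x) = of_real ((cmod c)\<^sup>2 * (hnorm H x)\<^sup>2)"
      using x inner_self[OF x] by (simp add: mult.left_commute)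
    then show ?thesis
      using x norm_sq[of "hscale H c x"] by (simp add: power_mult_distrib)
  qed
  then show ?thesis
    using x by (simp add: power2_eq_iff_nonneg)
qed

lemma cauchy_schwarz:
  assumes x: "x \<in> carr H" and y: "y \<in> carr H"
  shows "cmod (hinner H x y) \<le> hnorm H x * hnorm H y"
proof -
  let ?w = "hinner H x y"
  \<comment> \<open>The squared norm of r x minus the conjugate of \<open>?w\<close> times y,
    written as a quadratic polynomial in the real number r.\<close>
  have q: "0 \<le> (hnorm H x)\<^sup>2 * r\<^sup>2 - 2 * r * (cmod ?w)\<^sup>2 + (cmod ?w)\<^sup>2 * (hnorm H y)\<^sup>2" for r :: real
  proof -
    let ?v = "hadd H (hscale H (of_real r) x) (hscale H (- cnj ?w) y)"
    have "0 \<le> Re (hinner H ?v ?v)" using x y by (intro inner_nonneg) auto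
    also have "hinner H ?v ?v = of_real (r\<^sup>2 * (hnorm H x)\<^sup>2 - 2 * r * (cmod ?w)\<^sup>2 + (cmod ?w)\<^sup>2 * (hnorm H y)\<^sup>2)"
    proof -
      have w: "cnj ?w * ?w = of_real ((cmod ?w)\<^sup>2)" by (metis complex_norm_square mult.commute of_real_power)
      have "hinner H ?v ?v = of_real (r\<^sup>2 * (hnorm H x)\<^sup>2) - 2 * of_real r * (cnj ?w * ?w) + (cnj ?w * ?w) * of_real ((hnorm H y)\<^sup>2)"
        using x y by (simp add: inner_self[OF x] inner_self[OF y] inner_commute[OF x y] algebra_simps power2_eq_square)
      then show ?thesis unfolding w by simp
    qed
    finally show ?thesis by (simp add: algebra_simps)
  qed
  have "(cmod ?w)\<^sup>2 \<le> (hnorm H x * hnorm H y)\<^sup>2"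
  proof (cases "hnorm H x = 0")
    case True
    have "(cmod ?w)\<^sup>2 \<le> 0"
    proof (rule ccontr)
      assume "\<not> (cmod ?w)\<^sup>2 \<le> 0"
      then have p: "(cmod ?w)\<^sup>2 > 0" by simp
      have "0 \<le> - 2 * ((hnorm H y)\<^sup>2 + 1) * (cmod ?w)\<^sup>2 + (cmod ?w)\<^sup>2 * (hnorm H y)\<^sup>2"
        using q[of "(hnorm H y)\<^sup>2 + 1"] True by (simp add: algebra_simps)
      also have "\<dots> = - (cmod ?w)\<^sup>2 * ((hnorm H y)\<^sup>2 + 2)" by (simp add: algebra_simps)
      also have "\<dots> < 0" using p by (simp add: add_nonneg_pos)
      finally show False by simp
    qed
    then show ?thesis by (simp add: True)
  next
    case False
    let ?a = "(hnorm H x)\<^sup>2"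
    have a: "?a > 0" using False by simp
    \<comment> \<open>The value of r is the minimiser of the quadratic polynomial.\<close>
    have "0 \<le> ?a * ((cmod ?w)\<^sup>2 / ?a)\<^sup>2 - 2 * ((cmod ?w)\<^sup>2 / ?a) * (cmod ?w)\<^sup>2 + (cmod ?w)\<^sup>2 * (hnorm H y)\<^sup>2"
      by (rule q)
    also have "\<dots> = (cmod ?w)\<^sup>2 * ((hnorm H y)\<^sup>2 - (cmod ?w)\<^sup>2 / ?a)"
      using a by (simp add: field_simps power2_eq_square)
    finally have "(cmod ?w)\<^sup>2 = 0 \<or> (hnorm H y)\<^sup>2 - (cmod ?w)\<^sup>2 / ?a \<ge> 0"
      by (metis linorder_not_le mult_pos_neg zero_less_power2 not_le zero_eq_power2)
    then show ?thesis
      using a by (auto simp: field_simps power_mult_distrib)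
  qed
  then show ?thesis using x y by (simp add: power2_le_iff_abs_le)
qed

lemma norm_triangle:
  assumes x: "x \<in> carr H" and y: "y \<in> carr H"
  shows "hnorm H (hadd H x y) \<le> hnorm H x + hnorm H y"
proof -
  have "(hnorm H (hadd H x y))\<^sup>2 = (hnorm H x)\<^sup>2 + (hnorm H y)\<^sup>2 + 2 * Re (hinner H x y)"
    using x y by (simp add: norm_sq inner_commute[OF x y])
  also have "\<dots> \<le> (hnorm H x + hnorm H y)\<^sup>2"
    using cauchy_schwarz[OF x y] complex_Re_le_cmod[of "hinner H x y"]
    by (simp add: power2_sum)
  finally show ?thesis using x y by (simp add: power2_le_iff_abs_le)
qed

lemma norm_zero_iff: "x \<in> carr H \<Longrightarrow> hnorm H x = 0 \<longleftrightarrow> x = hzero H"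
proof
  assume x: "x \<in> carr H" and "hnorm H x = 0"
  then have "hinner H z x = 0" if "z \<in> carr H" for z
    using cauchy_schwarz[OF that x] by simp
  then show "x = hzero H" using x by (intro vec_eqI) auto
qed (simp add: hnorm_def)

lemma inner_self_zero: "x \<in> carr H \<Longrightarrow> hinner H x x = 0 \<Longrightarrow> x = hzero H"
  using norm_zero_iff[of x] by (simp add: inner_self)

lemma norm_zero [simp]: "hnorm H (hzero H) = 0"
  by (simp add: norm_zero_iff)

lemma hsub_zero_iff: "x \<in> carr H \<Longrightarrow> y \<in> carr H \<Longrightarrow> hnorm H (hsub x y) = 0 \<longleftrightarrow> x = y"
proof
  assume x: "x \<in> carr H" and y: "y \<in> carr H" and "hnorm H (hsub x y) = 0"
  then have z: "hsub x y = hzero H" by (simp add: norm_zero_iff)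
  have "hinner H z x = hinner H z y" if "z \<in> carr H" for z
  proof -
    have "hinner H z (hsub x y) = 0" using that z by simp
    then show ?thesis using that x y by simp
  qed
  then show "x = y" using x y by (intro vec_eqI)
qed (simp add: hnorm_def)

lemma hsub_commute: "x \<in> carr H \<Longrightarrow> y \<in> carr H \<Longrightarrow> hnorm H (hsub x y) = hnorm H (hsub y x)"
proof -
  assume "x \<in> carr H" "y \<in> carr H"
  then have "hsub x y = hscale H (-1) (hsub y x)" by (intro vec_eqI) auto
  then show ?thesis using \<open>x \<in> carr H\<close> \<open>y \<in> carr H\<close> by simp
qed

lemma hsub_triangle:
  assumes "x \<in> carr H" "y \<in> carr H" "z \<in> carr H"
  shows "hnorm H (hsub x z) \<le> hnorm H (hsub x y) + hnorm H (hsub y z)"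
proof -
  have "hsub x z = hadd H (hsub x y) (hsub y z)" using assms by (intro vec_eqI) auto
  then show ?thesis using assms norm_triangle[of "hsub x y" "hsub y z"] by simp
qed

lemma metric: "Metric_space (carr H) (hdist H)"
  by unfold_locales (auto simp: hdist_def hsub_zero_iff hsub_commute hsub_triangle)

definition tends :: "(nat \<Rightarrow> 'a) \<Rightarrow> 'a \<Rightarrow> bool" where
  "tends f x \<longleftrightarrow> (\<lambda>n. hnorm H (hsub (f n) x)) \<longlonglongrightarrow> 0"

definition cauchy :: "(nat \<Rightarrow> 'a) \<Rightarrow> bool" where
  "cauchy f \<longleftrightarrow> (\<forall>e>0. \<exists>N. \<forall>m\<ge>N. \<forall>n\<ge>N. hnorm H (hsub (f m) (f n)) < e)"

lemma tends_inner:
  assumes "\<And>n. f n \<in> carr H" "x \<in> carr H" "y \<in> carr H" "tends f x"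
  shows "(\<lambda>n. hinner H y (f n)) \<longlonglongrightarrow> hinner H y x" "(\<lambda>n. hinner H (f n) y) \<longlonglongrightarrow> hinner H x y"
proof -
  have "(\<lambda>n. hinner H y (f n) - hinner H y x) \<longlonglongrightarrow> 0"
  proof (rule Lim_null_comparison)
    show "\<forall>\<^sub>F n in sequentially. norm (hinner H y (f n) - hinner H y x) \<le> hnorm H y * hnorm H (hsub (f n) x)"
      using assms cauchy_schwarz[of y "hsub (f _) x"] by (intro always_eventually) simp
    show "(\<lambda>n. hnorm H y * hnorm H (hsub (f n) x)) \<longlonglongrightarrow> 0"
      using assms(4) by (auto simp: tends_def intro: tendsto_mult_right_zero)
  qed
  then show *: "(\<lambda>n. hinner H y (f n)) \<longlonglongrightarrow> hinner H y x" by (simp add: LIM_zero_iff)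
  have "(\<lambda>n. cnj (hinner H y (f n))) \<longlonglongrightarrow> cnj (hinner H y x)"
    using * by (rule tendsto_cnj)
  then show "(\<lambda>n. hinner H (f n) y) \<longlonglongrightarrow> hinner H x y"
    using assms inner_commute[of y] by simp
qed

lemma norm_diff_le: "x \<in> carr H \<Longrightarrow> y \<in> carr H \<Longrightarrow> \<bar>hnorm H x - hnorm H y\<bar> \<le> hnorm H (hsub x y)"
proof -
  assume x: "x \<in> carr H" and y: "y \<in> carr H"
  have "hadd H (hsub x y) y = x" "hadd H (hsub y x) x = y" using x y by (auto intro!: vec_eqI)
  then show ?thesis
    using norm_triangle[of "hsub x y" y] norm_triangle[of "hsub y x" x] x y hsub_commute[of x y] by simp
qed

lemma tends_norm:
  assumes "\<And>n. f n \<in> carr H" "x \<in> carr H" "tends f x"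
  shows "(\<lambda>n. hnorm H (f n)) \<longlonglongrightarrow> hnorm H x"
proof -
  have "(\<lambda>n. hnorm H (f n) - hnorm H x) \<longlonglongrightarrow> 0"
    by (rule Lim_null_comparison[OF _ assms(3)[unfolded tends_def]])
      (use assms norm_diff_le in auto)
  then show ?thesis by (simp add: LIM_zero_iff)
qed

lemma tends_unique:
  assumes "\<And>n. f n \<in> carr H" "x \<in> carr H" "y \<in> carr H" "tends f x" "tends f y"
  shows "x = y"
  using assms by (intro vec_eqI) (auto intro: LIMSEQ_unique tends_inner)

lemma tends_cauchy:
  assumes "\<And>n. f n \<in> carr H" "x \<in> carr H" "tends f x"
  shows "cauchy f"
  unfolding cauchy_def
proof (intro allI impI)
  fix e :: real assume "e > 0"
  then obtain N where N: "\<And>n. n \<ge> N \<Longrightarrow> hnorm H (hsub (f n) x) < e / 2"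
    using assms(1,2) assms(3)[unfolded tends_def lim_sequentially]
    by (force simp: dist_real_def dest!: spec[of _ "e/2"])
  have "hnorm H (hsub (f m) (f n)) < e" if "m \<ge> N" "n \<ge> N" for m n
    using hsub_triangle[of "f m" x "f n"] hsub_commute[of x "f n"] N[OF that(1)] N[OF that(2)] assms
    by simp
  then show "\<exists>N. \<forall>m\<ge>N. \<forall>n\<ge>N. hnorm H (hsub (f m) (f n)) < e" by blast
qed

lemma mcomplete_iff:
  "Metric_space.mcomplete (carr H) (hdist H) \<longleftrightarrow>
     (\<forall>f. (\<forall>n. f n \<in> carr H) \<and> cauchy f \<longrightarrow> (\<exists>x\<in>carr H. tends f x))"
proof -
  interpret M: Metric_space "carr H" "hdist H" by (rule metric)
  have 1: "M.MCauchy f \<longleftrightarrow> (\<forall>n. f n \<in> carr H) \<and> cauchy f" for f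
    by (auto simp: M.MCauchy_def cauchy_def hdist_def image_subset_iff)
  have 2: "limitin M.mtopology f x sequentially \<longleftrightarrow> x \<in> carr H \<and> tends f x" if "\<forall>n. f n \<in> carr H" for f x
    using that by (auto simp: M.limit_metric_sequentially tends_def lim_sequentially hdist_def dist_real_def)
  show ?thesis
    unfolding M.mcomplete_def using 1 2 by (metis (no_types, lifting))
qed

text \<open>Totality is encoded as a trivial orthogonal complement, the form in which adjoints can
  be tested directly. In a Hilbert space, density of the linear span is recovered by
  \<open>total_approx\<close>.\<close>

definition total :: "'a set \<Rightarrow> bool" where
  "total S \<longleftrightarrow> S \<subseteq> carr H \<and> (\<forall>y\<in>carr H. (\<forall>s\<in>S. hinner H s y = 0) \<longrightarrow> y = hzero H)"

lemma totalD: "total S \<Longrightarrow> y \<in> carr H \<Longrightarrow> (\<And>s. s \<in> S \<Longrightarrow> hinner H s y = 0) \<Longrightarrow> y = hzero H"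
  by (auto simp: total_def)

lemma totalD_eq:
  assumes "total S" "x \<in> carr H" "y \<in> carr H" "\<And>s. s \<in> S \<Longrightarrow> hinner H s x = hinner H s y"
  shows "x = y"
proof -
  have "hsub x y = hzero H"
    using assms by (intro totalD[OF assms(1)]) (auto simp: total_def subset_iff)
  then show ?thesis using assms hsub_zero_iff[of x y] by simp
qed

text \<open>Addition is a field of a record and not a class operation, hence lists of coefficients
  and indices in place of \<open>sum\<close>. Inner products turn them into ordinary sums.\<close>

fun lincomb :: "('i \<Rightarrow> 'a) \<Rightarrow> (complex \<times> 'i) list \<Rightarrow> 'a" where
  "lincomb f [] = hzero H"
| "lincomb f ((c, i) # xs) = hadd H (hscale H c (f i)) (lincomb f xs)"

lemma lincomb_closed [simp]: "(\<And>i. i \<in> snd ` set xs \<Longrightarrow> f i \<in> carr H) \<Longrightarrow> lincomb f xs \<in> carr H"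
  by (induction f xs rule: lincomb.induct) auto

lemma inner_lincomb: "(\<And>i. i \<in> snd ` set xs \<Longrightarrow> f i \<in> carr H) \<Longrightarrow> y \<in> carr H \<Longrightarrow>
    hinner H y (lincomb f xs) = (\<Sum>(c, i)\<leftarrow>xs. c * hinner H y (f i))"
  by (induction f xs rule: lincomb.induct) auto

lemma lincomb_append: "(\<And>i. i \<in> snd ` set xs \<Longrightarrow> f i \<in> carr H) \<Longrightarrow> (\<And>i. i \<in> snd ` set ys \<Longrightarrow> f i \<in> carr H) \<Longrightarrow>
    lincomb f (xs @ ys) = hadd H (lincomb f xs) (lincomb f ys)"
proof (induction xs)
  case (Cons a xs)
  then show ?case by (cases a) (auto intro!: vec_eqI simp: image_Un)
qed (auto intro: vec_eqI)

lemma lincomb_scale: "(\<And>i. i \<in> snd ` set xs \<Longrightarrow> f i \<in> carr H) \<Longrightarrow>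
    lincomb f (map (\<lambda>(c, i). (z * c, i)) xs) = hscale H z (lincomb f xs)"
proof (induction xs)
  case (Cons a xs)
  then show ?case by (cases a) (auto intro!: vec_eqI simp: algebra_simps)
qed (auto intro: vec_eqI)

end

sublocale hilbert_space \<subseteq> inner_space
proof
  show zero: "hinner H x (hzero H) = 0" if "x \<in> carr H" for x
  proof -
    have "hinner H x (hzero H) = hinner H x (hadd H x (hscale H (-1) x))"
      using add_inverse that by simp
    then show ?thesis using that scale_closed by (simp add: inner_add inner_scale)
  qed
  show "x = y" if *: "x \<in> carr H" "y \<in> carr H" "\<And>z. z \<in> carr H \<Longrightarrow> hinner H z x = hinner H z y" for x y
  proof -
    let ?d = "hadd H x (hscale H (-1) y)"
    have d: "?d \<in> carr H" using * add_closed scale_closed by simp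
    have "hinner H ?d ?d = 0"
      using *(3)[OF d] * d scale_closed by (simp add: inner_add inner_scale)
    then have "?d = hzero H" using d inner_definite by simp
    then have "hadd H y ?d = y" using * add_zero by simp
    moreover have "hadd H y ?d = hadd H x (hadd H y (hscale H (-1) y))"
      using * scale_closed add_closed by (metis add_assoc add_commute)
    ultimately show ?thesis using * add_inverse add_zero by simp
  qed
qed (auto intro: add_closed zero_closed scale_closed inner_commute inner_add inner_scale inner_nonneg)

text \<open>The vector space laws are not among the axioms of \<open>inner_space\<close>; they all
  follow from \<open>vec_eqI\<close>, since taking inner products reduces each of them to an
  identity between complex numbers. Only completeness has to be added.\<close>

lemma (in inner_space) hilbert_spaceI:
  assumes "\<And>f. (\<And>n. f n \<in> carr H) \<Longrightarrow> cauchy f \<Longrightarrow> \<exists>x\<in>carr H. tends f x"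
  shows "hilbert_space H"
proof
  show "Metric_space.mcomplete (carr H) (hdist H)"
    using assms by (auto simp: mcomplete_iff)
  show "\<And>x. x \<in> carr H \<Longrightarrow> hinner H x x = 0 \<Longrightarrow> x = hzero H"
    by (rule inner_self_zero)
  show "\<And>x y. x \<in> carr H \<Longrightarrow> y \<in> carr H \<Longrightarrow> hinner H y x = cnj (hinner H x y)"
    by (rule inner_commute)
qed (auto intro!: vec_eqI inner_nonneg simp: algebra_simps)

section \<open>Linear subspaces, the Riesz theorem and density\<close>

context inner_space
begin

definition lin_subspace :: "'a set \<Rightarrow> bool" where
  "lin_subspace M \<longleftrightarrow> M \<subseteq> carr H \<and> hzero H \<in> M \<and>
     (\<forall>x\<in>M. \<forall>y\<in>M. hadd H x y \<in> M) \<and> (\<forall>c. \<forall>x\<in>M. hscale H c x \<in> M)"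

lemma lin_subspace_lincombs:
  assumes "f ` S \<subseteq> carr H"
  shows "lin_subspace {lincomb f xs | xs. snd ` set xs \<subseteq> S}"
  unfolding lin_subspace_def
proof (intro conjI ballI allI)
  show "{lincomb f xs | xs. snd ` set xs \<subseteq> S} \<subseteq> carr H"
    using assms by (force intro!: lincomb_closed)
  show "hzero H \<in> {lincomb f xs | xs. snd ` set xs \<subseteq> S}"
    by (rule CollectI, rule exI[of _ "[]"]) simp
next
  fix x y assume "x \<in> {lincomb f xs | xs. snd ` set xs \<subseteq> S}" "y \<in> {lincomb f xs | xs. snd ` set xs \<subseteq> S}"
  then obtain xs ys where *: "x = lincomb f xs" "y = lincomb f ys" "snd ` set xs \<subseteq> S" "snd ` set ys \<subseteq> S"
    by blast
  then have "hadd H x y = lincomb f (xs @ ys)"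
    using assms by (subst lincomb_append) (auto simp: image_subset_iff)
  then show "hadd H x y \<in> {lincomb f xs | xs. snd ` set xs \<subseteq> S}"
    using * by (intro CollectI exI[of _ "xs @ ys"]) auto
next
  fix c x assume "x \<in> {lincomb f xs | xs. snd ` set xs \<subseteq> S}"
  then obtain xs where *: "x = lincomb f xs" "snd ` set xs \<subseteq> S" by blast
  then have "hscale H c x = lincomb f (map (\<lambda>(d, i). (c * d, i)) xs)"
    using assms by (subst lincomb_scale) (auto simp: image_subset_iff)
  then show "hscale H c x \<in> {lincomb f xs | xs. snd ` set xs \<subseteq> S}"
    using * by (intro CollectI exI[of _ "map (\<lambda>(d, i). (c * d, i)) xs"]) force
qed

end

context hilbert_space
begin

lemma cauchy_tends:
  assumes "\<And>n. f n \<in> carr H" "cauchy f"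
  shows "\<exists>x\<in>carr H. tends f x"
  using complete assms by (auto simp: mcomplete_iff)

text \<open>Minimising \<open>\<parallel>x\<parallel>\<^sup>2 - 2 Re (F x)\<close> over a subspace yields both the Riesz representation theorem
  (for the whole space) and orthogonal projections (for \<open>F = \<langle>x, \<cdot>\<rangle>\<close>).\<close>

lemma riesz_subspace:
  assumes M: "lin_subspace M"
    and F_add: "\<And>x y. x \<in> M \<Longrightarrow> y \<in> M \<Longrightarrow> F (hadd H x y) = F x + F y"
    and F_scale: "\<And>c x. x \<in> M \<Longrightarrow> F (hscale H c x) = c * F x"
    and F_bound: "\<And>x. x \<in> M \<Longrightarrow> cmod (F x) \<le> b * hnorm H x"
  shows "\<exists>v\<in>carr H. \<exists>xs. (\<forall>n. xs n \<in> M) \<and> tends xs v \<and> (\<forall>y\<in>M. hinner H v y = F y)"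
proof -
  have MH: "x \<in> M \<Longrightarrow> x \<in> carr H" and Mz: "hzero H \<in> M"
    and Ma: "x \<in> M \<Longrightarrow> y \<in> M \<Longrightarrow> hadd H x y \<in> M" and Ms: "x \<in> M \<Longrightarrow> hscale H c x \<in> M" for x y c
    using M by (auto simp: lin_subspace_def)
  define q where "q x = (hnorm H x)\<^sup>2 - 2 * Re (F x)" for x
  \<comment> \<open>Expansion of the functional along a line. The distance estimate for almost
    minimal points and the variation at the minimiser are both instances.\<close>
  have q_add: "q (hadd H x (hscale H z y)) =
      q x + (cmod z)\<^sup>2 * (hnorm H y)\<^sup>2 + 2 * Re (z * (hinner H x y - F y))" if "x \<in> M" "y \<in> M" for x y z
  proof -
    have "(hnorm H (hadd H x (hscale H z y)))\<^sup>2 = (hnorm H x)\<^sup>2 + (hnorm H (hscale H z y))\<^sup>2 + 2 * Re (z * hinner H x y)"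
      using that MH by (simp add: norm_sq[of "hadd H x (hscale H z y)"] norm_sq[of "hscale H z y"] norm_sq[of x]
        inner_commute[of x y] algebra_simps del: norm_scale)
    then show ?thesis
      using that MH Ms by (simp add: q_def F_add F_scale power_mult_distrib algebra_simps)
  qed
  have q_lower: "- b\<^sup>2 \<le> q x" if "x \<in> M" for x
  proof -
    have "Re (F x) \<le> b * hnorm H x"
      using F_bound[OF that] complex_Re_le_cmod order_trans by blast
    moreover have "0 \<le> (hnorm H x - b)\<^sup>2" by simp
    ultimately show ?thesis by (simp add: q_def power2_diff algebra_simps)
  qed
  define I where "I = Inf (q ` M)"
  have bdd: "bdd_below (q ` M)" using q_lower by (auto intro!: bdd_belowI2)
  have I_le: "I \<le> q x" if "x \<in> M" for x
    unfolding I_def using bdd that by (intro cInf_lower) auto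
  have "\<exists>x\<in>M. q x < I + 1 / real (Suc n)" for n
    using cInf_lessD[of "q ` M" "I + 1 / real (Suc n)"] Mz by (auto simp: I_def)
  then obtain xs where xs: "\<And>n. xs n \<in> M" "\<And>n. q (xs n) < I + 1 / real (Suc n)" by metis
  \<comment> \<open>Comparison with the midpoint \<open>?m\<close>, whose value is at least
    \<open>I\<close>, shows that almost minimal points lie close together.\<close>
  have par: "(hnorm H (hsub x y))\<^sup>2 \<le> 2 * (q x - I) + 2 * (q y - I)" if "x \<in> M" "y \<in> M" for x y
  proof -
    have e: "hadd H x (hscale H (1/2) (hsub y x)) \<in> M" (is "?m \<in> M") using that Ma Ms by simp
    have 1: "q ?m = q x + (hnorm H (hsub y x))\<^sup>2 / 4 + Re (hinner H x (hsub y x) - F (hsub y x))"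
      using q_add[of x "hsub y x" "1/2"] that Ma Ms by (simp add: power2_eq_square)
    have "hadd H x (hscale H 1 (hsub y x)) = y"
      using that MH by (intro vec_eqI) auto
    then have 2: "q y = q x + (hnorm H (hsub y x))\<^sup>2 + 2 * Re (hinner H x (hsub y x) - F (hsub y x))"
      using q_add[of x "hsub y x" 1] that Ma Ms by simp
    show ?thesis using 1 2 I_le[OF e] that MH hsub_commute[of x y] by simp
  qed
  have "cauchy xs"
    unfolding cauchy_def
  proof (intro allI impI)
    fix e :: real assume e: "e > 0"
    obtain N where N': "4 / real (Suc N) < e\<^sup>2"
      using reals_Archimedean[of "e\<^sup>2 / 4"] e by (auto simp: field_simps)
    define d where "d = 1 / real (Suc N)"
    have N: "4 * d < e\<^sup>2" using N' by (simp add: d_def)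
    have "hnorm H (hsub (xs m) (xs n)) < e" if "m \<ge> N" "n \<ge> N" for m n
    proof -
      have "1 / real (Suc k) \<le> d" if "k \<ge> N" for k
        using that by (simp add: d_def field_simps)
      then have "q (xs m) < I + d" "q (xs n) < I + d"
        using xs(2)[of m] xs(2)[of n] that by fastforce+
      moreover have "A < e\<^sup>2" if "P < I + d" "R < I + d" "A \<le> 2 * (P - I) + 2 * (R - I)" for A P R :: real
      proof -
        have "2 * (P - I) + 2 * (R - I) < 2 * d + 2 * d" using that by (intro add_strict_mono) simp_all
        then show ?thesis using N that by simp
      qed
      ultimately have "(hnorm H (hsub (xs m) (xs n)))\<^sup>2 < e\<^sup>2"
        using par[OF xs(1) xs(1), of m n] by blast
      then show ?thesis using e by (simp add: power2_less_imp_less)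
    qed
    then show "\<exists>N. \<forall>m\<ge>N. \<forall>n\<ge>N. hnorm H (hsub (xs m) (xs n)) < e" by blast
  qed
  then obtain v where v: "v \<in> carr H" "tends xs v" using cauchy_tends xs(1) MH by blast
  have "hinner H v y = F y" if y: "y \<in> M" for y
  proof (rule ccontr)
    assume "hinner H v y \<noteq> F y"
    define w where "w = hinner H v y - F y"
    have w: "w \<noteq> 0" using \<open>hinner H v y \<noteq> F y\<close> by (simp add: w_def)
    have *: "0 \<le> (cmod z)\<^sup>2 * (hnorm H y)\<^sup>2 + 2 * Re (z * w)" for z
    proof (rule LIMSEQ_le)
      show "(\<lambda>n. - 1 / real (Suc n)) \<longlonglongrightarrow> 0"
        using tendsto_minus[OF LIMSEQ_inverse_real_of_nat] by (simp add: field_simps)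
      have "(\<lambda>n. hinner H (xs n) y) \<longlonglongrightarrow> hinner H v y"
        using tends_inner(2)[OF _ v(1) MH[OF y] v(2)] xs(1) MH by blast
      then show "(\<lambda>n. (cmod z)\<^sup>2 * (hnorm H y)\<^sup>2 + 2 * Re (z * (hinner H (xs n) y - F y))) \<longlonglongrightarrow>
          (cmod z)\<^sup>2 * (hnorm H y)\<^sup>2 + 2 * Re (z * w)"
        unfolding w_def by (intro tendsto_intros)
      have "- 1 / real (Suc n) \<le> (cmod z)\<^sup>2 * (hnorm H y)\<^sup>2 + 2 * Re (z * (hinner H (xs n) y - F y))" for n
        using I_le[of "hadd H (xs n) (hscale H z y)"] q_add[OF xs(1) y, of n z] xs Ma Ms y
        by (smt (verit, best) minus_divide_left)
      then show "\<exists>N. \<forall>n\<ge>N. - 1 / real (Suc n) \<le> (cmod z)\<^sup>2 * (hnorm H y)\<^sup>2 + 2 * Re (z * (hinner H (xs n) y - F y))"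
        by blast
    qed
    \<comment> \<open>A step of this length against \<open>w\<close> keeps the quadratic term below
      the linear one, so the functional would drop below its infimum.\<close>
    define r where "r = 1 / ((hnorm H y)\<^sup>2 + 1)"
    have Y: "(hnorm H y)\<^sup>2 + 1 > 0" by (simp add: add_nonneg_pos)
    have r: "r > 0" using Y by (simp add: r_def)
    have "cnj w * w = of_real ((cmod w)\<^sup>2)" by (metis complex_norm_square mult.commute of_real_power)
    then have "Re (- of_real r * cnj w * w) = - r * (cmod w)\<^sup>2"
      by (metis Re_complex_of_real mult.assoc of_real_minus of_real_mult)
    then have "0 \<le> r\<^sup>2 * (cmod w)\<^sup>2 * (hnorm H y)\<^sup>2 - 2 * (r * (cmod w)\<^sup>2)"
      using *[of "- of_real r * cnj w"] r by (simp add: norm_mult power_mult_distrib)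
    also have "\<dots> = r * (cmod w)\<^sup>2 * (r * (hnorm H y)\<^sup>2 - 2)" by (simp add: algebra_simps power2_eq_square)
    finally have "0 \<le> r * (hnorm H y)\<^sup>2 - 2"
      using r w mult_pos_neg[of "r * (cmod w)\<^sup>2" "r * (hnorm H y)\<^sup>2 - 2"] by fastforce
    moreover have "r * (hnorm H y)\<^sup>2 \<le> 1" using Y by (simp add: r_def)
    ultimately show False by simp
  qed
  then show ?thesis using v xs(1) by blast
qed

lemma lin_subspace_carr: "lin_subspace (carr H)"
  by (simp add: lin_subspace_def)

lemma riesz:
  assumes "\<And>x y. x \<in> carr H \<Longrightarrow> y \<in> carr H \<Longrightarrow> F (hadd H x y) = F x + F y"
    and "\<And>c x. x \<in> carr H \<Longrightarrow> F (hscale H c x) = c * F x"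
    and "\<And>x. x \<in> carr H \<Longrightarrow> cmod (F x) \<le> b * hnorm H x"
  shows "\<exists>v\<in>carr H. \<forall>y\<in>carr H. hinner H v y = F y"
  using riesz_subspace[OF lin_subspace_carr, of F b] assms by blast

text \<open>The Riesz vector of the functional that x induces on \<open>M\<close> is a limit of
  points of \<open>M\<close>. It has the same inner products with \<open>S\<close> as x, so totality
  identifies the two.\<close>

lemma total_approx:
  assumes "total S" "S \<subseteq> M" "lin_subspace M" "x \<in> carr H"
  shows "\<exists>xs. (\<forall>n. xs n \<in> M) \<and> tends xs x"
proof -
  have MH: "y \<in> M \<Longrightarrow> y \<in> carr H" for y using assms(3) by (auto simp: lin_subspace_def)
  obtain v xs where v: "v \<in> carr H" "\<forall>n. xs n \<in> M" "tends xs v" "\<forall>y\<in>M. hinner H v y = hinner H x y"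
    using riesz_subspace[OF assms(3), of "hinner H x" "hnorm H x"] assms(4) MH cauchy_schwarz by auto
  have "v = x"
  proof (rule totalD_eq[OF assms(1)])
    fix s assume s: "s \<in> S"
    then have "s \<in> carr H" using assms(2) MH by blast
    then show "hinner H s v = hinner H s x"
      using v(4) s assms(2,4) v(1) by (metis inner_commute subsetD)
  qed (use v assms in auto)
  then show ?thesis using v by blast
qed

end

section \<open>Bounded operators, adjoints and their construction on total families\<close>

lemma bopI:
  assumes "\<And>x. x \<in> carr H \<Longrightarrow> f x \<in> carr K" "f \<in> extensional (carr H)"
    and "\<And>x y. x \<in> carr H \<Longrightarrow> y \<in> carr H \<Longrightarrow> f (hadd H x y) = hadd K (f x) (f y)"
    and "\<And>c x. x \<in> carr H \<Longrightarrow> f (hscale H c x) = hscale K c (f x)"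
    and "\<And>x. x \<in> carr H \<Longrightarrow> hnorm K (f x) \<le> b * hnorm H x"
  shows "f \<in> bop H K"
  using assms unfolding bop_def PiE_def by blast

lemma bop_carr [simp]: "f \<in> bop H K \<Longrightarrow> x \<in> carr H \<Longrightarrow> f x \<in> carr K"
  by (auto simp: bop_def PiE_def)

lemmas bop_iff = bop_def[unfolded set_eq_iff mem_Collect_eq, rule_format]

lemma bop_add: "f \<in> bop H K \<Longrightarrow> x \<in> carr H \<Longrightarrow> y \<in> carr H \<Longrightarrow> f (hadd H x y) = hadd K (f x) (f y)"
proof -
  assume *: "f \<in> bop H K" "x \<in> carr H" "y \<in> carr H"
  from *(1) have "\<forall>x\<in>carr H. \<forall>y\<in>carr H. f (hadd H x y) = hadd K (f x) (f y)"
    unfolding bop_iff by (elim conjE)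
  from bspec[OF this *(2)] have "\<forall>y\<in>carr H. f (hadd H x y) = hadd K (f x) (f y)" .
  from bspec[OF this *(3)] show ?thesis .
qed

lemma bop_scale: "f \<in> bop H K \<Longrightarrow> x \<in> carr H \<Longrightarrow> f (hscale H c x) = hscale K c (f x)"
proof -
  assume *: "f \<in> bop H K" "x \<in> carr H"
  from *(1) have "\<forall>c. \<forall>x\<in>carr H. f (hscale H c x) = hscale K c (f x)"
    unfolding bop_iff by (elim conjE)
  from spec[OF this, of c] have "\<forall>x\<in>carr H. f (hscale H c x) = hscale K c (f x)" .
  from bspec[OF this *(2)] show ?thesis .
qed

lemma bop_ext: "f \<in> bop H K \<Longrightarrow> f \<in> extensional (carr H)"
  by (drule bop_iff[THEN iffD1], elim conjE) (simp add: PiE_def)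

lemma bop_eqI: "f \<in> bop H K \<Longrightarrow> g \<in> bop H K \<Longrightarrow> (\<And>x. x \<in> carr H \<Longrightarrow> f x = g x) \<Longrightarrow> f = g"
  by (meson bop_ext extensionalityI)

lemma bop_bound:
  assumes "f \<in> bop H K" "hilbert_space H"
  obtains b where "b \<ge> 0" "\<And>x. x \<in> carr H \<Longrightarrow> hnorm K (f x) \<le> b * hnorm H x"
proof -
  interpret hilbert_space H by fact
  obtain c where c: "\<And>x. x \<in> carr H \<Longrightarrow> hnorm K (f x) \<le> c * hnorm H x"
    using assms(1) unfolding bop_def by blast
  have "c * hnorm H x \<le> \<bar>c\<bar> * hnorm H x" if "x \<in> carr H" for x
    using that by (simp add: mult_right_mono)
  then show thesis using c that[of "\<bar>c\<bar>"] by (meson abs_ge_zero order_trans)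
qed

lemma bop_zero: "f \<in> bop H K \<Longrightarrow> hilbert_space H \<Longrightarrow> hilbert_space K \<Longrightarrow> f (hzero H) = hzero K"
proof -
  assume f: "f \<in> bop H K" and "hilbert_space H" and "hilbert_space K"
  interpret H: hilbert_space H by fact
  interpret K: hilbert_space K by fact
  have "hscale H 0 (hzero H) = hzero H" "hscale K 0 (f (hzero H)) = hzero K"
    using f by (auto intro!: H.vec_eqI K.vec_eqI)
  then show ?thesis using bop_scale[OF f, of "hzero H" 0] by simp
qed

lemma comp_apply [simp]: "x \<in> carr H \<Longrightarrow> (g \<circ>\<^bsub>H\<^esub> f) x = g (f x)"
  by (simp add: compose_def)

lemma comp_bop [simp]:
  assumes "hilbert_space H" "hilbert_space K" "f \<in> bop H K" "g \<in> bop K L"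
  shows "g \<circ>\<^bsub>H\<^esub> f \<in> bop H L"
proof -
  obtain b where b: "b \<ge> 0" "\<And>x. x \<in> carr H \<Longrightarrow> hnorm K (f x) \<le> b * hnorm H x"
    using bop_bound assms by blast
  obtain c where c: "c \<ge> 0" "\<And>x. x \<in> carr K \<Longrightarrow> hnorm L (g x) \<le> c * hnorm K x"
    using bop_bound assms by blast
  interpret H: hilbert_space H by fact
  show ?thesis
  proof (rule bopI[where b = "c * b"])
    fix x assume x: "x \<in> carr H"
    then have "hnorm L (g (f x)) \<le> c * hnorm K (f x)" using c assms by simp
    also have "\<dots> \<le> c * (b * hnorm H x)" using b c x by (simp add: mult_left_mono)
    finally show "hnorm L ((g \<circ>\<^bsub>H\<^esub> f) x) \<le> c * b * hnorm H x" using x by simp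
  qed (use assms in \<open>auto simp: bop_add bop_scale\<close>)
qed

lemma op_id_bop [simp]: "op_id H \<in> BH H" if "hilbert_space H"
proof -
  interpret hilbert_space H by fact
  show ?thesis by (rule bopI[where b = 1]) (auto simp: op_id_def)
qed

lemma op_id_apply [simp]: "x \<in> carr H \<Longrightarrow> op_id H x = x"
  by (simp add: op_id_def)

text \<open>Legitimises the definite description in \<open>adj\<close>. The values come from the
  Riesz theorem, linearity from \<open>vec_eqI\<close>, and the bound from testing f (g y) against
  y.\<close>

lemma adj_ex:
  assumes "hilbert_space H" "hilbert_space K" "f \<in> bop H K"
  shows "\<exists>!g. g \<in> bop K H \<and> (\<forall>x\<in>carr H. \<forall>y\<in>carr K. hinner K (f x) y = hinner H x (g y))"
proof -
  interpret H: hilbert_space H by fact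
  interpret K: hilbert_space K by fact
  obtain b where b: "b \<ge> 0" "\<And>x. x \<in> carr H \<Longrightarrow> hnorm K (f x) \<le> b * hnorm H x"
    using bop_bound assms by blast
  have "\<exists>v\<in>carr H. \<forall>x\<in>carr H. hinner H v x = hinner K y (f x)" if y: "y \<in> carr K" for y
  proof (rule H.riesz[where b = "hnorm K y * b"])
    fix x assume x: "x \<in> carr H"
    have "cmod (hinner K y (f x)) \<le> hnorm K y * hnorm K (f x)" using x y assms K.cauchy_schwarz by simp
    also have "\<dots> \<le> hnorm K y * (b * hnorm H x)" using x y b by (simp add: mult_left_mono)
    finally show "cmod (hinner K y (f x)) \<le> hnorm K y * b * hnorm H x" by simp
  qed (use y assms in \<open>auto simp: bop_add bop_scale\<close>)
  then obtain g where g: "\<And>y. y \<in> carr K \<Longrightarrow> g y \<in> carr H"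
      "\<And>y x. y \<in> carr K \<Longrightarrow> x \<in> carr H \<Longrightarrow> hinner H (g y) x = hinner K y (f x)"
    by metis
  have g': "hinner H x (g y) = hinner K (f x) y" if "y \<in> carr K" "x \<in> carr H" for x y
    using g(2)[OF that] g(1)[OF that(1)] that assms(3) by (metis H.inner_commute K.inner_commute bop_carr)
  have "restrict g (carr K) \<in> bop K H"
  proof (rule bopI[where b = b])
    show "restrict g (carr K) (hadd K x y) = hadd H (restrict g (carr K) x) (restrict g (carr K) y)"
      if "x \<in> carr K" "y \<in> carr K" for x y
      using that g g' assms(3) by (intro H.vec_eqI) auto
    show "restrict g (carr K) (hscale K c x) = hscale H c (restrict g (carr K) x)"
      if "x \<in> carr K" for c x
      using that g g' assms(3) by (intro H.vec_eqI) auto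
    fix y assume y: "y \<in> carr K"
    have "(hnorm H (g y))\<^sup>2 = Re (hinner K y (f (g y)))" using g y by (simp add: H.norm_sq)
    also have "\<dots> \<le> hnorm K y * hnorm K (f (g y))"
      using K.cauchy_schwarz[of y "f (g y)"] complex_Re_le_cmod g y assms(3) by (meson bop_carr order_trans)
    also have "\<dots> \<le> hnorm K y * (b * hnorm H (g y))"
      using b g y by (intro mult_left_mono) auto
    finally have "hnorm H (g y) * hnorm H (g y) \<le> (b * hnorm K y) * hnorm H (g y)"
      by (simp add: power2_eq_square algebra_simps)
    then show "hnorm H (restrict g (carr K) y) \<le> b * hnorm K y"
      using y b H.norm_nonneg[OF g(1)[OF y]]
      by (cases "hnorm H (g y) = 0") (auto simp: mult_le_cancel_right)
  qed (use g in auto)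
  moreover have "\<forall>x\<in>carr H. \<forall>y\<in>carr K. hinner K (f x) y = hinner H x (restrict g (carr K) y)"
    using g' by simp
  moreover have "h = h'" if "h \<in> bop K H" "h' \<in> bop K H"
    "\<forall>x\<in>carr H. \<forall>y\<in>carr K. hinner K (f x) y = hinner H x (h y)"
    "\<forall>x\<in>carr H. \<forall>y\<in>carr K. hinner K (f x) y = hinner H x (h' y)" for h h'
    using that by (intro bop_eqI[OF that(1,2)] H.vec_eqI) auto
  ultimately show ?thesis by blast
qed

lemma adj_bop [simp]: "hilbert_space H \<Longrightarrow> hilbert_space K \<Longrightarrow> f \<in> bop H K \<Longrightarrow> adj H K f \<in> bop K H"
  and inner_adj: "hilbert_space H \<Longrightarrow> hilbert_space K \<Longrightarrow> f \<in> bop H K \<Longrightarrow> x \<in> carr H \<Longrightarrow> y \<in> carr K \<Longrightarrow>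
    hinner H x (adj H K f y) = hinner K (f x) y"
  using theI'[OF adj_ex[of H K f]] by (auto simp: adj_def)

lemma adj_carr [simp]: "hilbert_space H \<Longrightarrow> hilbert_space K \<Longrightarrow> f \<in> bop H K \<Longrightarrow> y \<in> carr K \<Longrightarrow>
    adj H K f y \<in> carr H"
  by (rule bop_carr[OF adj_bop])

lemma inner_adj_left:
  assumes "hilbert_space H" "hilbert_space K" "f \<in> bop H K" "x \<in> carr H" "y \<in> carr K"
  shows "hinner H (adj H K f y) x = hinner K y (f x)"
proof -
  interpret H: hilbert_space H by fact
  interpret K: hilbert_space K by fact
  show ?thesis using inner_adj[OF assms] assms
    by (metis H.inner_commute K.inner_commute adj_bop bop_carr)
qed

lemma adj_unique:
  assumes "hilbert_space H" "hilbert_space K" "f \<in> bop H K" "g \<in> bop K H"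
    "\<And>x y. x \<in> carr H \<Longrightarrow> y \<in> carr K \<Longrightarrow> hinner K (f x) y = hinner H x (g y)"
  shows "adj H K f = g"
  using the1_equality[OF adj_ex[OF assms(1-3)], of g] assms(4,5) by (auto simp: adj_def)

lemma adj_adj [simp]: "hilbert_space H \<Longrightarrow> hilbert_space K \<Longrightarrow> f \<in> bop H K \<Longrightarrow> adj K H (adj H K f) = f"
  by (rule adj_unique) (auto simp: inner_adj_left)

lemma adj_comp:
  assumes "hilbert_space H" "hilbert_space K" "hilbert_space L" "f \<in> bop H K" "g \<in> bop K L"
  shows "adj H L (g \<circ>\<^bsub>H\<^esub> f) = adj H K f \<circ>\<^bsub>L\<^esub> adj K L g"
proof (rule adj_unique)
  fix x y assume "x \<in> carr H" "y \<in> carr L"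
  moreover from this have "f x \<in> carr K" "adj K L g y \<in> carr K" using assms by auto
  ultimately show "hinner L ((g \<circ>\<^bsub>H\<^esub> f) x) y = hinner H x ((adj H K f \<circ>\<^bsub>L\<^esub> adj K L g) y)"
    using assms by (simp add: inner_adj)
next
  show "adj H K f \<circ>\<^bsub>L\<^esub> adj K L g \<in> bop L H"
    using assms by (intro comp_bop[of L K]) auto
qed (use assms in \<open>auto intro: comp_bop[of H K]\<close>)

lemma adj_op_id [simp]: "hilbert_space H \<Longrightarrow> adj H H (op_id H) = op_id H"
  by (rule adj_unique) auto

lemma isometry_iff:
  assumes "hilbert_space H" "hilbert_space K"
  shows "isometry H K f \<longleftrightarrow> f \<in> bop H K \<and> (\<forall>x\<in>carr H. \<forall>y\<in>carr H. hinner K (f x) (f y) = hinner H x y)"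
proof -
  interpret H: hilbert_space H by fact
  have "adj H K f \<circ>\<^bsub>H\<^esub> f = op_id H \<longleftrightarrow> (\<forall>x\<in>carr H. \<forall>y\<in>carr H. hinner K (f x) (f y) = hinner H x y)"
    if f: "f \<in> bop H K"
  proof
    assume *: "adj H K f \<circ>\<^bsub>H\<^esub> f = op_id H"
    have "adj H K f (f y) = y" if "y \<in> carr H" for y
      using fun_cong[OF *, of y] that by simp
    then show "\<forall>x\<in>carr H. \<forall>y\<in>carr H. hinner K (f x) (f y) = hinner H x y"
      using inner_adj[OF assms f] f by (metis bop_carr)
  next
    assume *: "\<forall>x\<in>carr H. \<forall>y\<in>carr H. hinner K (f x) (f y) = hinner H x y"
    show "adj H K f \<circ>\<^bsub>H\<^esub> f = op_id H"
    proof (rule bop_eqI[of _ H H])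
      fix x assume x: "x \<in> carr H"
      then have "f x \<in> carr K" using f by simp
      then show "(adj H K f \<circ>\<^bsub>H\<^esub> f) x = op_id H x"
        using assms f * x by (intro H.vec_eqI) (auto simp: inner_adj)
    qed (use assms f in \<open>auto intro: comp_bop[of H K]\<close>)
  qed
  then show ?thesis by (auto simp: isometry_def)
qed

lemma isometry_bop: "isometry H K f \<Longrightarrow> f \<in> bop H K"
  by (simp add: isometry_def)

lemma isometry_adj_apply: "isometry H K f \<Longrightarrow> x \<in> carr H \<Longrightarrow> adj H K f (f x) = x"
  unfolding isometry_def by (metis comp_apply op_id_apply)

lemma coisometry_adj_apply: "coisometry H K f \<Longrightarrow> x \<in> carr K \<Longrightarrow> f (adj H K f x) = x"
  unfolding coisometry_def by (metis comp_apply op_id_apply)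

lemma isometry_norm: "hilbert_space H \<Longrightarrow> hilbert_space K \<Longrightarrow> isometry H K f \<Longrightarrow> x \<in> carr H \<Longrightarrow>
    hnorm K (f x) = hnorm H x"
  by (simp add: isometry_iff hnorm_def)

text \<open>The adjoints agree, because their values have the same inner products with the total
  set; taking adjoints again gives f = g. No approximation is involved.\<close>

lemma bop_total_eq:
  assumes H: "hilbert_space H" and K: "hilbert_space K" and "f \<in> bop H K" "g \<in> bop H K"
    and S: "inner_space.total H S" and eq: "\<And>s. s \<in> S \<Longrightarrow> f s = g s"
  shows "f = g"
proof -
  interpret H: hilbert_space H by fact
  interpret K: hilbert_space K by fact
  have "adj H K f = adj H K g"
  proof (rule bop_eqI[of _ K H])
    fix y assume y: "y \<in> carr K"
    show "adj H K f y = adj H K g y"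
    proof (rule H.totalD_eq[OF S])
      fix s assume s: "s \<in> S"
      then have "s \<in> carr H" using S by (auto simp: H.total_def)
      then show "hinner H s (adj H K f y) = hinner H s (adj H K g y)"
        using assms y s by (simp add: inner_adj)
    qed (use assms y in auto)
  qed (use assms in auto)
  then show ?thesis using assms by (metis adj_adj)
qed

text \<open>An isometry composed with its adjoint fixes the range of the isometry, so a total set
  inside the range forces this composition to be the identity.\<close>

lemma unitary_opI:
  assumes H: "hilbert_space H" and K: "hilbert_space K" and f: "isometry H K f"
    and S: "inner_space.total K S" and "S \<subseteq> f ` carr H"
  shows "unitary_op H K f"
proof -
  interpret K: hilbert_space K by fact
  have fb: "f \<in> bop H K" using f by (rule isometry_bop)
  have "f \<circ>\<^bsub>K\<^esub> adj H K f = op_id K"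
  proof (rule bop_total_eq[OF K K _ _ S])
    fix s assume s: "s \<in> S"
    then obtain x where "x \<in> carr H" "s = f x" using assms(5) by blast
    then show "(f \<circ>\<^bsub>K\<^esub> adj H K f) s = op_id K s"
      using isometry_adj_apply[OF f] fb by simp
  qed (use H K fb in auto)
  then show ?thesis using f fb by (simp add: unitary_op_def coisometry_def)
qed

text \<open>The extension is constructed through its adjoint. For z in \<open>K\<close> the
  functional given by z on the span of the f i is bounded and has a Riesz vector \<open>Z z\<close>;
  the adjoint of \<open>Z\<close> is the required operator. This replaces extension by continuity
  from the span to its closure.\<close>

lemma bounded_extension:
  assumes H: "hilbert_space H" and K: "hilbert_space K"
    and f: "inner_space.total H (f ` S)" and g: "g ` S \<subseteq> carr K"
    and bound: "\<And>xs. snd ` set xs \<subseteq> S \<Longrightarrow>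
      hnorm K (inner_space.lincomb K g xs) \<le> b * hnorm H (inner_space.lincomb H f xs)"
  shows "\<exists>T\<in>bop H K. \<forall>i\<in>S. T (f i) = g i"
proof -
  interpret H: hilbert_space H by fact
  interpret K: hilbert_space K by fact
  have fH: "i \<in> S \<Longrightarrow> f i \<in> carr H" and gK: "i \<in> S \<Longrightarrow> g i \<in> carr K" for i
    using f g by (auto simp: H.total_def)
  define M where "M = {H.lincomb f xs | xs. snd ` set xs \<subseteq> S}"
  have M: "H.lin_subspace M" unfolding M_def using fH by (intro H.lin_subspace_lincombs) auto
  \<comment> \<open>One representation as a combination for each vector of the span. The bound,
    applied to the difference of two representations, makes the value \<open>G\<close> independent
    of the choice.\<close>
  define c where "c y = (SOME xs. snd ` set xs \<subseteq> S \<and> y = H.lincomb f xs)" for y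
  have c: "snd ` set (c y) \<subseteq> S" "H.lincomb f (c y) = y" if "y \<in> M" for y
  proof -
    have "\<exists>xs. snd ` set xs \<subseteq> S \<and> y = H.lincomb f xs" using that by (auto simp: M_def)
    then show "snd ` set (c y) \<subseteq> S" "H.lincomb f (c y) = y"
      unfolding c_def by (metis (mono_tags, lifting) someI_ex)+
  qed
  have fl [simp]: "H.lincomb f xs \<in> carr H" and gl [simp]: "K.lincomb g xs \<in> carr K" if "snd ` set xs \<subseteq> S" for xs
    using that fH gK by (auto intro!: H.lincomb_closed K.lincomb_closed)
  define G where "G y = K.lincomb g (c y)" for y
  have G: "K.lincomb g xs = G (H.lincomb f xs)" if xs: "snd ` set xs \<subseteq> S" for xs
  proof -
    let ?ys = "c (H.lincomb f xs)"
    have ys: "snd ` set ?ys \<subseteq> S" "H.lincomb f ?ys = H.lincomb f xs"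
      using c[of "H.lincomb f xs"] xs by (auto simp: M_def)
    let ?m = "map (\<lambda>(d, i). ((-1) * d, i)) ?ys"
    have zs: "snd ` set (xs @ ?m) \<subseteq> S" "snd ` set ?m \<subseteq> S" using xs ys by (auto simp: image_subset_iff)
    have "H.lincomb f (xs @ ?m) = H.hsub (H.lincomb f xs) (H.lincomb f ?ys)"
    proof -
      have e: "H.lincomb f ?m = hscale H (-1) (H.lincomb f ?ys)"
        using fH[OF subsetD[OF ys(1)]] by (intro H.lincomb_scale)
      show ?thesis
        unfolding e[symmetric] using fH[OF subsetD[OF xs]] fH[OF subsetD[OF zs(2)]] by (intro H.lincomb_append)
    qed
    then have "hnorm H (H.lincomb f (xs @ ?m)) = 0"
      using ys xs by (simp add: H.hsub_zero_iff)
    then have "hnorm K (K.lincomb g (xs @ ?m)) = 0"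
      using bound[OF zs(1)] gl[OF zs(1)] by (simp add: order_antisym)
    moreover have "K.lincomb g (xs @ ?m) = K.hsub (K.lincomb g xs) (K.lincomb g ?ys)"
    proof -
      have e: "K.lincomb g ?m = hscale K (-1) (K.lincomb g ?ys)"
        using gK[OF subsetD[OF ys(1)]] by (intro K.lincomb_scale)
      show ?thesis
        unfolding e[symmetric] using gK[OF subsetD[OF xs]] gK[OF subsetD[OF zs(2)]] by (intro K.lincomb_append)
    qed
    ultimately show ?thesis using xs ys by (simp add: K.hsub_zero_iff G_def)
  qed
  have MD: "\<exists>xs. snd ` set xs \<subseteq> S \<and> y = H.lincomb f xs" if "y \<in> M" for y
    using that by (auto simp: M_def)
  have G_carr: "G y \<in> carr K" if "y \<in> M" for y using c[OF that] by (simp add: G_def)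
  have G_add: "G (hadd H x y) = hadd K (G x) (G y)" if "x \<in> M" "y \<in> M" for x y
  proof -
    have s: "snd ` set (c x @ c y) \<subseteq> S" using c(1) that by auto
    have "hadd H x y = H.lincomb f (c x @ c y)"
      using c that H.lincomb_append[of "c x" f "c y"] fH[OF subsetD[OF c(1)[OF that(1)]]]
        fH[OF subsetD[OF c(1)[OF that(2)]]] by simp
    then have "G (hadd H x y) = K.lincomb g (c x @ c y)" using G[OF s] by simp
    also have "\<dots> = hadd K (G x) (G y)"
      unfolding G_def using gK[OF subsetD[OF c(1)[OF that(1)]]] gK[OF subsetD[OF c(1)[OF that(2)]]]
      by (intro K.lincomb_append) simp_all
    finally show ?thesis .
  qed
  have G_scale: "G (hscale H z x) = hscale K z (G x)" if "x \<in> M" for x z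
  proof -
    let ?m = "map (\<lambda>(d, i). (z * d, i)) (c x)"
    have s: "snd ` set ?m \<subseteq> S" using c(1)[OF that] by (auto simp: image_subset_iff)
    have "hscale H z x = H.lincomb f ?m"
      using c[OF that] H.lincomb_scale[of "c x" f z] fH[OF subsetD[OF c(1)[OF that]]] by simp
    then have "G (hscale H z x) = K.lincomb g ?m" using G[OF s] by simp
    also have "\<dots> = hscale K z (G x)"
      unfolding G_def using gK[OF subsetD[OF c(1)[OF that]]] by (intro K.lincomb_scale) simp_all
    finally show ?thesis .
  qed
  have G_bound: "hnorm K (G y) \<le> b * hnorm H y" if "y \<in> M" for y
    using bound[of "c y"] c[OF that] by (simp add: G_def)
  have fM: "f i \<in> M" "G (f i) = g i" if "i \<in> S" for i
  proof -
    have 1: "f i = H.lincomb f [(1, i)]" using fH[OF that] by (intro H.vec_eqI) simp_all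
    show "f i \<in> M" using that 1 by (auto simp: M_def intro!: exI[of _ "[(1, i)]"])
    have 2: "g i = K.lincomb g [(1, i)]" using gK[OF that] by (intro K.vec_eqI) simp_all
    show "G (f i) = g i" using G[of "[(1, i)]"] that unfolding 1[symmetric] 2[symmetric] by simp
  qed
  have b_bound: "b * hnorm H y \<le> \<bar>b\<bar> * hnorm H y" if "y \<in> M" for y
    using that M by (intro mult_right_mono) (auto simp: H.lin_subspace_def)
  have "\<exists>v\<in>carr H. \<forall>y\<in>M. hinner H v y = hinner K z (G y)" if z: "z \<in> carr K" for z
  proof -
    have "cmod (hinner K z (G y)) \<le> (hnorm K z * b) * hnorm H y" if "y \<in> M" for y
      using K.cauchy_schwarz[OF z G_carr[OF that]] G_bound[OF that] K.norm_nonneg[OF z]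
      by (metis (no_types, lifting) mult.assoc mult_left_mono order_trans)
    then show ?thesis
      using H.riesz_subspace[OF M, of "\<lambda>y. hinner K z (G y)" "hnorm K z * b"] z
      by (auto simp: G_add G_scale G_carr)
  qed
  then obtain Z where Z: "\<And>z. z \<in> carr K \<Longrightarrow> Z z \<in> carr H"
      "\<And>z y. z \<in> carr K \<Longrightarrow> y \<in> M \<Longrightarrow> hinner H (Z z) y = hinner K z (G y)"
    by metis
  have Z': "hinner H (f i) (Z z) = hinner K (g i) z" if "z \<in> carr K" "i \<in> S" for z i
    using Z[OF that(1)] fM[OF that(2)] fH gK that by (metis H.inner_commute K.inner_commute)
  have Zb: "restrict Z (carr K) \<in> bop K H"
  proof (rule bopI[where b = "\<bar>b\<bar>"])
    show "restrict Z (carr K) (hadd K x y) = hadd H (restrict Z (carr K) x) (restrict Z (carr K) y)"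
      if "x \<in> carr K" "y \<in> carr K" for x y
      using that Z Z' fH gK by (intro H.totalD_eq[OF f]) auto
    show "restrict Z (carr K) (hscale K c x) = hscale H c (restrict Z (carr K) x)"
      if "x \<in> carr K" for c x
      using that Z Z' fH gK by (intro H.totalD_eq[OF f]) auto
    fix z assume z: "z \<in> carr K"
    \<comment> \<open>By totality \<open>Z z\<close> is a limit of vectors of the span, where its
      inner products are known; this transfers the bound to the norm of \<open>Z z\<close>
      itself.\<close>
    have "\<exists>xs. (\<forall>n. xs n \<in> M) \<and> H.tends xs (Z z)"
      using fM by (intro H.total_approx[OF f _ M Z(1)[OF z]]) auto
    then obtain xs where xs: "\<And>n. xs n \<in> M" "H.tends xs (Z z)" by blast
    have xsH: "xs n \<in> carr H" for n using xs(1) M by (auto simp: H.lin_subspace_def)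
    have "(\<lambda>n. cmod (hinner H (Z z) (xs n))) \<longlonglongrightarrow> cmod (hinner H (Z z) (Z z))"
      using H.tends_inner(1)[OF xsH Z(1)[OF z] Z(1)[OF z] xs(2)] by (rule tendsto_norm)
    moreover have "(\<lambda>n. hnorm K z * (\<bar>b\<bar> * hnorm H (xs n))) \<longlonglongrightarrow> hnorm K z * (\<bar>b\<bar> * hnorm H (Z z))"
      using H.tends_norm[OF xsH Z(1)[OF z] xs(2)] by (intro tendsto_intros)
    moreover have "cmod (hinner H (Z z) (xs n)) \<le> hnorm K z * (\<bar>b\<bar> * hnorm H (xs n))" for n
    proof -
      have "cmod (hinner H (Z z) (xs n)) \<le> hnorm K z * hnorm K (G (xs n))"
        using Z(2)[OF z xs(1)] K.cauchy_schwarz[OF z G_carr[OF xs(1)]] by simp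
      also have "\<dots> \<le> hnorm K z * (\<bar>b\<bar> * hnorm H (xs n))"
        using G_bound[OF xs(1)] b_bound[OF xs(1)] z by (intro mult_left_mono) (auto intro: order_trans)
      finally show ?thesis .
    qed
    ultimately have "cmod (hinner H (Z z) (Z z)) \<le> hnorm K z * (\<bar>b\<bar> * hnorm H (Z z))"
      by (intro LIMSEQ_le) auto
    then have "hnorm H (Z z) * hnorm H (Z z) \<le> (\<bar>b\<bar> * hnorm K z) * hnorm H (Z z)"
      using Z(1)[OF z] by (simp add: H.inner_self norm_power power2_eq_square algebra_simps norm_mult)
    then show "hnorm H (restrict Z (carr K) z) \<le> \<bar>b\<bar> * hnorm K z"
      using z H.norm_nonneg[OF Z(1)[OF z]]
      by (cases "hnorm H (Z z) = 0") (auto simp: mult_le_cancel_right)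
  qed (use Z in auto)
  let ?T = "adj K H (restrict Z (carr K))"
  have "?T (f i) = g i" if "i \<in> S" for i
    using that fH gK Zb H K Z' by (intro K.vec_eqI) (auto simp: inner_adj, metis H.inner_commute K.inner_commute Z(1))
  then show ?thesis using Zb H K by (intro bexI[of _ ?T]) auto
qed

text \<open>Equal Gram matrices give equal norms to corresponding combinations, so the extension
  exists with bound 1. The embeddings of the completions and the cocycle itself arise from this
  lemma.\<close>

lemma gram_isometry:
  assumes H: "hilbert_space H" and K: "hilbert_space K"
    and f: "inner_space.total H (f ` S)" and g: "g ` S \<subseteq> carr K"
    and gram: "\<And>i j. i \<in> S \<Longrightarrow> j \<in> S \<Longrightarrow> hinner K (g i) (g j) = hinner H (f i) (f j)"
  shows "\<exists>T. isometry H K T \<and> (\<forall>i\<in>S. T (f i) = g i)"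
proof -
  interpret H: hilbert_space H by fact
  interpret K: hilbert_space K by fact
  have fH: "i \<in> S \<Longrightarrow> f i \<in> carr H" and gK: "i \<in> S \<Longrightarrow> g i \<in> carr K" for i
    using f g by (auto simp: H.total_def)
  have *: "hinner K (g i) (K.lincomb g xs) = hinner H (f i) (H.lincomb f xs)"
    if "snd ` set xs \<subseteq> S" "i \<in> S" for i xs
    using that
  proof (induction xs)
    case (Cons a xs)
    then have "H.lincomb f xs \<in> carr H" "K.lincomb g xs \<in> carr K"
      using fH gK by (auto intro!: H.lincomb_closed K.lincomb_closed)
    then show ?case using Cons gram fH gK by (cases a) auto
  qed (use fH gK in auto)
  have "hnorm K (K.lincomb g xs) = hnorm H (H.lincomb f xs)" if "snd ` set xs \<subseteq> S" for xs
  proof -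
    have c: "H.lincomb f ys \<in> carr H" "K.lincomb g ys \<in> carr K" if "snd ` set ys \<subseteq> S" for ys
      using that fH gK by (auto intro!: H.lincomb_closed K.lincomb_closed)
    have "hinner K (K.lincomb g ys) (K.lincomb g xs) = hinner H (H.lincomb f ys) (H.lincomb f xs)"
      if "snd ` set ys \<subseteq> S" for ys
      using that
    proof (induction ys)
      case (Cons a ys)
      then show ?case using *[OF \<open>snd ` set xs \<subseteq> S\<close>] c[of ys] c[OF \<open>snd ` set xs \<subseteq> S\<close>] fH gK
        by (cases a) auto
    qed (use c[OF \<open>snd ` set xs \<subseteq> S\<close>] in auto)
    from this[OF that] show ?thesis by (simp add: hnorm_def)
  qed
  then obtain T where T: "T \<in> bop H K" "\<And>i. i \<in> S \<Longrightarrow> T (f i) = g i"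
    using bounded_extension[OF H K f g, of 1] by auto
  have "adj H K T \<circ>\<^bsub>H\<^esub> T = op_id H"
  proof (rule bop_total_eq[OF H H _ _ f])
    fix s assume "s \<in> f ` S"
    then obtain i where i: "i \<in> S" "s = f i" by blast
    have "adj H K T (g i) = f i"
    proof (rule H.totalD_eq[OF f])
      fix s assume "s \<in> f ` S"
      then obtain j where j: "j \<in> S" "s = f j" by blast
      then show "hinner H s (adj H K T (g i)) = hinner H s (f i)"
        using i T H K fH gK gram by (simp add: inner_adj)
    qed (use T H K i fH gK in auto)
    then show "(adj H K T \<circ>\<^bsub>H\<^esub> T) s = op_id H s" using i T fH by simp
  qed (use T H K in auto)
  then show ?thesis using T by (auto simp: isometry_def)
qed

text \<open>Totality of the prescribed family makes the operator unique, so the definite description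
  in \<open>ext_op\<close> returns any operator that can be exhibited.\<close>

lemma ext_op_works:
  assumes H: "hilbert_space H" and K: "hilbert_space K"
    and f: "inner_space.total H (f ` S)" and T: "T \<in> bop H K" "\<And>i. i \<in> S \<Longrightarrow> T (f i) = g i"
  shows "ext_op H K S f g = T"
  unfolding ext_op_def
proof (rule the_equality)
  show "T \<in> bop H K \<and> (\<forall>x\<in>S. T (f x) = g x)" using T by blast
  show "T' = T" if "T' \<in> bop H K \<and> (\<forall>x\<in>S. T' (f x) = g x)" for T'
    using that T by (intro bop_total_eq[OF H K _ _ f]) auto
qed

text \<open>The orthogonal projection onto the closure of \<open>M\<close>, handled without
  closures: a vector is determined by its inner products with \<open>M\<close> and with the
  orthogonal complement \<open>N\<close>, and the Riesz theorem on \<open>M\<close> supplies one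
  with the prescribed products.\<close>

lemma projection_op:
  assumes H: "hilbert_space H" and M: "inner_space.lin_subspace H M"
  shows "\<exists>Q\<in>BH H. (\<forall>x\<in>M. Q x = x) \<and> (\<forall>x\<in>carr H. \<forall>y\<in>M. hinner H y (Q x) = hinner H y x) \<and>
    (\<forall>z\<in>carr H. (\<forall>y\<in>M. hinner H y z = 0) \<longrightarrow> Q z = hzero H)"
proof -
  interpret H: hilbert_space H by fact
  have MH: "y \<in> M \<Longrightarrow> y \<in> carr H" for y using M by (auto simp: H.lin_subspace_def)
  define N where "N = {z \<in> carr H. \<forall>y\<in>M. hinner H y z = 0}"
  have ex: "\<exists>v\<in>carr H. (\<forall>y\<in>M. hinner H y v = hinner H y x) \<and> (\<forall>z\<in>N. hinner H z v = 0) \<and> hnorm H v \<le> hnorm H x"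
    if x: "x \<in> carr H" for x
  proof -
    obtain v xs where v: "v \<in> carr H" "\<And>n. xs n \<in> M" "H.tends xs v" "\<And>y. y \<in> M \<Longrightarrow> hinner H v y = hinner H x y"
      using H.riesz_subspace[OF M, of "hinner H x" "hnorm H x"] x MH H.cauchy_schwarz by fastforce
    have 1: "hinner H y v = hinner H y x" if "y \<in> M" for y
      using v(4)[OF that] v(1) x MH[OF that] by (metis H.inner_commute)
    have 2: "hinner H z v = 0" if "z \<in> N" for z
    proof -
      have z: "z \<in> carr H" "\<And>y. y \<in> M \<Longrightarrow> hinner H z y = 0"
        using that MH by (auto simp: N_def) (metis H.inner_commute complex_cnj_zero)
      have "(\<lambda>n. hinner H z (xs n)) \<longlonglongrightarrow> hinner H z v"
        using H.tends_inner(1)[OF _ v(1) z(1) v(3)] v(2) MH by blast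
      moreover have "(\<lambda>n. hinner H z (xs n)) = (\<lambda>n. 0)" using z(2) v(2) by blast
      ultimately show ?thesis using LIMSEQ_unique[OF _ tendsto_const] by simp
    qed
    have "(\<lambda>n. hinner H v (xs n)) \<longlonglongrightarrow> hinner H v v"
      using H.tends_inner(1)[OF _ v(1) v(1) v(3)] v(2) MH by blast
    moreover have "(\<lambda>n. hinner H x (xs n)) \<longlonglongrightarrow> hinner H x v"
      using H.tends_inner(1)[OF _ v(1) x v(3)] v(2) MH by blast
    ultimately have "hinner H v v = hinner H x v"
      using v(4)[OF v(2)] LIMSEQ_unique by simp
    then have "(hnorm H v)\<^sup>2 = cmod (hinner H x v)"
      using v(1) by (metis H.inner_self norm_of_real abs_of_nonneg zero_le_power2)
    then have "hnorm H v * hnorm H v \<le> hnorm H x * hnorm H v"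
      using H.cauchy_schwarz[OF x v(1)] by (simp add: power2_eq_square)
    then have "hnorm H v \<le> hnorm H x"
      using H.norm_nonneg[OF v(1)] H.norm_nonneg[OF x]
      by (cases "hnorm H v = 0") (auto simp: mult_le_cancel_right)
    then show ?thesis using 1 2 v(1) by blast
  qed
  have un: "v = w" if "v \<in> carr H" "w \<in> carr H" "\<And>y. y \<in> M \<Longrightarrow> hinner H y v = hinner H y w"
    "\<And>z. z \<in> N \<Longrightarrow> hinner H z v = 0" "\<And>z. z \<in> N \<Longrightarrow> hinner H z w = 0" for v w
  proof -
    have d: "H.hsub v w \<in> N" using that MH by (auto simp: N_def)
    then have "hinner H (H.hsub v w) (H.hsub v w) = 0"
      using that(4,5)[OF d] that(1,2) d unfolding N_def by simp
    then show ?thesis using that(1,2) H.hsub_zero_iff[of v w] by (simp add: hnorm_def)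
  qed
  obtain Q where Q: "\<And>x. x \<in> carr H \<Longrightarrow> Q x \<in> carr H" "\<And>x y. x \<in> carr H \<Longrightarrow> y \<in> M \<Longrightarrow> hinner H y (Q x) = hinner H y x"
      "\<And>x z. x \<in> carr H \<Longrightarrow> z \<in> N \<Longrightarrow> hinner H z (Q x) = 0" "\<And>x. x \<in> carr H \<Longrightarrow> hnorm H (Q x) \<le> hnorm H x"
    using ex by metis
  have NH: "z \<in> N \<Longrightarrow> z \<in> carr H" for z by (simp add: N_def)
  have "restrict Q (carr H) \<in> BH H"
  proof (rule bopI[where b = 1])
    show "restrict Q (carr H) (hadd H x y) = hadd H (restrict Q (carr H) x) (restrict Q (carr H) y)"
      if "x \<in> carr H" "y \<in> carr H" for x y
      using that Q MH NH by (intro un) auto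
    show "restrict Q (carr H) (hscale H c x) = hscale H c (restrict Q (carr H) x)" if "x \<in> carr H" for c x
      using that Q MH NH by (intro un) auto
  qed (use Q in auto)
  moreover have "Q x = x" if x: "x \<in> M" for x
  proof (rule un)
    fix z assume z: "z \<in> N"
    then show "hinner H z x = 0" using x H.inner_commute[OF MH[OF x] NH[OF z]] by (simp add: N_def)
  qed (use Q(1,2,3) MH[OF x] in simp_all)
  moreover have "Q z = hzero H" if "z \<in> N" for z
  proof (rule un)
    show "hinner H y (Q z) = hinner H y (hzero H)" if "y \<in> M" for y
      using Q(2)[OF NH[OF \<open>z \<in> N\<close>] that] \<open>z \<in> N\<close> that MH by (simp add: N_def)
  qed (use Q(1)[OF NH[OF that]] Q(3)[OF NH[OF that]] NH in simp_all)
  ultimately show ?thesis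
    using Q MH by (intro bexI[of _ "restrict Q (carr H)"]) (auto simp: N_def)
qed

text \<open>Pulls the Hilbert space structure back along an injection that preserves all operations.
  Cauchy sequences converge in \<open>G\<close>, and sequential closedness of the range brings their
  limits back.\<close>

lemma hilbert_transport:
  assumes G: "hilbert_space G"
    and car: "\<And>x. x \<in> carr X \<Longrightarrow> p x \<in> carr G" and inj: "inj_on p (carr X)"
    and add: "\<And>x y. x \<in> carr X \<Longrightarrow> y \<in> carr X \<Longrightarrow> hadd X x y \<in> carr X \<and> p (hadd X x y) = hadd G (p x) (p y)"
    and zero: "hzero X \<in> carr X" "p (hzero X) = hzero G"
    and scale: "\<And>c x. x \<in> carr X \<Longrightarrow> hscale X c x \<in> carr X \<and> p (hscale X c x) = hscale G c (p x)"
    and inner: "\<And>x y. x \<in> carr X \<Longrightarrow> y \<in> carr X \<Longrightarrow> hinner X x y = hinner G (p x) (p y)"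
    and closed: "\<And>xs g. (\<And>n. xs n \<in> carr X) \<Longrightarrow> g \<in> carr G \<Longrightarrow> inner_space.tends G (\<lambda>n. p (xs n)) g \<Longrightarrow> g \<in> p ` carr X"
  shows "hilbert_space X"
proof -
  interpret G: hilbert_space G by fact
  interpret X: inner_space X
  proof
    fix x y assume xy: "x \<in> carr X" "y \<in> carr X" "\<And>z. z \<in> carr X \<Longrightarrow> hinner X z x = hinner X z y"
    have "hadd X x (hscale X (-1) y) \<in> carr X" using xy add scale by simp
    then have "hinner G (G.hsub (p x) (p y)) (G.hsub (p x) (p y)) = 0"
      using xy(3)[of "hadd X x (hscale X (-1) y)"] xy(1,2) add scale car by (simp add: inner)
    then have "p x = p y" using G.hsub_zero_iff[of "p x" "p y"] car xy(1,2) by (simp add: hnorm_def)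
    then show "x = y" using inj xy(1,2) by (simp add: inj_on_eq_iff)
  next
    show "hinner X y x = cnj (hinner X x y)" if "x \<in> carr X" "y \<in> carr X" for x y
      unfolding inner[OF that] inner[OF that(2,1)] by (rule G.inner_commute) (use car that in auto)
  qed (use add zero scale inner car in \<open>auto intro: G.inner_nonneg\<close>)
  show ?thesis
  proof (rule X.hilbert_spaceI)
    fix f assume f: "\<And>n. f n \<in> carr X" "X.cauchy f"
    have norm: "hnorm X (X.hsub x y) = hnorm G (G.hsub (p x) (p y))" if "x \<in> carr X" "y \<in> carr X" for x y
      using that add scale car by (simp add: hnorm_def inner)
    have "G.cauchy (\<lambda>n. p (f n))"
      using f norm by (simp add: G.cauchy_def X.cauchy_def)
    then obtain g where g: "g \<in> carr G" "G.tends (\<lambda>n. p (f n)) g"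
      using G.cauchy_tends[of "\<lambda>n. p (f n)"] f car by blast
    then obtain x where "x \<in> carr X" "g = p x" using closed[OF f(1) g] by blast
    then show "\<exists>x\<in>carr X. X.tends f x"
      using g f norm by (auto simp: X.tends_def G.tends_def)
  qed
qed

section \<open>Completions of Gram kernels\<close>

text \<open>A realisation of the kernel k by vectors f i of a Hilbert space yields positivity and a
  model at once: the completion \<open>hcompl S k\<close> is identified with the closed span of the
  f i, which makes its quotient operations and limits computable.\<close>

locale gram_kernel = G: hilbert_space G for G :: "'g hilb" +
  fixes S :: "'i set" and k :: "'i \<Rightarrow> 'i \<Rightarrow> complex" and f :: "'i \<Rightarrow> 'g"
  assumes f_carr: "i \<in> S \<Longrightarrow> f i \<in> carr G"
    and gram: "i \<in> S \<Longrightarrow> j \<in> S \<Longrightarrow> k i j = hinner G (f i) (f j)"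
begin

definition lc :: "('i \<Rightarrow>\<^sub>0 complex) \<Rightarrow> 'g" where
  "lc c = G.lincomb f (map (\<lambda>x. (Poly_Mapping.lookup c x, x))
     (SOME xs. distinct xs \<and> set xs = Poly_Mapping.keys c))"

lemma keys_list: "\<exists>xs. distinct xs \<and> set xs = Poly_Mapping.keys c"
  using finite_distinct_list[OF finite_keys[of c]] by metis

lemma lc_carr [simp]: "Poly_Mapping.keys c \<subseteq> S \<Longrightarrow> lc c \<in> carr G"
  using someI_ex[OF keys_list[of c]] f_carr unfolding lc_def by (intro G.lincomb_closed) auto

lemma inner_lc:
  assumes "Poly_Mapping.keys c \<subseteq> A" "finite A" "A \<subseteq> S" "z \<in> carr G"
  shows "hinner G z (lc c) = (\<Sum>x\<in>A. Poly_Mapping.lookup c x * hinner G z (f x))"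
proof -
  define xs where "xs = (SOME xs. distinct xs \<and> set xs = Poly_Mapping.keys c)"
  have xs: "distinct xs" "set xs = Poly_Mapping.keys c"
    using someI_ex[OF keys_list[of c]] by (auto simp: xs_def)
  have "hinner G z (lc c) = (\<Sum>(d, i)\<leftarrow>map (\<lambda>x. (Poly_Mapping.lookup c x, x)) xs. d * hinner G z (f i))"
    unfolding lc_def xs_def[symmetric] by (rule G.inner_lincomb) (use xs assms f_carr in auto)
  also have "\<dots> = (\<Sum>x\<in>Poly_Mapping.keys c. Poly_Mapping.lookup c x * hinner G z (f x))"
    using xs by (simp add: o_def sum_list_distinct_conv_sum_set)
  also have "\<dots> = (\<Sum>x\<in>A. Poly_Mapping.lookup c x * hinner G z (f x))"
    using assms by (intro sum.mono_neutral_left) (auto simp: in_keys_iff)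
  finally show ?thesis .
qed

lemma inner_lc_left:
  assumes "Poly_Mapping.keys c \<subseteq> A" "finite A" "A \<subseteq> S" "z \<in> carr G"
  shows "hinner G (lc c) z = (\<Sum>x\<in>A. cnj (Poly_Mapping.lookup c x) * hinner G (f x) z)"
proof -
  have "hinner G (lc c) z = cnj (hinner G z (lc c))"
    using assms by (intro G.inner_commute) auto
  also have "\<dots> = (\<Sum>x\<in>A. cnj (Poly_Mapping.lookup c x) * cnj (hinner G z (f x)))"
    using assms by (simp add: inner_lc)
  also have "\<dots> = (\<Sum>x\<in>A. cnj (Poly_Mapping.lookup c x) * hinner G (f x) z)"
    using assms f_carr G.inner_commute[of z "f _"] by (intro sum.cong) auto
  finally show ?thesis .
qed

lemma hc_form_lc:
  assumes "Poly_Mapping.keys c \<subseteq> S" "Poly_Mapping.keys d \<subseteq> S"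
  shows "hc_form k c d = hinner G (lc c) (lc d)"
proof -
  have "hinner G (lc c) (lc d) = (\<Sum>x\<in>Poly_Mapping.keys c. cnj (Poly_Mapping.lookup c x) * hinner G (f x) (lc d))"
    using assms by (intro inner_lc_left) auto
  also have "\<dots> = (\<Sum>x\<in>Poly_Mapping.keys c. cnj (Poly_Mapping.lookup c x) *
      (\<Sum>y\<in>Poly_Mapping.keys d. Poly_Mapping.lookup d y * hinner G (f x) (f y)))"
    using assms f_carr by (intro sum.cong refl arg_cong2[of _ _ _ _ "(*)"] inner_lc) auto
  also have "\<dots> = hc_form k c d"
    unfolding hc_form_def sum_distrib_left using assms gram
    by (intro sum.cong refl) (simp add: subset_iff algebra_simps)
  finally show ?thesis by simp
qed

lemma keys_ops:
  fixes c d :: "'i \<Rightarrow>\<^sub>0 complex"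
  assumes "Poly_Mapping.keys c \<subseteq> S" "Poly_Mapping.keys d \<subseteq> S"
  shows "Poly_Mapping.keys (c + d) \<subseteq> S" "Poly_Mapping.keys (c - d) \<subseteq> S"
  using assms keys_add[of c d] keys_diff[of c d] by auto

lemma keys_map:
  fixes c :: "'i \<Rightarrow>\<^sub>0 complex"
  assumes "Poly_Mapping.keys c \<subseteq> S"
  shows "Poly_Mapping.keys (Poly_Mapping.map ((*) z) c) \<subseteq> S"
  using assms by (auto simp: in_keys_iff Poly_Mapping.map.rep_eq when_def subset_iff)

lemma lc_add:
  assumes c: "Poly_Mapping.keys c \<subseteq> S" and d: "Poly_Mapping.keys d \<subseteq> S"
  shows "lc (c + d) = hadd G (lc c) (lc d)"
proof (rule G.vec_eqI)
  fix z assume z: "z \<in> carr G"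
  let ?A = "Poly_Mapping.keys c \<union> Poly_Mapping.keys d"
  have A: "finite ?A" "?A \<subseteq> S" "Poly_Mapping.keys (c + d) \<subseteq> ?A" using c d keys_add[of c d] by auto
  show "hinner G z (lc (c + d)) = hinner G z (hadd G (lc c) (lc d))"
    using c d z A by (simp add: inner_lc[where A = ?A] lookup_add sum.distrib algebra_simps)
qed (use c d keys_ops in auto)

lemma lc_diff:
  assumes c: "Poly_Mapping.keys c \<subseteq> S" and d: "Poly_Mapping.keys d \<subseteq> S"
  shows "lc (c - d) = G.hsub (lc c) (lc d)"
proof (rule G.vec_eqI)
  fix z assume z: "z \<in> carr G"
  let ?A = "Poly_Mapping.keys c \<union> Poly_Mapping.keys d"
  have A: "finite ?A" "?A \<subseteq> S" "Poly_Mapping.keys (c - d) \<subseteq> ?A" using c d keys_diff[of c d] by auto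
  show "hinner G z (lc (c - d)) = hinner G z (G.hsub (lc c) (lc d))"
    using c d z A by (simp add: inner_lc[where A = ?A] lookup_minus sum_subtractf algebra_simps)
qed (use c d keys_ops in auto)

lemma lc_scale:
  assumes c: "Poly_Mapping.keys c \<subseteq> S"
  shows "lc (Poly_Mapping.map ((*) z) c) = hscale G z (lc c)"
proof (rule G.vec_eqI)
  fix w assume w: "w \<in> carr G"
  let ?A = "Poly_Mapping.keys c"
  have l: "Poly_Mapping.lookup (Poly_Mapping.map ((*) z) c) x = z * Poly_Mapping.lookup c x" for x
    by (simp add: Poly_Mapping.map.rep_eq when_def)
  have A: "finite ?A" "Poly_Mapping.keys (Poly_Mapping.map ((*) z) c) \<subseteq> ?A" by (auto simp: in_keys_iff l)
  show "hinner G w (lc (Poly_Mapping.map ((*) z) c)) = hinner G w (hscale G z (lc c))"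
    using c w A by (simp add: inner_lc[where A = ?A] l sum_distrib_left algebra_simps)
qed (use c keys_map in auto)

lemma lc_zero: "lc 0 = hzero G"
  by (rule G.vec_eqI) (auto simp: inner_lc[where A = "{}"])

lemma lc_single: "i \<in> S \<Longrightarrow> lc (Poly_Mapping.single i 1) = f i"
  by (rule G.vec_eqI) (auto simp: inner_lc[where A = "{i}"] f_carr)

definition lim :: "(nat \<Rightarrow> 'i \<Rightarrow>\<^sub>0 complex) \<Rightarrow> 'g \<Rightarrow> bool" where
  "lim c g \<longleftrightarrow> (\<forall>n. Poly_Mapping.keys (c n) \<subseteq> S) \<and> g \<in> carr G \<and> G.tends (\<lambda>n. lc (c n)) g"

lemma form_diff: "Poly_Mapping.keys c \<subseteq> S \<Longrightarrow> Poly_Mapping.keys d \<subseteq> S \<Longrightarrow>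
    hc_form k (c - d) (c - d) = of_real ((hnorm G (G.hsub (lc c) (lc d)))\<^sup>2)"
  using keys_ops by (simp add: hc_form_lc lc_diff G.inner_self)

lemma hc_cauchy_iff:
  "c \<in> hc_cauchy S k \<longleftrightarrow> (\<forall>n. Poly_Mapping.keys (c n) \<subseteq> S) \<and> G.cauchy (\<lambda>n. lc (c n))"
proof -
  have "(\<forall>e>0. \<exists>N. \<forall>m\<ge>N. \<forall>n\<ge>N. Re (hc_form k (c m - c n) (c m - c n)) < e) \<longleftrightarrow> G.cauchy (\<lambda>n. lc (c n))"
    if keys: "\<forall>n. Poly_Mapping.keys (c n) \<subseteq> S"
  proof -
    have e: "Re (hc_form k (c m - c n) (c m - c n)) = (hnorm G (G.hsub (lc (c m)) (lc (c n))))\<^sup>2" for m n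
      using keys by (simp add: form_diff)
    have nn: "0 \<le> hnorm G (G.hsub (lc (c m)) (lc (c n)))" for m n using keys by simp
    show ?thesis
      unfolding e G.cauchy_def
    proof (intro iffI allI impI)
      fix e :: real assume "e > 0" and *: "\<forall>e>0. \<exists>N. \<forall>m\<ge>N. \<forall>n\<ge>N. (hnorm G (G.hsub (lc (c m)) (lc (c n))))\<^sup>2 < e"
      then obtain N where "\<forall>m\<ge>N. \<forall>n\<ge>N. (hnorm G (G.hsub (lc (c m)) (lc (c n))))\<^sup>2 < e\<^sup>2"
        by (meson zero_less_power)
      then show "\<exists>N. \<forall>m\<ge>N. \<forall>n\<ge>N. hnorm G (G.hsub (lc (c m)) (lc (c n))) < e"
        using \<open>e > 0\<close> by (meson less_imp_le power2_less_imp_less)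
    next
      fix e :: real assume "e > 0" and *: "\<forall>e>0. \<exists>N. \<forall>m\<ge>N. \<forall>n\<ge>N. hnorm G (G.hsub (lc (c m)) (lc (c n))) < e"
      then obtain N where N: "\<forall>m\<ge>N. \<forall>n\<ge>N. hnorm G (G.hsub (lc (c m)) (lc (c n))) < sqrt e"
        by (meson real_sqrt_gt_zero)
      have "(hnorm G (G.hsub (lc (c m)) (lc (c n))))\<^sup>2 < e" if "m \<ge> N" "n \<ge> N" for m n
        using power_strict_mono[OF _ nn, of m n "sqrt e" 2] N that \<open>e > 0\<close> by simp
      then show "\<exists>N. \<forall>m\<ge>N. \<forall>n\<ge>N. (hnorm G (G.hsub (lc (c m)) (lc (c n))))\<^sup>2 < e" by blast
    qed
  qed
  then show ?thesis by (auto simp: hc_cauchy_def)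
qed

lemma hc_cauchy_lim: "c \<in> hc_cauchy S k \<Longrightarrow> \<exists>g. lim c g"
  using G.cauchy_tends[of "\<lambda>n. lc (c n)"] by (auto simp: hc_cauchy_iff lim_def)

lemma lim_hc_cauchy: "lim c g \<Longrightarrow> c \<in> hc_cauchy S k"
  using G.tends_cauchy[of "\<lambda>n. lc (c n)" g] by (auto simp: hc_cauchy_iff lim_def)

lemma lim_unique: "lim c g \<Longrightarrow> lim c g' \<Longrightarrow> g = g'"
  using G.tends_unique[of "\<lambda>n. lc (c n)" g g'] by (auto simp: lim_def)

lemma lim_tends: "lim c g \<Longrightarrow> lc (c n) \<in> carr G" "lim c g \<Longrightarrow> g \<in> carr G" "lim c g \<Longrightarrow> G.tends (\<lambda>n. lc (c n)) g"
  "lim c g \<Longrightarrow> Poly_Mapping.keys (c n) \<subseteq> S"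
  by (auto simp: lim_def)

lemma tends_comparison:
  assumes "G.tends u x" "(\<lambda>n. hnorm G (G.hsub (u n) (v n))) \<longlonglongrightarrow> 0"
    "\<And>n. u n \<in> carr G" "\<And>n. v n \<in> carr G" "x \<in> carr G"
  shows "G.tends v x"
  unfolding G.tends_def
proof (rule Lim_null_comparison)
  have "hnorm G (G.hsub (v n) x) \<le> hnorm G (G.hsub (u n) (v n)) + hnorm G (G.hsub (u n) x)" for n
    using G.hsub_triangle[of "v n" "u n" x] G.hsub_commute[of "v n" "u n"] assms(3-5) by simp
  then show "\<forall>\<^sub>F n in sequentially. norm (hnorm G (G.hsub (v n) x)) \<le>
      hnorm G (G.hsub (u n) (v n)) + hnorm G (G.hsub (u n) x)"
    using assms(3-5) by simp
  show "(\<lambda>n. hnorm G (G.hsub (u n) (v n)) + hnorm G (G.hsub (u n) x)) \<longlonglongrightarrow> 0"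
    using tendsto_add[OF assms(2) assms(1)[unfolded G.tends_def]] by simp
qed

lemma hc_class_lim:
  assumes "lim c g"
  shows "hc_class S k c = {d. lim d g}"
proof -
  note c = lim_tends[OF assms]
  have "lim d g \<longleftrightarrow> d \<in> hc_cauchy S k \<and> (\<lambda>n. hc_form k (c n - d n) (c n - d n)) \<longlonglongrightarrow> 0" for d
  proof -
    have e: "(\<lambda>n. hc_form k (c n - d n) (c n - d n)) \<longlonglongrightarrow> 0 \<longleftrightarrow>
        (\<lambda>n. hnorm G (G.hsub (lc (c n)) (lc (d n)))) \<longlonglongrightarrow> 0" if "d \<in> hc_cauchy S k"
    proof -
      have "(\<lambda>n. hc_form k (c n - d n) (c n - d n)) =
          (\<lambda>n. complex_of_real ((hnorm G (G.hsub (lc (c n)) (lc (d n))))\<^sup>2))"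
        using that c(4) by (auto simp: form_diff hc_cauchy_iff)
      moreover have "(\<lambda>n. complex_of_real ((hnorm G (G.hsub (lc (c n)) (lc (d n))))\<^sup>2)) \<longlonglongrightarrow> 0 \<longleftrightarrow>
          (\<lambda>n. (hnorm G (G.hsub (lc (c n)) (lc (d n))))\<^sup>2) \<longlonglongrightarrow> 0"
        using tendsto_of_real_iff[of "\<lambda>n. (hnorm G (G.hsub (lc (c n)) (lc (d n))))\<^sup>2" 0] by simp
      moreover have "(\<lambda>n. (hnorm G (G.hsub (lc (c n)) (lc (d n))))\<^sup>2) \<longlonglongrightarrow> 0 \<longleftrightarrow>
          (\<lambda>n. hnorm G (G.hsub (lc (c n)) (lc (d n)))) \<longlonglongrightarrow> 0"
        using tendsto_power[of "\<lambda>n. hnorm G (G.hsub (lc (c n)) (lc (d n)))" 0 sequentially 2]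
          tendsto_real_sqrt[of "\<lambda>n. (hnorm G (G.hsub (lc (c n)) (lc (d n))))\<^sup>2" 0] that c
        by (auto simp: hc_cauchy_iff)
      ultimately show ?thesis by simp
    qed
    show ?thesis
    proof
      assume d: "lim d g"
      note d' = lim_tends[OF d]
      have "(\<lambda>n. hnorm G (G.hsub (lc (c n)) (lc (d n)))) \<longlonglongrightarrow> 0"
      proof (rule Lim_null_comparison)
        have "hnorm G (G.hsub (lc (c n)) (lc (d n))) \<le> hnorm G (G.hsub (lc (c n)) g) + hnorm G (G.hsub (lc (d n)) g)" for n
          using G.hsub_triangle[OF c(1) c(2) d'(1), of n n] G.hsub_commute[OF c(2) d'(1), of n] by simp
        then show "\<forall>\<^sub>F n in sequentially. norm (hnorm G (G.hsub (lc (c n)) (lc (d n)))) \<le>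
            hnorm G (G.hsub (lc (c n)) g) + hnorm G (G.hsub (lc (d n)) g)"
          using c(1) d'(1) by simp
        show "(\<lambda>n. hnorm G (G.hsub (lc (c n)) g) + hnorm G (G.hsub (lc (d n)) g)) \<longlonglongrightarrow> 0"
          using tendsto_add[OF c(3)[unfolded G.tends_def] d'(3)[unfolded G.tends_def]] by simp
      qed
      then show "d \<in> hc_cauchy S k \<and> (\<lambda>n. hc_form k (c n - d n) (c n - d n)) \<longlonglongrightarrow> 0"
        using lim_hc_cauchy[OF d] e by blast
    next
      assume d: "d \<in> hc_cauchy S k \<and> (\<lambda>n. hc_form k (c n - d n) (c n - d n)) \<longlonglongrightarrow> 0"
      then have k: "Poly_Mapping.keys (d n) \<subseteq> S" for n by (simp add: hc_cauchy_iff)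
      have "G.tends (\<lambda>n. lc (d n)) g"
        using d e c k by (intro tends_comparison[OF c(3)]) auto
      then show "lim d g" using k c by (simp add: lim_def)
    qed
  qed
  then show ?thesis by (auto simp: hc_class_def)
qed

abbreviation "HC \<equiv> hcompl S k"

lemma carr_HC: "v \<in> carr HC \<longleftrightarrow> (\<exists>c g. lim c g \<and> v = {d. lim d g})"
  unfolding hcompl_def using hc_cauchy_lim hc_class_lim lim_hc_cauchy
  by (auto simp: image_iff) metis+

text \<open>By \<open>hc_class_lim\<close> a class consists of all sequences of finite combinations
  with one common limit in \<open>G\<close>. That limit serves as the coordinate of the class, and
  the structure of the completion is pulled back along it.\<close>

definition val :: "'i hc \<Rightarrow> 'g" where
  "val v = (THE g. \<exists>c\<in>v. lim c g)"

lemma val_eq: "lim c g \<Longrightarrow> val {d. lim d g} = g"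
  unfolding val_def by (rule the_equality) (auto dest: lim_unique)

lemma HC_cases:
  assumes "v \<in> carr HC"
  obtains c where "lim c (val v)" "v = {d. lim d (val v)}"
proof -
  obtain c g where "lim c g" "v = {d. lim d g}" using assms by (auto simp: carr_HC)
  then show thesis using that val_eq by metis
qed

lemma tends_lc_add: "lim c g \<Longrightarrow> lim d h \<Longrightarrow> lim (\<lambda>n. c n + d n) (hadd G g h)"
proof -
  assume a: "lim c g" "lim d h"
  note c = lim_tends[OF a(1)] and d = lim_tends[OF a(2)]
  have "G.tends (\<lambda>n. lc (c n + d n)) (hadd G g h)"
    unfolding G.tends_def
  proof (rule Lim_null_comparison)
    have "hnorm G (G.hsub (lc (c n + d n)) (hadd G g h)) \<le> hnorm G (G.hsub (lc (c n)) g) + hnorm G (G.hsub (lc (d n)) h)" for n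
    proof -
      have "G.hsub (lc (c n + d n)) (hadd G g h) = hadd G (G.hsub (lc (c n)) g) (G.hsub (lc (d n)) h)"
        using c d by (intro G.vec_eqI) (auto simp: lc_add algebra_simps)
      then show ?thesis using c d by (simp add: G.norm_triangle)
    qed
    then show "\<forall>\<^sub>F n in sequentially. norm (hnorm G (G.hsub (lc (c n + d n)) (hadd G g h))) \<le>
        hnorm G (G.hsub (lc (c n)) g) + hnorm G (G.hsub (lc (d n)) h)"
      using c d keys_ops(1) by simp
    show "(\<lambda>n. hnorm G (G.hsub (lc (c n)) g) + hnorm G (G.hsub (lc (d n)) h)) \<longlonglongrightarrow> 0"
      using tendsto_add[OF c(3)[unfolded G.tends_def] d(3)[unfolded G.tends_def]] by simp
  qed
  then show ?thesis using c d keys_ops(1) by (simp add: lim_def)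
qed

lemma tends_lc_scale: "lim c g \<Longrightarrow> lim (\<lambda>n. Poly_Mapping.map ((*) z) (c n)) (hscale G z g)"
proof -
  assume a: "lim c g"
  note c = lim_tends[OF a]
  have "hnorm G (G.hsub (lc (Poly_Mapping.map ((*) z) (c n))) (hscale G z g)) = cmod z * hnorm G (G.hsub (lc (c n)) g)" for n
  proof -
    have "G.hsub (lc (Poly_Mapping.map ((*) z) (c n))) (hscale G z g) = hscale G z (G.hsub (lc (c n)) g)"
      using c by (intro G.vec_eqI) (auto simp: lc_scale algebra_simps)
    then show ?thesis using c by simp
  qed
  then have "G.tends (\<lambda>n. lc (Poly_Mapping.map ((*) z) (c n))) (hscale G z g)"
    using tendsto_mult_right_zero[OF c(3)[unfolded G.tends_def], of "cmod z"] by (simp add: G.tends_def)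
  then show ?thesis using c keys_map by (simp add: lim_def)
qed

lemma HC_add:
  assumes "v \<in> carr HC" "w \<in> carr HC"
  shows "hadd HC v w \<in> carr HC \<and> val (hadd HC v w) = hadd G (val v) (val w)"
proof -
  obtain c where c: "lim c (val v)" "v = {d. lim d (val v)}" using HC_cases[OF assms(1)] .
  obtain d where d: "lim d (val w)" "w = {d. lim d (val w)}" using HC_cases[OF assms(2)] .
  let ?g = "hadd G (val v) (val w)"
  have s: "lim (\<lambda>n. c n + d n) ?g" using tends_lc_add c(1) d(1) by blast
  have "hc_class S k (\<lambda>n. c' n + d' n) = {d. lim d ?g}" if "c' \<in> v" "d' \<in> w" for c' d'
    using that c d tends_lc_add hc_class_lim by blast
  then have "hadd HC v w = {d. lim d ?g}"
    using c d by (force simp: hcompl_def)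
  then show ?thesis using s val_eq[OF s] carr_HC by auto
qed

lemma HC_scale:
  assumes "v \<in> carr HC"
  shows "hscale HC z v \<in> carr HC \<and> val (hscale HC z v) = hscale G z (val v)"
proof -
  obtain c where c: "lim c (val v)" "v = {d. lim d (val v)}" using HC_cases[OF assms] .
  let ?g = "hscale G z (val v)"
  have s: "lim (\<lambda>n. Poly_Mapping.map ((*) z) (c n)) ?g" using tends_lc_scale c(1) by blast
  have "hc_class S k (\<lambda>n. Poly_Mapping.map ((*) z) (c' n)) = {d. lim d ?g}" if "c' \<in> v" for c'
    using that c tends_lc_scale hc_class_lim by blast
  then have "hscale HC z v = {d. lim d ?g}"
    using c by (force simp: hcompl_def)
  then show ?thesis using s val_eq[OF s] carr_HC by auto
qed

lemma tends_const: "x \<in> carr G \<Longrightarrow> G.tends (\<lambda>n. x) x"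
  using G.hsub_zero_iff[of x x] by (simp add: G.tends_def)

lemma lim_elt: "i \<in> S \<Longrightarrow> lim (\<lambda>n. Poly_Mapping.single i 1) (f i)"
  by (auto simp: lim_def lc_single f_carr tends_const)

lemma HC_zero: "hzero HC \<in> carr HC" "val (hzero HC) = hzero G"
proof -
  have l: "lim (\<lambda>n. 0) (hzero G)" by (auto simp: lim_def lc_zero tends_const)
  have "hzero HC = {d. lim d (hzero G)}" using hc_class_lim[OF l] by (simp add: hcompl_def)
  then show "hzero HC \<in> carr HC" "val (hzero HC) = hzero G" using l val_eq[OF l] carr_HC by auto
qed

lemma HC_inner:
  assumes "v \<in> carr HC" "w \<in> carr HC"
  shows "hinner HC v w = hinner G (val v) (val w)"
proof -
  obtain c where c: "lim c (val v)" "v = {d. lim d (val v)}" using HC_cases[OF assms(1)] .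
  obtain d where d: "lim d (val w)" "w = {d. lim d (val w)}" using HC_cases[OF assms(2)] .
  have *: "(\<lambda>n. hc_form k (c' n) (d' n)) \<longlonglongrightarrow> hinner G (val v) (val w)" if "c' \<in> v" "d' \<in> w" for c' d'
  proof -
    have "lim c' (val v)" "lim d' (val w)" using that c(2) d(2) by auto
    note c' = lim_tends[OF this(1)] and d' = lim_tends[OF this(2)]
    have "(\<lambda>n. hinner G (lc (c' n)) (lc (d' n)) - hinner G (val v) (val w)) \<longlonglongrightarrow> 0"
    proof (rule Lim_null_comparison)
      have "cmod (hinner G (lc (c' n)) (lc (d' n)) - hinner G (val v) (val w)) \<le>
          hnorm G (lc (c' n)) * hnorm G (G.hsub (lc (d' n)) (val w)) + hnorm G (G.hsub (lc (c' n)) (val v)) * hnorm G (val w)" for n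
      proof -
        have e: "hinner G (lc (c' n)) (lc (d' n)) - hinner G (val v) (val w) =
          hinner G (lc (c' n)) (G.hsub (lc (d' n)) (val w)) + hinner G (G.hsub (lc (c' n)) (val v)) (val w)"
          using c' d' by simp
        show ?thesis
          unfolding e by (rule order_trans[OF norm_triangle_ineq add_mono]) (intro G.cauchy_schwarz; use c' d' in simp)+
      qed
      then show "\<forall>\<^sub>F n in sequentially. norm (hinner G (lc (c' n)) (lc (d' n)) - hinner G (val v) (val w)) \<le>
          hnorm G (lc (c' n)) * hnorm G (G.hsub (lc (d' n)) (val w)) + hnorm G (G.hsub (lc (c' n)) (val v)) * hnorm G (val w)"
        by simp
      have "(\<lambda>n. hnorm G (lc (c' n)) * hnorm G (G.hsub (lc (d' n)) (val w)) + hnorm G (G.hsub (lc (c' n)) (val v)) * hnorm G (val w))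
          \<longlonglongrightarrow> hnorm G (val v) * 0 + 0 * hnorm G (val w)"
        using c'(3) d'(3) G.tends_norm[OF c'(1,2,3)] unfolding G.tends_def by (intro tendsto_intros)
      then show "(\<lambda>n. hnorm G (lc (c' n)) * hnorm G (G.hsub (lc (d' n)) (val w)) + hnorm G (G.hsub (lc (c' n)) (val v)) * hnorm G (val w))
          \<longlonglongrightarrow> 0" by simp
    qed
    then show ?thesis using c'(4) d'(4) by (simp add: hc_form_lc LIM_zero_iff)
  qed
  have "c \<in> v" "d \<in> w" using c d by auto
  then show ?thesis
    unfolding hcompl_def hilb.simps using * LIMSEQ_unique by (intro the_equality) blast+
qed

lemma HC_inj: "inj_on val (carr HC)"
  by (rule inj_onI) (metis HC_cases)

text \<open>A diagonal choice: the n-th vector is approximated within 1/(n+1) by the image of a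
  finite combination, and these combinations represent the limit.\<close>

lemma HC_closed:
  assumes xs: "\<And>n. xs n \<in> carr HC" and g: "g \<in> carr G" "G.tends (\<lambda>n. val (xs n)) g"
  shows "g \<in> val ` carr HC"
proof -
  have "\<exists>d. Poly_Mapping.keys d \<subseteq> S \<and> hnorm G (G.hsub (lc d) (val (xs n))) < 1 / real (Suc n)" for n
  proof -
    obtain c where c: "lim c (val (xs n))" using HC_cases[OF xs] .
    note c' = lim_tends[OF c]
    have "\<forall>\<^sub>F m in sequentially. hnorm G (G.hsub (lc (c m)) (val (xs n))) < 1 / real (Suc n)"
      using order_tendstoD(2)[OF c'(3)[unfolded G.tends_def], of "1 / real (Suc n)"] by simp
    then show ?thesis using c'(4) by (meson eventually_happens sequentially_bot)
  qed
  then obtain d where d: "\<And>n. Poly_Mapping.keys (d n) \<subseteq> S"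
      "\<And>n. hnorm G (G.hsub (lc (d n)) (val (xs n))) < 1 / real (Suc n)" by metis
  have v: "val (xs n) \<in> carr G" for n using HC_cases[OF xs[of n]] lim_tends(2) by metis
  have "G.tends (\<lambda>n. lc (d n)) g"
  proof (rule tends_comparison[OF g(2)])
    show "(\<lambda>n. hnorm G (G.hsub (val (xs n)) (lc (d n)))) \<longlonglongrightarrow> 0"
    proof (rule Lim_null_comparison)
      show "\<forall>\<^sub>F n in sequentially. norm (hnorm G (G.hsub (val (xs n)) (lc (d n)))) \<le> 1 / real (Suc n)"
        using d v G.hsub_commute[of "val (xs _)" "lc (d _)"] by (intro always_eventually) (auto intro: less_imp_le)
      show "(\<lambda>n. 1 / real (Suc n)) \<longlonglongrightarrow> 0"
        using LIMSEQ_inverse_real_of_nat by (simp add: inverse_eq_divide)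
    qed
  qed (use d v g in auto)
  then have l: "lim d g" using d g by (simp add: lim_def)
  then have "{d. lim d g} \<in> carr HC" by (auto simp: carr_HC)
  then show ?thesis using val_eq[OF l] by force
qed

lemma HC_val_carr: "v \<in> carr HC \<Longrightarrow> val v \<in> carr G"
  using HC_cases lim_tends(2) by metis

lemma hilbert_HC: "hilbert_space HC"
  by (rule hilbert_transport[where p = val, OF G.hilbert_space_axioms])
    (rule HC_val_carr HC_inj HC_add HC_zero HC_scale HC_inner HC_closed; assumption)+

lemma hc_elt: "i \<in> S \<Longrightarrow> hc_elt S k i \<in> carr HC" "i \<in> S \<Longrightarrow> val (hc_elt S k i) = f i"
proof -
  assume i: "i \<in> S"
  have "hc_elt S k i = {d. lim d (f i)}"
    unfolding hc_elt_def using hc_class_lim[OF lim_elt[OF i]] .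
  then show "hc_elt S k i \<in> carr HC" "val (hc_elt S k i) = f i"
    using lim_elt[OF i] val_eq[OF lim_elt[OF i]] carr_HC by auto
qed

lemma inner_hc_elt: "i \<in> S \<Longrightarrow> j \<in> S \<Longrightarrow> hinner HC (hc_elt S k i) (hc_elt S k j) = k i j"
  by (simp add: HC_inner hc_elt gram)

text \<open>A vector orthogonal to all generators is orthogonal to the combinations of any sequence
  representing it, hence to their limit, which is the vector itself.\<close>

lemma total_hc_elt: "inner_space.total HC (hc_elt S k ` S)"
proof -
  interpret HC: hilbert_space HC by (rule hilbert_HC)
  show ?thesis
    unfolding HC.total_def
  proof (intro conjI ballI impI)
    fix y assume y: "y \<in> carr HC" and *: "\<forall>s\<in>hc_elt S k ` S. hinner HC s y = 0"
    obtain c where c: "lim c (val y)" using HC_cases[OF y] .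
    note c' = lim_tends[OF c]
    have "hinner G (f i) (val y) = 0" if "i \<in> S" for i
      using * that y by (auto simp: HC_inner hc_elt)
    then have "hinner G (lc (c n)) (val y) = 0" for n
      using c'(4)[of n] c'(2) by (subst inner_lc_left[where A = "Poly_Mapping.keys (c n)"]) (auto intro!: sum.neutral)
    then have "hinner G (val y) (val y) = 0"
      using LIMSEQ_unique[OF tendsto_const, of 0 "hinner G (val y) (val y)"] G.tends_inner(2)[OF c'(1,2,2,3)] by simp
    then show "y = hzero HC" using y by (intro HC.inner_self_zero) (simp_all add: HC_inner)
  qed (use hc_elt in auto)
qed

lemma hc_isometry: "\<exists>T. isometry HC G T \<and> (\<forall>i\<in>S. T (hc_elt S k i) = f i)"
  by (rule gram_isometry[OF hilbert_HC G.hilbert_space_axioms total_hc_elt])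
    (use f_carr gram inner_hc_elt in auto)

end

section \<open>Rank one operators and orthonormal sets\<close>

definition rank_one :: "'a hilb \<Rightarrow> 'a \<Rightarrow> 'a \<Rightarrow> 'a \<Rightarrow> 'a" where
  "rank_one H g d = (\<lambda>x\<in>carr H. hscale H (hinner H d x) g)"

lemma cnj_mult_self: "cnj z * z = of_real ((cmod z)\<^sup>2)"
  by (metis complex_norm_square mult.commute of_real_power)

context hilbert_space
begin

lemma inner_normalized:
  assumes "x \<in> carr H" "hnorm H x > 0"
  shows "hinner H (hscale H (of_real (1 / hnorm H x)) x) (hscale H (of_real (1 / hnorm H x)) x) = 1"
proof -
  have "cmod (of_real (1 / hnorm H x)) = 1 / hnorm H x" using assms(2) by (simp add: norm_divide)
  then show ?thesis
    using assms inner_self[of "hscale H (of_real (1 / hnorm H x)) x"] norm_scale[of x "of_real (1 / hnorm H x)"]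
    by simp
qed

lemma rank_one_apply [simp]: "x \<in> carr H \<Longrightarrow> rank_one H g d x = hscale H (hinner H d x) g"
  by (simp add: rank_one_def)

lemma rank_one_bop [simp]: "g \<in> carr H \<Longrightarrow> d \<in> carr H \<Longrightarrow> rank_one H g d \<in> BH H"
proof (rule bopI[where b = "hnorm H d * hnorm H g"])
  fix x assume *: "g \<in> carr H" "d \<in> carr H" "x \<in> carr H"
  then have "hnorm H (rank_one H g d x) = cmod (hinner H d x) * hnorm H g" by simp
  also have "\<dots> \<le> (hnorm H d * hnorm H x) * hnorm H g"
    using * cauchy_schwarz by (intro mult_right_mono) auto
  finally show "hnorm H (rank_one H g d x) \<le> hnorm H d * hnorm H g * hnorm H x" by (simp add: algebra_simps)
qed (auto intro!: vec_eqI simp: rank_one_def algebra_simps)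

lemma star_rank_one [simp]: "g \<in> carr H \<Longrightarrow> d \<in> carr H \<Longrightarrow> star H (rank_one H g d) = rank_one H d g"
proof (rule adj_unique)
  fix x y assume *: "g \<in> carr H" "d \<in> carr H" "x \<in> carr H" "y \<in> carr H"
  have "hinner H (rank_one H g d x) y = cnj (hinner H d x) * hinner H g y" using * by simp
  also have "\<dots> = hinner H x (rank_one H d g y)" using * inner_commute[of d x] by simp
  finally show "hinner H (rank_one H g d x) y = hinner H x (rank_one H d g y)" .
qed (use hilbert_space_axioms in auto)

lemma comp_rank_one: "A \<in> BH H \<Longrightarrow> g \<in> carr H \<Longrightarrow> d \<in> carr H \<Longrightarrow>
    A \<circ>\<^bsub>H\<^esub> rank_one H g d = rank_one H (A g) d"
  using hilbert_space_axioms
  by (intro bop_eqI[of _ H H]) (auto simp: bop_scale intro: comp_bop[of H H])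

lemma rank_one_comp_rank_one: "g \<in> carr H \<Longrightarrow> d \<in> carr H \<Longrightarrow> g' \<in> carr H \<Longrightarrow> d' \<in> carr H \<Longrightarrow>
    rank_one H g d \<circ>\<^bsub>H\<^esub> rank_one H g' d' = rank_one H (hscale H (hinner H d g') g) d'"
  by (subst comp_rank_one) auto

lemma rank_one_add: "g \<in> carr H \<Longrightarrow> g' \<in> carr H \<Longrightarrow> d \<in> carr H \<Longrightarrow>
    rank_one H (hadd H g g') d = op_add H H (rank_one H g d) (rank_one H g' d)"
  by (auto simp: rank_one_def op_add_def fun_eq_iff intro!: vec_eqI simp: algebra_simps)

lemma rank_one_scale: "g \<in> carr H \<Longrightarrow> d \<in> carr H \<Longrightarrow>
    rank_one H (hscale H c g) d = op_scale H H c (rank_one H g d)"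
  by (auto simp: rank_one_def op_scale_def fun_eq_iff intro!: vec_eqI simp: algebra_simps)

lemma op_scale_bop [simp]:
  assumes B: "B \<in> BH H"
  shows "op_scale H H c B \<in> BH H"
proof -
  have "op_scale H H c B = op_scale H H c (op_id H) \<circ>\<^bsub>H\<^esub> B"
    using B by (intro extensionalityI[of _ "carr H"]) (auto simp: op_scale_def compose_def)
  moreover have "op_scale H H c (op_id H) \<in> BH H"
    by (rule bopI[where b = "cmod c"]) (auto simp: op_scale_def intro!: vec_eqI simp: algebra_simps)
  ultimately show ?thesis using B hilbert_space_axioms by simp
qed

lemma op_add_bop [simp]:
  assumes "A \<in> BH H" "B \<in> BH H"
  shows "op_add H H A B \<in> BH H"
proof -
  obtain a where a: "a \<ge> 0" "\<And>x. x \<in> carr H \<Longrightarrow> hnorm H (A x) \<le> a * hnorm H x"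
    using bop_bound assms hilbert_space_axioms by blast
  obtain b where b: "b \<ge> 0" "\<And>x. x \<in> carr H \<Longrightarrow> hnorm H (B x) \<le> b * hnorm H x"
    using bop_bound assms hilbert_space_axioms by blast
  show ?thesis
  proof (rule bopI[where b = "a + b"])
    fix x assume x: "x \<in> carr H"
    then have "hnorm H (op_add H H A B x) \<le> hnorm H (A x) + hnorm H (B x)"
      using assms by (simp add: op_add_def norm_triangle)
    also have "\<dots> \<le> (a + b) * hnorm H x" using a(2)[OF x] b(2)[OF x] by (simp add: algebra_simps)
    finally show "hnorm H (op_add H H A B x) \<le> (a + b) * hnorm H x" .
  next
    show "op_add H H A B (hadd H x y) = hadd H (op_add H H A B x) (op_add H H A B y)"
      if "x \<in> carr H" "y \<in> carr H" for x y
    proof -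
      have "A x \<in> carr H" "A y \<in> carr H" "B x \<in> carr H" "B y \<in> carr H" using assms that by auto
      then show ?thesis using assms that by (intro vec_eqI) (auto simp: op_add_def bop_add)
    qed
    show "op_add H H A B (hscale H c x) = hscale H c (op_add H H A B x)" if "x \<in> carr H" for c x
    proof -
      have "A x \<in> carr H" "B x \<in> carr H" using assms that by auto
      then show ?thesis using assms that by (intro vec_eqI) (auto simp: op_add_def bop_scale algebra_simps)
    qed
  qed (use assms in \<open>auto simp: op_add_def\<close>)
qed

definition orthonormal :: "'a set \<Rightarrow> bool" where
  "orthonormal B \<longleftrightarrow> B \<subseteq> carr H \<and> (\<forall>e\<in>B. \<forall>f\<in>B. hinner H e f = (if e = f then 1 else 0))"

lemma orthonormal_subset: "orthonormal B \<Longrightarrow> C \<subseteq> B \<Longrightarrow> orthonormal C"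
  by (auto simp: orthonormal_def subset_iff)

text \<open>Zorn's lemma. Closure of \<open>M\<close> under scalars keeps the normalisation of a
  nonzero vector orthogonal to the maximal family inside \<open>M\<close>, contradicting
  maximality.\<close>

lemma maximal_orthonormal:
  assumes M: "M \<subseteq> carr H" "\<And>c x. x \<in> M \<Longrightarrow> hscale H c x \<in> M"
    and B0: "orthonormal B0" "B0 \<subseteq> M"
  shows "\<exists>B. B0 \<subseteq> B \<and> B \<subseteq> M \<and> orthonormal B \<and> (\<forall>x\<in>M. (\<forall>e\<in>B. hinner H e x = 0) \<longrightarrow> x = hzero H)"
proof -
  let ?A = "{B. B0 \<subseteq> B \<and> B \<subseteq> M \<and> orthonormal B}"
  have "\<exists>B\<in>?A. \<forall>X\<in>?A. B \<subseteq> X \<longrightarrow> X = B"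
  proof (rule subset_Zorn_nonempty)
    fix C assume C: "C \<noteq> {}" "subset.chain ?A C"
    have o: "\<And>X. X \<in> C \<Longrightarrow> B0 \<subseteq> X \<and> X \<subseteq> M \<and> orthonormal X" using C(2) by (auto simp: subset_chain_def)
    have "hinner H e f = (if e = f then 1 else 0)" if "e \<in> \<Union>C" "f \<in> \<Union>C" for e f
    proof -
      obtain X Y where XY: "X \<in> C" "Y \<in> C" "e \<in> X" "f \<in> Y" using \<open>e \<in> \<Union>C\<close> \<open>f \<in> \<Union>C\<close> by blast
      then obtain Z where "Z \<in> C" "e \<in> Z" "f \<in> Z"
        using C(2) unfolding subset_chain_def by blast
      then show ?thesis using o[of Z] by (auto simp: orthonormal_def)
    qed
    moreover have "\<Union>C \<subseteq> carr H" using o M(1) by blast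
    ultimately have "orthonormal (\<Union>C)" by (simp add: orthonormal_def)
    then show "\<Union>C \<in> ?A" using o C(1) by blast
  qed (use B0 in blast)
  then obtain B where B: "B0 \<subseteq> B" "B \<subseteq> M" "orthonormal B"
    and max: "\<And>X. B0 \<subseteq> X \<Longrightarrow> X \<subseteq> M \<Longrightarrow> orthonormal X \<Longrightarrow> B \<subseteq> X \<Longrightarrow> X = B" by auto
  have "x = hzero H" if x: "x \<in> M" "\<forall>e\<in>B. hinner H e x = 0" for x
  proof (rule ccontr)
    assume nz: "x \<noteq> hzero H"
    have xH: "x \<in> carr H" using x M by blast
    have n: "hnorm H x > 0" using nz norm_zero_iff[OF xH] norm_nonneg[OF xH] by linarith
    define e where "e = hscale H (of_real (1 / hnorm H x)) x"
    have e: "e \<in> M" "e \<in> carr H" using M x xH by (auto simp: e_def)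
    have 1: "hinner H e e = 1"
      unfolding e_def by (rule inner_normalized[OF xH n])
    have 0: "hinner H b e = 0" "hinner H e b = 0" if "b \<in> B" for b
    proof -
      have b: "b \<in> carr H" using that B M by blast
      show "hinner H b e = 0" using x(2) that b xH by (simp add: e_def)
      then show "hinner H e b = 0" using inner_commute[OF b e(2)] by simp
    qed
    have "orthonormal (insert e B)"
      using B(3) 1 0 e unfolding orthonormal_def by auto
    moreover have "e \<notin> B" using 0 1 by auto
    ultimately show False using max[of "insert e B"] B e by blast
  qed
  then show ?thesis using B by blast
qed

text \<open>\<open>Q\<close> is the sum of the projections \<open>rank_one H e e\<close> for e in
  \<open>F\<close>, described by its matrix coefficients. The second clause stores the consequence
  of linearity that the faithfulness proof needs: if every summand is annihilated at y after
  applying \<Phi>, so is the sum.\<close>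

lemma finite_projection:
  assumes "finite F" "orthonormal F"
  shows "\<exists>Q\<in>BH H. (\<forall>x\<in>carr H. \<forall>y\<in>carr H. hinner H y (Q x) = (\<Sum>e\<in>F. hinner H y e * hinner H e x)) \<and>
    (\<forall>\<Phi> y. op_linear H H \<Phi> \<longrightarrow> y \<in> carr H \<longrightarrow> (\<forall>e\<in>F. \<Phi> (rank_one H e e) y = hzero H) \<longrightarrow> \<Phi> Q y = hzero H)"
  using assms
proof (induction F rule: finite_induct)
  case empty
  \<comment> \<open>The zero operator, written as a rank one operator so that its boundedness is
    already known.\<close>
  let ?z = "rank_one H (hzero H) (hzero H)"
  have "\<Phi> ?z y = hzero H" if \<Phi>: "op_linear H H \<Phi>" and y: "y \<in> carr H" for \<Phi> y
  proof -
    have z: "?z \<in> BH H" by simp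
    have "op_scale H H 0 ?z = ?z" by (auto simp: op_scale_def rank_one_def fun_eq_iff intro!: vec_eqI)
    moreover have "\<Phi> (op_scale H H 0 ?z) = op_scale H H 0 (\<Phi> ?z)" using \<Phi> z unfolding op_linear_def by blast
    ultimately have "\<Phi> ?z = op_scale H H 0 (\<Phi> ?z)" by simp
    then have "\<Phi> ?z y = op_scale H H 0 (\<Phi> ?z) y" by (rule fun_cong)
    then have "\<Phi> ?z y = hscale H 0 (\<Phi> ?z y)" using y by (simp add: op_scale_def)
    moreover have "\<Phi> ?z \<in> BH H" using \<Phi> z unfolding op_linear_def by blast
    then have "\<Phi> ?z y \<in> carr H" using y by simp
    then have "hscale H 0 (\<Phi> ?z y) = hzero H" by (intro vec_eqI) auto
    ultimately show ?thesis by simp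
  qed
  then show ?case by (intro bexI[of _ ?z]) auto
next
  case (insert e F)
  have eF: "orthonormal F" "e \<in> carr H" using insert.prems by (auto simp: orthonormal_def)
  then obtain Q where Q: "Q \<in> BH H" "\<And>x y. x \<in> carr H \<Longrightarrow> y \<in> carr H \<Longrightarrow> hinner H y (Q x) = (\<Sum>e\<in>F. hinner H y e * hinner H e x)"
    "\<And>\<Phi> y. op_linear H H \<Phi> \<Longrightarrow> y \<in> carr H \<Longrightarrow> \<forall>e\<in>F. \<Phi> (rank_one H e e) y = hzero H \<Longrightarrow> \<Phi> Q y = hzero H"
    using insert.IH by blast
  let ?Q = "op_add H H (rank_one H e e) Q"
  have "\<Phi> ?Q y = hzero H" if \<Phi>: "op_linear H H \<Phi>" and y: "y \<in> carr H" and k: "\<forall>e\<in>insert e F. \<Phi> (rank_one H e e) y = hzero H" for \<Phi> y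
  proof -
    have "\<Phi> ?Q = op_add H H (\<Phi> (rank_one H e e)) (\<Phi> Q)"
      using \<Phi> Q(1) eF unfolding op_linear_def by simp
    then have "\<Phi> ?Q y = hadd H (\<Phi> (rank_one H e e) y) (\<Phi> Q y)"
      using y by (simp add: op_add_def)
    also have "\<dots> = hadd H (hzero H) (hzero H)" using Q(3)[OF \<Phi> y] k by simp
    also have "\<dots> = hzero H" by (intro vec_eqI) auto
    finally show ?thesis .
  qed
  moreover have "hinner H y (?Q x) = (\<Sum>e\<in>insert e F. hinner H y e * hinner H e x)" if "x \<in> carr H" "y \<in> carr H" for x y
    using that Q(1,2) insert.hyps eF by (simp add: op_add_def)
  ultimately show ?case using Q(1) eF by (intro bexI[of _ ?Q]) auto
qed

lemma bessel:
  assumes "finite F" "orthonormal F" "x \<in> carr H"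
  shows "(\<Sum>e\<in>F. (cmod (hinner H e x))\<^sup>2) \<le> (hnorm H x)\<^sup>2"
proof -
  obtain Q where Q: "Q \<in> BH H" "\<And>x y. x \<in> carr H \<Longrightarrow> y \<in> carr H \<Longrightarrow> hinner H y (Q x) = (\<Sum>e\<in>F. hinner H y e * hinner H e x)"
    using finite_projection[OF assms(1,2)] by blast
  have F: "e \<in> F \<Longrightarrow> e \<in> carr H" for e using assms(2) by (auto simp: orthonormal_def)
  have Qx: "Q x \<in> carr H" using Q(1) assms(3) by simp
  define s where "s = (\<Sum>e\<in>F. (cmod (hinner H e x))\<^sup>2)"
  have 1: "hinner H x (Q x) = of_real s"
  proof -
    have "hinner H x (Q x) = (\<Sum>e\<in>F. cnj (hinner H e x) * hinner H e x)"
      unfolding Q(2)[OF assms(3,3)] using F inner_commute[OF _ assms(3)] by (intro sum.cong) auto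
    then show ?thesis by (simp only: cnj_mult_self of_real_sum s_def)
  qed
  have 2: "hinner H e (Q x) = hinner H e x" if "e \<in> F" for e
  proof -
    have "hinner H e (Q x) = (\<Sum>f\<in>F. (if e = f then hinner H f x else 0))"
      unfolding Q(2)[OF assms(3) F[OF that]] using assms(2) that by (intro sum.cong) (auto simp: orthonormal_def)
    then show ?thesis using assms(1) that by simp
  qed
  have 3: "hinner H (Q x) (Q x) = of_real s"
  proof -
    have "hinner H (Q x) (Q x) = (\<Sum>e\<in>F. cnj (hinner H e (Q x)) * hinner H e x)"
      unfolding Q(2)[OF assms(3) Qx] using F inner_commute[OF _ Qx] by (intro sum.cong) auto
    also have "\<dots> = (\<Sum>e\<in>F. cnj (hinner H e x) * hinner H e x)" using 2 by (intro sum.cong) auto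
    finally show ?thesis by (simp only: cnj_mult_self of_real_sum s_def)
  qed
  have "hinner H (Q x) x = of_real s" using 1 inner_commute[OF assms(3) Qx] by simp
  then have "Re (hinner H (hsub x (Q x)) (hsub x (Q x))) = (hnorm H x)\<^sup>2 - s"
    using assms(3) Qx 1 3 by (simp add: inner_self[OF assms(3)])
  then show ?thesis using inner_nonneg[of "hsub x (Q x)"] assms(3) Qx by (simp add: s_def)
qed

lemma countable_nonzero_coeffs:
  assumes "orthonormal B" "x \<in> carr H"
  shows "countable {e\<in>B. hinner H e x \<noteq> 0}"
proof -
  have "(\<lambda>e. (cmod (hinner H e x))\<^sup>2) summable_on B"
  proof (rule nonneg_bdd_above_summable_on)
    show "bdd_above (sum (\<lambda>e. (cmod (hinner H e x))\<^sup>2) ` {F. F \<subseteq> B \<and> finite F})"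
      using bessel orthonormal_subset assms by (intro bdd_aboveI2[where M = "(hnorm H x)\<^sup>2"]) blast
  qed simp
  then have "countable {e\<in>B. (cmod (hinner H e x))\<^sup>2 \<noteq> 0}" by (rule summable_countable_real)
  then show ?thesis by simp
qed

text \<open>Totality gives every element of \<open>B\<close> a nonzero inner product with some
  element of the countable set \<open>D\<close>, and by Bessel's inequality each element of
  \<open>D\<close> has only countably many nonzero coefficients.\<close>

lemma countable_orthonormal:
  assumes D: "countable D" "total D" and B: "orthonormal B"
  shows "countable B"
proof -
  have "B \<subseteq> (\<Union>d\<in>D. {e\<in>B. hinner H e d \<noteq> 0})"
  proof
    fix e assume e: "e \<in> B"
    then have eH: "e \<in> carr H" "hinner H e e = 1" using B by (auto simp: orthonormal_def)
    have "\<exists>d\<in>D. hinner H d e \<noteq> 0"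
      using totalD[OF D(2) eH(1)] eH by fastforce
    then obtain d where d: "d \<in> D" "hinner H d e \<noteq> 0" by blast
    then have "d \<in> carr H" using D(2) by (auto simp: total_def)
    then have "hinner H e d \<noteq> 0" using d eH inner_commute[of e d] by simp
    then show "e \<in> (\<Union>d\<in>D. {e\<in>B. hinner H e d \<noteq> 0})" using d e by blast
  qed
  moreover have "countable (\<Union>d\<in>D. {e\<in>B. hinner H e d \<noteq> 0})"
    using D B by (intro countable_UN countable_nonzero_coeffs) (auto simp: total_def)
  ultimately show ?thesis using countable_subset by blast
qed

lemma separable_countable_total:
  assumes "separable_space (htop H)"
  shows "\<exists>D. countable D \<and> total D"
proof -
  interpret M: Metric_space "carr H" "hdist H" by (rule metric)
  obtain C where C: "countable C" "C \<subseteq> carr H" "M.mtopology closure_of C = carr H"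
    using assms by (auto simp: separable_space_def htop_def)
  have "y = hzero H" if y: "y \<in> carr H" "\<And>s. s \<in> C \<Longrightarrow> hinner H s y = 0" for y
  proof (rule ccontr)
    assume "y \<noteq> hzero H"
    then have n: "hnorm H y > 0" using norm_zero_iff[OF y(1)] norm_nonneg[OF y(1)] by linarith
    have "\<exists>s\<in>C. s \<in> M.mball y (hnorm H y)"
      using y(1) n C(3) unfolding M.metric_closure_of by blast
    then obtain s where s: "s \<in> C" "s \<in> carr H" "hnorm H (hsub y s) < hnorm H y"
      using y(1) by (auto simp: hdist_def)
    have "hinner H (hsub y s) y = hinner H y y" using s y by simp
    then have "(hnorm H y)\<^sup>2 = cmod (hinner H (hsub y s) y)" using y(1) by (simp add: inner_self norm_power)
    also have "\<dots> \<le> hnorm H (hsub y s) * hnorm H y" using s y by (intro cauchy_schwarz) auto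
    also have "\<dots> < hnorm H y * hnorm H y" using s n by simp
    finally show False by (simp add: power2_eq_square)
  qed
  then show ?thesis using C by (auto simp: total_def)
qed

lemma tends_inner2:
  assumes f: "\<And>n. f n \<in> carr H" "x \<in> carr H" "tends f x" and g: "\<And>n. g n \<in> carr H" "y \<in> carr H" "tends g y"
  shows "(\<lambda>n. hinner H (f n) (g n)) \<longlonglongrightarrow> hinner H x y"
proof -
  have "(\<lambda>n. hinner H (f n) (g n) - hinner H x y) \<longlonglongrightarrow> 0"
  proof (rule Lim_null_comparison)
    have "cmod (hinner H (f n) (g n) - hinner H x y) \<le>
        hnorm H (f n) * hnorm H (hsub (g n) y) + hnorm H (hsub (f n) x) * hnorm H y" for n
    proof -
      have e: "hinner H (f n) (g n) - hinner H x y = hinner H (f n) (hsub (g n) y) + hinner H (hsub (f n) x) y"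
        using f g by simp
      show ?thesis
        unfolding e by (rule order_trans[OF norm_triangle_ineq add_mono]) (intro cauchy_schwarz; use f g in simp)+
    qed
    then show "\<forall>\<^sub>F n in sequentially. norm (hinner H (f n) (g n) - hinner H x y) \<le>
        hnorm H (f n) * hnorm H (hsub (g n) y) + hnorm H (hsub (f n) x) * hnorm H y" by simp
    have "(\<lambda>n. hnorm H (f n) * hnorm H (hsub (g n) y) + hnorm H (hsub (f n) x) * hnorm H y)
        \<longlonglongrightarrow> hnorm H x * 0 + 0 * hnorm H y"
      using f(3) g(3) tends_norm[OF f] unfolding tends_def by (intro tendsto_intros)
    then show "(\<lambda>n. hnorm H (f n) * hnorm H (hsub (g n) y) + hnorm H (hsub (f n) x) * hnorm H y) \<longlonglongrightarrow> 0" by simp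
  qed
  then show ?thesis by (simp add: LIM_zero_iff)
qed

lemma bop_sub: "A \<in> BH H \<Longrightarrow> x \<in> carr H \<Longrightarrow> y \<in> carr H \<Longrightarrow> A (hsub x y) = hsub (A x) (A y)"
  by (simp add: bop_add bop_scale)

lemma bop_tends:
  assumes "A \<in> BH H" "\<And>n. f n \<in> carr H" "x \<in> carr H" "tends f x"
  shows "tends (\<lambda>n. A (f n)) (A x)"
proof -
  obtain b where b: "b \<ge> 0" "\<And>x. x \<in> carr H \<Longrightarrow> hnorm H (A x) \<le> b * hnorm H x"
    using bop_bound assms(1) hilbert_space_axioms by blast
  show ?thesis
    unfolding tends_def
  proof (rule Lim_null_comparison)
    have "hnorm H (hsub (A (f n)) (A x)) \<le> b * hnorm H (hsub (f n) x)" for n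
      using b(2)[of "hsub (f n) x"] assms by (simp add: bop_sub[symmetric])
    then show "\<forall>\<^sub>F n in sequentially. norm (hnorm H (hsub (A (f n)) (A x))) \<le> b * hnorm H (hsub (f n) x)"
      using assms by simp
    show "(\<lambda>n. b * hnorm H (hsub (f n) x)) \<longlonglongrightarrow> 0"
      using tendsto_mult_right_zero[OF assms(4)[unfolded tends_def]] .
  qed
qed

lemma bop_lincomb: "A \<in> BH H \<Longrightarrow> (\<And>i. i \<in> snd ` set xs \<Longrightarrow> f i \<in> carr H) \<Longrightarrow>
    A (lincomb f xs) = lincomb (\<lambda>i. A (f i)) xs"
proof (induction xs)
  case Nil
  then show ?case using bop_zero[of A H H] hilbert_space_axioms by simp
next
  case (Cons a xs)
  then show ?case by (cases a) (simp add: bop_add bop_scale)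
qed

text \<open>Normality enters only here: the projections onto the spans of finite subsets of an orthonormal
  basis increase to the identity.\<close>

lemma normal_star_hom_faithful:
  assumes hom: "star_hom H H \<Phi>" and normal: "normal_map H \<Phi>" and unit: "\<Phi> (op_id H) = op_id H"
    and y: "y \<in> carr H" and kill: "\<And>e. e \<in> carr H \<Longrightarrow> \<Phi> (rank_one H e e) y = hzero H"
  shows "y = hzero H"
proof (rule ccontr)
  assume nz: "y \<noteq> hzero H"
  have lin: "op_linear H H \<Phi>" using hom by (simp add: star_hom_def)
  have \<Phi>: "A \<in> BH H \<Longrightarrow> \<Phi> A \<in> BH H" for A using lin by (auto simp: op_linear_def)
  obtain B where B: "orthonormal B" "\<And>x. x \<in> carr H \<Longrightarrow> (\<And>e. e \<in> B \<Longrightarrow> hinner H e x = 0) \<Longrightarrow> x = hzero H"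
    using maximal_orthonormal[of "carr H" "{}"] by (auto simp: orthonormal_def)
  have BH: "e \<in> B \<Longrightarrow> e \<in> carr H" for e using B(1) by (auto simp: orthonormal_def)
  have totB: "total B" using B BH by (auto simp: total_def)
  \<comment> \<open>\<open>P F Q\<close> expresses that \<open>Q\<close> is the projection onto the
    span of the finite set \<open>F\<close> of basis vectors. The matrix coefficients determine
    \<open>Q\<close>, so every property of such a projection can be read off from
    \<open>F\<close>.\<close>
  define P where "P F Q \<longleftrightarrow> F \<subseteq> B \<and> finite F \<and> Q \<in> BH H \<and>
    (\<forall>x\<in>carr H. \<forall>y\<in>carr H. hinner H y (Q x) = (\<Sum>e\<in>F. hinner H y e * hinner H e x))" for F Q
  have P_ex: "\<exists>Q. P F Q \<and> \<Phi> Q y = hzero H" if "F \<subseteq> B" "finite F" for F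
  proof -
    have "\<forall>e\<in>F. \<Phi> (rank_one H e e) y = hzero H" using that kill BH by blast
    then show ?thesis
      using finite_projection[OF that(2) orthonormal_subset[OF B(1) that(1)]] lin y that unfolding P_def by blast
  qed
  have P_unique: "Q = Q'" if "P F Q" "P F Q'" for F Q Q'
  proof (rule bop_eqI[of _ H H])
    fix x assume "x \<in> carr H"
    then show "Q x = Q' x" using that by (intro vec_eqI) (auto simp: P_def)
  qed (use that in \<open>auto simp: P_def\<close>)
  have P_kill: "\<Phi> Q y = hzero H" if "P F Q" for F Q
    using P_ex[of F] P_unique[OF that] that by (auto simp: P_def)
  have P_fix: "Q e = e" if "P F Q" "e \<in> F" for F Q e
  proof (rule vec_eqI)
    have F: "F \<subseteq> B" "finite F" "Q \<in> BH H" using that(1) by (auto simp: P_def)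
    show e: "e \<in> carr H" "Q e \<in> carr H" using F that(2) BH by auto
    fix z assume z: "z \<in> carr H"
    have "hinner H z (Q e) = (\<Sum>f\<in>F. hinner H z f * hinner H f e)"
      using that(1) e z by (simp add: P_def)
    also have "\<dots> = (\<Sum>f\<in>F. if f = e then hinner H z f else 0)"
      using F(1) B(1) that(2) by (intro sum.cong) (auto simp: orthonormal_def subset_iff)
    also have "\<dots> = hinner H z e" using F that(2) by simp
    finally show "hinner H z (Q e) = hinner H z e" .
  qed
  have P_pos: "hinner H x (Q x) = of_real (\<Sum>e\<in>F. (cmod (hinner H e x))\<^sup>2)" if "P F Q" "x \<in> carr H" for F Q x
  proof -
    have "hinner H x (Q x) = (\<Sum>e\<in>F. cnj (hinner H e x) * hinner H e x)"
      using that inner_commute[OF BH that(2)] by (auto simp: P_def intro!: sum.cong)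
    then show ?thesis by (simp only: cnj_mult_self of_real_sum)
  qed
  define D where "D = {Q. \<exists>F. P F Q}"
  have D_BH: "Q \<in> D \<Longrightarrow> Q \<in> BH H" for Q by (auto simp: D_def P_def)
  have D_star: "star H Q = Q" if QD: "Q \<in> D" for Q
  proof (rule adj_unique[OF hilbert_space_axioms hilbert_space_axioms D_BH[OF that] D_BH[OF that]])
    fix x z assume xz: "x \<in> carr H" "z \<in> carr H"
    obtain F where F: "P F Q" using QD by (auto simp: D_def)
    have FB: "F \<subseteq> B" using F by (simp add: P_def)
    have Qx: "Q x \<in> carr H" using D_BH[OF that] xz by simp
    have "hinner H (Q x) z = cnj (hinner H z (Q x))" by (rule inner_commute[OF xz(2) Qx])
    also have "\<dots> = (\<Sum>e\<in>F. cnj (hinner H z e) * cnj (hinner H e x))" using F xz by (simp add: P_def)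
    also have "\<dots> = (\<Sum>e\<in>F. hinner H x e * hinner H e z)"
      using xz BH FB inner_commute[OF xz(2)] inner_commute[OF _ xz(1)] by (intro sum.cong) auto
    also have "\<dots> = hinner H x (Q z)" using F xz by (simp add: P_def)
    finally show "hinner H (Q x) z = hinner H x (Q z)" .
  qed
  have D_idem: "Q \<circ>\<^bsub>H\<^esub> Q = Q" if QD: "Q \<in> D" for Q
  proof -
    obtain F where F: "P F Q" using QD by (auto simp: D_def)
    have FB: "F \<subseteq> B" using F by (simp add: P_def)
    show ?thesis
    proof (rule bop_eqI[of _ H H])
      fix x assume x: "x \<in> carr H"
      then have Qx: "Q x \<in> carr H" using D_BH[OF QD] by simp
      have "hinner H e (Q x) = hinner H e x" if e: "e \<in> F" for e
      proof -
        have eH: "e \<in> carr H" using e FB BH by blast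
        have "hinner H e (Q x) = hinner H (star H Q e) x"
          using inner_adj_left[OF hilbert_space_axioms hilbert_space_axioms D_BH[OF QD] x eH] by simp
        then show ?thesis using D_star[OF QD] P_fix[OF F e] by simp
      qed
      then have "Q (Q x) = Q x" using F x Qx D_BH[OF QD] by (intro vec_eqI) (auto simp: P_def)
      then show "(Q \<circ>\<^bsub>H\<^esub> Q) x = Q x" using x by simp
    qed (use D_BH[OF QD] hilbert_space_axioms in \<open>auto intro: comp_bop[of H H]\<close>)
  qed
  have D_self: "D \<subseteq> self_adjoint H" using D_BH D_star by (auto simp: self_adjoint_def)
  have D_ne: "D \<noteq> {}" using P_ex[of "{}"] by (auto simp: D_def)
  have D_dir: "\<forall>A\<in>D. \<forall>A'\<in>D. \<exists>C\<in>D. op_le H A C \<and> op_le H A' C"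
  proof (intro ballI)
    fix A A' assume "A \<in> D" "A' \<in> D"
    then obtain F F' where F: "P F A" "P F' A'" by (auto simp: D_def)
    then have fin: "finite (F \<union> F')" "F \<union> F' \<subseteq> B" by (auto simp: P_def)
    then obtain C where C: "P (F \<union> F') C" using P_ex by blast
    have "op_le H A C" "op_le H A' C"
      using F C fin by (auto simp: op_le_def P_pos intro!: sum_mono2)
    then show "\<exists>C\<in>D. op_le H A C \<and> op_le H A' C" using C by (auto simp: D_def)
  qed
  have id_self: "op_id H \<in> self_adjoint H" using hilbert_space_axioms by (simp add: self_adjoint_def)
  have D_le: "op_le H A (op_id H)" if AD: "A \<in> D" for A
  proof -
    obtain F where F: "P F A" using AD by (auto simp: D_def)
    then have "finite F" "orthonormal F" using B(1) orthonormal_subset by (auto simp: P_def)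
    then show ?thesis using F bessel by (auto simp: op_le_def P_pos inner_self)
  qed
  have sup: "op_is_sup H D (op_id H)"
    unfolding op_is_sup_def
  proof (intro conjI ballI impI)
    fix C assume C: "C \<in> self_adjoint H" "\<forall>A\<in>D. op_le H A C"
    have CB: "C \<in> BH H" using C by (simp add: self_adjoint_def)
    show "op_le H (op_id H) C"
      unfolding op_le_def
    proof
      fix x assume x: "x \<in> carr H"
      \<comment> \<open>Each finite combination of basis vectors is fixed by some projection in
        \<open>D\<close>, so the upper bound \<open>C\<close> dominates the identity on such
        combinations. They are dense, and both quadratic forms are continuous.\<close>
      let ?M = "{lincomb (\<lambda>i. i) xs | xs. snd ` set xs \<subseteq> B}"
      have M: "lin_subspace ?M" using BH by (intro lin_subspace_lincombs) auto
      have "B \<subseteq> ?M"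
      proof
        fix e assume e: "e \<in> B"
        then have "e = lincomb (\<lambda>i. i) [(1, e)]" using BH by (intro vec_eqI) auto
        then show "e \<in> ?M" using e by (intro CollectI exI[of _ "[(1, e)]"]) auto
      qed
      then obtain u where u: "\<And>n. u n \<in> ?M" "tends u x"
        using total_approx[OF totB _ M x] by blast
      have uH: "u n \<in> carr H" for n using u(1)[of n] M by (auto simp: lin_subspace_def)
      have le: "Re (hinner H (u n) (u n)) \<le> Re (hinner H (u n) (C (u n)))" for n
      proof -
        obtain xs where xs: "u n = lincomb (\<lambda>i. i) xs" "snd ` set xs \<subseteq> B" using u(1)[of n] by blast
        obtain Q where Q: "P (snd ` set xs) Q" using P_ex[of "snd ` set xs"] xs by auto
        have QB: "Q \<in> BH H" using Q by (simp add: P_def)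
        have "Q (u n) = lincomb (\<lambda>i. Q i) xs"
          unfolding xs(1) using QB xs BH by (intro bop_lincomb) auto
        also have "\<dots> = u n"
        proof -
          have "set ys \<subseteq> set xs \<Longrightarrow> lincomb Q ys = lincomb (\<lambda>i. i) ys" for ys
          proof (induction ys)
            case (Cons a ys)
            from Cons.prems have "snd a \<in> snd ` set xs" by simp
            then show ?case using P_fix[OF Q, of "snd a"] Cons by (cases a) auto
          qed simp
          then show ?thesis using xs(1) by simp
        qed
        finally have "Q (u n) = u n" .
        moreover have "op_le H Q C" using C Q by (auto simp: D_def)
        ultimately show ?thesis using uH[of n] unfolding op_le_def by metis
      qed
      have "Re (hinner H x x) \<le> Re (hinner H x (C x))"
      proof (rule LIMSEQ_le)
        show "(\<lambda>n. Re (hinner H (u n) (u n))) \<longlonglongrightarrow> Re (hinner H x x)"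
          using uH x u(2) by (intro tendsto_Re tends_inner2)
        show "(\<lambda>n. Re (hinner H (u n) (C (u n)))) \<longlonglongrightarrow> Re (hinner H x (C x))"
          using uH x u(2) CB bop_tends[OF CB uH x u(2)] by (intro tendsto_Re tends_inner2) auto
      qed (use le in auto)
      then show "Re (hinner H x (op_id H x)) \<le> Re (hinner H x (C x))" using x by simp
    qed
  qed (use id_self D_le in auto)
  have sup': "op_is_sup H (\<Phi> ` D) (op_id H)"
    using normal D_ne D_self D_dir sup unit unfolding normal_map_def by metis
  define w where "w = hscale H (of_real (1 / hnorm H y)) y"
  have n: "hnorm H y > 0" using nz norm_zero_iff[OF y] norm_nonneg[OF y] by linarith
  have w: "w \<in> carr H" "hinner H w w = 1"
    using inner_normalized[OF y n] y by (auto simp: w_def)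
  have kw: "\<Phi> A w = hzero H" if "A \<in> D" for A
  proof -
    have "\<Phi> A y = hzero H" using that P_kill by (auto simp: D_def)
    then have "\<Phi> A w = hscale H (of_real (1 / hnorm H y)) (hzero H)"
      using \<Phi>[OF D_BH[OF that]] y by (simp add: w_def bop_scale)
    also have "\<dots> = hzero H" by (intro vec_eqI) auto
    finally show ?thesis .
  qed
  \<comment> \<open>The projection onto the orthogonal complement of the unit vector w. Each \<Phi>
    A with A in \<open>D\<close> is a projection annihilating w, hence below \<open>?C\<close>; then
    so is their supremum, the identity, which fails at w.\<close>
  let ?C = "op_add H H (op_id H) (rank_one H (hscale H (-1) w) w)"
  have C_BH: "?C \<in> BH H" using w hilbert_space_axioms by simp
  have C_in: "hinner H x (?C z) = hinner H x z - hinner H w z * hinner H x w" if "x \<in> carr H" "z \<in> carr H" for x z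
    using that w by (simp add: op_add_def)
  have C_self: "?C \<in> self_adjoint H"
  proof -
    have "star H ?C = ?C"
    proof (rule adj_unique[OF hilbert_space_axioms hilbert_space_axioms C_BH C_BH])
      fix x z assume xz: "x \<in> carr H" "z \<in> carr H"
      have "?C x \<in> carr H" using C_BH xz by simp
      then have "hinner H (?C x) z = cnj (hinner H z x - hinner H w x * hinner H z w)"
        using inner_commute[OF xz(2), of "?C x"] C_in[OF xz(2,1)] by simp
      also have "\<dots> = hinner H x (?C z)"
        using xz w inner_commute[OF xz(2,1)] inner_commute[OF w(1) xz(1)] inner_commute[OF xz(2) w(1)]
        by (simp add: C_in algebra_simps)
      finally show "hinner H (?C x) z = hinner H x (?C z)" .
    qed
    then show ?thesis using C_BH by (simp add: self_adjoint_def)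
  qed
  have "op_le H (\<Phi> A) ?C" if A: "A \<in> D" for A
    unfolding op_le_def
  proof
    fix x assume x: "x \<in> carr H"
    have AB: "\<Phi> A \<in> BH H" using \<Phi> D_BH A by blast
    have idem: "\<Phi> A \<circ>\<^bsub>H\<^esub> \<Phi> A = \<Phi> A" "star H (\<Phi> A) = \<Phi> A"
      using hom D_idem[OF A] D_star[OF A] D_BH[OF A] unfolding star_hom_def by metis+
    have quad: "hinner H z (\<Phi> A z) = of_real ((hnorm H (\<Phi> A z))\<^sup>2)" if z: "z \<in> carr H" for z
    proof -
      have Az: "\<Phi> A z \<in> carr H" using AB z by simp
      have "\<Phi> A (\<Phi> A z) = \<Phi> A z" using fun_cong[OF idem(1), of z] z by simp
      then have "hinner H z (\<Phi> A z) = hinner H (star H (\<Phi> A) z) (\<Phi> A z)"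
        using inner_adj_left[OF hilbert_space_axioms hilbert_space_axioms AB Az z] by simp
      then show ?thesis using Az idem(2) by (simp add: inner_self)
    qed
    let ?x = "hsub x (hscale H (hinner H w x) w)"
    have x': "?x \<in> carr H" using x w by simp
    have "\<Phi> A ?x = hsub (\<Phi> A x) (hscale H (hinner H w x) (hzero H))"
      using AB x w kw[OF A] by (simp add: bop_add bop_scale)
    also have "\<dots> = \<Phi> A x" using AB x by (intro vec_eqI) auto
    finally have "Re (hinner H x (\<Phi> A x)) = (hnorm H (\<Phi> A ?x))\<^sup>2" using quad[OF x] by simp
    also have "\<dots> = Re (hinner H ?x (\<Phi> A ?x))" using quad[OF x'] by simp
    also have "\<dots> \<le> hnorm H ?x * hnorm H ?x"
    proof -
      have Ax': "\<Phi> A ?x \<in> carr H" using AB x' by simp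
      have "(hnorm H (\<Phi> A ?x))\<^sup>2 \<le> hnorm H ?x * hnorm H (\<Phi> A ?x)"
        using quad[OF x'] cauchy_schwarz[OF x' Ax'] by (simp add: norm_power)
      then have "hnorm H (\<Phi> A ?x) \<le> hnorm H ?x"
        using norm_nonneg[OF Ax'] norm_nonneg[OF x'] by (cases "hnorm H (\<Phi> A ?x) = 0") (auto simp: power2_eq_square mult_le_cancel_right)
      then show ?thesis using quad[OF x'] norm_nonneg[OF Ax'] norm_nonneg[OF x']
        by (simp add: power2_eq_square mult_mono)
    qed
    also have "\<dots> = Re (hinner H ?x ?x)" using x' by (simp add: norm_sq[symmetric] power2_eq_square del: inner_add)
    also have "\<dots> = Re (hinner H x (?C x))"
    proof -
      have "hinner H ?x ?x = hinner H x x - hinner H w x * hinner H x w - cnj (hinner H w x) * hinner H w x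
          + cnj (hinner H w x) * hinner H w x * hinner H w w"
        using x w(1) by (simp add: algebra_simps)
      then show ?thesis using w(2) C_in[OF x x] by simp
    qed
    finally show "Re (hinner H x (\<Phi> A x)) \<le> Re (hinner H x (?C x))" .
  qed
  then have "op_le H (op_id H) ?C" using sup' C_self unfolding op_is_sup_def by blast
  then have "Re (hinner H w (op_id H w)) \<le> Re (hinner H w (?C w))" using w(1) unfolding op_le_def by blast
  then show False using w C_in[OF w(1) w(1)] by simp
qed

text \<open>A unit vector w orthogonal to the range of \<open>R\<close> is a wandering vector: the
  powers of \<open>R\<close> applied to w are orthonormal, because an inner product of two different
  powers reduces to one of w with a vector of the range.\<close>

lemma isometry_not_unitary_infinite:
  assumes R: "isometry H H R" "\<not> unitary_op H H R"
  shows "\<exists>e :: nat \<Rightarrow> 'a. inj e \<and> orthonormal (range e)"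
proof -
  note hh = hilbert_space_axioms
  have RB: "R \<in> BH H" using R(1) by (rule isometry_bop)
  have inner: "hinner H (R x) (R y) = hinner H x y" if "x \<in> carr H" "y \<in> carr H" for x y
    using R(1) that isometry_iff[OF hh hh] by blast
  have sR: "star H R x \<in> carr H" if "x \<in> carr H" for x using that RB hh by simp
  have "R \<circ>\<^bsub>H\<^esub> star H R \<noteq> op_id H"
    using R RB by (auto simp: unitary_op_def coisometry_def)
  then obtain y where y: "y \<in> carr H" "R (star H R y) \<noteq> y"
    using RB hh bop_eqI[of "R \<circ>\<^bsub>H\<^esub> star H R" H H "op_id H"] comp_bop[of H H "star H R" R H] by auto
  define z where "z = hsub y (R (star H R y))"
  have z: "z \<in> carr H" using y RB hh sR by (simp add: z_def)
  have zn: "hnorm H z > 0"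
    using y hsub_zero_iff[of y "R (star H R y)"] norm_nonneg[OF z] RB sR[OF y(1)] by (simp add: z_def less_le)
  have z0: "hinner H (R x) z = 0" if "x \<in> carr H" for x
  proof -
    have "hinner H (R x) z = hinner H (R x) y - hinner H x (star H R y)"
      using that y RB inner[OF that sR[OF y(1)]] sR[OF y(1)] by (simp add: z_def)
    then show ?thesis using inner_adj[OF hh hh RB that y(1)] by simp
  qed
  define w where "w = hscale H (of_real (1 / hnorm H z)) z"
  have w: "w \<in> carr H" "hinner H w w = 1"
    using inner_normalized[OF z zn] z by (auto simp: w_def)
  have w0: "hinner H (R x) w = 0" if "x \<in> carr H" for x
    using z0[OF that] z RB that by (simp add: w_def)
  define e where "e n = (R ^^ n) w" for n
  have e: "e n \<in> carr H" for n by (induction n) (use w RB in \<open>auto simp: e_def\<close>)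
  have shift: "hinner H (e (n + k)) (e (m + k)) = hinner H (e n) (e m)" for n m k
  proof (induction k)
    case (Suc k)
    have "hinner H (e (n + Suc k)) (e (m + Suc k)) = hinner H (R (e (n + k))) (R (e (m + k)))"
      by (simp add: e_def)
    then show ?case using inner[OF e e] Suc by simp
  qed simp
  have lt: "hinner H (e n) (e m) = 0" if "m < n" for m n
  proof -
    obtain j where j: "n = Suc j + m" using \<open>m < n\<close> less_imp_Suc_add by (metis add.commute add_Suc_right)
    have "hinner H (e n) (e m) = hinner H (e (Suc j)) (e 0)" using shift[of "Suc j" m 0] j by simp
    also have "\<dots> = hinner H (R (e j)) w" by (simp add: e_def)
    finally show ?thesis using w0[OF e] by simp
  qed
  have ee: "hinner H (e n) (e m) = (if n = m then 1 else 0)" for n m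
  proof (cases "n < m")
    case True
    then show ?thesis using lt[OF True] inner_commute[OF e e, of m n] by simp
  next
    case False
    then show ?thesis using lt[of m n] shift[of 0 m 0] w(2) by (cases "n = m") (auto simp: e_def)
  qed
  have "inj e" by (rule injI) (metis ee zero_neq_one)
  moreover from this have "orthonormal (range e)" using e ee by (auto simp: orthonormal_def inj_eq)
  ultimately show ?thesis by blast
qed

end

text \<open>The given sequences are extended to maximal orthonormal sets, which are countable by
  separability and infinite by construction. Enumerations of the two sets have the same Gram
  matrix.\<close>

lemma unitary_between_separable:
  assumes H: "hilbert_space H" and K: "hilbert_space K"
    and DH: "countable D" "inner_space.total H D" and DK: "countable D'" "inner_space.total K D'"
    and eH: "inj e" "hilbert_space.orthonormal H (range (e :: nat \<Rightarrow> 'a))"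
    and eK: "inj e'" "hilbert_space.orthonormal K (range (e' :: nat \<Rightarrow> 'b))"
  shows "\<exists>W. unitary_op H K W"
proof -
  interpret H: hilbert_space H by fact
  interpret K: hilbert_space K by fact
  obtain B where B: "range e \<subseteq> B" "H.orthonormal B" "\<And>x. x \<in> carr H \<Longrightarrow> (\<And>b. b \<in> B \<Longrightarrow> hinner H b x = 0) \<Longrightarrow> x = hzero H"
    using H.maximal_orthonormal[OF subset_refl _ eH(2)] eH(2)
    by (metis (no_types, lifting) H.orthonormal_def H.scale_closed)
  obtain B' where B': "range e' \<subseteq> B'" "K.orthonormal B'" "\<And>x. x \<in> carr K \<Longrightarrow> (\<And>b. b \<in> B' \<Longrightarrow> hinner K b x = 0) \<Longrightarrow> x = hzero K"
    using K.maximal_orthonormal[OF subset_refl _ eK(2)] eK(2)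
    by (metis (no_types, lifting) K.orthonormal_def K.scale_closed)
  have tot: "H.total B" "K.total B'" using B B' by (auto simp: H.total_def K.total_def H.orthonormal_def K.orthonormal_def)
  have inf: "infinite B" "infinite B'"
    using B(1) B'(1) eH(1) eK(1) by (meson finite_subset range_inj_infinite)+
  have "countable B" "countable B'"
    using H.countable_orthonormal[OF DH B(2)] K.countable_orthonormal[OF DK B'(2)] by auto
  then obtain f f' where f: "bij_betw f (UNIV :: nat set) B" "bij_betw f' (UNIV :: nat set) B'"
    using inf by (meson bij_betw_from_nat_into)
  have "f n \<in> B" "f' n \<in> B'" for n using f by (auto simp: bij_betw_def)
  moreover have "f n = f m \<longleftrightarrow> n = m" "f' n = f' m \<longleftrightarrow> n = m" for n m
    using f by (auto simp: bij_betw_def inj_on_def)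
  ultimately have gram: "hinner K (f' n) (f' m) = hinner H (f n) (f m)" for n m
    using B(2) B'(2) by (auto simp: H.orthonormal_def K.orthonormal_def)
  have im: "f ` UNIV = B" "f' ` UNIV = B'" using f by (auto simp: bij_betw_def)
  have "\<exists>W. isometry H K W \<and> (\<forall>n\<in>UNIV. W (f n) = f' n)"
    using gram_isometry[OF H K, of f UNIV f'] gram im tot by (auto simp: K.total_def)
  then obtain W where W: "isometry H K W" "\<And>n. W (f n) = f' n" by auto
  have "B' \<subseteq> W ` carr H"
  proof
    fix b assume "b \<in> B'"
    then obtain n where "b = f' n" using im by auto
    moreover have "f n \<in> carr H" using im tot by (auto simp: H.total_def)
    ultimately show "b \<in> W ` carr H" using W(2) by (metis imageI)
  qed
  then show ?thesis using unitary_opI[OF H K W(1) tot(2)] by blast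
qed

section \<open>Dilations of a semigroup\<close>

text \<open>Interpreted for \<alpha> and \<beta> on \<open>K\<close> and for \<sigma> on
  \<open>G\<close>. The spaces attached to \<phi> are realised inside \<open>G\<close>, so
  positivity of their kernels is inherited from \<open>G\<close>. The fixed unit vector
  \<open>h0\<close> provides matrix units: rank one operators ending at \<open>J h0\<close> make
  intertwiners explicit.\<close>

locale dilation = H: hilbert_space H + G: hilbert_space G
  for H :: "'h hilb" and G :: "'g hilb" +
  fixes J :: "'h \<Rightarrow> 'g" and \<phi> :: "'h semigrp" and \<sigma> :: "'g semigrp" and h0 :: 'h
  assumes J_isometry: "isometry H G J"
    and e0: "e0_semigroup G \<sigma>"
    and phi_compr: "t \<ge> 0 \<Longrightarrow> A \<in> BH G \<Longrightarrow> \<phi> t (compr H G J A) = compr H G J (\<sigma> t A)"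
    and phi_unital: "t \<ge> 0 \<Longrightarrow> \<phi> t (op_id H) = op_id H"
    and h0: "h0 \<in> carr H" "hinner H h0 h0 = 1"
begin

lemmas hil = H.hilbert_space_axioms G.hilbert_space_axioms

abbreviation Js :: "'g \<Rightarrow> 'h" where "Js \<equiv> adj H G J"

lemma J_bop [simp]: "J \<in> bop H G" using J_isometry by (rule isometry_bop)

lemma J_carr [simp]: "h \<in> carr H \<Longrightarrow> J h \<in> carr G" by (rule bop_carr[OF J_bop])

lemma Js_bop [simp]: "Js \<in> bop G H" using hil by simp

lemma Js_carr [simp]: "g \<in> carr G \<Longrightarrow> Js g \<in> carr H" by (rule bop_carr[OF Js_bop])

lemma Js_J [simp]: "h \<in> carr H \<Longrightarrow> Js (J h) = h" using isometry_adj_apply[OF J_isometry] .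

lemma inner_J [simp]: "h \<in> carr H \<Longrightarrow> k \<in> carr H \<Longrightarrow> hinner G (J h) (J k) = hinner H h k"
  using J_isometry isometry_iff[OF hil] by blast

lemma inner_Js: "h \<in> carr H \<Longrightarrow> g \<in> carr G \<Longrightarrow> hinner H h (Js g) = hinner G (J h) g"
  using inner_adj[OF hil J_bop] .

lemma inner_Js_left: "h \<in> carr H \<Longrightarrow> g \<in> carr G \<Longrightarrow> hinner H (Js g) h = hinner G g (J h)"
  using inner_adj_left[OF hil J_bop] .

lemma comp_BG [simp]: "A \<in> BH G \<Longrightarrow> B \<in> BH G \<Longrightarrow> A \<circ>\<^bsub>G\<^esub> B \<in> BH G"
  using hil by (intro comp_bop[of G G])

lemma comp_BH [simp]: "A \<in> BH H \<Longrightarrow> B \<in> BH H \<Longrightarrow> A \<circ>\<^bsub>H\<^esub> B \<in> BH H"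
  using hil by (intro comp_bop[of H H])

lemma star_BG [simp]: "A \<in> BH G \<Longrightarrow> star G A \<in> BH G" and star_BH [simp]: "B \<in> BH H \<Longrightarrow> star H B \<in> BH H"
  using hil by auto

lemma id_BG [simp]: "op_id G \<in> BH G" and id_BH [simp]: "op_id H \<in> BH H"
  using hil by auto

lemma sigma_bop [simp]: "t \<ge> 0 \<Longrightarrow> A \<in> BH G \<Longrightarrow> \<sigma> t A \<in> BH G"
  using e0 unfolding e0_semigroup_def star_hom_def op_linear_def by blast

lemma sigma_carr [simp]: "t \<ge> 0 \<Longrightarrow> A \<in> BH G \<Longrightarrow> x \<in> carr G \<Longrightarrow> \<sigma> t A x \<in> carr G"
  by (rule bop_carr[OF sigma_bop])

lemma sigma_comp: "t \<ge> 0 \<Longrightarrow> A \<in> BH G \<Longrightarrow> B \<in> BH G \<Longrightarrow> \<sigma> t (A \<circ>\<^bsub>G\<^esub> B) = \<sigma> t A \<circ>\<^bsub>G\<^esub> \<sigma> t B"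
  using e0 by (simp add: e0_semigroup_def star_hom_def)

lemma sigma_comp_apply: "t \<ge> 0 \<Longrightarrow> A \<in> BH G \<Longrightarrow> B \<in> BH G \<Longrightarrow> x \<in> carr G \<Longrightarrow>
    \<sigma> t A (\<sigma> t B x) = \<sigma> t (A \<circ>\<^bsub>G\<^esub> B) x"
  by (simp add: sigma_comp)

lemma sigma_star: "t \<ge> 0 \<Longrightarrow> A \<in> BH G \<Longrightarrow> \<sigma> t (star G A) = star G (\<sigma> t A)"
  using e0 by (simp add: e0_semigroup_def star_hom_def)

lemma inner_sigma: "t \<ge> 0 \<Longrightarrow> A \<in> BH G \<Longrightarrow> x \<in> carr G \<Longrightarrow> y \<in> carr G \<Longrightarrow>
    hinner G (\<sigma> t A x) y = hinner G x (\<sigma> t (star G A) y)"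
  using inner_adj[of G G "\<sigma> t A" x y] hil by (simp add: sigma_star)

lemma sigma_add: "t \<ge> 0 \<Longrightarrow> A \<in> BH G \<Longrightarrow> B \<in> BH G \<Longrightarrow> \<sigma> t (op_add G G A B) = op_add G G (\<sigma> t A) (\<sigma> t B)"
  using e0 by (simp add: e0_semigroup_def star_hom_def op_linear_def)

lemma sigma_scale: "t \<ge> 0 \<Longrightarrow> A \<in> BH G \<Longrightarrow> \<sigma> t (op_scale G G c A) = op_scale G G c (\<sigma> t A)"
  using e0 by (simp add: e0_semigroup_def star_hom_def op_linear_def)

lemma sigma_0 [simp]: "A \<in> BH G \<Longrightarrow> \<sigma> 0 A = A"
  using e0 by (simp add: e0_semigroup_def cp0_semigroup_def)

lemma sigma_id [simp]: "t \<ge> 0 \<Longrightarrow> \<sigma> t (op_id G) = op_id G"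
  using e0 by (simp add: e0_semigroup_def cp0_semigroup_def)

lemma sigma_sigma: "s \<ge> 0 \<Longrightarrow> t \<ge> 0 \<Longrightarrow> A \<in> BH G \<Longrightarrow> \<sigma> s (\<sigma> t A) = \<sigma> (s + t) A"
  using e0 by (simp add: e0_semigroup_def cp0_semigroup_def)

definition lift :: "('h \<Rightarrow> 'h) \<Rightarrow> 'g \<Rightarrow> 'g" where
  "lift A = J \<circ>\<^bsub>G\<^esub> (A \<circ>\<^bsub>G\<^esub> Js)"

lemma lift_bop [simp]: "A \<in> BH H \<Longrightarrow> lift A \<in> BH G"
  unfolding lift_def using hil by (intro comp_bop[of G H] comp_bop[of G H]) auto

lemma lift_apply [simp]: "A \<in> BH H \<Longrightarrow> x \<in> carr G \<Longrightarrow> lift A x = J (A (Js x))"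
  by (simp add: lift_def)

lemma lift_comp: "A \<in> BH H \<Longrightarrow> B \<in> BH H \<Longrightarrow> lift A \<circ>\<^bsub>G\<^esub> lift B = lift (A \<circ>\<^bsub>H\<^esub> B)"
  by (intro bop_eqI[of _ G G]) auto

lemma star_lift: "A \<in> BH H \<Longrightarrow> star G (lift A) = lift (star H A)"
proof (rule adj_unique)
  fix x y assume A: "A \<in> BH H" and xy: "x \<in> carr G" "y \<in> carr G"
  have c: "A (Js x) \<in> carr H" "star H A (Js y) \<in> carr H" using A xy hil by auto
  have "hinner G (lift A x) y = hinner H (A (Js x)) (Js y)" using A xy c by (simp add: inner_Js)
  also have "\<dots> = hinner H (Js x) (star H A (Js y))" using A xy hil by (simp add: inner_adj)
  also have "\<dots> = hinner G x (lift (star H A) y)" using A xy c by (simp add: inner_Js_left)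
  finally show "hinner G (lift A x) y = hinner G x (lift (star H A) y)" .
qed (use hil in auto)

lemma lift_rank_one: "g \<in> carr H \<Longrightarrow> d \<in> carr H \<Longrightarrow> lift (rank_one H g d) = rank_one G (J g) (J d)"
  by (intro bop_eqI[of _ G G]) (auto simp: bop_scale[OF J_bop] inner_Js)

abbreviation P where "P \<equiv> lift (op_id H)"

lemma compr_lift: "A \<in> BH H \<Longrightarrow> compr H G J (lift A) = A"
  unfolding compr_def using hil
  by (intro bop_eqI[of _ H H] comp_bop[of H G] comp_bop[of H G]) (auto intro: bop_carr)

lemma compr_bop [simp]: "A \<in> BH G \<Longrightarrow> compr H G J A \<in> BH H"
  unfolding compr_def using hil by (intro comp_bop[of H G] comp_bop[of H G]) auto

lemma lift_compr: "A \<in> BH G \<Longrightarrow> lift (compr H G J A) = P \<circ>\<^bsub>G\<^esub> (A \<circ>\<^bsub>G\<^esub> P)"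
proof (rule bop_eqI[of _ G G])
  fix x assume A: "A \<in> BH G" and x: "x \<in> carr G"
  have "lift (compr H G J A) x = J (compr H G J A (Js x))" using A x by (intro lift_apply) auto
  then show "lift (compr H G J A) x = (P \<circ>\<^bsub>G\<^esub> (A \<circ>\<^bsub>G\<^esub> P)) x"
    using A x by (simp add: compr_def)
qed auto

lemma phi_eq: "t \<ge> 0 \<Longrightarrow> A \<in> BH H \<Longrightarrow> \<phi> t A = compr H G J (\<sigma> t (lift A))"
  using phi_compr[of t "lift A"] by (simp add: compr_lift)

lemma phi_bop [simp]: "t \<ge> 0 \<Longrightarrow> A \<in> BH H \<Longrightarrow> \<phi> t A \<in> BH H"
  by (simp add: phi_eq)

lemma lift_phi: "t \<ge> 0 \<Longrightarrow> A \<in> BH H \<Longrightarrow> lift (\<phi> t A) = P \<circ>\<^bsub>G\<^esub> (\<sigma> t (lift A) \<circ>\<^bsub>G\<^esub> P)"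
  by (simp add: phi_eq lift_compr)

lemma P_star: "star G P = P" using hil by (simp add: star_lift)

lemma P_lift: "A \<in> BH H \<Longrightarrow> P \<circ>\<^bsub>G\<^esub> lift A = lift A" "A \<in> BH H \<Longrightarrow> lift A \<circ>\<^bsub>G\<^esub> P = lift A"
  using hil by (auto intro!: bop_eqI[of _ G G])

text \<open>Unitality of \<phi> enters here. The projection \<open>\<sigma> t P\<close> compresses
  to \<open>\<phi> t\<close> of the identity, so its quadratic form at \<open>J h\<close> is the
  squared norm of \<open>J h\<close>, and a projection with that property fixes the vector. Hence
  the projections \<open>\<sigma> t P\<close> increase with t.\<close>

lemma sigma_P_J [simp]: "t \<ge> 0 \<Longrightarrow> h \<in> carr H \<Longrightarrow> \<sigma> t P (J h) = J h"
proof -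
  assume t: "t \<ge> 0" and h: "h \<in> carr H"
  let ?x = "J h" and ?E = "\<sigma> t P"
  have "compr H G J ?E h = h" using phi_eq[of t "op_id H"] phi_unital[OF t] t h by simp
  then have "Js (?E ?x) = h" using h by (simp add: compr_def)
  then have 1: "hinner G ?x (?E ?x) = hinner H h h" using inner_Js[OF h, of "?E ?x"] t h by simp
  have 2: "hinner G (?E ?x) (?E ?x) = hinner H h h"
    using 1 t h by (simp add: inner_sigma P_star sigma_comp_apply P_lift)
  have 3: "hinner G (?E ?x) ?x = hinner H h h"
    using 1 t h by (simp add: inner_sigma P_star)
  have "hnorm G (G.hsub (?E ?x) ?x) = 0"
    using 1 2 3 t h by (simp add: hnorm_def)
  then show "?E ?x = ?x" using t h by (simp add: G.hsub_zero_iff)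
qed

lemma sigma_P_P: "t \<ge> 0 \<Longrightarrow> \<sigma> t P \<circ>\<^bsub>G\<^esub> P = P"
  by (intro bop_eqI[of _ G G]) auto

lemma sigma_P_mono: "0 \<le> s \<Longrightarrow> s \<le> t \<Longrightarrow> x \<in> carr G \<Longrightarrow> \<sigma> t P (\<sigma> s P x) = \<sigma> s P x"
proof -
  assume *: "0 \<le> s" "s \<le> t" "x \<in> carr G"
  have "\<sigma> t P = \<sigma> s (\<sigma> (t - s) P)" using * by (simp add: sigma_sigma)
  then show ?thesis using * by (simp add: sigma_comp_apply sigma_P_P)
qed

lemma sigma_P_lift: "t \<ge> 0 \<Longrightarrow> A \<in> BH H \<Longrightarrow> x \<in> carr G \<Longrightarrow> \<sigma> t P (\<sigma> t (lift A) x) = \<sigma> t (lift A) x"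
  "t \<ge> 0 \<Longrightarrow> A \<in> BH H \<Longrightarrow> x \<in> carr G \<Longrightarrow> \<sigma> t (lift A) (\<sigma> t P x) = \<sigma> t (lift A) x"
  by (simp_all add: sigma_comp_apply P_lift)

text \<open>The left endpoint r contributes \<sigma> at the remaining time t - r, so factors further
  to the left have been evolved longer. The last point of the list carries no factor.\<close>

fun word :: "real \<Rightarrow> (real \<Rightarrow> 'h \<Rightarrow> 'h) \<Rightarrow> real list \<Rightarrow> 'g \<Rightarrow> 'g" where
  "word t a (r # s # ts) = \<sigma> (t - r) (lift (a r)) \<circ>\<^bsub>G\<^esub> word t a (s # ts)"
| "word t a [s] = op_id G"
| "word t a [] = op_id G"

lemma word_bop [simp]: "(\<And>r. r \<in> set ts \<Longrightarrow> r \<le> t) \<Longrightarrow> (\<And>r. r \<in> set (butlast ts) \<Longrightarrow> a r \<in> BH H) \<Longrightarrow>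
    word t a ts \<in> BH G"
  by (induction t a ts rule: word.induct) auto

lemma word_cong: "(\<And>r. r \<in> set (butlast ts) \<Longrightarrow> a r = b r) \<Longrightarrow> word t a ts = word t b ts"
  by (induction t a ts rule: word.induct) auto

lemma sorted_le_last: "sorted ts \<Longrightarrow> r \<in> set ts \<Longrightarrow> r \<le> (last ts :: real)"
  by (induction ts) auto

lemma word_range:
  assumes "sorted (s # ts)" "last (s # ts) = t" "\<And>r. r \<in> set (butlast (s # ts)) \<Longrightarrow> a r \<in> BH H" "h \<in> carr H"
  shows "\<sigma> (t - s) P (word t a (s # ts) (J h)) = word t a (s # ts) (J h)"
proof (cases ts)
  case Nil
  then show ?thesis using assms hil by simp
next
  case (Cons r us)
  have le: "\<And>r. r \<in> set (s # ts) \<Longrightarrow> r \<le> t" using assms(1,2) sorted_le_last by blast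
  have "word t a ts \<in> BH G" using le assms(3) Cons by (intro word_bop) (auto split: if_splits)
  then show ?thesis using Cons assms le[of s] by (simp add: sigma_P_lift)
qed

text \<open>The factor at the first endpoint r is moved to the other side, which leaves \<sigma> at
  time t - r of one operator Y between two shorter words. These are fixed by the projection
  \<open>\<sigma> (t - s) P\<close>, so Y may be evolved by s - r and compressed to
  \<open>H\<close>, which is exactly \<open>\<phi> (s - r)\<close>. The operator \<open>Z\<close>
  accumulates these compressions along the induction.\<close>

lemma word_form:
  assumes "sorted ts" "ts \<noteq> []" "last ts = t" "\<And>r. r \<in> set (butlast ts) \<Longrightarrow> a r \<in> BH H"
    "\<And>r. r \<in> set (butlast ts) \<Longrightarrow> b r \<in> BH H" "Z \<in> BH H" "h \<in> carr H" "k \<in> carr H"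
  shows "hinner G (word t a ts (J h)) (\<sigma> (t - hd ts) (lift Z) (word t b ts (J k))) =
    hinner H h (ms_fold H \<phi> a b ts Z k)"
  using assms
proof (induction ts arbitrary: Z rule: induct_list012)
  case (2 s)
  then show ?case using hil by simp
next
  case (3 r s ts)
  have le: "\<And>r'. r' \<in> set (r # s # ts) \<Longrightarrow> r' \<le> t" and rs: "r \<le> s" using "3.prems"(1,3) sorted_le_last by (blast, simp)
  let ?wa = "word t a (s # ts) (J h)" and ?wb = "word t b (s # ts) (J k)"
  have ab: "a r \<in> BH H" "b r \<in> BH H" using "3.prems" by auto
  have WB: "word t a (s # ts) \<in> BH G" "word t b (s # ts) \<in> BH G"
    using le "3.prems"(4,5) by (auto intro!: word_bop simp del: word.simps)
  then have w: "?wa \<in> carr G" "?wb \<in> carr G" using "3.prems" by (auto simp del: word.simps)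
  let ?Y = "star H (a r) \<circ>\<^bsub>H\<^esub> (Z \<circ>\<^bsub>H\<^esub> b r)"
  have Y: "?Y \<in> BH H" using ab "3.prems" by simp
  have tr: "t - r \<ge> 0" "t - s \<ge> 0" "s - r \<ge> 0" using le rs by auto
  have rng: "\<sigma> (t - s) P ?wa = ?wa" "\<sigma> (t - s) P ?wb = ?wb"
    using "3.prems" by (auto intro!: word_range simp del: word.simps)
  have "hinner G (word t a (r # s # ts) (J h)) (\<sigma> (t - hd (r # s # ts)) (lift Z) (word t b (r # s # ts) (J k))) =
      hinner G (\<sigma> (t - r) (lift (a r)) ?wa) (\<sigma> (t - r) (lift Z) (\<sigma> (t - r) (lift (b r)) ?wb))"
    using "3.prems" by simp
  also have "\<dots> = hinner G ?wa (\<sigma> (t - r) (lift ?Y) ?wb)"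
    using w ab tr "3.prems"(6) by (simp add: inner_sigma star_lift sigma_comp_apply lift_comp del: word.simps)
  also have "\<sigma> (t - r) (lift ?Y) = \<sigma> (t - s) (\<sigma> (s - r) (lift ?Y))"
    using tr Y by (simp add: sigma_sigma)
  also have "hinner G ?wa (\<sigma> (t - s) (\<sigma> (s - r) (lift ?Y)) ?wb) =
      hinner G (\<sigma> (t - s) P ?wa) (\<sigma> (t - s) (\<sigma> (s - r) (lift ?Y)) (\<sigma> (t - s) P ?wb))"
    using rng by simp
  also have "\<dots> = hinner G ?wa (\<sigma> (t - s) (lift (\<phi> (s - r) ?Y)) ?wb)"
    using w tr Y by (simp add: inner_sigma P_star sigma_comp_apply lift_phi del: word.simps)
  also have "\<dots> = hinner G ?wa (\<sigma> (t - hd (s # ts)) (lift (\<phi> (s - r) ?Y)) ?wb)" by simp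
  also have "\<dots> = hinner H h (ms_fold H \<phi> a b (s # ts) (\<phi> (s - r) ?Y) k)"
    using "3.prems" Y tr by (intro "3.IH"(2)) auto
  finally show ?case by simp
qed simp

text \<open>A point outside \<open>Q\<close> contributes \<sigma> of \<open>P\<close> at its
  remaining time. The rest of the word lies in the range of the same projection at a smaller
  remaining time, and these ranges increase, so the factor acts as the identity.\<close>

lemma word_filter:
  assumes "sorted ts" "ts \<noteq> []" "last ts = t" "t \<in> Q" "\<And>r. r \<in> set (butlast ts) \<Longrightarrow> r \<in> Q \<Longrightarrow> a r \<in> BH H" "h \<in> carr H"
  shows "word t (\<lambda>r. if r \<in> Q then a r else op_id H) ts (J h) = word t a (filter (\<lambda>r. r \<in> Q) ts) (J h)"
  using assms
proof (induction ts rule: induct_list012)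
  case (3 r s ts)
  let ?a = "\<lambda>r. if r \<in> Q then a r else op_id H"
  let ?f = "filter (\<lambda>r. r \<in> Q) (s # ts)"
  have le: "\<And>r'. r' \<in> set (r # s # ts) \<Longrightarrow> r' \<le> t" and rs: "r \<le> s" using "3.prems"(1,3) sorted_le_last by (blast, simp)
  have IH: "word t ?a (s # ts) (J h) = word t a ?f (J h)"
    using "3.prems" by (intro "3.IH"(2)) auto
  have bl: "s # ts = butlast (s # ts) @ [t]" using "3.prems"(3) append_butlast_last_id[of "s # ts"] by simp
  have fbl: "?f = filter (\<lambda>r. r \<in> Q) (butlast (s # ts)) @ [t]" using "3.prems"(4) by (subst bl) simp
  have tQ: "t \<in> set ?f" unfolding fbl by simp
  then obtain q us where f: "?f = q # us" by (cases ?f) auto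
  have srt: "sorted (q # us)" using "3.prems"(1) f by (metis sorted2 sorted_wrt_filter)
  have lst: "last (q # us) = t" using fbl f by (metis last_snoc)
  have sub: "r' \<in> set (butlast (s # ts)) \<and> r' \<in> Q" if r': "r' \<in> set (butlast (q # us))" for r'
  proof -
    have "butlast (q # us) = filter (\<lambda>r. r \<in> Q) (butlast (s # ts))" using fbl f by (metis butlast_snoc)
    then show ?thesis using r' by simp
  qed
  have aq: "r' \<in> set (butlast (q # us)) \<Longrightarrow> a r' \<in> BH H" for r'
    using sub "3.prems"(5) by simp
  have le': "r' \<in> set (q # us) \<Longrightarrow> r' \<le> t" for r' using srt lst sorted_le_last by metis
  have wb: "word t a (q # us) \<in> BH G" using aq le' by (intro word_bop) auto
  have "q \<in> set ?f" unfolding f by simp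
  then have "q \<in> set (s # ts)" unfolding set_filter by blast
  then have "r \<le> q" using "3.prems"(1) by auto
  moreover have "q \<le> t" "r \<le> t" using le' le by auto
  ultimately have tr: "t - r \<ge> 0" "t - q \<ge> 0" "t - q \<le> t - r" by auto
  show ?case
  proof (cases "r \<in> Q")
    case True
    then show ?thesis using IH f "3.prems"(6) by simp
  next
    case False
    have "word t ?a (r # s # ts) (J h) = \<sigma> (t - r) P (word t a (q # us) (J h))"
      using IH f False "3.prems"(6) by simp
    also have "\<dots> = \<sigma> (t - r) P (\<sigma> (t - q) P (word t a (q # us) (J h)))"
      using word_range[OF srt lst aq "3.prems"(6)] by simp
    also have "\<dots> = \<sigma> (t - q) P (word t a (q # us) (J h))"
      using tr wb "3.prems"(6) by (intro sigma_P_mono) auto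
    also have "\<dots> = word t a (q # us) (J h)"
      using word_range[OF srt lst aq "3.prems"(6)] by simp
    finally show ?thesis using f False by simp
  qed
qed auto

end

section \<open>Partitions as sorted lists of points\<close>

lemma partitionsD:
  assumes "Q \<in> partitions t"
  shows "finite Q" "0 \<in> Q" "t \<in> Q" "r \<in> Q \<Longrightarrow> 0 \<le> r" "r \<in> Q \<Longrightarrow> r \<le> t" "t \<ge> 0"
    "Max Q = t" "left_ends Q = Q - {t}"
proof -
  show *: "finite Q" "0 \<in> Q" "t \<in> Q" "r \<in> Q \<Longrightarrow> 0 \<le> r" "r \<in> Q \<Longrightarrow> r \<le> t" "t \<ge> 0"
    using assms by (auto simp: partitions_def)
  show "Max Q = t" using assms by (intro Max_eqI) (auto simp: partitions_def)
  then show "left_ends Q = Q - {t}" by (simp add: left_ends_def)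
qed

lemma partition_list:
  assumes Q: "Q \<in> partitions t"
  defines "ts \<equiv> sorted_list_of_set Q"
  shows "sorted ts" "ts \<noteq> []" "last ts = t" "hd ts = 0" "set ts = Q" "set (butlast ts) = left_ends Q" "distinct ts"
proof -
  note q = partitionsD[OF Q]
  show srt: "sorted ts" and set: "set ts = Q" and d: "distinct ts" using q(1) by (auto simp: ts_def)
  show ne: "ts \<noteq> []" using set q(2) by auto
  show l: "last ts = t"
  proof (rule antisym)
    have "last ts \<in> Q" using ne set last_in_set by blast
    then show "last ts \<le> t" using q(5) by blast
    have "sorted ts \<Longrightarrow> r \<in> set ts \<Longrightarrow> r \<le> last ts" for r by (induction ts) auto
    then show "t \<le> last ts" using srt set q(3) by blast
  qed
  show "hd ts = 0"
  proof (rule antisym)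
    show "0 \<le> hd ts" using ne set q(4) by (metis hd_in_set)
    have "0 \<in> set ts" using set q(2) by blast
    then show "hd ts \<le> 0" using srt ne by (cases ts) auto
  qed
  have e: "ts = butlast ts @ [t]" using append_butlast_last_id[OF ne] l by simp
  then have "set ts = set (butlast ts) \<union> {t}" by (metis list.set(1) list.simps(15) set_append)
  moreover have "t \<notin> set (butlast ts)" using d e by (metis distinct_append disjoint_iff list.set_intros(1))
  ultimately show "set (butlast ts) = left_ends Q" using set q(8) by auto
qed

lemma partitions_union: "Q \<in> partitions t \<Longrightarrow> R \<in> partitions t \<Longrightarrow> Q \<union> R \<in> partitions t"
  by (auto simp: partitions_def)

lemma filter_sorted_list_of_set:
  assumes "finite R" "Q \<subseteq> R"
  shows "filter (\<lambda>r. r \<in> Q) (sorted_list_of_set R) = sorted_list_of_set (Q :: real set)"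
proof (rule sorted_distinct_set_unique)
  have "finite Q" using assms finite_subset by blast
  then show "set (filter (\<lambda>r. r \<in> Q) (sorted_list_of_set R)) = set (sorted_list_of_set Q)"
    using assms unfolding set_filter sorted_list_of_set.set_sorted_key_list_of_set[OF assms(1)]
      sorted_list_of_set.set_sorted_key_list_of_set[OF \<open>finite Q\<close>] by blast
  show "sorted (filter (\<lambda>r. r \<in> Q) (sorted_list_of_set R))"
    using sorted_wrt_filter[of "(\<le>)" "sorted_list_of_set R"] sorted_sorted_list_of_set by simp
qed auto

section \<open>Embedding the Muhly-Solel spaces into the dilation space\<close>

context dilation
begin

definition gvec :: "real \<Rightarrow> real set \<times> 'h etens \<Rightarrow> 'g" where
  "gvec t = (\<lambda>(Q, a, h). word t a (sorted_list_of_set Q) (J h))"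

lemma word_partition_bop [simp]:
  assumes "Q \<in> partitions t" "a \<in> left_ends Q \<rightarrow>\<^sub>E BH H"
  shows "word t a (sorted_list_of_set Q) \<in> BH G"
  using partition_list[OF assms(1)] partitionsD[OF assms(1)] assms(2)
  by (intro word_bop) (auto simp: PiE_iff simp del: set_sorted_list_of_set sorted_list_of_set.set_sorted_key_list_of_set)

lemma gvec_carr [simp]: "Q \<in> partitions t \<Longrightarrow> x \<in> P_idx H Q \<Longrightarrow> gvec t (Q, x) \<in> carr G"
  by (cases x) (auto simp: gvec_def P_idx_def intro!: bop_carr[OF word_partition_bop])

lemma P_form_gvec:
  assumes Q: "Q \<in> partitions t" and x: "x \<in> P_idx H Q" and y: "y \<in> P_idx H Q"
  shows "P_form H \<phi> Q x y = hinner G (gvec t (Q, x)) (gvec t (Q, y))"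
proof -
  obtain a h b k where xy: "x = (a, h)" "y = (b, k)" by (cases x, cases y) auto
  let ?ts = "sorted_list_of_set Q"
  note ts = partition_list[OF Q]
  have ab: "a r \<in> BH H" "b r \<in> BH H" if "r \<in> set (butlast ?ts)" for r
    using x y xy that ts(6) by (auto simp: P_idx_def PiE_iff)
  have hk: "h \<in> carr H" "k \<in> carr H" using x y xy by (auto simp: P_idx_def)
  have "hinner G (word t a ?ts (J h)) (\<sigma> (t - hd ?ts) P (word t b ?ts (J k))) = P_form H \<phi> Q x y"
    unfolding P_form_def xy prod.case using ts ab hk by (intro word_form) auto
  moreover have "\<sigma> (t - hd ?ts) P (word t b ?ts (J k)) = word t b ?ts (J k)"
    using word_range[of "hd ?ts" "tl ?ts" t b k] ts(1-3) ab hk by simp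
  ultimately show ?thesis by (simp add: gvec_def xy)
qed

lemma P_gram: "Q \<in> partitions t \<Longrightarrow> gram_kernel G (P_idx H Q) (P_form H \<phi> Q) (\<lambda>x. gvec t (Q, x))"
  by unfold_locales (auto simp: P_form_gvec)

lemma P_hilbert: "Q \<in> partitions t \<Longrightarrow> hilbert_space (P_space H \<phi> Q)"
  unfolding P_space_def by (rule gram_kernel.hilbert_HC[OF P_gram])

lemma P_vec_total: "Q \<in> partitions t \<Longrightarrow> inner_space.total (P_space H \<phi> Q) (P_vec H \<phi> Q ` P_idx H Q)"
  unfolding P_space_def P_vec_def by (rule gram_kernel.total_hc_elt[OF P_gram])

lemma P_vec_carr: "Q \<in> partitions t \<Longrightarrow> x \<in> P_idx H Q \<Longrightarrow> P_vec H \<phi> Q x \<in> carr (P_space H \<phi> Q)"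
  unfolding P_space_def P_vec_def by (rule gram_kernel.hc_elt(1)[OF P_gram])

definition gamP :: "real \<Rightarrow> real set \<Rightarrow> 'h pvec \<Rightarrow> 'g" where
  "gamP t Q = (SOME T. isometry (P_space H \<phi> Q) G T \<and> (\<forall>x\<in>P_idx H Q. T (P_vec H \<phi> Q x) = gvec t (Q, x)))"

lemma gamP:
  assumes "Q \<in> partitions t"
  shows "isometry (P_space H \<phi> Q) G (gamP t Q)" "x \<in> P_idx H Q \<Longrightarrow> gamP t Q (P_vec H \<phi> Q x) = gvec t (Q, x)"
proof -
  have ex: "\<exists>T. isometry (P_space H \<phi> Q) G T \<and> (\<forall>x\<in>P_idx H Q. T (P_vec H \<phi> Q x) = gvec t (Q, x))"
    unfolding P_space_def P_vec_def by (rule gram_kernel.hc_isometry[OF P_gram[OF assms]])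
  show "isometry (P_space H \<phi> Q) G (gamP t Q)" "x \<in> P_idx H Q \<Longrightarrow> gamP t Q (P_vec H \<phi> Q x) = gvec t (Q, x)"
    using someI_ex[OF ex] by (auto simp: gamP_def)
qed

lemma gamP_bop: "Q \<in> partitions t \<Longrightarrow> gamP t Q \<in> bop (P_space H \<phi> Q) G"
  using isometry_bop[OF gamP(1)] .

lemma gamP_inner: "Q \<in> partitions t \<Longrightarrow> v \<in> carr (P_space H \<phi> Q) \<Longrightarrow> w \<in> carr (P_space H \<phi> Q) \<Longrightarrow>
    hinner G (gamP t Q v) (gamP t Q w) = hinner (P_space H \<phi> Q) v w"
  using gamP(1) isometry_iff[OF P_hilbert hil(2)] by blast

definition refine :: "real set \<Rightarrow> real set \<Rightarrow> 'h etens \<Rightarrow> 'h etens" where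
  "refine Q R = (\<lambda>(a, h). (\<lambda>r\<in>left_ends R. if r \<in> Q then a r else op_id H, h))"

lemma refine_idx:
  assumes "Q \<in> partitions t" "R \<in> partitions t" "Q \<subseteq> R" "x \<in> P_idx H Q"
  shows "refine Q R x \<in> P_idx H R"
  using assms partitionsD(8)[OF assms(1)] partitionsD(8)[OF assms(2)]
  by (auto simp: refine_def P_idx_def PiE_iff extensional_def split: prod.splits)

lemma gvec_refine:
  assumes Q: "Q \<in> partitions t" and R: "R \<in> partitions t" and QR: "Q \<subseteq> R" and x: "x \<in> P_idx H Q"
  shows "gvec t (R, refine Q R x) = gvec t (Q, x)"
proof -
  obtain a h where xa: "x = (a, h)" by (cases x)
  note ts = partition_list[OF R] and q = partitionsD[OF Q] and r = partitionsD[OF R]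
  have "word t (\<lambda>r\<in>left_ends R. if r \<in> Q then a r else op_id H) (sorted_list_of_set R) =
      word t (\<lambda>r. if r \<in> Q then a r else op_id H) (sorted_list_of_set R)"
    using ts(6) by (intro word_cong) auto
  moreover have "word t (\<lambda>r. if r \<in> Q then a r else op_id H) (sorted_list_of_set R) (J h) =
      word t a (filter (\<lambda>r. r \<in> Q) (sorted_list_of_set R)) (J h)"
    using ts q r x xa by (intro word_filter) (auto simp: P_idx_def PiE_iff simp del: set_sorted_list_of_set sorted_list_of_set.set_sorted_key_list_of_set)
  ultimately show ?thesis
    using filter_sorted_list_of_set[OF r(1) QR] by (simp add: gvec_def xa refine_def)
qed

text \<open>Inserting the identity does not change the word, so the embeddings of a partition and of
  its refinement take the same values on elementary tensors. The refinement map is therefore the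
  embedding for \<open>Q\<close> followed by the adjoint of the embedding for
  \<open>R\<close>.\<close>

lemma refine_op:
  assumes Q: "Q \<in> partitions t" and R: "R \<in> partitions t" and QR: "Q \<subseteq> R"
  shows "refine_op H \<phi> Q R \<in> bop (P_space H \<phi> Q) (P_space H \<phi> R)"
    and "v \<in> carr (P_space H \<phi> Q) \<Longrightarrow> gamP t R (refine_op H \<phi> Q R v) = gamP t Q v"
proof -
  note hQ = P_hilbert[OF Q] and hR = P_hilbert[OF R]
  let ?T = "adj (P_space H \<phi> R) G (gamP t R) \<circ>\<^bsub>P_space H \<phi> Q\<^esub> gamP t Q"
  have T: "?T \<in> bop (P_space H \<phi> Q) (P_space H \<phi> R)"
    using hQ hR hil gamP_bop[OF Q] gamP_bop[OF R] by (intro comp_bop[of _ G]) auto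
  have T_vec: "?T (P_vec H \<phi> Q x) = P_vec H \<phi> R (refine Q R x)" if "x \<in> P_idx H Q" for x
  proof -
    have "?T (P_vec H \<phi> Q x) = adj (P_space H \<phi> R) G (gamP t R) (gamP t R (P_vec H \<phi> R (refine Q R x)))"
      using that P_vec_carr[OF Q that] gamP(2)[OF Q that] gamP(2)[OF R refine_idx[OF Q R QR that]]
        gvec_refine[OF Q R QR that] by simp
    then show ?thesis
      using isometry_adj_apply[OF gamP(1)[OF R]] P_vec_carr[OF R refine_idx[OF Q R QR that]] by simp
  qed
  have eq: "refine_op H \<phi> Q R = ?T"
    unfolding refine_op_def using T T_vec
    by (intro ext_op_works[OF hQ hR P_vec_total[OF Q]]) (auto simp: refine_def split: prod.splits)
  show "refine_op H \<phi> Q R \<in> bop (P_space H \<phi> Q) (P_space H \<phi> R)" using T eq by simp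
  have "gamP t R \<circ>\<^bsub>P_space H \<phi> Q\<^esub> refine_op H \<phi> Q R = gamP t Q"
  proof (rule bop_total_eq[OF hQ hil(2) _ gamP_bop[OF Q] P_vec_total[OF Q]])
    show "gamP t R \<circ>\<^bsub>P_space H \<phi> Q\<^esub> refine_op H \<phi> Q R \<in> bop (P_space H \<phi> Q) G"
      using T eq hQ hR gamP_bop[OF R] by (intro comp_bop[of _ "P_space H \<phi> R"]) auto
    fix s assume "s \<in> P_vec H \<phi> Q ` P_idx H Q"
    then obtain x where x: "x \<in> P_idx H Q" "s = P_vec H \<phi> Q x" by blast
    show "(gamP t R \<circ>\<^bsub>P_space H \<phi> Q\<^esub> refine_op H \<phi> Q R) s = gamP t Q s"
      using x eq T_vec[OF x(1)] P_vec_carr[OF Q x(1)] gamP(2)[OF Q x(1)] gamP(2)[OF R refine_idx[OF Q R QR x(1)]]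
        gvec_refine[OF Q R QR x(1)] by simp
  qed
  then show "v \<in> carr (P_space H \<phi> Q) \<Longrightarrow> gamP t R (refine_op H \<phi> Q R v) = gamP t Q v"
    by (metis comp_apply)
qed

abbreviation MS where "MS t \<equiv> ms_space H \<phi> t"
abbreviation MSI where "MSI t \<equiv> (SIGMA Q:partitions t. carr (P_space H \<phi> Q))"

text \<open>The embeddings of all partitions are compatible with refinement, so comparing two
  vectors in a common refinement is the same as comparing their images in \<open>G\<close>. The
  direct limit becomes one more Gram completion.\<close>

lemma ms_gram: "gram_kernel G (MSI t) (ms_form H \<phi>) (\<lambda>(Q, v). gamP t Q v)"
proof unfold_locales
  show "i \<in> MSI t \<Longrightarrow> (case i of (Q, v) \<Rightarrow> gamP t Q v) \<in> carr G" for i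
    by (auto intro: bop_carr[OF gamP_bop])
next
  fix i j assume "i \<in> MSI t" "j \<in> MSI t"
  then obtain Q v R w where i: "i = (Q, v)" "Q \<in> partitions t" "v \<in> carr (P_space H \<phi> Q)"
    and j: "j = (R, w)" "R \<in> partitions t" "w \<in> carr (P_space H \<phi> R)" by blast
  have U: "Q \<union> R \<in> partitions t" using partitions_union i j by blast
  have v: "refine_op H \<phi> Q (Q \<union> R) v \<in> carr (P_space H \<phi> (Q \<union> R))" "refine_op H \<phi> R (Q \<union> R) w \<in> carr (P_space H \<phi> (Q \<union> R))"
    using refine_op(1)[OF i(2) U] refine_op(1)[OF j(2) U] i j by auto
  show "ms_form H \<phi> i j = hinner G (case i of (Q, v) \<Rightarrow> gamP t Q v) (case j of (Q, v) \<Rightarrow> gamP t Q v)"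
    using gamP_inner[OF U v] refine_op(2)[OF i(2) U _ i(3)] refine_op(2)[OF j(2) U _ j(3)]
    by (simp add: ms_form_def i(1) j(1))
qed

lemma MS_hilbert: "hilbert_space (MS t)"
  unfolding ms_space_def by (rule gram_kernel.hilbert_HC[OF ms_gram])

definition gam :: "real \<Rightarrow> 'h msvec \<Rightarrow> 'g" where
  "gam t = (SOME T. isometry (MS t) G T \<and>
     (\<forall>i\<in>MSI t. T (hc_elt (MSI t) (ms_form H \<phi>) i) = (case i of (Q, v) \<Rightarrow> gamP t Q v)))"

lemma gam_ex: "isometry (MS t) G (gam t) \<and>
    (\<forall>i\<in>MSI t. gam t (hc_elt (MSI t) (ms_form H \<phi>) i) = (case i of (Q, v) \<Rightarrow> gamP t Q v))"
proof -
  have "\<exists>T. isometry (MS t) G T \<and> (\<forall>i\<in>MSI t. T (hc_elt (MSI t) (ms_form H \<phi>) i) = (case i of (Q, v) \<Rightarrow> gamP t Q v))"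
    unfolding ms_space_def by (rule gram_kernel.hc_isometry[OF ms_gram])
  then show ?thesis unfolding gam_def by (rule someI_ex)
qed

lemma gam_elt: "Q \<in> partitions t \<Longrightarrow> v \<in> carr (P_space H \<phi> Q) \<Longrightarrow>
    gam t (hc_elt (MSI t) (ms_form H \<phi>) (Q, v)) = gamP t Q v"
  using gam_ex[of t] by auto

lemma gam_isometry: "isometry (MS t) G (gam t)"
  using gam_ex by blast

lemma gam_bop [simp]: "gam t \<in> bop (MS t) G"
  using gam_isometry isometry_bop by blast

lemma gam_carr [simp]: "v \<in> carr (MS t) \<Longrightarrow> gam t v \<in> carr G"
  by (rule bop_carr[OF gam_bop])

lemma gam_inner: "v \<in> carr (MS t) \<Longrightarrow> w \<in> carr (MS t) \<Longrightarrow> hinner G (gam t v) (gam t w) = hinner (MS t) v w"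
  using gam_isometry isometry_iff[OF MS_hilbert hil(2)] by blast

abbreviation gams where "gams t \<equiv> adj (MS t) G (gam t)"

lemma gams_bop [simp]: "gams t \<in> bop G (MS t)"
  using MS_hilbert hil by simp

lemma gams_carr [simp]: "g \<in> carr G \<Longrightarrow> gams t g \<in> carr (MS t)"
  by (rule bop_carr[OF gams_bop])

lemma gams_gam [simp]: "v \<in> carr (MS t) \<Longrightarrow> gams t (gam t v) = v"
  using isometry_adj_apply[OF gam_isometry] .

lemma ms_vec_carr [simp]: "i \<in> ms_idx H t \<Longrightarrow> ms_vec H \<phi> t i \<in> carr (MS t)"
  using gram_kernel.hc_elt(1)[OF ms_gram] P_vec_carr by (auto simp: ms_idx_def ms_vec_def ms_space_def)

lemma gam_ms_vec [simp]: "i \<in> ms_idx H t \<Longrightarrow> gam t (ms_vec H \<phi> t i) = gvec t i"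
  using P_vec_carr gamP(2) by (auto simp: ms_idx_def ms_vec_def gam_elt)

lemma ms_vec_total: "inner_space.total (MS t) (ms_vec H \<phi> t ` ms_idx H t)"
proof -
  interpret M: hilbert_space "MS t" by (rule MS_hilbert)
  show ?thesis
    unfolding M.total_def
  proof (intro conjI ballI impI)
    show "ms_vec H \<phi> t ` ms_idx H t \<subseteq> carr (MS t)" by auto
    fix y assume y: "y \<in> carr (MS t)" and *: "\<forall>s\<in>ms_vec H \<phi> t ` ms_idx H t. hinner (MS t) s y = 0"
    have "hinner (MS t) (hc_elt (MSI t) (ms_form H \<phi>) (Q, v)) y = 0"
      if Q: "Q \<in> partitions t" and v: "v \<in> carr (P_space H \<phi> Q)" for Q v
    proof -
      interpret PS: hilbert_space "P_space H \<phi> Q" by (rule P_hilbert[OF Q])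
      have e: "hc_elt (MSI t) (ms_form H \<phi>) (Q, v) \<in> carr (MS t)" if "v \<in> carr (P_space H \<phi> Q)" for v
        using gram_kernel.hc_elt(1)[OF ms_gram] Q that by (simp add: ms_space_def)
      have i: "hinner (MS t) (hc_elt (MSI t) (ms_form H \<phi>) (Q, v)) y =
          hinner (P_space H \<phi> Q) v (adj (P_space H \<phi> Q) G (gamP t Q) (gam t y))" if v: "v \<in> carr (P_space H \<phi> Q)" for v
        using gam_inner[OF e[OF v] y] gam_elt[OF Q v] inner_adj[OF P_hilbert[OF Q] hil(2) gamP_bop[OF Q] v gam_carr[OF y]]
        by simp
      have "adj (P_space H \<phi> Q) G (gamP t Q) (gam t y) = hzero (P_space H \<phi> Q)"
      proof (rule PS.totalD[OF P_vec_total[OF Q]])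
        show "adj (P_space H \<phi> Q) G (gamP t Q) (gam t y) \<in> carr (P_space H \<phi> Q)"
          using P_hilbert[OF Q] hil gamP_bop[OF Q] y by simp
        fix s assume "s \<in> P_vec H \<phi> Q ` P_idx H Q"
        then obtain x where x: "x \<in> P_idx H Q" "s = P_vec H \<phi> Q x" by blast
        have "ms_vec H \<phi> t (Q, x) = hc_elt (MSI t) (ms_form H \<phi>) (Q, s)" by (simp add: ms_vec_def x)
        moreover have "(Q, x) \<in> ms_idx H t" using Q x by (simp add: ms_idx_def)
        ultimately have "hinner (MS t) (hc_elt (MSI t) (ms_form H \<phi>) (Q, s)) y = 0" using * by (metis imageI)
        then show "hinner (P_space H \<phi> Q) s (adj (P_space H \<phi> Q) G (gamP t Q) (gam t y)) = 0"
          using i[of s] P_vec_carr[OF Q x(1)] x by simp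
      qed
      then show ?thesis using i[OF v] v by simp
    qed
    then show "y = hzero (MS t)"
      using gram_kernel.total_hc_elt[OF ms_gram, of t] y
      by (intro M.totalD[of "hc_elt (MSI t) (ms_form H \<phi>) ` MSI t"]) (auto simp: ms_space_def)
  qed
qed

end

section \<open>Induced operators, the fibres and their representation on the dilation space\<close>

context dilation
begin

text \<open>Operators between Muhly-Solel spaces are prescribed on elementary tensors only. If the
  prescription is implemented in \<open>G\<close> by a bounded operator \<open>R\<close>, then
  \<open>R\<close> between the embeddings gives the extension, and the definite description in
  \<open>ext_op\<close> is meaningful.\<close>

lemma induced_op:
  assumes R: "R \<in> BH G"
    and F: "\<And>i. i \<in> ms_idx H s \<Longrightarrow> F i \<in> carr (MS t) \<and> gam t (F i) = R (gvec s i)"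
  defines "T \<equiv> ext_op (MS s) (MS t) (ms_idx H s) (ms_vec H \<phi> s) F"
  shows "T \<in> bop (MS s) (MS t)" and "v \<in> carr (MS s) \<Longrightarrow> gam t (T v) = R (gam s v)"
proof -
  let ?T = "gams t \<circ>\<^bsub>MS s\<^esub> (R \<circ>\<^bsub>MS s\<^esub> gam s)"
  have RB: "R \<circ>\<^bsub>MS s\<^esub> gam s \<in> bop (MS s) G" using R MS_hilbert hil by (intro comp_bop[of _ G]) auto
  have T: "?T \<in> bop (MS s) (MS t)" by (rule comp_bop[OF MS_hilbert hil(2) RB gams_bop])
  have T_vec: "?T (ms_vec H \<phi> s i) = F i" if i: "i \<in> ms_idx H s" for i
    using F[OF i] i by (metis comp_apply gam_ms_vec gams_gam ms_vec_carr)
  have eq: "T = ?T"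
    unfolding T_def using T T_vec by (intro ext_op_works[OF MS_hilbert MS_hilbert ms_vec_total]) auto
  show "T \<in> bop (MS s) (MS t)" using T eq by simp
  have "gam t \<circ>\<^bsub>MS s\<^esub> T = R \<circ>\<^bsub>MS s\<^esub> gam s"
  proof (rule bop_total_eq[OF MS_hilbert hil(2) _ RB ms_vec_total])
    show "gam t \<circ>\<^bsub>MS s\<^esub> T \<in> bop (MS s) G"
      using T eq MS_hilbert by (intro comp_bop[of _ "MS t"]) auto
    fix v assume "v \<in> ms_vec H \<phi> s ` ms_idx H s"
    then obtain i where i: "i \<in> ms_idx H s" "v = ms_vec H \<phi> s i" by blast
    then have "T v = F i" using eq T_vec by simp
    then show "(gam t \<circ>\<^bsub>MS s\<^esub> T) v = (R \<circ>\<^bsub>MS s\<^esub> gam s) v" using i F[OF i(1)] by simp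
  qed
  from fun_cong[OF this, of v]
  show "v \<in> carr (MS s) \<Longrightarrow> gam t (T v) = R (gam s v)" by simp
qed

lemma word_Cons: "ts \<noteq> [] \<Longrightarrow> word t a (r # ts) = \<sigma> (t - r) (lift (a r)) \<circ>\<^bsub>G\<^esub> word t a ts"
  by (cases ts) auto

lemma partitions_0: "Q \<in> partitions 0 \<Longrightarrow> Q = {0}"
  by (auto simp: partitions_def)

lemma gvec_0 [simp]: "h \<in> carr H \<Longrightarrow> gvec 0 ({0}, a, h) = J h"
  by (simp add: gvec_def)

lemma partition_cons:
  assumes Q: "Q \<in> partitions t" and t: "t > 0"
  obtains s ts where "sorted_list_of_set Q = 0 # s # ts" "set (butlast (s # ts)) \<subseteq> left_ends Q - {0}"
proof -
  note ts = partition_list[OF Q]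
  obtain u us where u: "sorted_list_of_set Q = u # us" using ts(2) by (cases "sorted_list_of_set Q") auto
  have u0: "u = 0" using ts(4) u by simp
  have "us \<noteq> []" using ts(3) u u0 t by auto
  then obtain s vs where us: "us = s # vs" by (cases us) auto
  have "set (butlast us) \<subseteq> left_ends Q" unfolding ts(6)[symmetric] u by (auto simp: us)
  moreover have "0 \<notin> set us" using ts(7) u u0 by simp
  then have "0 \<notin> set (butlast us)" using in_set_butlastD by metis
  ultimately show thesis using that u us u0 by blast
qed

text \<open>The first left endpoint is 0, so multiplying the first tensor factor by \<open>A\<close>
  multiplies the word by \<open>\<sigma> t (lift A)\<close>. At t = 0 there is no tensor factor and
  \<open>A\<close> acts on the vector, consistently with \<open>\<sigma> 0\<close> being the
  identity.\<close>

lemma ms_act: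
  assumes t: "t \<ge> 0" and A: "A \<in> BH H"
  shows "ms_act H \<phi> t A \<in> BH (MS t)" and "v \<in> carr (MS t) \<Longrightarrow> gam t (ms_act H \<phi> t A v) = \<sigma> t (lift A) (gam t v)"
proof -
  let ?F = "\<lambda>(Q, a, h). if t = 0 then ms_vec H \<phi> t (Q, a, A h) else ms_vec H \<phi> t (Q, a(0 := A \<circ>\<^bsub>H\<^esub> a 0), h)"
  have "?F i \<in> carr (MS t) \<and> gam t (?F i) = \<sigma> t (lift A) (gvec t i)" if i: "i \<in> ms_idx H t" for i
  proof -
    obtain Q a h where qah: "i = (Q, a, h)" "Q \<in> partitions t" "a \<in> left_ends Q \<rightarrow>\<^sub>E BH H" "h \<in> carr H"
      using i by (auto simp: ms_idx_def P_idx_def)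
    show ?thesis
    proof (cases "t = 0")
      case True
      then have "Q = {0}" using qah partitions_0 by blast
      moreover have "(Q, a, A h) \<in> ms_idx H t" using qah A by (auto simp: ms_idx_def P_idx_def)
      ultimately show ?thesis using qah A True by simp
    next
      case False
      then have t0: "t > 0" using t by simp
      obtain s ts where st: "sorted_list_of_set Q = 0 # s # ts" "set (butlast (s # ts)) \<subseteq> left_ends Q - {0}"
        using partition_cons[OF qah(2) t0] .
      have z: "0 \<in> left_ends Q" using partitionsD[OF qah(2)] t0 by simp
      have a0: "a 0 \<in> BH H" using qah z by auto
      let ?a = "a(0 := A \<circ>\<^bsub>H\<^esub> a 0)"
      have idx: "(Q, ?a, h) \<in> ms_idx H t"
        using qah z a0 A by (auto simp: ms_idx_def P_idx_def PiE_iff extensional_def)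
      have w: "word t ?a (s # ts) = word t a (s # ts)" using st(2) by (intro word_cong) auto
      have wB: "word t a (s # ts) \<in> BH G"
      proof (rule word_bop)
        have sQ: "set (0 # s # ts) = Q" using partition_list(5)[OF qah(2)] unfolding st(1) .
        show "r \<le> t" if "r \<in> set (s # ts)" for r using that sQ partitionsD(5)[OF qah(2), of r] by auto
        show "a r \<in> BH H" if "r \<in> set (butlast (s # ts))" for r using that st(2) qah(3) by (blast dest: PiE_mem)
      qed
      have "gvec t (Q, ?a, h) = \<sigma> t (lift A) (gvec t (Q, a, h))"
        using st(1) w wB a0 A t qah(4) by (simp add: gvec_def sigma_comp_apply lift_comp del: word.simps add: word.simps(1))
      then show ?thesis using idx False qah by simp
    qed
  qed
  note F = this
  have "\<sigma> t (lift A) \<in> BH G" using t A by simp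
  from induced_op[OF this F]
  show "ms_act H \<phi> t A \<in> BH (MS t)" "v \<in> carr (MS t) \<Longrightarrow> gam t (ms_act H \<phi> t A v) = \<sigma> t (lift A) (gam t v)"
    unfolding ms_act_def by blast+
qed

abbreviation E where "E t \<equiv> ms_fibre H \<phi> t"

lemma E_bop: "X \<in> carr (E t) \<Longrightarrow> X \<in> bop H (MS t)"
  by (simp add: ms_fibre_def intertwiners_def)

lemma E_carr [simp]: "X \<in> carr (E t) \<Longrightarrow> h \<in> carr H \<Longrightarrow> X h \<in> carr (MS t)"
  by (rule bop_carr[OF E_bop])

text \<open>Transfers membership in the fibre to an intertwining relation in \<open>G\<close>, which
  is legitimate because \<open>gam t\<close> is injective and carries the left action to
  \<sigma>.\<close>

lemma E_iff:
  assumes t: "t \<ge> 0"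
  shows "X \<in> carr (E t) \<longleftrightarrow> X \<in> bop H (MS t) \<and>
    (\<forall>A\<in>BH H. \<forall>h\<in>carr H. gam t (X (A h)) = \<sigma> t (lift A) (gam t (X h)))"
proof -
  have "X \<circ>\<^bsub>H\<^esub> A = ms_act H \<phi> t A \<circ>\<^bsub>H\<^esub> X \<longleftrightarrow> (\<forall>h\<in>carr H. gam t (X (A h)) = \<sigma> t (lift A) (gam t (X h)))"
    if X: "X \<in> bop H (MS t)" and A: "A \<in> BH H" for A
  proof
    have Xc: "\<And>h. h \<in> carr H \<Longrightarrow> X h \<in> carr (MS t)" using X by simp
    have Ac: "\<And>h. h \<in> carr H \<Longrightarrow> A h \<in> carr H" using A by simp
    {
      assume *: "X \<circ>\<^bsub>H\<^esub> A = ms_act H \<phi> t A \<circ>\<^bsub>H\<^esub> X"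
      show "\<forall>h\<in>carr H. gam t (X (A h)) = \<sigma> t (lift A) (gam t (X h))"
      proof
        fix h assume h: "h \<in> carr H"
        have "X (A h) = ms_act H \<phi> t A (X h)" using fun_cong[OF *, of h] h by simp
        then show "gam t (X (A h)) = \<sigma> t (lift A) (gam t (X h))" using ms_act(2)[OF t A Xc[OF h]] by simp
      qed
    next
      assume *: "\<forall>h\<in>carr H. gam t (X (A h)) = \<sigma> t (lift A) (gam t (X h))"
      show "X \<circ>\<^bsub>H\<^esub> A = ms_act H \<phi> t A \<circ>\<^bsub>H\<^esub> X"
      proof (rule bop_eqI)
        show "X \<circ>\<^bsub>H\<^esub> A \<in> bop H (MS t)" using X A hil by (intro comp_bop[of H H]) auto
        show "ms_act H \<phi> t A \<circ>\<^bsub>H\<^esub> X \<in> bop H (MS t)"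
          using X ms_act(1)[OF t A] hil MS_hilbert by (intro comp_bop[of H "MS t"]) auto
        fix h assume h: "h \<in> carr H"
        have "gam t (ms_act H \<phi> t A (X h)) = gam t (X (A h))" using ms_act(2)[OF t A Xc[OF h]] * h by simp
        moreover have "ms_act H \<phi> t A (X h) \<in> carr (MS t)" using ms_act(1)[OF t A] Xc[OF h] by simp
        ultimately have "ms_act H \<phi> t A (X h) = X (A h)" using Xc[OF Ac[OF h]] by (metis gams_gam)
        then show "(X \<circ>\<^bsub>H\<^esub> A) h = (ms_act H \<phi> t A \<circ>\<^bsub>H\<^esub> X) h" using h by simp
      qed
    }
  qed
  then show ?thesis by (auto simp: ms_fibre_def intertwiners_def)
qed

lemma E_gam: "t \<ge> 0 \<Longrightarrow> X \<in> carr (E t) \<Longrightarrow> A \<in> BH H \<Longrightarrow> h \<in> carr H \<Longrightarrow>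
    gam t (X (A h)) = \<sigma> t (lift A) (gam t (X h))"
  using E_iff by blast

abbreviation d0 where "d0 \<equiv> J h0"

lemma d0: "d0 \<in> carr G" "hinner G d0 d0 = 1"
  using h0 by auto

text \<open>An operator R with \<open>\<sigma> t A\<close> R = R \<open>A\<close> for all
  \<open>A\<close> satisfies R g = \<sigma> t (|g><d0|) (R d0), since |g><d0| maps d0 to g. So R is
  determined by r = R d0; conversely every r fixed by the projection \<open>pt0 t\<close> arises, as
  the next lemmas show.\<close>

definition rop :: "real \<Rightarrow> 'g \<Rightarrow> 'g \<Rightarrow> 'g" where
  "rop t r = (\<lambda>g\<in>carr G. \<sigma> t (rank_one G g d0) r)"

definition pt0 :: "real \<Rightarrow> 'g \<Rightarrow> 'g" where
  "pt0 t = \<sigma> t (rank_one G d0 d0)"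

lemma rop_carr [simp]: "t \<ge> 0 \<Longrightarrow> r \<in> carr G \<Longrightarrow> g \<in> carr G \<Longrightarrow> rop t r g \<in> carr G"
  using d0 by (simp add: rop_def)

text \<open>Moving one factor across leaves |d0><g| |g'><d0|, a multiple of the projection onto d0,
  and its image under \<open>\<sigma> t\<close> fixes r'. The inner product splits
  accordingly.\<close>

lemma rop_inner:
  assumes "t \<ge> 0" "r \<in> carr G" "r' \<in> carr G" "pt0 t r' = r'" "g \<in> carr G" "g' \<in> carr G"
  shows "hinner G (rop t r g) (rop t r' g') = hinner G g g' * hinner G r r'"
proof -
  have "hinner G (rop t r g) (rop t r' g') = hinner G r (\<sigma> t (rank_one G d0 g \<circ>\<^bsub>G\<^esub> rank_one G g' d0) r')"
    using assms d0 by (simp add: rop_def inner_sigma sigma_comp_apply)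
  also have "rank_one G d0 g \<circ>\<^bsub>G\<^esub> rank_one G g' d0 = op_scale G G (hinner G g g') (rank_one G d0 d0)"
    using assms d0 by (simp add: G.rank_one_comp_rank_one G.rank_one_scale)
  also have "\<sigma> t \<dots> = op_scale G G (hinner G g g') (pt0 t)"
    unfolding pt0_def using assms d0 by (intro sigma_scale) auto
  also have "\<dots> r' = hscale G (hinner G g g') (pt0 t r')"
    using assms by (simp add: op_scale_def)
  finally show ?thesis using assms by simp
qed

lemma rop_bop:
  assumes "t \<ge> 0" "r \<in> carr G" "pt0 t r = r"
  shows "rop t r \<in> BH G"
proof (rule bopI[where b = "hnorm G r"])
  have ext: "rop t r \<in> extensional (carr G)" by (simp add: rop_def)
  show "rop t r (hadd G x y) = hadd G (rop t r x) (rop t r y)" if "x \<in> carr G" "y \<in> carr G" for x y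
    using that assms d0 by (simp add: rop_def G.rank_one_add sigma_add) (simp add: op_add_def)
  show "rop t r (hscale G c x) = hscale G c (rop t r x)" if "x \<in> carr G" for c x
    using that assms d0 by (simp add: rop_def G.rank_one_scale sigma_scale) (simp add: op_scale_def)
  fix x assume x: "x \<in> carr G"
  have "complex_of_real ((hnorm G (rop t r x))\<^sup>2) = of_real ((hnorm G r * hnorm G x)\<^sup>2)"
    using rop_inner[OF assms(1,2,2,3) x x] x assms by (simp add: G.inner_self power_mult_distrib mult.commute)
  then have "(hnorm G (rop t r x))\<^sup>2 = (hnorm G r * hnorm G x)\<^sup>2" by (simp only: of_real_eq_iff)
  then show "hnorm G (rop t r x) \<le> hnorm G r * hnorm G x"
    using x assms by (simp add: power2_eq_iff_nonneg)
qed (use assms in \<open>auto simp: rop_def d0\<close>)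

lemma rop_intertwine: "t \<ge> 0 \<Longrightarrow> r \<in> carr G \<Longrightarrow> A \<in> BH G \<Longrightarrow> g \<in> carr G \<Longrightarrow>
    \<sigma> t A (rop t r g) = rop t r (A g)"
  using d0 by (simp add: rop_def sigma_comp_apply G.comp_rank_one)

lemma rop_d0: "t \<ge> 0 \<Longrightarrow> rop t r d0 = pt0 t r"
  using d0 by (simp add: rop_def pt0_def)

text \<open>\<open>S t X\<close> is the operator \<open>g \<mapsto> \<sigma>\<^sub>t(|g\<rangle>\<langle>J h0|) \<Gamma>\<^sub>t X h0\<close> with \<open>\<Gamma>\<^sub>t = gam t\<close>.\<close>

definition S :: "real \<Rightarrow> 'h fib \<Rightarrow> 'g \<Rightarrow> 'g" where
  "S t X = rop t (gam t (X h0))"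

lemma E_h0:
  assumes "t \<ge> 0" "X \<in> carr (E t)"
  shows "gam t (X h0) \<in> carr G" "pt0 t (gam t (X h0)) = gam t (X h0)"
proof -
  show "gam t (X h0) \<in> carr G" using assms h0 by simp
  have "rank_one H h0 h0 h0 = h0" using h0 by (auto intro: H.vec_eqI)
  then have "gam t (X h0) = \<sigma> t (lift (rank_one H h0 h0)) (gam t (X h0))"
    using E_gam[OF assms, of "rank_one H h0 h0" h0] h0 by simp
  then show "pt0 t (gam t (X h0)) = gam t (X h0)" using h0 by (simp add: pt0_def lift_rank_one)
qed

lemma S_bop [simp]: "t \<ge> 0 \<Longrightarrow> X \<in> carr (E t) \<Longrightarrow> S t X \<in> BH G"
  unfolding S_def using E_h0 by (intro rop_bop)

lemma S_carr [simp]: "t \<ge> 0 \<Longrightarrow> X \<in> carr (E t) \<Longrightarrow> g \<in> carr G \<Longrightarrow> S t X g \<in> carr G"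
  by (rule bop_carr[OF S_bop])

lemma S_intertwine: "t \<ge> 0 \<Longrightarrow> X \<in> carr (E t) \<Longrightarrow> A \<in> BH G \<Longrightarrow> g \<in> carr G \<Longrightarrow>
    \<sigma> t A (S t X g) = S t X (A g)"
  unfolding S_def using E_h0 by (intro rop_intertwine)

text \<open>The intertwining relation for |h><h0| expresses X h through X h0. So
  \<open>S t X\<close> extends the composition of X with the embedding from the copy of
  \<open>H\<close> to all of \<open>G\<close>.\<close>

lemma S_J: "t \<ge> 0 \<Longrightarrow> X \<in> carr (E t) \<Longrightarrow> h \<in> carr H \<Longrightarrow> S t X (J h) = gam t (X h)"
proof -
  assume *: "t \<ge> 0" "X \<in> carr (E t)" "h \<in> carr H"
  have "rank_one H h h0 h0 = h" using h0 * by (auto intro: H.vec_eqI)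
  then have "gam t (X h) = \<sigma> t (lift (rank_one H h h0)) (gam t (X h0))"
    using E_gam[OF *(1,2), of "rank_one H h h0" h0] h0 * by simp
  then show ?thesis using h0 * by (simp add: S_def rop_def lift_rank_one)
qed

lemma S_inner_h0: "t \<ge> 0 \<Longrightarrow> X \<in> carr (E t) \<Longrightarrow> Y \<in> carr (E t) \<Longrightarrow> g \<in> carr G \<Longrightarrow> g' \<in> carr G \<Longrightarrow>
    hinner G (S t X g) (S t Y g') = hinner G g g' * hinner (MS t) (X h0) (Y h0)"
  unfolding S_def using E_h0 h0 by (simp add: rop_inner gam_inner)

text \<open>The definite description in \<open>intertwiners\<close> requires the adjoint of X times
  Y to be a scalar. It is, because \<langle>X h, Y k\<rangle> equals the inner product of the
  \<open>S\<close>-images of \<open>J h\<close> and \<open>J k\<close>, which factorises; evaluation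
  at the unit vector \<open>h0\<close> identifies the scalar.\<close>

lemma E_inner:
  assumes t: "t \<ge> 0" and X: "X \<in> carr (E t)" and Y: "Y \<in> carr (E t)"
  shows "hinner (E t) X Y = hinner (MS t) (X h0) (Y h0)"
proof -
  let ?c = "hinner (MS t) (X h0) (Y h0)"
  have "op_scale H H ?c (op_id H) = adj H (MS t) X \<circ>\<^bsub>H\<^esub> Y"
  proof (rule extensionalityI[of _ "carr H"])
    fix k assume k: "k \<in> carr H"
    have "hinner H h (adj H (MS t) X (Y k)) = hinner H h (hscale H ?c k)" if h: "h \<in> carr H" for h
    proof -
      have "hinner H h (adj H (MS t) X (Y k)) = hinner (MS t) (X h) (Y k)"
        using inner_adj[OF hil(1) MS_hilbert E_bop[OF X] h] Y k by simp
      also have "\<dots> = hinner G (S t X (J h)) (S t Y (J k))"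
        using gam_inner X Y h k t by (simp add: S_J)
      also have "\<dots> = hinner H h k * ?c" using S_inner_h0[OF t X Y] h k by simp
      finally show ?thesis using h k by simp
    qed
    moreover have "adj H (MS t) X (Y k) \<in> carr H" using hil MS_hilbert E_bop[OF X] Y k by simp
    ultimately have "adj H (MS t) X (Y k) = hscale H ?c k" using k by (intro H.vec_eqI) auto
    then show "op_scale H H ?c (op_id H) k = (adj H (MS t) X \<circ>\<^bsub>H\<^esub> Y) k" using k by (simp add: op_scale_def)
  qed (auto simp: op_scale_def compose_def)
  note eq = this
  have un: "c = ?c" if "op_scale H H c (op_id H) = op_scale H H ?c (op_id H)" for c
  proof -
    have "hscale H c h0 = hscale H ?c h0" using fun_cong[OF that, of h0] h0 by (simp add: op_scale_def)
    then have "hinner H h0 (hscale H c h0) = hinner H h0 (hscale H ?c h0)" by simp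
    then show ?thesis using h0 by simp
  qed
  have "(THE c. op_scale H H c (op_id H) = adj H (MS t) X \<circ>\<^bsub>H\<^esub> Y) = ?c"
    by (rule the_equality[where P = "\<lambda>c. op_scale H H c (op_id H) = adj H (MS t) X \<circ>\<^bsub>H\<^esub> Y", OF eq])
      (simp add: un eq[symmetric])
  then show ?thesis by (simp add: ms_fibre_def intertwiners_def)
qed

lemma S_inner: "t \<ge> 0 \<Longrightarrow> X \<in> carr (E t) \<Longrightarrow> Y \<in> carr (E t) \<Longrightarrow> g \<in> carr G \<Longrightarrow> g' \<in> carr G \<Longrightarrow>
    hinner G (S t X g) (S t Y g') = hinner (E t) X Y * hinner G g g'"
  by (simp add: S_inner_h0 E_inner)

text \<open>Relative to the final time s + t, every remaining time in the first block exceeds its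
  remaining time relative to s by t. By the semigroup law \<open>\<sigma> t\<close> factors out of
  the whole block.\<close>

lemma word_append:
  assumes "vs \<noteq> []" "\<And>r. r \<in> set us \<Longrightarrow> r < s \<and> a r \<in> BH H \<and> c r = a r" "word (s + t) c vs \<in> BH G" "s \<ge> 0" "t \<ge> 0"
  shows "word (s + t) c (us @ vs) = \<sigma> t (word s a (us @ [s])) \<circ>\<^bsub>G\<^esub> word (s + t) c vs"
  using assms(2)
proof (induction us)
  case Nil
  then show ?case using assms by (intro bop_eqI[of _ G G]) auto
next
  case (Cons r us)
  have r: "r < s" "a r \<in> BH H" "c r = a r" using Cons.prems by auto
  have us: "x < s" "a x \<in> BH H" if "x \<in> set us" for x using Cons.prems[of x] that by auto
  have w: "word s a (us @ [s]) \<in> BH G" using us by (intro word_bop) (auto simp: less_imp_le)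
  have e: "s + t - r = t + (s - r)" by simp
  have ss: "\<sigma> t (\<sigma> (s - r) (lift (a r))) = \<sigma> (t + (s - r)) (lift (a r))"
    using r assms(5) by (intro sigma_sigma) auto
  have "word (s + t) c ((r # us) @ vs) = \<sigma> (s + t - r) (lift (c r)) \<circ>\<^bsub>G\<^esub> word (s + t) c (us @ vs)"
    using assms(1) by (simp add: word_Cons)
  also have "\<dots> = \<sigma> t (\<sigma> (s - r) (lift (a r))) \<circ>\<^bsub>G\<^esub> (\<sigma> t (word s a (us @ [s])) \<circ>\<^bsub>G\<^esub> word (s + t) c vs)"
    using Cons r assms(5) unfolding e ss by simp
  also have "\<dots> = \<sigma> t (word s a ((r # us) @ [s])) \<circ>\<^bsub>G\<^esub> word (s + t) c vs"
    using w r assms by (intro bop_eqI[of _ G G]) (auto simp: word_Cons sigma_comp_apply)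
  finally show ?case .
qed

lemma word_shift:
  assumes "\<And>r. r \<in> set (butlast qs) \<Longrightarrow> c (s + r) = b r"
  shows "word (s + t) c (map ((+) s) qs) = word t b qs"
  using assms by (induction t b qs rule: word.induct) auto

text \<open>The point s closes the first partition and opens the shifted second one. It must be
  counted once, as a left endpoint of the second block, whence the \<open>butlast\<close>.\<close>

lemma concat_partition:
  assumes Q: "Q \<in> partitions s" and R: "R \<in> partitions t"
  shows "Q \<union> (+) s ` R \<in> partitions (s + t)"
    and "sorted_list_of_set (Q \<union> (+) s ` R) = butlast (sorted_list_of_set Q) @ map ((+) s) (sorted_list_of_set R)"
    and "left_ends (Q \<union> (+) s ` R) = left_ends Q \<union> (+) s ` left_ends R"
proof -
  note q = partitionsD[OF Q] and r = partitionsD[OF R] and ql = partition_list[OF Q] and rl = partition_list[OF R]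
  show U: "Q \<union> (+) s ` R \<in> partitions (s + t)"
    using Q R by (fastforce simp: partitions_def)
  have lt: "x < s" if "x \<in> set (butlast (sorted_list_of_set Q))" for x
    using that ql(6) q(5,8) by fastforce
  show "sorted_list_of_set (Q \<union> (+) s ` R) = butlast (sorted_list_of_set Q) @ map ((+) s) (sorted_list_of_set R)"
  proof (rule sorted_distinct_set_unique[symmetric])
    have "sorted (butlast (sorted_list_of_set Q))" using ql(1) by (simp add: butlast_conv_take sorted_wrt_take)
    moreover have "sorted (map ((+) s) (sorted_list_of_set R))" using rl(1) by (simp add: sorted_wrt_map)
    moreover have "x \<le> y" if "x \<in> set (butlast (sorted_list_of_set Q))" "y \<in> set (map ((+) s) (sorted_list_of_set R))" for x y
      using lt[OF that(1)] that(2) r(1,4) by fastforce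
    ultimately show "sorted (butlast (sorted_list_of_set Q) @ map ((+) s) (sorted_list_of_set R))"
      by (simp add: sorted_append del: sorted_list_of_set.set_sorted_key_list_of_set)
    have "set (butlast (sorted_list_of_set Q)) \<inter> set (map ((+) s) (sorted_list_of_set R)) = {}"
      using lt r(1,4) by fastforce
    then show "distinct (butlast (sorted_list_of_set Q) @ map ((+) s) (sorted_list_of_set R))"
      using ql(7) rl(7) by (simp add: distinct_butlast distinct_map inj_on_def del: sorted_list_of_set.set_sorted_key_list_of_set)
    have "set (butlast (sorted_list_of_set Q) @ map ((+) s) (sorted_list_of_set R)) = (Q - {s}) \<union> (+) s ` R"
      using ql(6) q(8) rl(5) by (metis set_append set_map)
    also have "\<dots> = Q \<union> (+) s ` R" using r(2) by force
    also have "\<dots> = set (sorted_list_of_set (Q \<union> (+) s ` R))" using q(1) r(1) by simp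
    finally show "set (butlast (sorted_list_of_set Q) @ map ((+) s) (sorted_list_of_set R)) = set (sorted_list_of_set (Q \<union> (+) s ` R))" .
  qed auto
  show "left_ends (Q \<union> (+) s ` R) = left_ends Q \<union> (+) s ` left_ends R"
    unfolding partitionsD(8)[OF U] q(8) r(8)
  proof (intro set_eqI iffI)
    fix x assume x: "x \<in> Q \<union> (+) s ` R - {s + t}"
    show "x \<in> Q - {s} \<union> (+) s ` (R - {t})"
    proof (cases "x \<in> Q - {s}")
      case False
      then have "x \<in> (+) s ` R" using x r(2) by force
      then show ?thesis using x by auto
    qed simp
  next
    fix x assume "x \<in> Q - {s} \<union> (+) s ` (R - {t})"
    moreover have "x \<noteq> s + t" if "x \<in> Q - {s}" using q(5)[of x] r(6) that by auto
    ultimately show "x \<in> Q \<union> (+) s ` R - {s + t}" by auto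
  qed
qed

lemma gvec_concat:
  assumes Q: "Q \<in> partitions s" and a: "a \<in> left_ends Q \<rightarrow>\<^sub>E BH H"
    and R: "R \<in> partitions t" and b: "b \<in> left_ends R \<rightarrow>\<^sub>E BH H" and k: "k \<in> carr H"
  defines "c \<equiv> \<lambda>r\<in>left_ends (Q \<union> (+) s ` R). if r < s then a r else b (r - s)"
  shows "(Q \<union> (+) s ` R, c, k) \<in> ms_idx H (s + t)"
    and "gvec (s + t) (Q \<union> (+) s ` R, c, k) = \<sigma> t (word s a (sorted_list_of_set Q)) (gvec t (R, b, k))"
proof -
  note q = partitionsD[OF Q] and r = partitionsD[OF R] and ql = partition_list[OF Q] and rl = partition_list[OF R]
  note U = concat_partition[OF Q R]
  have lQ: "x \<in> left_ends Q \<Longrightarrow> x < s" and lR: "x \<in> left_ends R \<Longrightarrow> 0 \<le> x" for x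
    using q(5,8) r(4,8) by (auto simp: less_le)
  have c: "c \<in> left_ends (Q \<union> (+) s ` R) \<rightarrow>\<^sub>E BH H"
    unfolding c_def U(3)
  proof (rule restrict_PiE_iff[THEN iffD2], intro ballI)
    fix x assume x: "x \<in> left_ends Q \<union> (+) s ` left_ends R"
    show "(if x < s then a x else b (x - s)) \<in> BH H"
    proof (cases "x \<in> left_ends Q")
      case True
      then show ?thesis using lQ a by auto
    next
      case False
      then obtain y where "y \<in> left_ends R" "x = s + y" using x by blast
      then show ?thesis using lR[of y] b by auto
    qed
  qed
  then show "(Q \<union> (+) s ` R, c, k) \<in> ms_idx H (s + t)"
    using U(1) k by (simp add: ms_idx_def P_idx_def)
  let ?us = "butlast (sorted_list_of_set Q)" and ?vs = "map ((+) s) (sorted_list_of_set R)"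
  have vs: "word (s + t) c ?vs = word t b (sorted_list_of_set R)"
  proof (rule word_shift)
    fix x assume "x \<in> set (butlast (sorted_list_of_set R))"
    then have x: "x \<in> left_ends R" using rl(6) by simp
    then show "c (s + x) = b x" using lR[OF x] by (simp add: c_def U(3))
  qed
  have us: "?us @ [s] = sorted_list_of_set Q" using ql(2,3) append_butlast_last_id by metis
  have "word (s + t) c (?us @ ?vs) = \<sigma> t (word s a (?us @ [s])) \<circ>\<^bsub>G\<^esub> word (s + t) c ?vs"
  proof (rule word_append)
    show "?vs \<noteq> []" using rl(2) by simp
    show "word (s + t) c ?vs \<in> BH G" unfolding vs using R b by simp
    show "x < s \<and> a x \<in> BH H \<and> c x = a x" if "x \<in> set ?us" for x
      using that ql(6) lQ a by (auto simp: c_def U(3))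
  qed (use q r in auto)
  then show "gvec (s + t) (Q \<union> (+) s ` R, c, k) = \<sigma> t (word s a (sorted_list_of_set Q)) (gvec t (R, b, k))"
    using k R b by (simp add: gvec_def U(2) vs us)
qed

lemma ms_concat:
  assumes Q: "Q \<in> partitions s" and a: "a \<in> left_ends Q \<rightarrow>\<^sub>E BH H" and t: "t \<ge> 0"
  shows "ms_concat H \<phi> s t Q a \<in> bop (MS t) (MS (s + t))"
    and "v \<in> carr (MS t) \<Longrightarrow> gam (s + t) (ms_concat H \<phi> s t Q a v) = \<sigma> t (word s a (sorted_list_of_set Q)) (gam t v)"
proof -
  let ?F = "\<lambda>(R, b, k). ms_vec H \<phi> (s + t) (Q \<union> (+) s ` R,
    \<lambda>r\<in>left_ends (Q \<union> (+) s ` R). if r < s then a r else b (r - s), k)"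
  have "?F i \<in> carr (MS (s + t)) \<and> gam (s + t) (?F i) = \<sigma> t (word s a (sorted_list_of_set Q)) (gvec t i)"
    if i: "i \<in> ms_idx H t" for i
  proof -
    obtain R b k where rbk: "i = (R, b, k)" "R \<in> partitions t" "b \<in> left_ends R \<rightarrow>\<^sub>E BH H" "k \<in> carr H"
      using i by (auto simp: ms_idx_def P_idx_def)
    note g = gvec_concat[OF Q a rbk(2,3,4)]
    show ?thesis unfolding rbk(1) prod.case using ms_vec_carr[OF g(1)] gam_ms_vec[OF g(1)] g(2) by simp
  qed
  note F = this
  have "\<sigma> t (word s a (sorted_list_of_set Q)) \<in> BH G" using t Q a by simp
  from induced_op[OF this F]
  show "ms_concat H \<phi> s t Q a \<in> bop (MS t) (MS (s + t))"
    "v \<in> carr (MS t) \<Longrightarrow> gam (s + t) (ms_concat H \<phi> s t Q a v) = \<sigma> t (word s a (sorted_list_of_set Q)) (gam t v)"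
    unfolding ms_concat_def by blast+
qed

text \<open>The first block acts as \<sigma> t of a word on the vector X h, which is
  \<open>S t X (J h)\<close>; by the intertwining relation the word passes through
  \<open>S t X\<close>. Hence the identity tensored with X is implemented by \<open>S t X\<close>
  itself.\<close>

lemma ms_id_tensor:
  assumes X: "X \<in> carr (E t)" and t: "t \<ge> 0"
  shows "ms_id_tensor H \<phi> s t X \<in> bop (MS s) (MS (s + t))"
    and "v \<in> carr (MS s) \<Longrightarrow> gam (s + t) (ms_id_tensor H \<phi> s t X v) = S t X (gam s v)"
proof -
  let ?F = "\<lambda>(Q, a, h). ms_concat H \<phi> s t Q a (X h)"
  have "?F i \<in> carr (MS (s + t)) \<and> gam (s + t) (?F i) = S t X (gvec s i)" if i: "i \<in> ms_idx H s" for i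
  proof -
    obtain Q a h where q: "i = (Q, a, h)" "Q \<in> partitions s" "a \<in> left_ends Q \<rightarrow>\<^sub>E BH H" "h \<in> carr H"
      using i by (auto simp: ms_idx_def P_idx_def)
    note c = ms_concat[OF q(2,3) t]
    have Xh: "X h \<in> carr (MS t)" using X q by simp
    have "gam (s + t) (?F i) = \<sigma> t (word s a (sorted_list_of_set Q)) (gam t (X h))" using c(2)[OF Xh] q by simp
    also have "\<dots> = S t X (gvec s i)" using X t q by (simp add: S_J[symmetric] S_intertwine gvec_def)
    finally show ?thesis using bop_carr[OF c(1) Xh] q by simp
  qed
  note F = this
  from induced_op[OF S_bop[OF t X] F]
  show "ms_id_tensor H \<phi> s t X \<in> bop (MS s) (MS (s + t))"
    "v \<in> carr (MS s) \<Longrightarrow> gam (s + t) (ms_id_tensor H \<phi> s t X v) = S t X (gam s v)"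
    unfolding ms_id_tensor_def by blast+
qed

text \<open>Multiplication of the product system becomes composition of operators on
  \<open>G\<close>. Since the identity tensored with X is implemented by \<open>S t X\<close>, this
  holds on the copy of \<open>H\<close>; a matrix unit ending at d0 extends it to every g.\<close>

lemma ms_mult:
  assumes X: "X \<in> carr (E t)" and t: "t \<ge> 0" and Y: "Y \<in> carr (E s)" and s: "s \<ge> 0"
  shows "ms_mult H \<phi> t s X Y \<in> carr (E (t + s))"
    and "g \<in> carr G \<Longrightarrow> S (t + s) (ms_mult H \<phi> t s X Y) g = S t X (S s Y g)"
proof -
  let ?Z = "ms_mult H \<phi> t s X Y"
  have st: "s + t = t + s" by simp
  note i = ms_id_tensor[OF X t, where s = s, unfolded st]
  have Z: "?Z \<in> bop H (MS (t + s))"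
    unfolding ms_mult_def using i(1) hil MS_hilbert E_bop[OF Y] by (intro comp_bop[of H "MS s"]) (auto simp: add.commute)
  have gZ: "gam (t + s) (?Z h) = S t X (gam s (Y h))" if "h \<in> carr H" for h
    unfolding ms_mult_def using i(2)[of "Y h"] that Y by simp
  show "?Z \<in> carr (E (t + s))"
    using Z t s X Y by (subst E_iff) (auto simp: gZ E_gam S_intertwine[symmetric] sigma_sigma)
  show "S (t + s) ?Z g = S t X (S s Y g)" if g: "g \<in> carr G"
  proof -
    have "S (t + s) ?Z g = \<sigma> (t + s) (rank_one G g d0) (S t X (gam s (Y h0)))"
      using gZ[OF h0(1)] g by (simp add: S_def rop_def)
    also have "\<dots> = \<sigma> t (\<sigma> s (rank_one G g d0)) (S t X (gam s (Y h0)))"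
      using t s g d0 by (simp add: sigma_sigma)
    also have "\<dots> = S t X (\<sigma> s (rank_one G g d0) (gam s (Y h0)))"
      using t s g d0 X Y h0 by (intro S_intertwine) auto
    also have "\<dots> = S t X (S s Y g)" using g by (simp add: S_def[of s] rop_def)
    finally show ?thesis .
  qed
qed

lemma iota_idx: "t \<ge> 0 \<Longrightarrow> h \<in> carr H \<Longrightarrow> ({0, t}, \<lambda>r\<in>left_ends {0, t}. op_id H, h) \<in> ms_idx H t"
  by (auto simp: ms_idx_def P_idx_def partitions_def)

lemma gvec_iota: "t \<ge> 0 \<Longrightarrow> h \<in> carr H \<Longrightarrow> gvec t ({0, t}, \<lambda>r\<in>left_ends {0, t}. op_id H, h) = J h"
proof (cases "t = 0")
  case False
  assume *: "t \<ge> 0" "h \<in> carr H"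
  then have t: "t > 0" using False by simp
  then have "sorted_list_of_set {0, t} = [0, t]" by simp
  moreover have "0 \<in> left_ends {0, t}" using t by (simp add: left_ends_def)
  ultimately show ?thesis using * by (simp add: gvec_def)
qed simp

lemma iota:
  assumes t: "t \<ge> 0"
  shows "isometry H (MS t) (ms_iota H \<phi> t)" and "h \<in> carr H \<Longrightarrow> gam t (ms_iota H \<phi> t h) = J h"
proof -
  interpret M: hilbert_space "MS t" by (rule MS_hilbert)
  show g: "gam t (ms_iota H \<phi> t h) = J h" if "h \<in> carr H" for h
    using t that iota_idx gvec_iota by (simp add: ms_iota_def)
  have c: "ms_iota H \<phi> t h \<in> carr (MS t)" if "h \<in> carr H" for h
    using t that iota_idx by (simp add: ms_iota_def)
  have "ms_iota H \<phi> t = gams t \<circ>\<^bsub>H\<^esub> J"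
  proof (rule extensionalityI[of _ "carr H"])
    fix h assume h: "h \<in> carr H"
    then show "ms_iota H \<phi> t h = (gams t \<circ>\<^bsub>H\<^esub> J) h" using g[OF h, symmetric] c[OF h] by simp
  qed (auto simp: ms_iota_def compose_def)
  then have "ms_iota H \<phi> t \<in> bop H (MS t)" using hil MS_hilbert by (simp add: comp_bop[of H G])
  then show "isometry H (MS t) (ms_iota H \<phi> t)"
    using c g by (auto simp: isometry_iff[OF hil(1) MS_hilbert] gam_inner[symmetric])
qed

text \<open>The left side involves only \<phi>, so compressions to \<open>H\<close> of the operators
  implementing an element of the fibre agree for all dilations of \<phi>. This is the bridge between
  \<open>K\<close> and \<open>G\<close> in the continuity proof.\<close>

lemma inner_ms_rep:
  assumes t: "t \<ge> 0" and X: "X \<in> carr (E t)" and hk: "h \<in> carr H" "k \<in> carr H"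
  shows "hinner H h (ms_rep H \<phi> t X k) = hinner G (J h) (S t X (J k))" "ms_rep H \<phi> t X k \<in> carr H"
proof -
  note i = isometry_bop[OF iota(1)[OF t]]
  have "hinner H h (ms_rep H \<phi> t X k) = hinner (MS t) (ms_iota H \<phi> t h) (X k)"
    using inner_adj[OF hil(1) MS_hilbert i hk(1)] X hk by (simp add: ms_rep_def)
  also have "\<dots> = hinner G (gam t (ms_iota H \<phi> t h)) (gam t (X k))"
    using X hk i by (simp add: gam_inner)
  finally show "hinner H h (ms_rep H \<phi> t X k) = hinner G (J h) (S t X (J k))"
    using iota(2)[OF t hk(1)] S_J[OF t X hk(2)] by simp
  show "ms_rep H \<phi> t X k \<in> carr H"
    using hil MS_hilbert i X hk by (simp add: ms_rep_def)
qed

lemma iota0_E: "ms_iota H \<phi> 0 \<in> carr (E 0)"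
  using isometry_bop[OF iota(1)[of 0]] by (subst E_iff) (auto simp: iota(2))

lemma iota0_rep: "h \<in> carr H \<Longrightarrow> ms_rep H \<phi> 0 (ms_iota H \<phi> 0) h = h"
  using isometry_adj_apply[OF iota(1)[of 0]] by (simp add: ms_rep_def)

lemma iota0_inner: "hinner (E 0) (ms_iota H \<phi> 0) (ms_iota H \<phi> 0) = 1"
proof -
  have c: "ms_iota H \<phi> 0 h0 \<in> carr (MS 0)" using isometry_bop[OF iota(1)[of 0]] h0 by simp
  then show ?thesis using E_inner[OF _ iota0_E iota0_E] gam_inner[OF c c] h0 by (simp add: iota(2))
qed

text \<open>The fibre at time 0 is one-dimensional: \<open>pt0 0\<close> is the projection onto d0,
  so the vector representing X is a multiple of d0.\<close>

lemma E0_inner: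
  assumes X: "X \<in> carr (E 0)" and Y: "Y \<in> carr (E 0)"
  shows "hinner (E 0) X Y = cnj (hinner (E 0) (ms_iota H \<phi> 0) X) * hinner (E 0) (ms_iota H \<phi> 0) Y"
proof -
  have *: "gam 0 (X h0) = hscale G (hinner (E 0) (ms_iota H \<phi> 0) X) d0" if X: "X \<in> carr (E 0)" for X
  proof -
    have c: "ms_iota H \<phi> 0 h0 \<in> carr (MS 0)" using isometry_bop[OF iota(1)[of 0]] h0 by simp
    have "hinner (E 0) (ms_iota H \<phi> 0) X = hinner G d0 (gam 0 (X h0))"
      using E_inner[OF _ iota0_E X] gam_inner[OF c, of "X h0"] X h0 by (simp add: iota(2))
    then show ?thesis using E_h0[OF _ X] d0 by (simp add: pt0_def)
  qed
  have "hinner (E 0) X Y = hinner G (gam 0 (X h0)) (gam 0 (Y h0))"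
    using E_inner[OF _ X Y] gam_inner[of "X h0" 0 "Y h0"] X Y h0 by simp
  then show ?thesis unfolding *[OF X] *[OF Y] using d0 by simp
qed

end

section \<open>Commutants and von Neumann algebras\<close>

lemma commutant_antimono: "M \<subseteq> N \<Longrightarrow> commutant H N \<subseteq> commutant H M"
  by (auto simp: commutant_def)

lemma double_commutant: "M \<subseteq> BH H \<Longrightarrow> M \<subseteq> commutant H (commutant H M)"
  by (auto simp: commutant_def)

lemma triple_commutant: "M \<subseteq> BH H \<Longrightarrow> commutant H (commutant H (commutant H M)) = commutant H M"
proof
  assume M: "M \<subseteq> BH H"
  show "commutant H (commutant H (commutant H M)) \<subseteq> commutant H M"
    using commutant_antimono[OF double_commutant[OF M]] .
  show "commutant H M \<subseteq> commutant H (commutant H (commutant H M))"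
    by (rule double_commutant) (auto simp: commutant_def)
qed

lemma commutant_star:
  assumes H: "hilbert_space H" and M: "M \<subseteq> BH H" "\<And>A. A \<in> M \<Longrightarrow> star H A \<in> M" and B: "B \<in> commutant H M"
  shows "star H B \<in> commutant H M"
proof -
  have BH: "B \<in> BH H" using B by (simp add: commutant_def)
  have "A \<circ>\<^bsub>H\<^esub> star H B = star H B \<circ>\<^bsub>H\<^esub> A" if A: "A \<in> M" for A
  proof -
    have AH: "A \<in> BH H" using A M by blast
    have "star H A \<circ>\<^bsub>H\<^esub> B = B \<circ>\<^bsub>H\<^esub> star H A" using B M(2)[OF A] by (simp add: commutant_def)
    then have "star H (star H A \<circ>\<^bsub>H\<^esub> B) = star H (B \<circ>\<^bsub>H\<^esub> star H A)" by simp
    then show ?thesis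
      using adj_comp[OF H H H BH adj_bop[OF H H AH]] adj_comp[OF H H H adj_bop[OF H H AH] BH] adj_adj[OF H H AH] by simp
  qed
  then show ?thesis using BH H by (simp add: commutant_def)
qed

text \<open>Gives an upper bound for \<open>vn_generated\<close>: the von Neumann algebra generated
  by a set closed under adjoints is contained in its double commutant.\<close>

lemma von_neumann_double_commutant:
  assumes H: "hilbert_space H" and M: "M \<subseteq> BH H" "\<And>A. A \<in> M \<Longrightarrow> star H A \<in> M"
  shows "von_neumann_algebra H (commutant H (commutant H M))"
  unfolding von_neumann_algebra_def
proof (intro conjI ballI)
  show "commutant H (commutant H M) \<subseteq> BH H" by (auto simp: commutant_def)
  show "star H A \<in> commutant H (commutant H M)" if "A \<in> commutant H (commutant H M)" for A
    using commutant_star[OF H _ _ that] commutant_star[OF H M] by (auto simp: commutant_def)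
  show "commutant H (commutant H (commutant H (commutant H M))) = commutant H (commutant H M)"
    using triple_commutant[OF M(1)] by simp
qed

lemma projection_obtain:
  assumes H: "hilbert_space H" and M: "inner_space.lin_subspace H M"
  obtains Q where "Q \<in> BH H" "\<And>x. x \<in> M \<Longrightarrow> Q x = x"
    "\<forall>z\<in>carr H. (\<forall>y\<in>M. hinner H y z = 0) \<longrightarrow> Q z = hzero H"
proof (rule bexE[OF projection_op[OF assms]])
  fix Q assume Q: "Q \<in> BH H" and c: "(\<forall>x\<in>M. Q x = x) \<and> (\<forall>x\<in>carr H. \<forall>y\<in>M. hinner H y (Q x) = hinner H y x) \<and>
    (\<forall>z\<in>carr H. (\<forall>y\<in>M. hinner H y z = 0) \<longrightarrow> Q z = hzero H)"
  show thesis by (rule that[OF Q]) (use c in simp_all)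
qed

section \<open>The increasing ranges of the embeddings\<close>

context dilation
begin

text \<open>The range of \<open>gam t\<close>, described as the fixed points of its range
  projection, so that membership is an equation between operators and can be checked on total
  sets.\<close>

definition rng :: "real \<Rightarrow> 'g set" where
  "rng t = {x \<in> carr G. gam t (gams t x) = x}"

lemma gam_rng [simp]: "v \<in> carr (MS t) \<Longrightarrow> gam t v \<in> rng t"
  by (simp add: rng_def)

lemma rng_op:
  assumes R: "R \<in> BH G" and i: "\<And>i. i \<in> ms_idx H s \<Longrightarrow> R (gvec s i) \<in> rng t" and x: "x \<in> rng s"
  shows "R x \<in> rng t"
proof -
  have c1: "R \<circ>\<^bsub>MS s\<^esub> gam s \<in> bop (MS s) G" using R MS_hilbert hil by (intro comp_bop[of _ G]) auto
  have gg: "gam t \<circ>\<^bsub>G\<^esub> gams t \<in> BH G" using MS_hilbert hil by (intro comp_bop[of G "MS t"]) auto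
  have "(gam t \<circ>\<^bsub>G\<^esub> gams t) \<circ>\<^bsub>MS s\<^esub> (R \<circ>\<^bsub>MS s\<^esub> gam s) = R \<circ>\<^bsub>MS s\<^esub> gam s"
  proof (rule bop_total_eq[OF MS_hilbert hil(2) _ c1 ms_vec_total])
    show "(gam t \<circ>\<^bsub>G\<^esub> gams t) \<circ>\<^bsub>MS s\<^esub> (R \<circ>\<^bsub>MS s\<^esub> gam s) \<in> bop (MS s) G"
      by (rule comp_bop[OF MS_hilbert hil(2) c1 gg])
    fix v assume "v \<in> ms_vec H \<phi> s ` ms_idx H s"
    then obtain j where j: "j \<in> ms_idx H s" "v = ms_vec H \<phi> s j" by blast
    have "gvec s j \<in> carr G" using j by (metis gam_carr gam_ms_vec ms_vec_carr)
    then show "((gam t \<circ>\<^bsub>G\<^esub> gams t) \<circ>\<^bsub>MS s\<^esub> (R \<circ>\<^bsub>MS s\<^esub> gam s)) v = (R \<circ>\<^bsub>MS s\<^esub> gam s) v"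
      using j i[OF j(1)] R by (simp add: rng_def)
  qed
  from fun_cong[OF this, of "gams s x"] show ?thesis
    using x R by (simp add: rng_def)
qed

lemma gvec_rng [simp]: "i \<in> ms_idx H s \<Longrightarrow> gvec s i \<in> rng s"
  using gam_rng[of "ms_vec H \<phi> s i" s] by simp

lemma gvec_carr' [simp]: "i \<in> ms_idx H s \<Longrightarrow> gvec s i \<in> carr G"
  using gvec_rng by (simp add: rng_def)

lemma gvec_P: "t \<ge> 0 \<Longrightarrow> i \<in> ms_idx H t \<Longrightarrow> \<sigma> t P (gvec t i) = gvec t i"
proof -
  assume t: "t \<ge> 0" and i: "i \<in> ms_idx H t"
  obtain Q a h where q: "i = (Q, a, h)" "Q \<in> partitions t" "a \<in> left_ends Q \<rightarrow>\<^sub>E BH H" "h \<in> carr H"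
    using i by (auto simp: ms_idx_def P_idx_def)
  note ts = partition_list[OF q(2)]
  obtain us where us: "sorted_list_of_set Q = 0 # us" using ts(2,4) by (cases "sorted_list_of_set Q") auto
  have "a r \<in> BH H" if "r \<in> set (butlast (0 # us))" for r
    using that ts(6) us q(3) by (metis PiE_mem)
  then show ?thesis
    using word_range[of 0 us t a h] ts(1,3) us q by (simp add: gvec_def)
qed

text \<open>Prepending the interval from 0 to t - s with factor I multiplies the word by
  \<open>\<sigma> t P\<close>. The word is fixed by \<open>\<sigma> s P\<close> and these
  projections increase, so its vector is unchanged while its time has become t.\<close>

lemma gvec_insert_left:
  assumes i: "i \<in> ms_idx H s" and s: "0 \<le> s" "s < t"
  shows "gvec s i \<in> rng t"
proof -
  obtain Q a h where q: "i = (Q, a, h)" "Q \<in> partitions s" "a \<in> left_ends Q \<rightarrow>\<^sub>E BH H" "h \<in> carr H"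
    using i by (auto simp: ms_idx_def P_idx_def)
  let ?Q = "{0, t - s}" and ?a = "\<lambda>r\<in>left_ends {0, t - s}. op_id H"
  have Q: "?Q \<in> partitions (t - s)" "?a \<in> left_ends ?Q \<rightarrow>\<^sub>E BH H" using s by (auto simp: partitions_def)
  define i' where "i' = (?Q \<union> (+) (t - s) ` Q, \<lambda>r\<in>left_ends (?Q \<union> (+) (t - s) ` Q). if r < t - s then ?a r else a (r - (t - s)), h)"
  note c = gvec_concat[OF Q q(2,3,4), folded i'_def]
  have l: "sorted_list_of_set ?Q = [0, t - s]" using s by simp
  have z: "0 \<in> left_ends ?Q" using s by (simp add: left_ends_def)
  have "word (t - s) ?a [0, t - s] = \<sigma> (t - s) P"
    using s z by (intro bop_eqI[of _ G G]) auto
  then have "gvec (t - s + s) i'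
      = \<sigma> s (\<sigma> (t - s) P) (gvec s i)"
    using c(2) l q by simp
  also have "\<dots> = \<sigma> t P (\<sigma> s P (gvec s i))" using s i by (simp add: sigma_sigma gvec_P)
  also have "\<dots> = gvec s i" using s i by (subst sigma_P_mono) (auto simp: gvec_P)
  finally have "gvec t i' = gvec s i"
    by simp
  moreover have "i' \<in> ms_idx H t"
    using c(1) by simp
  ultimately show ?thesis using gvec_rng[of i' t] by simp
qed

lemma rng_mono: "0 \<le> s \<Longrightarrow> s \<le> t \<Longrightarrow> x \<in> rng s \<Longrightarrow> x \<in> rng t"
  using rng_op[of "op_id G" s t x] gvec_insert_left[of _ s t]
  by (cases "s = t") (auto simp: rng_def)

lemma rng_P:
  assumes t: "t \<ge> 0" and x: "x \<in> rng t"
  shows "\<sigma> t P x = x"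
proof -
  have c: "\<sigma> t P \<circ>\<^bsub>MS t\<^esub> gam t \<in> bop (MS t) G" using t MS_hilbert hil by (intro comp_bop[of _ G]) auto
  have "\<sigma> t P \<circ>\<^bsub>MS t\<^esub> gam t = gam t"
    by (rule bop_total_eq[OF MS_hilbert hil(2) c gam_bop ms_vec_total]) (use t gvec_P in auto)
  from fun_cong[OF this, of "gams t x"] show ?thesis using x by (simp add: rng_def)
qed

lemma rng_act: "t \<ge> 0 \<Longrightarrow> A \<in> BH H \<Longrightarrow> x \<in> rng t \<Longrightarrow> \<sigma> t (lift A) x \<in> rng t"
proof -
  assume *: "t \<ge> 0" "A \<in> BH H" "x \<in> rng t"
  have v: "gams t x \<in> carr (MS t)" using * by (simp add: rng_def)
  have "gam t (ms_act H \<phi> t A (gams t x)) = \<sigma> t (lift A) x"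
    using ms_act(2)[OF *(1,2) v] * by (simp add: rng_def)
  then show ?thesis using bop_carr[OF ms_act(1)[OF *(1,2)] v] gam_rng by metis
qed

text \<open>For s > t a word of length s is split at u = s - t. Its first block is
  \<open>\<sigma> t\<close> of an operator, which the projections \<open>\<sigma> t P\<close> on
  both sides compress to \<open>H\<close>; the result is a left action on a word of length t. For s
  at most t the ranges increase and nothing is cut off.\<close>

lemma rng_cut:
  assumes t: "0 \<le> t" and s: "0 \<le> s" and x: "x \<in> rng s"
  shows "\<sigma> t P x \<in> rng t"
proof (cases "s \<le> t")
  case True
  then show ?thesis using rng_mono[OF s True x] rng_P[OF t] by simp
next
  case False
  define u where "u = s - t"
  have u: "u > 0" "u + t = s" using False by (auto simp: u_def)
  have "\<sigma> t P (gvec s i) \<in> rng t" if i: "i \<in> ms_idx H s" for i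
  proof -
    obtain Q y where q: "i = (Q, y)" "Q \<in> partitions s" "y \<in> P_idx H Q"
      using i by (auto simp: ms_idx_def)
    \<comment> \<open>Refinement by u, so that the word splits at a partition point; refining leaves
      the represented vector unchanged.\<close>
    define Q' where "Q' = Q \<union> {0, u, s}"
    have Q': "Q' \<in> partitions s" "Q \<subseteq> Q'" using q(2) u t by (auto simp: Q'_def partitions_def)
    obtain a h where a: "refine Q Q' y = (a, h)" by (cases "refine Q Q' y")
    have ah: "a \<in> left_ends Q' \<rightarrow>\<^sub>E BH H" "h \<in> carr H"
      using refine_idx[OF q(2) Q' q(3)] a by (auto simp: P_idx_def)
    define Q1 where "Q1 = {r \<in> Q'. r \<le> u}"
    define Q2 where "Q2 = (\<lambda>r. r - u) ` {r \<in> Q'. u \<le> r}"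
    note p' = partitionsD[OF Q'(1)]
    have Q1: "Q1 \<in> partitions u"
    proof -
      have "finite Q1" using p'(1) by (simp add: Q1_def)
      moreover have "{0, u} \<subseteq> Q1" using u by (auto simp: Q1_def Q'_def)
      moreover have "Q1 \<subseteq> {0..u}" using p'(4) by (auto simp: Q1_def)
      ultimately show ?thesis by (simp add: partitions_def)
    qed
    have Q2: "Q2 \<in> partitions t"
    proof -
      have "finite Q2" using p'(1) by (simp add: Q2_def)
      moreover have "0 \<in> Q2" unfolding Q2_def by (rule image_eqI[of _ _ u]) (auto simp: Q'_def)
      moreover have "t \<in> Q2" unfolding Q2_def by (rule image_eqI[of _ _ s]) (use u t in \<open>auto simp: Q'_def\<close>)
      moreover have "Q2 \<subseteq> {0..t}" using p'(5) u by (fastforce simp: Q2_def)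
      ultimately show ?thesis by (simp add: partitions_def)
    qed
    have un: "Q1 \<union> (+) u ` Q2 = Q'"
    proof -
      have "(+) u ` Q2 = {r \<in> Q'. u \<le> r}" by (force simp: Q2_def image_iff)
      then show ?thesis by (auto simp: Q1_def)
    qed
    define a1 where "a1 = (\<lambda>r\<in>left_ends Q1. a r)"
    define b where "b = (\<lambda>r\<in>left_ends Q2. a (u + r))"
    have le: "left_ends Q' = left_ends Q1 \<union> (+) u ` left_ends Q2"
      using concat_partition(3)[OF Q1 Q2] un by simp
    have a1: "a1 \<in> left_ends Q1 \<rightarrow>\<^sub>E BH H" using ah(1) le by (auto simp: a1_def)
    have b: "b \<in> left_ends Q2 \<rightarrow>\<^sub>E BH H" using ah(1) le by (auto simp: b_def)
    have lt: "r \<in> left_ends Q1 \<Longrightarrow> r < u" "r \<in> left_ends Q2 \<Longrightarrow> 0 \<le> r" for r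
      using partitionsD(5,8)[OF Q1] partitionsD(4,8)[OF Q2] by (auto simp: less_le)
    have c: "(\<lambda>r\<in>left_ends (Q1 \<union> (+) u ` Q2). if r < u then a1 r else b (r - u)) = a"
    proof (rule extensionalityI[of _ "left_ends Q'"])
      fix r assume r: "r \<in> left_ends Q'"
      show "(\<lambda>r\<in>left_ends (Q1 \<union> (+) u ` Q2). if r < u then a1 r else b (r - u)) r = a r"
      proof (cases "r \<in> left_ends Q1")
        case True
        then show ?thesis using lt(1) r by (simp add: un a1_def)
      next
        case False
        then obtain y where "y \<in> left_ends Q2" "r = u + y" using r le by blast
        then show ?thesis using lt(2)[of y] r by (simp add: un b_def)
      qed
    qed (use ah in \<open>auto simp: un PiE_iff\<close>)
    let ?w = "word u a1 (sorted_list_of_set Q1)"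
    have w: "?w \<in> BH G" using Q1 a1 by simp
    have i2: "(Q2, b, h) \<in> ms_idx H t" using Q2 b ah by (simp add: ms_idx_def P_idx_def)
    have "gvec s i = gvec s (Q', a, h)" using gvec_refine[OF q(2) Q' q(3)] q(1) a by simp
    also have "\<dots> = \<sigma> t ?w (gvec t (Q2, b, h))"
      using gvec_concat(2)[OF Q1 a1 Q2 b ah(2)] unfolding un u(2) c[unfolded un] .
    finally have e: "gvec s i = \<sigma> t ?w (\<sigma> t P (gvec t (Q2, b, h)))" using gvec_P[OF t i2] by simp
    \<comment> \<open>The inner copy of \<open>\<sigma> t P\<close> comes from the second block,
      which it fixes; together with the outer copy it turns the first block into the lift of its
      compression.\<close>
    have "\<sigma> t P (gvec s i) = \<sigma> t (lift (compr H G J ?w)) (gvec t (Q2, b, h))"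
      unfolding e using t w i2 by (simp add: sigma_comp_apply lift_compr)
    then show ?thesis using rng_act[OF t compr_bop[OF w] gvec_rng[OF i2]] by simp
  qed
  then show ?thesis using rng_op[of "\<sigma> t P" s t x] t x by simp
qed

lemma rng_subspace: "G.lin_subspace (rng t)"
  using bop_add[OF gams_bop] bop_scale[OF gams_bop] bop_zero[OF gams_bop hil(2) MS_hilbert]
    bop_add[OF gam_bop] bop_scale[OF gam_bop] bop_zero[OF gam_bop MS_hilbert hil(2)]
  by (auto simp: G.lin_subspace_def rng_def)

lemma J_rng: "t \<ge> 0 \<Longrightarrow> h \<in> carr H \<Longrightarrow> J h \<in> rng t"
  using gvec_rng[OF iota_idx] gvec_iota by metis

end

section \<open>Consequences of minimality\<close>

locale minimal_dilation = dilation H G J \<phi> \<sigma> h0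
  for H :: "'h hilb" and G :: "'g hilb" and J \<phi> \<sigma> h0 +
  assumes minimal: "vn_generated G (\<Union>t\<in>{0..}.
    {\<sigma> t ((J \<circ>\<^bsub>G\<^esub> adj H G J) \<circ>\<^bsub>G\<^esub> (A \<circ>\<^bsub>G\<^esub> (J \<circ>\<^bsub>G\<^esub> adj H G J))) | A. A \<in> BH G}) = BH G"
begin

lemma J_Js: "J \<circ>\<^bsub>G\<^esub> Js = P"
  using hil by (intro bop_eqI[of _ G G] comp_bop[of G H]) auto

text \<open>An operator commuting with the generators lies in their commutant, while minimality
  places every bounded operator in their double commutant.\<close>

lemma commutes_all:
  assumes Q: "Q \<in> BH G" and comm: "\<And>t A x. t \<ge> 0 \<Longrightarrow> A \<in> BH H \<Longrightarrow> x \<in> carr G \<Longrightarrow> \<sigma> t (lift A) (Q x) = Q (\<sigma> t (lift A) x)"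
    and B: "B \<in> BH G"
  shows "Q \<circ>\<^bsub>G\<^esub> B = B \<circ>\<^bsub>G\<^esub> Q"
proof -
  let ?M = "(\<Union>t\<in>{0..}. {\<sigma> t (P \<circ>\<^bsub>G\<^esub> (A \<circ>\<^bsub>G\<^esub> P)) | A. A \<in> BH G})"
  have M: "?M = (\<Union>t\<in>{0..}. {\<sigma> t (lift (compr H G J A)) | A. A \<in> BH G})"
    by (intro SUP_cong refl Collect_cong ex_cong1) (auto simp: lift_compr)
  have MB: "?M \<subseteq> BH G" unfolding M by auto
  have Ms: "star G A \<in> ?M" if "A \<in> ?M" for A
  proof -
    obtain t C where C: "t \<ge> 0" "C \<in> BH G" "A = \<sigma> t (lift (compr H G J C))" using \<open>A \<in> ?M\<close> unfolding M by auto
    have "star G A = \<sigma> t (lift (star H (compr H G J C)))" using C by (simp add: sigma_star[symmetric] star_lift)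
    also have "star H (compr H G J C) = compr H G J (lift (star H (compr H G J C)))" using C by (simp add: compr_lift)
    finally show ?thesis unfolding M using C by (auto intro!: exI[of _ "lift (star H (compr H G J C))"])
  qed
  have "vn_generated G ?M = BH G" using minimal unfolding J_Js .
  moreover have "vn_generated G ?M \<subseteq> commutant G (commutant G ?M)"
    unfolding vn_generated_def
    using von_neumann_double_commutant[OF hil(2) MB Ms] double_commutant[OF MB] by blast
  ultimately have BM: "B \<in> commutant G (commutant G ?M)" using B by blast
  have "Q \<in> commutant G ?M"
  proof -
    have "A \<circ>\<^bsub>G\<^esub> Q = Q \<circ>\<^bsub>G\<^esub> A" if "A \<in> ?M" for A
    proof -
      obtain t C where C: "t \<ge> 0" "C \<in> BH G" "A = \<sigma> t (lift (compr H G J C))" using \<open>A \<in> ?M\<close> unfolding M by auto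
      show ?thesis using C Q comm by (intro bop_eqI[of _ G G]) auto
    qed
    then show ?thesis using Q unfolding commutant_def by blast
  qed
  then show ?thesis using BM by (simp add: commutant_def)
qed

text \<open>The union of the ranges is a subspace, by monotonicity, and invariant under all
  \<open>\<sigma> s (lift A)\<close>, by \<open>rng_cut\<close> and \<open>rng_act\<close>. As these
  operators are closed under adjoints, the projection \<open>Q\<close> onto its closure commutes
  with them and, by minimality, with every bounded operator.\<close>

lemma rng_total:
  assumes y: "y \<in> carr G" and orth: "\<And>t x. t \<ge> 0 \<Longrightarrow> x \<in> rng t \<Longrightarrow> hinner G x y = 0"
  shows "y = hzero G"
proof -
  let ?M = "\<Union>t\<in>{0..}. rng t"
  have MG: "x \<in> ?M \<Longrightarrow> x \<in> carr G" for x by (auto simp: rng_def)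
  have sub: "G.lin_subspace ?M"
    unfolding G.lin_subspace_def
  proof (intro conjI ballI allI)
    show "hzero G \<in> ?M" using rng_subspace[of 0] by (auto simp: G.lin_subspace_def)
    fix x z assume "x \<in> ?M" "z \<in> ?M"
    then obtain s t where "s \<ge> 0" "x \<in> rng s" "t \<ge> 0" "z \<in> rng t" by auto
    then have "x \<in> rng (max s t)" "z \<in> rng (max s t)" using rng_mono[of s "max s t"] rng_mono[of t "max s t"] by auto
    then have "hadd G x z \<in> rng (max s t)" using rng_subspace by (auto simp: G.lin_subspace_def)
    then show "hadd G x z \<in> ?M" using \<open>s \<ge> 0\<close> by (auto intro!: bexI[of _ "max s t"])
  next
    fix c x assume "x \<in> ?M"
    then obtain s where s: "s \<ge> 0" "x \<in> rng s" by auto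
    then have "hscale G c x \<in> rng s" using rng_subspace by (auto simp: G.lin_subspace_def)
    then show "hscale G c x \<in> ?M" using s by auto
  qed (use MG in blast)
  have inv: "\<sigma> s (lift A) x \<in> ?M" if sAx: "s \<ge> 0" "A \<in> BH H" "x \<in> ?M" for s A x
  proof -
    obtain t where t: "t \<ge> 0" "x \<in> rng t" using sAx(3) by auto
    have "\<sigma> s (lift A) x = \<sigma> s (lift A) (\<sigma> s P x)" using sAx MG by (simp add: sigma_P_lift)
    then show ?thesis using rng_act[OF sAx(1,2) rng_cut[OF sAx(1) t]] sAx(1) by auto
  qed
  define M where "M = ?M"
  have subM: "G.lin_subspace M" using sub by (simp only: M_def)
  obtain Q where Q': "Q \<in> BH G" "\<And>x. x \<in> M \<Longrightarrow> Q x = x"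
    "\<forall>z\<in>carr G. (\<forall>x\<in>M. hinner G x z = 0) \<longrightarrow> Q z = hzero G"
    using projection_obtain[OF hil(2) subM] by metis
  have Q3: "Q z = hzero G" if "z \<in> carr G" "\<And>x. x \<in> ?M \<Longrightarrow> hinner G x z = 0" for z
    using Q'(3) that unfolding M_def by blast
  note Q = Q'(1,2)[unfolded M_def] Q3
  let ?N = "{z \<in> carr G. \<forall>x\<in>?M. hinner G x z = 0}"
  have tot: "G.total (?M \<union> ?N)"
    unfolding G.total_def
  proof (intro conjI ballI impI)
    fix z assume z: "z \<in> carr G" "\<forall>s\<in>?M \<union> ?N. hinner G s z = 0"
    then have "z \<in> ?N" by blast
    then have "hinner G z z = 0" using z(2) by blast
    then show "z = hzero G" using z(1) G.inner_self_zero by blast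
  qed (use MG in blast)
  have comm: "\<sigma> t (lift A) (Q x) = Q (\<sigma> t (lift A) x)" if t: "t \<ge> 0" and A: "A \<in> BH H" and x: "x \<in> carr G" for t A x
  proof -
    have SB: "\<sigma> t (lift A) \<in> BH G" using t A by simp
    have "\<sigma> t (lift A) \<circ>\<^bsub>G\<^esub> Q = Q \<circ>\<^bsub>G\<^esub> \<sigma> t (lift A)"
    proof (rule bop_total_eq[OF hil(2) hil(2) _ _ tot])
      fix z assume "z \<in> ?M \<union> ?N"
      then consider "z \<in> ?M" | "z \<in> ?N" by blast
      then show "(\<sigma> t (lift A) \<circ>\<^bsub>G\<^esub> Q) z = (Q \<circ>\<^bsub>G\<^esub> \<sigma> t (lift A)) z"
      proof cases
        case 1
        then show ?thesis using inv[OF t A 1] Q(2) MG by simp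
      next
        case 2
        then have z: "z \<in> carr G" "\<And>x. x \<in> ?M \<Longrightarrow> hinner G x z = 0" by blast+
        have "hinner G x (\<sigma> t (lift A) z) = 0" if x: "x \<in> ?M" for x
        proof -
          have "hinner G (\<sigma> t (lift (star H A)) x) z = 0" by (rule z(2)[OF inv[OF t star_BH[OF A] x]])
          then show ?thesis using t A MG[OF x] z(1) hil by (simp add: inner_sigma star_lift)
        qed
        then have "Q (\<sigma> t (lift A) z) = hzero G" using SB z(1) by (intro Q(3)) auto
        moreover have "\<sigma> t (lift A) (Q z) = hzero G" using Q(3)[OF z] bop_zero[OF SB hil(2) hil(2)] by simp
        ultimately show ?thesis using z(1) by simp
      qed
    qed (use SB Q(1) in auto)
    from fun_cong[OF this, of x] show ?thesis using x by simp
  qed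
  \<comment> \<open>Commuting with |y><d0| suffices: d0 lies in the subspace, so \<open>Q\<close>
    fixes it and hence fixes y, whereas orthogonality makes \<open>Q y\<close> zero.\<close>
  have "Q \<circ>\<^bsub>G\<^esub> rank_one G y d0 = rank_one G y d0 \<circ>\<^bsub>G\<^esub> Q"
    using commutes_all[OF Q(1) comm] y d0 by simp
  from fun_cong[OF this, of d0] have "Q (rank_one G y d0 d0) = rank_one G y d0 (Q d0)" using d0 by simp
  moreover have "Q d0 = d0" using J_rng[of 0 h0] h0 by (intro Q(2)) auto
  moreover have "rank_one G y d0 d0 = y" using y d0 by (auto intro: G.vec_eqI)
  ultimately have "Q y = y" by simp
  moreover have "Q y = hzero G" using orth y by (intro Q(3)) auto
  ultimately show ?thesis by simp
qed

text \<open>With the reverse inclusion \<open>rng_P\<close>, minimality identifies the range of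
  \<open>gam t\<close> with the range of \<open>\<sigma> t P\<close>. It is enough to test on the
  union of all ranges, where cutting down is known.\<close>

lemma sigma_P_rng:
  assumes t: "t \<ge> 0" and x: "x \<in> carr G"
  shows "\<sigma> t P x \<in> rng t"
proof -
  have gg: "gam t \<circ>\<^bsub>G\<^esub> gams t \<in> BH G" using MS_hilbert hil by (intro comp_bop[of G "MS t"]) auto
  have tot: "G.total (\<Union>t\<in>{0..}. rng t)"
    using rng_total by (auto simp: G.total_def rng_def)
  have "(gam t \<circ>\<^bsub>G\<^esub> gams t) \<circ>\<^bsub>G\<^esub> \<sigma> t P = \<sigma> t P"
  proof (rule bop_total_eq[OF hil(2) hil(2) _ _ tot])
    fix x assume "x \<in> (\<Union>t\<in>{0..}. rng t)"
    then obtain s where "s \<ge> 0" "x \<in> rng s" by auto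
    then show "((gam t \<circ>\<^bsub>G\<^esub> gams t) \<circ>\<^bsub>G\<^esub> \<sigma> t P) x = \<sigma> t P x"
      using rng_cut[OF t] t by (simp add: rng_def)
  qed (use t gg in auto)
  from fun_cong[OF this, of x] show ?thesis using t x by (simp add: rng_def)
qed

text \<open>The intertwiner \<open>rop t r\<close> maps the copy of \<open>H\<close> into the range
  of \<open>\<sigma> t P\<close>, because it intertwines \<open>P\<close> with this projection. In a
  minimal dilation that range is covered by \<open>gam t\<close>, so the intertwiner restricted to
  \<open>H\<close> can be pulled back to the fibre.\<close>

lemma E_surj:
  assumes t: "t \<ge> 0" and r: "r \<in> carr G" "pt0 t r = r"
  shows "\<exists>X\<in>carr (E t). gam t (X h0) = r"
proof -
  let ?X = "gams t \<circ>\<^bsub>H\<^esub> (rop t r \<circ>\<^bsub>H\<^esub> J)"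
  note rB = rop_bop[OF t r]
  have c: "rop t r \<circ>\<^bsub>H\<^esub> J \<in> bop H G" using rB hil by (intro comp_bop[of H G]) auto
  have X: "?X \<in> bop H (MS t)" by (rule comp_bop[OF hil c gams_bop])
  have g: "gam t (?X h) = rop t r (J h)" if h: "h \<in> carr H" for h
  proof -
    have Jh: "J h \<in> carr G" using h by simp
    have "\<sigma> t P (rop t r (J h)) = rop t r (J h)"
      using rop_intertwine[OF t r(1) _ Jh, of P] h by simp
    then have "rop t r (J h) \<in> rng t" using sigma_P_rng[OF t, of "rop t r (J h)"] t r Jh by simp
    then show ?thesis using h by (simp add: rng_def)
  qed
  have "?X \<in> carr (E t)"
    unfolding E_iff[OF t]
  proof (intro conjI ballI X)
    fix A h assume A: "A \<in> BH H" and h: "h \<in> carr H"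
    have Ah: "A h \<in> carr H" "J h \<in> carr G" using A h by auto
    show "gam t (?X (A h)) = \<sigma> t (lift A) (gam t (?X h))"
      unfolding g[OF Ah(1)] g[OF h] using rop_intertwine[OF t r(1) lift_bop[OF A] Ah(2)] A h by simp
  qed
  moreover have "gam t (?X h0) = r" using g[OF h0(1)] rop_d0[OF t] r by simp
  ultimately show ?thesis by blast
qed

text \<open>For a vector e put z = \<sigma> t (|d0><e|) y. It lies in the range of
  \<open>pt0 t\<close>, hence comes from some X in the fibre, and the inner product of
  \<open>S t X e\<close> with y is that of z with itself. So z vanishes, \<sigma> t (|e><e|)
  annihilates y for every e, and normality yields y = 0.\<close>

lemma S_total:
  assumes t: "t \<ge> 0" and y: "y \<in> carr G"
    and orth: "\<And>X g. X \<in> carr (E t) \<Longrightarrow> g \<in> carr G \<Longrightarrow> hinner G (S t X g) y = 0"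
  shows "y = hzero G"
proof (rule G.normal_star_hom_faithful[of "\<sigma> t"])
  show "star_hom G G (\<sigma> t)" "normal_map G (\<sigma> t)"
    using e0 t by (auto simp: e0_semigroup_def cp0_semigroup_def)
  fix e assume e: "e \<in> carr G"
  define z where "z = \<sigma> t (rank_one G d0 e) y"
  have z: "z \<in> carr G" using t e y d0 by (simp add: z_def)
  have dz: "rank_one G d0 d0 \<circ>\<^bsub>G\<^esub> rank_one G d0 e = rank_one G d0 e"
    using e d0 by (simp add: G.rank_one_comp_rank_one) (auto intro!: arg_cong2[of _ _ _ _ "rank_one G"] G.vec_eqI)
  then have "pt0 t z = z" using t e y d0 by (simp add: pt0_def z_def sigma_comp_apply)
  then obtain X where X: "X \<in> carr (E t)" "gam t (X h0) = z" using E_surj[OF t z] by blast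
  have "hinner G (S t X e) y = 0" using orth X(1) e by blast
  moreover have "S t X e = \<sigma> t (rank_one G e d0) z" using X(2) e by (simp add: S_def rop_def)
  ultimately have "hinner G z z = 0" using t e y z d0 by (simp add: inner_sigma z_def[symmetric])
  then have z0: "z = hzero G" using z by (intro G.inner_self_zero)
  have ee: "rank_one G e d0 \<circ>\<^bsub>G\<^esub> rank_one G d0 e = rank_one G e e"
    using e d0 by (simp add: G.rank_one_comp_rank_one) (auto intro!: arg_cong2[of _ _ _ _ "rank_one G"] G.vec_eqI)
  have "\<sigma> t (rank_one G e e) y = \<sigma> t (rank_one G e d0) z"
    using t e y d0 by (simp add: z_def sigma_comp_apply ee)
  also have "\<dots> = hzero G" unfolding z0 using t e d0 hil by (intro bop_zero[of _ G G]) auto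
  finally show "\<sigma> t (rank_one G e e) y = hzero G" .
qed (use t y in auto)

end

section \<open>Finite sums of vectors\<close>

context inner_space
begin

lemma foldr_hadd_closed: "(\<And>j. j \<in> set js \<Longrightarrow> x j \<in> carr H) \<Longrightarrow> foldr (hadd H) (map x js) (hzero H) \<in> carr H"
  by (induction js) auto

lemma inner_foldr_hadd: "(\<And>j. j \<in> set js \<Longrightarrow> x j \<in> carr H) \<Longrightarrow> z \<in> carr H \<Longrightarrow>
    hinner H z (foldr (hadd H) (map x js) (hzero H)) = (\<Sum>j\<leftarrow>js. hinner H z (x j))"
  by (induction js) (auto simp: foldr_hadd_closed)

lemma hsum_closed: "(\<And>j. j < n \<Longrightarrow> x j \<in> carr H) \<Longrightarrow> hsum H x n \<in> carr H"
  unfolding hsum_def by (rule foldr_hadd_closed) auto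

lemma inner_hsum: "(\<And>j. j < n \<Longrightarrow> x j \<in> carr H) \<Longrightarrow> z \<in> carr H \<Longrightarrow>
    hinner H z (hsum H x n) = (\<Sum>j<n. hinner H z (x j))"
  unfolding hsum_def by (subst inner_foldr_hadd) (auto simp: interv_sum_list_conv_sum_set_nat atLeast0LessThan)

lemma inner_hsum_left:
  assumes "\<And>j. j < n \<Longrightarrow> x j \<in> carr H" "z \<in> carr H"
  shows "hinner H (hsum H x n) z = (\<Sum>j<n. hinner H (x j) z)"
proof -
  have "hinner H (hsum H x n) z = cnj (hinner H z (hsum H x n))"
    using assms hsum_closed by (intro inner_commute) auto
  also have "\<dots> = (\<Sum>j<n. cnj (hinner H z (x j)))" using inner_hsum[OF assms] by simp
  also have "\<dots> = (\<Sum>j<n. hinner H (x j) z)"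
    using inner_commute[OF assms(2)] assms(1) by (intro sum.cong) auto
  finally show ?thesis .
qed

end

section \<open>Tensor products\<close>

definition bilinear_form :: "'a hilb \<Rightarrow> 'b hilb \<Rightarrow> ('a \<Rightarrow> 'b \<Rightarrow> complex) \<Rightarrow> bool" where
  "bilinear_form X K b \<longleftrightarrow>
     (\<forall>x\<in>carr X. \<forall>y\<in>carr X. \<forall>k\<in>carr K. b (hadd X x y) k = b x k + b y k) \<and>
     (\<forall>c. \<forall>x\<in>carr X. \<forall>k\<in>carr K. b (hscale X c x) k = c * b x k) \<and>
     (\<forall>x\<in>carr X. \<forall>k\<in>carr K. \<forall>l\<in>carr K. b x (hadd K k l) = b x k + b x l) \<and>
     (\<forall>c. \<forall>x\<in>carr X. \<forall>k\<in>carr K. b x (hscale K c k) = c * b x k)"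

lemma bilinear_formD:
  assumes "bilinear_form X K b"
  shows "x \<in> carr X \<Longrightarrow> y \<in> carr X \<Longrightarrow> k \<in> carr K \<Longrightarrow> b (hadd X x y) k = b x k + b y k"
    "x \<in> carr X \<Longrightarrow> k \<in> carr K \<Longrightarrow> b (hscale X c x) k = c * b x k"
    "x \<in> carr X \<Longrightarrow> k \<in> carr K \<Longrightarrow> l \<in> carr K \<Longrightarrow> b x (hadd K k l) = b x k + b x l"
    "x \<in> carr X \<Longrightarrow> k \<in> carr K \<Longrightarrow> b x (hscale K c k) = c * b x k"
  using assms by (simp_all add: bilinear_form_def)

text \<open>Gram--Schmidt for tensors: a finite sum of elementary tensors is rewritten with an orthonormal
  first factor.  Tensors are represented by the values of all bilinear forms.\<close>

lemma orthonormal_decomposition: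
  assumes X: "hilbert_space X" and K: "hilbert_space K"
    and xs: "snd ` set xs \<subseteq> carr X \<times> carr K"
  shows "\<exists>(n :: nat) e k'. (\<forall>i<n. e i \<in> carr X \<and> k' i \<in> carr K) \<and>
    (\<forall>i<n. \<forall>j<n. hinner X (e i) (e j) = (if i = j then 1 else 0)) \<and>
    (\<forall>b. bilinear_form X K b \<longrightarrow> (\<Sum>(c, x, k)\<leftarrow>xs. c * b x k) = (\<Sum>i<n. b (e i) (k' i)))"
  using xs
proof (induction xs)
  case Nil
  then show ?case by (intro exI[of _ 0]) auto
next
  case (Cons a xs)
  interpret X: hilbert_space X by fact
  interpret K: hilbert_space K by fact
  obtain c x k where a: "a = (c, x, k)" by (cases a)
  have xk: "x \<in> carr X" "k \<in> carr K" using Cons.prems a by auto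
  obtain n :: nat and e k' where IH: "\<And>i. i < n \<Longrightarrow> e i \<in> carr X" "\<And>i. i < n \<Longrightarrow> k' i \<in> carr K"
    "\<And>i j. i < n \<Longrightarrow> j < n \<Longrightarrow> hinner X (e i) (e j) = (if i = j then 1 else 0)"
    "\<And>b. bilinear_form X K b \<Longrightarrow> (\<Sum>(c, x, k)\<leftarrow>xs. c * b x k) = (\<Sum>i<n. b (e i) (k' i))"
  proof -
    have "\<exists>(n :: nat) e k'. (\<forall>i<n. e i \<in> carr X \<and> k' i \<in> carr K) \<and>
      (\<forall>i<n. \<forall>j<n. hinner X (e i) (e j) = (if i = j then 1 else 0)) \<and>
      (\<forall>b. bilinear_form X K b \<longrightarrow> (\<Sum>(c, x, k)\<leftarrow>xs. c * b x k) = (\<Sum>i<n. b (e i) (k' i)))"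
      using Cons.prems by (intro Cons.IH) auto
    then show thesis using that by blast
  qed
  let ?p = "hsum X (\<lambda>i. hscale X (hinner X (e i) x) (e i)) n"
  have p: "?p \<in> carr X" using IH(1) by (intro X.hsum_closed) auto
  have ip: "hinner X z ?p = (\<Sum>i<n. hinner X (e i) x * hinner X z (e i))" if "z \<in> carr X" for z
    using IH(1) that by (subst X.inner_hsum) auto
  \<comment> \<open>The component of x orthogonal to the vectors already chosen. The tensor of x and
    k splits into corrections of the second factors \<open>k' i\<close> and one new term with first
    factor r.\<close>
  define r where "r = X.hsub x ?p"
  have r: "r \<in> carr X" using p xk by (simp add: r_def)
  have er: "hinner X (e i) r = 0" if i: "i < n" for i
  proof -
    have "hinner X (e i) ?p = (\<Sum>j<n. (if i = j then hinner X (e j) x else 0))"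
      unfolding ip[OF IH(1)[OF i]] using IH(3)[OF i] by (intro sum.cong) auto
    then show ?thesis using i p xk IH(1) by (simp add: r_def)
  qed
  have re: "hinner X r (e i) = 0" if "i < n" for i
    using er[OF that] X.inner_commute[OF IH(1)[OF that] r] by simp
  have bx: "b x k = (\<Sum>i<n. hinner X (e i) x * b (e i) k) + b r k" if b: "bilinear_form X K b" for b
  proof -
    have s: "b (hsum X y j) k = (\<Sum>i<j. b (y i) k)" if y: "\<And>i. i < j \<Longrightarrow> y i \<in> carr X" for y j
    proof -
      have z: "b (hzero X) k = 0"
      proof -
        have "hscale X 0 (hzero X) = hzero X" by (intro X.vec_eqI) auto
        then show ?thesis using bilinear_formD(2)[OF b, of "hzero X" k 0] xk by simp
      qed
      have "b (foldr (hadd X) (map y js) (hzero X)) k = (\<Sum>i\<leftarrow>js. b (y i) k)" if "\<forall>i\<in>set js. y i \<in> carr X" for js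
        using that by (induction js) (auto simp: z bilinear_formD(1)[OF b] X.foldr_hadd_closed xk)
      then show ?thesis
        unfolding hsum_def using y by (simp add: interv_sum_list_conv_sum_set_nat atLeast0LessThan)
    qed
    have "x = hadd X ?p r" using p xk r by (intro X.vec_eqI) (auto simp: r_def)
    then have "b x k = b ?p k + b r k" using bilinear_formD(1)[OF b p r xk(2)] by simp
    also have "b ?p k = (\<Sum>i<n. b (hscale X (hinner X (e i) x) (e i)) k)" using IH(1) by (intro s) auto
    also have "\<dots> = (\<Sum>i<n. hinner X (e i) x * b (e i) k)"
      using IH(1) xk by (intro sum.cong) (auto simp: bilinear_formD(2)[OF b])
    finally show ?thesis .
  qed
  define k'' where "k'' i = hadd K (k' i) (hscale K (c * hinner X (e i) x) k)" for i
  have k'': "k'' i \<in> carr K" if "i < n" for i using IH(2)[OF that] xk by (simp add: k''_def)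
  have sum: "(\<Sum>(c, x, k)\<leftarrow>a # xs. c * b x k) = (\<Sum>i<n. b (e i) (k'' i)) + c * b r k" if b: "bilinear_form X K b" for b
  proof -
    have "(\<Sum>i<n. b (e i) (k'' i)) = (\<Sum>i<n. b (e i) (k' i) + c * (hinner X (e i) x * b (e i) k))"
      using IH(1,2) xk by (intro sum.cong) (auto simp: k''_def bilinear_formD(3,4)[OF b] algebra_simps)
    then show ?thesis using IH(4)[OF b] bx[OF b] by (simp add: a sum.distrib sum_distrib_left algebra_simps)
  qed
  show ?case
  proof (cases "hnorm X r = 0")
    case True
    then have r0: "r = hzero X" using r X.norm_zero_iff by blast
    have "b r k = 0" if b: "bilinear_form X K b" for b
    proof -
      have "hscale X 0 r = r" unfolding r0 by (intro X.vec_eqI) auto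
      then show ?thesis using bilinear_formD(2)[OF b r xk(2), of 0] by simp
    qed
    then show ?thesis using sum IH(1,3) k'' by (intro exI[of _ n] exI[of _ e] exI[of _ k'']) simp
  next
    case False
    then have rn: "hnorm X r > 0" using X.norm_nonneg[OF r] by linarith
    let ?u = "hscale X (of_real (1 / hnorm X r)) r"
    let ?e = "e(n := ?u)" and ?k = "k''(n := hscale K (c * of_real (hnorm X r)) k)"
    have u: "?u \<in> carr X" "hinner X ?u ?u = 1" using r X.inner_normalized[OF r rn] by auto
    have eu: "hinner X (e i) ?u = 0" "hinner X ?u (e i) = 0" if "i < n" for i
      using er re that r IH(1) by auto
    have "hinner X (?e i) (?e j) = (if i = j then 1 else 0)" if "i < Suc n" "j < Suc n" for i j
      using that IH(3) eu u(2) by (auto simp: less_Suc_eq)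
    moreover have "(\<Sum>(c, x, k)\<leftarrow>a # xs. c * b x k) = (\<Sum>i<Suc n. b (?e i) (?k i))" if b: "bilinear_form X K b" for b
    proof -
      have "b ?u (hscale K (c * of_real (hnorm X r)) k) = c * b r k"
        using rn r xk u by (simp add: bilinear_formD(2)[OF b] bilinear_formD(4)[OF b])
      then show ?thesis using sum[OF b] by simp
    qed
    moreover have "\<forall>i<Suc n. ?e i \<in> carr X \<and> ?k i \<in> carr K"
      using IH(1) k'' u(1) xk by (auto simp: less_Suc_eq)
    ultimately show ?thesis by (intro exI[of _ "Suc n"] exI[of _ ?e] exI[of _ ?k]) simp
  qed
qed

text \<open>The tensor product of \<open>X\<close> and \<open>K\<close> together with a realisation
  of its kernel in \<open>G\<close>; the realisation is what makes the completion a Hilbert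
  space.\<close>

locale gram_tensor = X: hilbert_space X + K: hilbert_space K + gram_kernel G "carr X \<times> carr K" "tensor_form X K" f
  for X :: "'x hilb" and K :: "'k hilb" and G :: "'g hilb" and f
begin

abbreviation "TT \<equiv> tensor X K"

lemma TT_hilbert: "hilbert_space TT"
  unfolding tensor_def by (rule hilbert_HC)

sublocale TT: hilbert_space TT by (rule TT_hilbert)

lemma pt_carr: "x \<in> carr X \<Longrightarrow> k \<in> carr K \<Longrightarrow> pt X K x k \<in> carr TT"
  unfolding tensor_def pt_def by (rule hc_elt) auto

lemma inner_pt: "x \<in> carr X \<Longrightarrow> k \<in> carr K \<Longrightarrow> x' \<in> carr X \<Longrightarrow> k' \<in> carr K \<Longrightarrow>
    hinner TT (pt X K x k) (pt X K x' k') = hinner X x x' * hinner K k k'"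
  unfolding tensor_def pt_def by (subst inner_hc_elt) (auto simp: tensor_form_def)

lemma pt_total: "TT.total ((\<lambda>(x, k). pt X K x k) ` (carr X \<times> carr K))"
  using total_hc_elt unfolding tensor_def pt_def by (simp add: case_prod_unfold)

lemma pt_eqI:
  assumes "u \<in> carr TT" "v \<in> carr TT"
    "\<And>x k. x \<in> carr X \<Longrightarrow> k \<in> carr K \<Longrightarrow> hinner TT (pt X K x k) u = hinner TT (pt X K x k) v"
  shows "u = v"
  by (rule TT.totalD_eq[OF pt_total]) (use assms in auto)

lemma pt_bilinear:
  "x \<in> carr X \<Longrightarrow> y \<in> carr X \<Longrightarrow> k \<in> carr K \<Longrightarrow> pt X K (hadd X x y) k = hadd TT (pt X K x k) (pt X K y k)"
  "x \<in> carr X \<Longrightarrow> k \<in> carr K \<Longrightarrow> pt X K (hscale X c x) k = hscale TT c (pt X K x k)"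
  "x \<in> carr X \<Longrightarrow> k \<in> carr K \<Longrightarrow> l \<in> carr K \<Longrightarrow> pt X K x (hadd K k l) = hadd TT (pt X K x k) (pt X K x l)"
  "x \<in> carr X \<Longrightarrow> k \<in> carr K \<Longrightarrow> pt X K x (hscale K c k) = hscale TT c (pt X K x k)"
  by (rule pt_eqI; simp add: pt_carr inner_pt algebra_simps)+

text \<open>Complete contractivity for the column structure makes \<open>x \<otimes> k \<mapsto> R x k\<close> a contraction.\<close>

lemma tilde_exists:
  assumes R: "\<And>x. x \<in> carr X \<Longrightarrow> R x \<in> BH K"
    and R_add: "\<And>x y. x \<in> carr X \<Longrightarrow> y \<in> carr X \<Longrightarrow> R (hadd X x y) = op_add K K (R x) (R y)"
    and R_scale: "\<And>c x. x \<in> carr X \<Longrightarrow> R (hscale X c x) = op_scale K K c (R x)"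
    and cc: "completely_contractive X K R"
  shows "tilde X K R \<in> bop TT K" "x \<in> carr X \<Longrightarrow> k \<in> carr K \<Longrightarrow> tilde X K R (pt X K x k) = R x k"
proof -
  have Rc: "R x k \<in> carr K" if "x \<in> carr X" "k \<in> carr K" for x k using R[OF that(1)] that(2) by simp
  let ?p = "\<lambda>(x, k). pt X K x k" and ?R = "\<lambda>(x, k). R x k"
  have "hnorm K (K.lincomb ?R xs) \<le> 1 * hnorm TT (TT.lincomb ?p xs)" if xs: "snd ` set xs \<subseteq> carr X \<times> carr K" for xs
  proof -
    obtain n :: nat and e k' where d: "\<And>i. i < n \<Longrightarrow> e i \<in> carr X \<and> k' i \<in> carr K"
      "\<And>i j. i < n \<Longrightarrow> j < n \<Longrightarrow> hinner X (e i) (e j) = (if i = j then 1 else 0)"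
      "\<And>b. bilinear_form X K b \<Longrightarrow> (\<Sum>(c, x, k)\<leftarrow>xs. c * b x k) = (\<Sum>i<n. b (e i) (k' i))"
      using orthonormal_decomposition[OF X.hilbert_space_axioms K.hilbert_space_axioms xs] by blast
    have Rl: "K.lincomb ?R xs \<in> carr K" using xs Rc by (intro K.lincomb_closed) auto
    have pl: "TT.lincomb ?p xs \<in> carr TT" using xs pt_carr by (intro TT.lincomb_closed) auto
    have 1: "hinner K z (K.lincomb ?R xs) = (\<Sum>i<n. hinner K z (R (e i) (k' i)))" if z: "z \<in> carr K" for z
    proof -
      have "bilinear_form X K (\<lambda>x k. hinner K z (R x k))"
        using z Rc by (auto simp: bilinear_form_def R_add R_scale op_add_def op_scale_def bop_add[OF R] bop_scale[OF R])
      moreover have "hinner K z (K.lincomb ?R xs) = (\<Sum>(c, i)\<leftarrow>xs. c * hinner K z (?R i))"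
        using xs Rc z by (intro K.inner_lincomb) auto
      ultimately show ?thesis using d(3) by (simp add: case_prod_unfold)
    qed
    have 2: "hinner TT z (TT.lincomb ?p xs) = (\<Sum>i<n. hinner TT z (pt X K (e i) (k' i)))" if z: "z \<in> carr TT" for z
    proof -
      have "bilinear_form X K (\<lambda>x k. hinner TT z (pt X K x k))"
        using z by (auto simp: bilinear_form_def pt_bilinear pt_carr)
      moreover have "hinner TT z (TT.lincomb ?p xs) = (\<Sum>(c, i)\<leftarrow>xs. c * hinner TT z (?p i))"
        using xs pt_carr z by (intro TT.inner_lincomb) auto
      ultimately show ?thesis using d(3) by (simp add: case_prod_unfold)
    qed
    have n1: "(hnorm TT (TT.lincomb ?p xs))\<^sup>2 = (\<Sum>i<n. (hnorm K (k' i))\<^sup>2)"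
    proof -
      have "hinner TT (TT.lincomb ?p xs) (pt X K (e i) (k' i)) = of_real ((hnorm K (k' i))\<^sup>2)" if i: "i < n" for i
      proof -
        have c: "pt X K (e i) (k' i) \<in> carr TT" using d(1)[OF i] pt_carr by blast
        have "hinner TT (pt X K (e i) (k' i)) (TT.lincomb ?p xs) = (\<Sum>j<n. if i = j then hinner K (k' i) (k' j) else 0)"
          unfolding 2[OF c] using d(1) d(2)[OF i] i by (intro sum.cong) (auto simp: inner_pt)
        then have "hinner TT (pt X K (e i) (k' i)) (TT.lincomb ?p xs) = of_real ((hnorm K (k' i))\<^sup>2)"
          using i d(1)[OF i] by (simp add: K.inner_self)
        then show ?thesis using TT.inner_commute[OF c pl] by simp
      qed
      then have "hinner TT (TT.lincomb ?p xs) (TT.lincomb ?p xs) = of_real (\<Sum>i<n. (hnorm K (k' i))\<^sup>2)"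
        unfolding 2[OF pl] by simp
      then show ?thesis unfolding TT.inner_self[OF pl] of_real_eq_iff .
    qed
    have Rs: "K.lincomb ?R xs = hsum K (\<lambda>j. R (e j) (k' j)) n"
      using 1 d(1) Rc Rl by (intro K.vec_eqI) (auto simp: K.inner_hsum K.hsum_closed)
    have "(hnorm K (K.lincomb ?R xs))\<^sup>2 \<le> (\<Sum>i<n. (hnorm K (k' i))\<^sup>2)"
    proof (cases "n = 0")
      case True
      then show ?thesis using Rs by (simp add: hsum_def)
    next
      case False
      \<comment> \<open>The square matrix whose first row is the orthonormal family e and whose
        other rows vanish. As a map from scalar columns to columns over \<open>X\<close> it is
        isometric, so the bound 1 is admissible in complete contractivity, and the first row of the
        image is the sum to be estimated.\<close>
      define M where "M i j = (if i = (0::nat) then e j else hzero X)" for i j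
      have Mc: "\<forall>i<n. \<forall>j<n. M i j \<in> carr X" using d(1) by (auto simp: M_def)
      have "(\<Sum>i<n. (hnorm X (hsum X (\<lambda>j. hscale X (\<xi> j) (M i j)) n))\<^sup>2) \<le> 1\<^sup>2 * (\<Sum>j<n. (cmod (\<xi> j))\<^sup>2)" for \<xi>
      proof -
        have "(hnorm X (hsum X (\<lambda>j. hscale X (\<xi> j) (M i j)) n))\<^sup>2 = (if i = 0 then (\<Sum>j<n. (cmod (\<xi> j))\<^sup>2) else 0)" if i: "i < n" for i
        proof -
          let ?h = "hsum X (\<lambda>j. hscale X (\<xi> j) (M i j)) n"
          have mc: "hscale X (\<xi> j) (M i j) \<in> carr X" if "j < n" for j using Mc that i by simp
          have hc: "?h \<in> carr X" using mc by (rule X.hsum_closed)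
          have "hinner X ?h ?h = (\<Sum>j<n. \<Sum>l<n. hinner X (hscale X (\<xi> l) (M i l)) (hscale X (\<xi> j) (M i j)))"
            using mc hc by (subst X.inner_hsum) (auto intro!: sum.cong X.inner_hsum_left)
          also have "\<dots> = (\<Sum>j<n. \<Sum>l<n. if j = l then (if i = 0 then cnj (\<xi> j) * \<xi> j else 0) else 0)"
            using d(1,2) by (intro sum.cong refl) (auto simp: M_def)
          also have "\<dots> = (\<Sum>j<n. if i = 0 then cnj (\<xi> j) * \<xi> j else 0)" by (intro sum.cong refl) simp
          also have "\<dots> = of_real (if i = 0 then (\<Sum>j<n. (cmod (\<xi> j))\<^sup>2) else 0)" by (simp add: cnj_mult_self)
          finally show ?thesis unfolding X.inner_self[OF hc] of_real_eq_iff .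
        qed
        then have "(\<Sum>i<n. (hnorm X (hsum X (\<lambda>j. hscale X (\<xi> j) (M i j)) n))\<^sup>2) =
            (\<Sum>i<n. if i = 0 then (\<Sum>j<n. (cmod (\<xi> j))\<^sup>2) else 0)" by (intro sum.cong) auto
        then show ?thesis using False by simp
      qed
      then have "(\<Sum>i<n. (hnorm K (hsum K (\<lambda>j. R (M i j) (k' j)) n))\<^sup>2) \<le> 1\<^sup>2 * (\<Sum>j<n. (hnorm K (k' j))\<^sup>2)"
        using cc[unfolded completely_contractive_def, rule_format, of n M 1 k'] Mc d(1) by auto
      moreover have "(hnorm K (hsum K (\<lambda>j. R (M 0 j) (k' j)) n))\<^sup>2 \<le> (\<Sum>i<n. (hnorm K (hsum K (\<lambda>j. R (M i j) (k' j)) n))\<^sup>2)"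
        using False by (intro member_le_sum) auto
      ultimately show ?thesis unfolding Rs by (simp add: M_def)
    qed
    then have "(hnorm K (K.lincomb ?R xs))\<^sup>2 \<le> (hnorm TT (TT.lincomb ?p xs))\<^sup>2" using n1 by simp
    then show ?thesis using pl by (simp add: power2_le_iff_abs_le)
  qed
  note contr = this
  have im: "?R ` (carr X \<times> carr K) \<subseteq> carr K" using Rc by auto
  obtain T where T: "T \<in> bop TT K" "\<forall>i\<in>carr X \<times> carr K. T (?p i) = ?R i"
    using bounded_extension[OF TT_hilbert K.hilbert_space_axioms pt_total im contr] by blast
  have "tilde X K R = T"
    unfolding tilde_def using T by (intro ext_op_works[OF TT_hilbert K.hilbert_space_axioms pt_total]) auto
  then show "tilde X K R \<in> bop TT K" "x \<in> carr X \<Longrightarrow> k \<in> carr K \<Longrightarrow> tilde X K R (pt X K x k) = R x k"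
    using T by auto
qed

end

section \<open>The product system representation\<close>

text \<open>The dilation of \<theta> is carried along because the fibre over (t, 0) is the tensor
  product of \<open>E t\<close> with the fibre of \<theta> at time 0, which is recognised as
  one-dimensional through \<beta>.\<close>

locale product_dilation =
  A: dilation H K J \<phi> \<alpha> h0 + B: dilation H K J \<theta> \<beta> h0
  for H :: "'h hilb" and K :: "'k hilb" and J \<phi> \<theta> \<alpha> \<beta> h0 +
  fixes m :: "real \<times> real \<Rightarrow> real \<times> real \<Rightarrow> 'h fib2 \<Rightarrow> 'h fib2 \<Rightarrow> 'h fib2"
    and T :: "real \<times> real \<Rightarrow> 'h fib2 \<Rightarrow> 'h \<Rightarrow> 'h"
    and V :: "real \<times> real \<Rightarrow> 'h fib2 \<Rightarrow> 'k \<Rightarrow> 'k" and e :: "'h fib2"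
  assumes m_inE: "s \<ge> 0 \<Longrightarrow> s' \<ge> 0 \<Longrightarrow> x \<in> carr (ms_fibre H \<phi> s) \<Longrightarrow> x' \<in> carr (ms_fibre H \<phi> s') \<Longrightarrow>
      m (s, 0) (s', 0) (inE H \<phi> \<theta> s x) (inE H \<phi> \<theta> s' x') = inE H \<phi> \<theta> (s + s') (ms_mult H \<phi> s s' x x')"
    and T_pt: "s \<ge> 0 \<Longrightarrow> t \<ge> 0 \<Longrightarrow> x \<in> carr (ms_fibre H \<phi> s) \<Longrightarrow> y \<in> carr (ms_fibre H \<theta> t) \<Longrightarrow>
      T (s, t) (pt2 H \<phi> \<theta> s t x y) = ms_rep H \<phi> s x \<circ>\<^bsub>H\<^esub> ms_rep H \<theta> t y"
    and V_rep: "ps_representation Rplus2 (fibre2 H \<phi> \<theta>) e m K V"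
    and V_iso: "rep_isometric Rplus2 (fibre2 H \<phi> \<theta>) K V"
    and V_coiso: "rep_fully_coisometric Rplus2 (fibre2 H \<phi> \<theta>) K V"
    and V_T: "p \<in> Rplus2 \<Longrightarrow> \<xi> \<in> carr (fibre2 H \<phi> \<theta> p) \<Longrightarrow> compr H K J (V p \<xi>) = T p \<xi>"
    and alpha: "t \<ge> 0 \<Longrightarrow> A \<in> BH K \<Longrightarrow>
      \<alpha> t A = conj_semigroup (ms_fibre H \<phi>) K (\<lambda>t x. V (t, 0) (inE H \<phi> \<theta> t x)) t A"
begin

abbreviation E where "E t \<equiv> ms_fibre H \<phi> t"
abbreviation F where "F \<equiv> ms_fibre H \<theta> 0"
abbreviation \<iota> where "\<iota> \<equiv> ms_iota H \<theta> 0"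
abbreviation X where "X t \<equiv> tensor (E t) F"
abbreviation jE where "jE t \<equiv> inE H \<phi> \<theta> t"

lemma jE_def: "jE t x = pt (E t) F x \<iota>"
  by (simp add: inE_def pt2_def)

lemma fibre2_t0: "fibre2 H \<phi> \<theta> (t, 0) = X t"
  by (simp add: fibre2_def)

text \<open>An element of the one-dimensional second factor is replaced by its coordinate with
  respect to \<open>\<iota>\<close>; the first factor is represented by the vector
  \<open>A.S t x A.d0\<close> of \<open>K\<close>.\<close>

lemma X_gram: "t \<ge> 0 \<Longrightarrow> gram_kernel K (carr (E t) \<times> carr F) (tensor_form (E t) F)
    (\<lambda>(x, y). hscale K (hinner F \<iota> y) (A.S t x A.d0))"
  by unfold_locales
    (use A.d0 in \<open>auto simp: tensor_form_def A.S_inner B.E0_inner[of _ _] algebra_simps\<close>)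

lemma X_hilbert: "t \<ge> 0 \<Longrightarrow> hilbert_space (X t)"
  unfolding tensor_def by (rule gram_kernel.hilbert_HC[OF X_gram])

lemma pt_carr: "t \<ge> 0 \<Longrightarrow> x \<in> carr (E t) \<Longrightarrow> y \<in> carr F \<Longrightarrow> pt (E t) F x y \<in> carr (X t)"
  unfolding tensor_def pt_def by (rule gram_kernel.hc_elt(1)[OF X_gram]) auto

lemma inner_pt: "t \<ge> 0 \<Longrightarrow> x \<in> carr (E t) \<Longrightarrow> y \<in> carr F \<Longrightarrow> x' \<in> carr (E t) \<Longrightarrow> y' \<in> carr F \<Longrightarrow>
    hinner (X t) (pt (E t) F x y) (pt (E t) F x' y') = hinner (E t) x x' * hinner F y y'"
  unfolding tensor_def pt_def by (subst gram_kernel.inner_hc_elt[OF X_gram]) (auto simp: tensor_form_def)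

lemma pt_total: "t \<ge> 0 \<Longrightarrow> inner_space.total (X t) ((\<lambda>(x, y). pt (E t) F x y) ` (carr (E t) \<times> carr F))"
  using gram_kernel.total_hc_elt[OF X_gram, of t] unfolding tensor_def pt_def by (simp add: case_prod_unfold)

lemma jE_carr [simp]: "t \<ge> 0 \<Longrightarrow> x \<in> carr (E t) \<Longrightarrow> jE t x \<in> carr (X t)"
  unfolding jE_def using B.iota0_E by (intro pt_carr)

lemma inner_jE: "t \<ge> 0 \<Longrightarrow> x \<in> carr (E t) \<Longrightarrow> x' \<in> carr (E t) \<Longrightarrow>
    hinner (X t) (jE t x) (jE t x') = hinner (E t) x x'"
  unfolding jE_def using B.iota0_E B.iota0_inner by (simp add: inner_pt)

text \<open>Since \<open>\<iota>\<close> spans the second factor, every elementary tensor is a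
  multiple of some \<open>jE t x\<close>. So \<open>E t\<close> can replace the fibre over (t,
  0).\<close>

lemma jE_total:
  assumes t: "t \<ge> 0"
  shows "inner_space.total (X t) (jE t ` carr (E t))"
proof -
  interpret X: hilbert_space "X t" by (rule X_hilbert[OF t])
  have pt: "pt (E t) F x y = hscale (X t) (hinner F \<iota> y) (jE t x)" if xy: "x \<in> carr (E t)" "y \<in> carr F" for x y
  proof (rule X.totalD_eq[OF pt_total[OF t]])
    fix s assume "s \<in> (\<lambda>(x, y). pt (E t) F x y) ` (carr (E t) \<times> carr F)"
    then obtain x' y' where s: "s = pt (E t) F x' y'" "x' \<in> carr (E t)" "y' \<in> carr F" by auto
    then show "hinner (X t) s (pt (E t) F x y) = hinner (X t) s (hscale (X t) (hinner F \<iota> y) (jE t x))"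
      using t xy B.iota0_E B.iota0_inner pt_carr[OF t s(2,3)]
      by (simp add: inner_pt jE_def B.E0_inner[of y' y] B.E0_inner[of y' \<iota>] pt_carr)
  qed (use t xy pt_carr in auto)
  show ?thesis
    unfolding X.total_def
  proof (intro conjI ballI impI)
    fix z assume z: "z \<in> carr (X t)" "\<forall>s\<in>jE t ` carr (E t). hinner (X t) s z = 0"
    show "z = hzero (X t)"
      by (rule X.totalD[OF pt_total[OF t] z(1)]) (use z t in \<open>auto simp: pt\<close>)
  qed (use t in auto)
qed

text \<open>\<open>X(t,0)\<close> embeds isometrically into \<open>K\<close>, with range in the projection \<open>pt0\<close>; this makes
  the tensor product with \<open>K\<close> a Gram space.\<close>

lemma XK_gram:
  assumes t: "t \<ge> 0"
  shows "\<exists>\<Psi>. gram_tensor (X t) K K (\<lambda>(\<xi>, k). A.rop t (\<Psi> \<xi>) k)"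
proof -
  interpret X: hilbert_space "X t" by (rule X_hilbert[OF t])
  obtain \<Psi> where \<Psi>: "isometry (X t) K \<Psi>"
    "\<And>x y. x \<in> carr (E t) \<Longrightarrow> y \<in> carr F \<Longrightarrow> \<Psi> (pt (E t) F x y) = hscale K (hinner F \<iota> y) (A.S t x A.d0)"
    using gram_kernel.hc_isometry[OF X_gram[OF t]] unfolding tensor_def pt_def by fastforce
  have \<Psi>b: "\<Psi> \<in> bop (X t) K" using \<Psi>(1) by (rule isometry_bop)
  have pB: "A.pt0 t \<in> BH K" unfolding A.pt0_def using t A.d0 by simp
  have "A.pt0 t \<circ>\<^bsub>X t\<^esub> \<Psi> = \<Psi>"
  proof (rule bop_total_eq[OF X.hilbert_space_axioms A.hil(2) _ \<Psi>b jE_total[OF t]])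
    show "A.pt0 t \<circ>\<^bsub>X t\<^esub> \<Psi> \<in> bop (X t) K"
      by (rule comp_bop[OF X.hilbert_space_axioms A.hil(2) \<Psi>b pB])
    fix s assume "s \<in> jE t ` carr (E t)"
    then obtain x where x: "x \<in> carr (E t)" "s = jE t x" by auto
    have "\<Psi> s = hscale K (hinner F \<iota> \<iota>) (A.S t x A.d0)"
      unfolding x(2) jE_def by (rule \<Psi>(2)[OF x(1) B.iota0_E])
    also have "\<dots> = A.S t x A.d0" using t x A.d0 by (simp add: B.iota0_inner) (auto intro: A.G.vec_eqI)
    also have "\<dots> = A.gam t (x h0)" using A.S_J[OF t x(1)] A.h0 by simp
    finally show "(A.pt0 t \<circ>\<^bsub>X t\<^esub> \<Psi>) s = \<Psi> s" using A.E_h0(2)[OF t x(1)] t x by simp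
  qed
  note eq = this
  have pf: "A.pt0 t (\<Psi> \<xi>) = \<Psi> \<xi>" if "\<xi> \<in> carr (X t)" for \<xi> using fun_cong[OF eq, of \<xi>] that by simp
  have "gram_tensor (X t) K K (\<lambda>(\<xi>, k). A.rop t (\<Psi> \<xi>) k)"
  proof unfold_locales
    show "(case i of (\<xi>, k) \<Rightarrow> A.rop t (\<Psi> \<xi>) k) \<in> carr K" if "i \<in> carr (X t) \<times> carr K" for i
      using that t \<Psi>b by auto
    fix i j assume "i \<in> carr (X t) \<times> carr K" "j \<in> carr (X t) \<times> carr K"
    then obtain \<xi> k \<xi>' k' where ij: "i = (\<xi>, k)" "j = (\<xi>', k')" "\<xi> \<in> carr (X t)" "k \<in> carr K" "\<xi>' \<in> carr (X t)" "k' \<in> carr K"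
      by auto
    have "hinner K (\<Psi> \<xi>) (\<Psi> \<xi>') = hinner (X t) \<xi> \<xi>'"
      using \<Psi>(1) ij isometry_iff[OF X.hilbert_space_axioms A.hil(2)] by blast
    then show "tensor_form (X t) K i j = hinner K (case i of (\<xi>, k) \<Rightarrow> A.rop t (\<Psi> \<xi>) k) (case j of (\<xi>, k) \<Rightarrow> A.rop t (\<Psi> \<xi>) k)"
      using ij t pf \<Psi>b by (simp add: tensor_form_def A.rop_inner)
  qed
  then show ?thesis by blast
qed

lemma V_props:
  assumes t: "t \<ge> 0"
  shows "\<xi> \<in> carr (X t) \<Longrightarrow> V (t, 0) \<xi> \<in> BH K"
    and "\<xi> \<in> carr (X t) \<Longrightarrow> \<eta> \<in> carr (X t) \<Longrightarrow> V (t, 0) (hadd (X t) \<xi> \<eta>) = op_add K K (V (t, 0) \<xi>) (V (t, 0) \<eta>)"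
    and "\<xi> \<in> carr (X t) \<Longrightarrow> V (t, 0) (hscale (X t) c \<xi>) = op_scale K K c (V (t, 0) \<xi>)"
    and "completely_contractive (X t) K (V (t, 0))"
proof -
  have "(t, 0) \<in> Rplus2" using t by simp
  from bspec[OF conjunct1[OF V_rep[unfolded ps_representation_def]] this]
  have *: "V (t, 0) ` carr (X t) \<subseteq> BH K \<and>
        (\<forall>x\<in>carr (X t). \<forall>y\<in>carr (X t). V (t, 0) (hadd (X t) x y) = op_add K K (V (t, 0) x) (V (t, 0) y)) \<and>
        (\<forall>c. \<forall>x\<in>carr (X t). V (t, 0) (hscale (X t) c x) = op_scale K K c (V (t, 0) x)) \<and>
        completely_contractive (X t) K (V (t, 0))"
    unfolding fibre2_t0 .
  show "\<xi> \<in> carr (X t) \<Longrightarrow> V (t, 0) \<xi> \<in> BH K" using * by blast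
  show "\<xi> \<in> carr (X t) \<Longrightarrow> \<eta> \<in> carr (X t) \<Longrightarrow> V (t, 0) (hadd (X t) \<xi> \<eta>) = op_add K K (V (t, 0) \<xi>) (V (t, 0) \<eta>)"
    using * by simp
  show "\<xi> \<in> carr (X t) \<Longrightarrow> V (t, 0) (hscale (X t) c \<xi>) = op_scale K K c (V (t, 0) \<xi>)"
    using * by simp
  show "completely_contractive (X t) K (V (t, 0))" using * by simp
qed

text \<open>Isometry of the tilde operator is the inner product formula. Coisometry gives totality:
  a vector orthogonal to all \<open>V (t, 0) \<xi> k\<close> is annihilated by the adjoint, and the
  tilde operator recovers the vector from that.\<close>

lemma V_inner_total:
  assumes t: "t \<ge> 0"
  shows "\<xi> \<in> carr (X t) \<Longrightarrow> k \<in> carr K \<Longrightarrow> \<eta> \<in> carr (X t) \<Longrightarrow> l \<in> carr K \<Longrightarrow>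
      hinner K (V (t, 0) \<xi> k) (V (t, 0) \<eta> l) = hinner (X t) \<xi> \<eta> * hinner K k l"
    and "y \<in> carr K \<Longrightarrow> (\<And>\<xi> k. \<xi> \<in> carr (X t) \<Longrightarrow> k \<in> carr K \<Longrightarrow> hinner K (V (t, 0) \<xi> k) y = 0) \<Longrightarrow> y = hzero K"
proof -
  obtain \<Psi> where "gram_tensor (X t) K K (\<lambda>(\<xi>, k). A.rop t (\<Psi> \<xi>) k)" using XK_gram[OF t] by blast
  then interpret GT: gram_tensor "X t" K K "\<lambda>(\<xi>, k). A.rop t (\<Psi> \<xi>) k" .
  let ?\<tau> = "tilde (X t) K (V (t, 0))"
  have \<tau>: "?\<tau> \<in> bop GT.TT K" "?\<tau> (pt (X t) K \<xi> k) = V (t, 0) \<xi> k" if "\<xi> \<in> carr (X t)" "k \<in> carr K" for \<xi> k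
    using GT.tilde_exists[of "V (t, 0)"] V_props[OF t] that by auto
  have iso: "isometry GT.TT K ?\<tau>" "coisometry GT.TT K ?\<tau>"
    using V_iso V_coiso t unfolding rep_isometric_def rep_fully_coisometric_def by (metis SigmaI atLeast_iff fibre2_t0 order_refl)+
  have \<tau>b: "?\<tau> \<in> bop GT.TT K" using iso(1) by (rule isometry_bop)
  show "hinner K (V (t, 0) \<xi> k) (V (t, 0) \<eta> l) = hinner (X t) \<xi> \<eta> * hinner K k l"
    if "\<xi> \<in> carr (X t)" "k \<in> carr K" "\<eta> \<in> carr (X t)" "l \<in> carr K"
  proof -
    have "hinner K (?\<tau> (pt (X t) K \<xi> k)) (?\<tau> (pt (X t) K \<eta> l)) = hinner GT.TT (pt (X t) K \<xi> k) (pt (X t) K \<eta> l)"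
      using iso(1) that GT.pt_carr isometry_iff[OF GT.TT_hilbert A.hil(2)] by blast
    then show ?thesis using that \<tau>(2) by (simp add: GT.inner_pt)
  qed
  show "y = hzero K" if y: "y \<in> carr K" and orth: "\<And>\<xi> k. \<xi> \<in> carr (X t) \<Longrightarrow> k \<in> carr K \<Longrightarrow> hinner K (V (t, 0) \<xi> k) y = 0"
  proof -
    have "adj GT.TT K ?\<tau> y = hzero GT.TT"
    proof (rule GT.TT.totalD[OF GT.pt_total])
      show "adj GT.TT K ?\<tau> y \<in> carr GT.TT" using \<tau>b y GT.TT_hilbert A.hil by simp
      fix s assume "s \<in> (\<lambda>(x, k). pt (X t) K x k) ` (carr (X t) \<times> carr K)"
      then obtain \<xi> k where s: "s = pt (X t) K \<xi> k" "\<xi> \<in> carr (X t)" "k \<in> carr K" by auto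
      then show "hinner GT.TT s (adj GT.TT K ?\<tau> y) = 0"
        using inner_adj[OF GT.TT_hilbert A.hil(2) \<tau>b GT.pt_carr[OF s(2,3)] y] \<tau>(2)[OF s(2,3)] orth by simp
    qed
    then show ?thesis
      using coisometry_adj_apply[OF iso(2) y] bop_zero[OF \<tau>b GT.TT_hilbert A.hil(2)] by simp
  qed
qed

definition W :: "real \<Rightarrow> 'h fib \<Rightarrow> 'k \<Rightarrow> 'k" where
  "W t x = V (t, 0) (jE t x)"

lemma W_bop [simp]: "t \<ge> 0 \<Longrightarrow> x \<in> carr (E t) \<Longrightarrow> W t x \<in> BH K"
  by (simp add: W_def V_props)

lemma W_carr [simp]: "t \<ge> 0 \<Longrightarrow> x \<in> carr (E t) \<Longrightarrow> k \<in> carr K \<Longrightarrow> W t x k \<in> carr K"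
  by (rule bop_carr[OF W_bop])

lemma W_inner: "t \<ge> 0 \<Longrightarrow> x \<in> carr (E t) \<Longrightarrow> y \<in> carr (E t) \<Longrightarrow> k \<in> carr K \<Longrightarrow> l \<in> carr K \<Longrightarrow>
    hinner K (W t x k) (W t y l) = hinner (E t) x y * hinner K k l"
  by (simp add: W_def V_inner_total inner_jE)

text \<open>For fixed k the map from \<xi> to \<open>V (t, 0) \<xi> k\<close> is bounded, so
  orthogonality to y on the total family \<open>jE t x\<close> extends to all \<xi> by way of the
  adjoint.\<close>

lemma W_total:
  assumes t: "t \<ge> 0" and y: "y \<in> carr K"
    and orth: "\<And>x k. x \<in> carr (E t) \<Longrightarrow> k \<in> carr K \<Longrightarrow> hinner K (W t x k) y = 0"
  shows "y = hzero K"
proof (rule V_inner_total(2)[OF t y])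
  interpret X: hilbert_space "X t" by (rule X_hilbert[OF t])
  fix \<xi> k assume \<xi>: "\<xi> \<in> carr (X t)" and k: "k \<in> carr K"
  have c: "V (t, 0) \<xi> k \<in> carr K" if "\<xi> \<in> carr (X t)" for \<xi> using V_props(1)[OF t that] k by simp
  let ?R = "\<lambda>\<xi>\<in>carr (X t). V (t, 0) \<xi> k"
  have R: "?R \<in> bop (X t) K"
  proof (rule bopI[where b = "hnorm K k"])
    fix \<xi> assume x: "\<xi> \<in> carr (X t)"
    have "of_real ((hnorm K (V (t, 0) \<xi> k))\<^sup>2) = complex_of_real ((hnorm K k * hnorm (X t) \<xi>)\<^sup>2)"
      using V_inner_total(1)[OF t x k x k] x k c[OF x] by (simp add: A.G.inner_self X.inner_self power_mult_distrib mult.commute)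
    then have "(hnorm K (V (t, 0) \<xi> k))\<^sup>2 = (hnorm K k * hnorm (X t) \<xi>)\<^sup>2" by (simp only: of_real_eq_iff)
    then show "hnorm K (?R \<xi>) \<le> hnorm K k * hnorm (X t) \<xi>"
      using x k c[OF x] by (simp add: power2_eq_iff_nonneg)
  qed (use c k V_props[OF t] in \<open>auto simp: op_add_def op_scale_def\<close>)
  have Rc: "adj (X t) K ?R y \<in> carr (X t)" using adj_carr[OF X.hilbert_space_axioms A.hil(2) R y] .
  have "adj (X t) K ?R y = hzero (X t)"
  proof (rule X.totalD[OF jE_total[OF t] Rc])
    fix s assume "s \<in> jE t ` carr (E t)"
    then obtain x where s: "s = jE t x" "x \<in> carr (E t)" by auto
    have sc: "s \<in> carr (X t)" using s t by simp
    have "hinner (X t) s (adj (X t) K ?R y) = hinner K (?R s) y"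
      by (rule inner_adj[OF X.hilbert_space_axioms A.hil(2) R sc y])
    also have "\<dots> = hinner K (W t x k) y" using sc s by (simp add: W_def)
    finally show "hinner (X t) s (adj (X t) K ?R y) = 0" using orth[OF s(2) k] by simp
  qed
  then have "hinner K (?R \<xi>) y = 0"
    using inner_adj[OF X.hilbert_space_axioms A.hil(2) R \<xi> y] \<xi> by simp
  then show "hinner K (V (t, 0) \<xi> k) y = 0" using \<xi> by simp
qed

lemma W_mult:
  assumes "s \<ge> 0" "t \<ge> 0" "x \<in> carr (E s)" "y \<in> carr (E t)" "k \<in> carr K"
  shows "W (s + t) (ms_mult H \<phi> s t x y) k = W s x (W t y k)"
proof -
  have st: "(s, 0) \<in> Rplus2" "(t, 0) \<in> Rplus2" using assms by auto
  have "\<forall>p\<in>Rplus2. \<forall>q\<in>Rplus2. \<forall>x\<in>carr (fibre2 H \<phi> \<theta> p). \<forall>y\<in>carr (fibre2 H \<phi> \<theta> q).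
      V (p + q) (m p q x y) = V p x \<circ>\<^bsub>K\<^esub> V q y"
    using V_rep unfolding ps_representation_def by simp
  then have "V ((s, 0) + (t, 0)) (m (s, 0) (t, 0) (jE s x) (jE t y)) = V (s, 0) (jE s x) \<circ>\<^bsub>K\<^esub> V (t, 0) (jE t y)"
    using st assms by (metis fibre2_t0 jE_carr)
  then show ?thesis using assms by (simp add: W_def m_inE)
qed

text \<open>The dilation property of \<open>V\<close> computes the compression as a product of the
  two Muhly-Solel representations, and the factor of \<theta> is the identity because it is
  evaluated at \<open>\<iota>\<close>.\<close>

lemma W_compr:
  assumes t: "t \<ge> 0" and x: "x \<in> carr (E t)" and hk: "h \<in> carr H" "k \<in> carr H"
  shows "hinner K (J h) (W t x (J k)) = hinner H h (ms_rep H \<phi> t x k)"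
proof -
  have "compr H K J (W t x) = T (t, 0) (jE t x)"
    unfolding W_def using t x fibre2_t0 jE_carr by (intro V_T) auto
  also have "\<dots> = ms_rep H \<phi> t x \<circ>\<^bsub>H\<^esub> ms_rep H \<theta> 0 \<iota>"
    unfolding inE_def using t x B.iota0_E by (intro T_pt) auto
  finally have "compr H K J (W t x) k = ms_rep H \<phi> t x k" using hk B.iota0_rep by simp
  then have "A.Js (W t x (J k)) = ms_rep H \<phi> t x k" using hk by (simp add: compr_def)
  then show ?thesis using A.inner_Js[OF hk(1), of "W t x (J k)"] t x hk by simp
qed

lemma EK_gram: "t \<ge> 0 \<Longrightarrow> gram_kernel K (carr (E t) \<times> carr K) (tensor_form (E t) K) (\<lambda>(x, k). W t x k)"
  "t \<ge> 0 \<Longrightarrow> gram_kernel K (carr (E t) \<times> carr K) (tensor_form (E t) K) (\<lambda>(x, k). A.S t x k)"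
  by (unfold_locales; auto simp: tensor_form_def W_inner A.S_inner)+

text \<open>The definition of \<open>\<alpha> t A\<close> involves the amplification of
  \<open>A\<close> on the tensor product of \<open>E t\<close> and \<open>K\<close>, whose existence
  as a bounded operator has to be established. Besides \<open>W\<close>, the intertwiners
  \<open>A.S\<close> also realise this tensor product inside \<open>K\<close>, and for them the
  intertwining relation with \<alpha> is already known.\<close>

lemma alpha_W:
  assumes t: "t \<ge> 0" and A: "A \<in> BH K" and x: "x \<in> carr (E t)" and k: "k \<in> carr K"
  shows "\<alpha> t A (W t x k) = W t x (A k)"
proof -
  let ?TT = "tensor (E t) K" and ?S = "carr (E t) \<times> carr K" and ?p = "\<lambda>(x, k). pt (E t) K x k"
  have TT: "hilbert_space ?TT" unfolding tensor_def by (rule gram_kernel.hilbert_HC[OF EK_gram(1)[OF t]])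
  have ptc: "pt (E t) K x k \<in> carr ?TT" if "x \<in> carr (E t)" "k \<in> carr K" for x k
    unfolding tensor_def pt_def by (rule gram_kernel.hc_elt(1)[OF EK_gram(1)[OF t]]) (use that in auto)
  have tot: "inner_space.total ?TT (?p ` ?S)"
    using gram_kernel.total_hc_elt[OF EK_gram(1)[OF t]] unfolding tensor_def pt_def by (simp add: case_prod_unfold)
  obtain R where R: "isometry ?TT K R" "\<And>x k. x \<in> carr (E t) \<Longrightarrow> k \<in> carr K \<Longrightarrow> R (pt (E t) K x k) = W t x k"
    using gram_kernel.hc_isometry[OF EK_gram(1)[OF t]] unfolding tensor_def pt_def by fastforce
  obtain R' where R': "isometry ?TT K R'" "\<And>x k. x \<in> carr (E t) \<Longrightarrow> k \<in> carr K \<Longrightarrow> R' (pt (E t) K x k) = A.S t x k"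
    using gram_kernel.hc_isometry[OF EK_gram(2)[OF t]] unfolding tensor_def pt_def by fastforce
  note Rb = isometry_bop[OF R(1)] and Rb' = isometry_bop[OF R'(1)]
  have tl: "tilde (E t) K (\<lambda>x. V (t, 0) (jE t x)) = R"
    unfolding tilde_def using R(2) by (intro ext_op_works[OF TT A.hil(2) tot Rb]) (auto simp: W_def)
  \<comment> \<open>The amplification of \<open>A\<close>, obtained by compressing
    \<open>\<alpha> t A\<close> along the realisation by \<open>A.S\<close>.\<close>
  define Q where "Q = adj ?TT K R' \<circ>\<^bsub>?TT\<^esub> (\<alpha> t A \<circ>\<^bsub>?TT\<^esub> R')"
  have aR: "\<alpha> t A \<circ>\<^bsub>?TT\<^esub> R' \<in> bop ?TT K"
    by (rule comp_bop[OF TT A.hil(2) Rb' A.sigma_bop[OF t A]])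
  have Q: "Q \<in> BH ?TT"
    unfolding Q_def by (rule comp_bop[OF TT A.hil(2) aR]) (use TT A.hil Rb' in simp)
  have Qpt: "Q (pt (E t) K x k) = pt (E t) K x (A k)" if xk: "x \<in> carr (E t)" "k \<in> carr K" for x k
  proof -
    have "\<alpha> t A (R' (pt (E t) K x k)) = R' (pt (E t) K x (A k))"
      using xk A t by (simp add: R'(2) A.S_intertwine)
    then show ?thesis using isometry_adj_apply[OF R'(1), of "pt (E t) K x (A k)"] ptc xk A by (simp add: Q_def)
  qed
  have am: "ampl (E t) K A = Q"
    unfolding ampl_def using Qpt by (intro ext_op_works[OF TT TT tot Q]) auto
  have "\<alpha> t A (W t x k) = R (Q (adj ?TT K R (R (pt (E t) K x k))))"
    using fun_cong[OF alpha[OF t A], of "W t x k"] W_carr[OF t x k] R(2)[OF x k]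
    unfolding conj_semigroup_def tl am by simp
  also have "\<dots> = R (pt (E t) K x (A k))"
    using isometry_adj_apply[OF R(1) ptc[OF x k]] Qpt[OF x k] by simp
  finally show ?thesis using R(2)[OF x, of "A k"] A k by simp
qed

end

section \<open>Unitary conjugation and infinite-dimensionality\<close>

lemma unitary_adj_apply: "unitary_op H K U \<Longrightarrow> x \<in> carr H \<Longrightarrow> adj H K U (U x) = x"
  "unitary_op H K U \<Longrightarrow> y \<in> carr K \<Longrightarrow> U (adj H K U y) = y"
  by (simp_all add: unitary_op_def isometry_adj_apply coisometry_adj_apply)

text \<open>The map \<Phi> need only agree with the conjugation on vectors of the carrier, so that
  the lemma covers a given \<open>\<phi> t\<close> as well as an explicit conjugation.\<close>

lemma conjugation_star_iso:
  assumes H: "hilbert_space H" and K: "hilbert_space K" and u: "unitary_op H K u"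
    and eq: "\<And>A k. A \<in> BH H \<Longrightarrow> k \<in> carr K \<Longrightarrow> \<Phi> A k = u (A (adj H K u k))"
    and \<Phi>: "\<And>A. A \<in> BH H \<Longrightarrow> \<Phi> A \<in> BH K"
  shows "star_iso H K \<Phi>"
proof -
  interpret H: hilbert_space H by (rule H)
  interpret K: hilbert_space K by (rule K)
  let ?w = "adj H K u"
  have uB: "u \<in> bop H K" using u by (simp add: unitary_op_def isometry_def)
  have wB: "?w \<in> bop K H" using H K uB by simp
  note [simp] = unitary_adj_apply[OF u] bop_carr[OF uB] bop_carr[OF wB]
  have add: "\<Phi> (op_add H H A B) = op_add K K (\<Phi> A) (\<Phi> B)" if AB: "A \<in> BH H" "B \<in> BH H" for A B
  proof (rule bop_eqI[of _ K K])
    fix k assume k: "k \<in> carr K"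
    have "A (?w k) \<in> carr H" "B (?w k) \<in> carr H" using AB k by auto
    then show "\<Phi> (op_add H H A B) k = op_add K K (\<Phi> A) (\<Phi> B) k"
      using AB k by (simp add: eq) (simp add: op_add_def eq bop_add[OF uB])
  qed (use AB \<Phi> in auto)
  have scale: "\<Phi> (op_scale H H c A) = op_scale K K c (\<Phi> A)" if A: "A \<in> BH H" for c A
  proof (rule bop_eqI[of _ K K])
    fix k assume k: "k \<in> carr K"
    have "A (?w k) \<in> carr H" using A k by auto
    then show "\<Phi> (op_scale H H c A) k = op_scale K K c (\<Phi> A) k"
      using A k by (simp add: eq) (simp add: op_scale_def eq bop_scale[OF uB])
  qed (use A \<Phi> in auto)
  have mult: "\<Phi> (A \<circ>\<^bsub>H\<^esub> B) = \<Phi> A \<circ>\<^bsub>K\<^esub> \<Phi> B" if AB: "A \<in> BH H" "B \<in> BH H" for A B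
  proof (rule bop_eqI[of _ K K])
    fix k assume k: "k \<in> carr K"
    have "B (?w k) \<in> carr H" using AB k by auto
    then show "\<Phi> (A \<circ>\<^bsub>H\<^esub> B) k = (\<Phi> A \<circ>\<^bsub>K\<^esub> \<Phi> B) k" using AB H k by (simp add: eq)
  qed (use AB \<Phi> H K in auto)
  have st: "\<Phi> (star H A) = star K (\<Phi> A)" if A: "A \<in> BH H" for A
  proof (rule adj_unique[symmetric, OF K K])
    fix x y assume xy: "x \<in> carr K" "y \<in> carr K"
    have "hinner K (\<Phi> A x) y = hinner H (A (?w x)) (?w y)"
      using xy A inner_adj[OF H K uB, of "A (?w x)" y] by (simp add: eq)
    also have "\<dots> = hinner H (?w x) (star H A (?w y))"
      using xy inner_adj[OF H H A, of "?w x" "?w y"] by simp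
    also have "\<dots> = hinner K x (u (star H A (?w y)))"
      using xy A H inner_adj_left[OF H K uB, of "star H A (?w y)" x] by simp
    finally show "hinner K (\<Phi> A x) y = hinner K x (\<Phi> (star H A) y)" using xy A H by (simp add: eq)
  qed (use A \<Phi> H in auto)
  have winv: "?w \<circ>\<^bsub>H\<^esub> (B \<circ>\<^bsub>H\<^esub> u) \<in> BH H" if "B \<in> BH K" for B
    using comp_bop[OF H K comp_bop[OF H K uB that] wB] .
  have "bij_betw \<Phi> (BH H) (BH K)"
  proof (rule bij_betw_byWitness[where f' = "\<lambda>B. ?w \<circ>\<^bsub>H\<^esub> (B \<circ>\<^bsub>H\<^esub> u)"])
    show "\<forall>A\<in>BH H. ?w \<circ>\<^bsub>H\<^esub> (\<Phi> A \<circ>\<^bsub>H\<^esub> u) = A"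
      by (intro ballI bop_eqI[of _ H H] winv \<Phi>) (auto simp: eq)
    show "\<forall>B\<in>BH K. \<Phi> (?w \<circ>\<^bsub>H\<^esub> (B \<circ>\<^bsub>H\<^esub> u)) = B"
      by (intro ballI bop_eqI[of _ K K] winv \<Phi>) (auto simp: eq winv)
    show "\<Phi> ` BH H \<subseteq> BH K" using \<Phi> by blast
    show "(\<lambda>B. ?w \<circ>\<^bsub>H\<^esub> (B \<circ>\<^bsub>H\<^esub> u)) ` BH K \<subseteq> BH H" using winv by blast
  qed
  then show ?thesis using add scale mult st \<Phi> by (simp add: star_iso_def star_hom_def op_linear_def image_subset_iff)
qed

context dilation
begin

text \<open>Without an infinite orthonormal sequence every isometry of \<open>G\<close>, and of
  \<open>H\<close> inside it, is unitary. Then the intertwiner \<open>R t\<close> implements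
  \<open>\<sigma> t\<close> by conjugation, and \<open>\<phi> t\<close> becomes conjugation by a
  compression w, which unitality makes isometric and hence unitary: every \<open>\<phi> t\<close>
  would be an automorphism.\<close>

lemma infinite_dimensional:
  assumes R: "\<And>t. t \<ge> 0 \<Longrightarrow> isometry G G (R t)"
    and int: "\<And>t A g. t \<ge> 0 \<Longrightarrow> A \<in> BH G \<Longrightarrow> g \<in> carr G \<Longrightarrow> \<sigma> t A (R t g) = R t (A g)"
    and not_auto: "\<not> (\<forall>t\<ge>0. star_automorphism H (\<phi> t))"
  shows "\<exists>e :: nat \<Rightarrow> 'g. inj e \<and> G.orthonormal (range e)"
proof (rule ccontr)
  assume no: "\<nexists>e :: nat \<Rightarrow> 'g. inj e \<and> G.orthonormal (range e)"
  obtain t where t: "t \<ge> 0" "\<not> star_automorphism H (\<phi> t)" using not_auto by blast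
  let ?R = "R t"
  have RB: "?R \<in> BH G" using R[OF t(1)] by (rule isometry_bop)
  have "unitary_op G G ?R" using G.isometry_not_unitary_infinite[OF R[OF t(1)]] no by blast
  then have RR: "?R (star G ?R g) = g" if "g \<in> carr G" for g
    using that by (simp add: unitary_op_def coisometry_adj_apply)
  have sR: "star G ?R g \<in> carr G" if "g \<in> carr G" for g using RB that hil by simp
  define w where "w = compr H G J (star G ?R)"
  have wB: "w \<in> BH H" using RB by (simp add: w_def)
  have w: "w h = Js (star G ?R (J h))" if "h \<in> carr H" for h using that by (simp add: w_def compr_def)
  have sw: "star H w h = Js (?R (J h))" if h: "h \<in> carr H" for h
  proof (rule H.vec_eqI)
    show "star H w h \<in> carr H" "Js (?R (J h)) \<in> carr H" using h wB RB hil by auto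
    fix z assume z: "z \<in> carr H"
    have "hinner H z (star H w h) = hinner H (w z) h" using inner_adj[OF hil(1) hil(1) wB z h] .
    also have "\<dots> = hinner G (star G ?R (J z)) (J h)" using w[OF z] h z sR by (simp add: inner_Js_left)
    also have "\<dots> = hinner H z (Js (?R (J h)))"
      using inner_adj_left[OF hil(2) hil(2) RB, of "J h" "J z"] h z RB by (simp add: inner_Js)
    finally show "hinner H z (star H w h) = hinner H z (Js (?R (J h)))" .
  qed
  have phi: "\<phi> t A h = star H w (A (w h))" if A: "A \<in> BH H" and h: "h \<in> carr H" for A h
  proof -
    have Aw: "A (w h) \<in> carr H" using A wB h by simp
    have "\<phi> t A h = Js (\<sigma> t (lift A) (J h))" using A h t by (simp add: phi_eq compr_def)
    also have "J h = ?R (star G ?R (J h))" using RR h by simp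
    also have "\<sigma> t (lift A) (?R (star G ?R (J h))) = ?R (lift A (star G ?R (J h)))"
      using t A h sR by (intro int) auto
    also have "Js \<dots> = star H w (A (w h))" using A h sR sw[OF Aw] w[OF h] by simp
    finally show ?thesis .
  qed
  \<comment> \<open>Unitality of \<open>\<phi> t\<close> says precisely that w is an
    isometry.\<close>
  have sww: "star H w (w h) = h" if "h \<in> carr H" for h
    using phi[of "op_id H" h] phi_unital[OF t(1)] that wB by simp
  have isoW: "isometry H H w"
    using wB sww hil by (auto simp: isometry_def intro!: bop_eqI[of _ H H])
  have uW: "unitary_op H H w"
  proof (rule ccontr)
    assume "\<not> unitary_op H H w"
    then obtain e :: "nat \<Rightarrow> 'h" where e: "inj e" "H.orthonormal (range e)"
      using H.isometry_not_unitary_infinite[OF isoW] by blast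
    have "G.orthonormal (range (\<lambda>n. J (e n)))"
      using e by (auto simp: G.orthonormal_def H.orthonormal_def image_subset_iff)
        (metis Js_J)+
    moreover have "inj (\<lambda>n. J (e n))"
      using e by (intro injI) (metis H.orthonormal_def Js_J injD rangeI subsetD)
    ultimately show False using no by blast
  qed
  have ww: "w (star H w h) = h" if "h \<in> carr H" for h
    using uW that by (simp add: unitary_op_def coisometry_adj_apply)
  have "unitary_op H H (star H w)"
    using wB hil sww ww by (auto simp: unitary_op_def isometry_def coisometry_def intro!: bop_eqI[of _ H H])
  then have "star_automorphism H (\<phi> t)"
    unfolding star_automorphism_def
    by (intro conjugation_star_iso[of H H "star H w"] hil) (use phi t wB hil in auto)
  then show False using t by blast
qed

end

context minimal_dilation
begin

text \<open>Totality of the vectors \<open>S t Y g\<close> excludes that all of them vanish, so the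
  fibre contains a Y of nonzero norm. Normalisation is carried out in \<open>G\<close> and
  transferred back by \<open>E_surj\<close>.\<close>

lemma unit_in_E:
  assumes t: "t \<ge> 0"
  shows "\<exists>X\<in>carr (E t). hinner (E t) X X = 1"
proof -
  have "\<exists>X g. X \<in> carr (E t) \<and> g \<in> carr G \<and> hinner G (S t X g) d0 \<noteq> 0"
  proof (rule ccontr)
    assume "\<not> ?thesis"
    then have "d0 = hzero G" using S_total[OF t d0(1)] by blast
    then show False using d0 by simp
  qed
  then obtain Y g where Y: "Y \<in> carr (E t)" "g \<in> carr G" "hinner G (S t Y g) d0 \<noteq> 0" by blast
  let ?r = "gam t (Y h0)"
  have r: "?r \<in> carr G" "pt0 t ?r = ?r" using E_h0[OF t Y(1)] .
  have "?r \<noteq> hzero G"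
  proof
    assume 0: "?r = hzero G"
    have "hinner (E t) Y Y = hinner G ?r ?r" using E_inner[OF t Y(1) Y(1)] Y h0 by (simp add: gam_inner)
    then have "hinner G (S t Y g) (S t Y g) = 0" using S_inner[OF t Y(1) Y(1) Y(2) Y(2)] 0 by simp
    then have "S t Y g = hzero G" using t Y by (intro G.inner_self_zero) auto
    then show False using Y(3) d0 by simp
  qed
  then have rn: "hnorm G ?r > 0" using G.norm_zero_iff[OF r(1)] G.norm_nonneg[OF r(1)] by linarith
  let ?u = "hscale G (of_real (1 / hnorm G ?r)) ?r"
  have pB: "pt0 t \<in> BH G" unfolding pt0_def using t d0 by simp
  have u: "?u \<in> carr G" "pt0 t ?u = ?u" using r bop_scale[OF pB r(1)] by simp_all
  obtain X where X: "X \<in> carr (E t)" "gam t (X h0) = ?u" using E_surj[OF t u] by blast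
  have "hinner (E t) X X = hinner G ?u ?u" using E_inner[OF t X(1) X(1)] X(1) h0 X(2)[symmetric] by (simp add: gam_inner)
  then show ?thesis using G.inner_normalized[OF r(1) rn] X(1) by auto
qed

end

section \<open>The cocycle\<close>

locale cocycle_setup = product_dilation H K J \<phi> \<theta> \<alpha> \<beta> h0 m T V e + D: minimal_dilation H G J' \<phi> \<sigma> h0
  for H :: "'h hilb" and K :: "'k hilb" and J \<phi> \<theta> \<alpha> \<beta> h0 m T V e and G :: "'g hilb" and J' \<sigma> +
  assumes sepH: "separable_space (htop H)" and sepK: "separable_space (htop K)"
    and not_auto: "\<not> (\<forall>t\<ge>0. star_automorphism H (\<phi> t))"
begin

text \<open>A unit vector of \<open>E t\<close> gives an isometry intertwining \<alpha> through
  \<open>W\<close> and one intertwining \<sigma> through \<open>S\<close>, which is what excludes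
  finite dimension in both spaces.\<close>

lemma infinite_K: "\<exists>e :: nat \<Rightarrow> 'k. inj e \<and> A.G.orthonormal (range e)"
  and infinite_G: "\<exists>e :: nat \<Rightarrow> 'g. inj e \<and> D.G.orthonormal (range e)"
proof -
  obtain x where x: "\<And>t. t \<ge> 0 \<Longrightarrow> x t \<in> carr (E t) \<and> hinner (E t) (x t) (x t) = 1"
    using D.unit_in_E by metis
  show "\<exists>e :: nat \<Rightarrow> 'k. inj e \<and> A.G.orthonormal (range e)"
    by (rule A.infinite_dimensional[of "\<lambda>t. W t (x t)"])
      (use x not_auto in \<open>auto simp: isometry_iff[OF A.hil(2) A.hil(2)] W_inner alpha_W\<close>)
  show "\<exists>e :: nat \<Rightarrow> 'g. inj e \<and> D.G.orthonormal (range e)"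
    by (rule D.infinite_dimensional[of "\<lambda>t. D.S t (x t)"])
      (use x not_auto in \<open>auto simp: isometry_iff[OF D.hil(2) D.hil(2)] D.S_inner D.S_intertwine\<close>)
qed

text \<open>Since \<open>x \<mapsto> W t x k\<close> embeds \<open>E(t)\<close> into the separable space \<open>K\<close>, the space \<open>E(t)\<close> is separable,
  and \<open>G\<close> is generated by the vectors \<open>S n x J' h\<close> with \<open>x \<in> E(n)\<close>, \<open>h \<in> H\<close>.\<close>

lemma countable_total_G: "\<exists>C. countable C \<and> D.G.total C"
proof -
  obtain DH where DH: "countable DH" "A.H.total DH" using A.H.separable_countable_total[OF sepH] by blast
  obtain DK where DK: "countable DK" "A.G.total DK" using A.G.separable_countable_total[OF sepK] by blast
  \<comment> \<open>These are the vectors \<open>D.gam n (X h0)\<close> with X in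
    \<open>E n\<close>. Integer times suffice because the ranges of the embeddings increase.\<close>
  define M where "M n = {r \<in> carr G. D.pt0 (real n) r = r}" for n :: nat
  have pB: "D.pt0 (real n) \<in> BH G" for n unfolding D.pt0_def using D.d0 by simp
  have "\<exists>B. B \<subseteq> M n \<and> D.G.orthonormal B \<and> (\<forall>x\<in>M n. (\<forall>e\<in>B. hinner G e x = 0) \<longrightarrow> x = hzero G)" for n
    using D.G.maximal_orthonormal[of "M n" "{}"] bop_scale[OF pB[of n]]
    by (auto simp: M_def D.G.orthonormal_def)
  then obtain B where B: "\<And>n. B n \<subseteq> M n" "\<And>n. D.G.orthonormal (B n)"
    "\<And>n x. x \<in> M n \<Longrightarrow> (\<forall>e\<in>B n. hinner G e x = 0) \<Longrightarrow> x = hzero G" by metis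
  have cB: "countable (B n)" for n
  proof -
    have "\<exists>X\<in>carr (E (real n)). D.gam (real n) (X h0) = r" if "r \<in> B n" for r
      using D.E_surj[of "real n" r] B(1) that by (auto simp: M_def)
    then obtain X where X: "\<And>r. r \<in> B n \<Longrightarrow> X r \<in> carr (E (real n)) \<and> D.gam (real n) (X r h0) = r" by metis
    \<comment> \<open>Carries the orthonormal set from \<open>G\<close> through the fibre into
      \<open>K\<close>, where separability bounds its cardinality.\<close>
    let ?f = "\<lambda>r. W (real n) (X r) A.d0"
    have in_f: "hinner K (?f r) (?f s) = (if r = s then 1 else 0)" if rs: "r \<in> B n" "s \<in> B n" for r s
    proof -
      have "hinner (E (real n)) (X r) (X s) = hinner G r s"
        using D.E_inner[of "real n" "X r" "X s"] D.gam_inner[of "X r h0" "real n" "X s h0"] X rs A.h0 by simp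
      then have "hinner K (?f r) (?f s) = hinner G r s" using X rs A.d0 by (simp add: W_inner)
      then show ?thesis using B(2) rs by (simp add: D.G.orthonormal_def)
    qed
    have inj: "inj_on ?f (B n)"
    proof (rule inj_onI)
      fix r s assume rs: "r \<in> B n" "s \<in> B n" "?f r = ?f s"
      then show "r = s" using in_f[OF rs(1,2)] in_f[OF rs(1,1)] by (metis zero_neq_one)
    qed
    have "A.G.orthonormal (?f ` B n)"
      unfolding A.G.orthonormal_def
    proof (intro conjI ballI)
      show "?f ` B n \<subseteq> carr K" using X A.d0 by auto
      fix u v assume "u \<in> ?f ` B n" "v \<in> ?f ` B n"
      then obtain r s where rs: "r \<in> B n" "s \<in> B n" and uv: "u = ?f r" "v = ?f s" by blast
      have "u = v \<longleftrightarrow> r = s" using inj_on_eq_iff[OF inj rs] uv by simp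
      then show "hinner K u v = (if u = v then 1 else 0)" using in_f[OF rs] uv by simp
    qed
    then have "countable (?f ` B n)" using A.G.countable_orthonormal[OF DK] by blast
    then show ?thesis using inj countable_image_inj_on by blast
  qed
  let ?C = "\<Union>n. (\<lambda>(r, h). D.rop (real n) r (J' h)) ` (B n \<times> DH)"
  have DHc: "h \<in> DH \<Longrightarrow> h \<in> carr H" for h using DH by (auto simp: A.H.total_def)
  have Bc: "r \<in> B n \<Longrightarrow> r \<in> carr G \<and> D.pt0 (real n) r = r" for r n using B(1) by (auto simp: M_def)
  have "D.G.total ?C"
    unfolding D.G.total_def
  proof (intro conjI ballI impI)
    show "?C \<subseteq> carr G" using DHc Bc by auto
    fix y assume y: "y \<in> carr G" and all: "\<forall>s\<in>?C. hinner G s y = 0"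
    have orth: "hinner G (D.rop (real n) r (J' h)) y = 0" if "r \<in> B n" "h \<in> DH" for n r h
    proof -
      have "D.rop (real n) r (J' h) \<in> ?C" using that by (intro UN_I[of n] image_eqI[of _ _ "(r, h)"]) auto
      then show ?thesis using all by blast
    qed
    have orth1: "hinner G (D.rop (real n) r (J' h)) y = 0" if r: "r \<in> B n" and h: "h \<in> carr H" for n r h
    proof -
      have rB: "D.rop (real n) r \<in> BH G" using Bc[OF r] by (intro D.rop_bop) auto
      have c: "star G (D.rop (real n) r) y \<in> carr G" using rB y by (intro adj_carr[OF D.hil(2) D.hil(2)])
      have ip: "hinner H k (D.Js (star G (D.rop (real n) r) y)) = hinner G (D.rop (real n) r (J' k)) y" if "k \<in> carr H" for k
        using that c inner_adj[OF D.hil(2) D.hil(2) rB, of "J' k" y] y by (simp add: D.inner_Js)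
      have "D.Js (star G (D.rop (real n) r) y) = hzero H"
        by (rule A.H.totalD[OF DH(2)]) (use c ip DHc orth[OF r] in auto)
      then show ?thesis using ip[OF h] h by simp
    qed
    \<comment> \<open>From the orthonormal set to all of \<open>M n\<close>: the dependence on r is
      an inner product with \<open>?z\<close>, which itself lies in \<open>M n\<close>, so
      orthogonality to the maximal set makes \<open>?z\<close> vanish.\<close>
    have orth2: "hinner G (D.rop (real n) r (J' h)) y = 0" if r: "r \<in> carr G" "D.pt0 (real n) r = r" and h: "h \<in> carr H" for n r h
    proof -
      let ?z = "\<sigma> (real n) (rank_one G D.d0 (J' h)) y"
      have zc: "?z \<in> carr G" using y h D.d0 by simp
      have ip: "hinner G (D.rop (real n) q (J' h)) y = hinner G q ?z" if "q \<in> carr G" for q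
        using that y h D.d0 by (simp add: D.rop_def D.inner_sigma)
      have dd: "rank_one G D.d0 D.d0 \<circ>\<^bsub>G\<^esub> rank_one G D.d0 (J' h) = rank_one G D.d0 (J' h)"
        using h D.d0 by (simp add: D.G.rank_one_comp_rank_one) (auto intro!: arg_cong2[of _ _ _ _ "rank_one G"] D.G.vec_eqI)
      have "?z \<in> M n" using zc y h D.d0 by (simp add: M_def D.pt0_def D.sigma_comp_apply dd)
      moreover have "\<forall>q\<in>B n. hinner G q ?z = 0"
      proof
        fix q assume q: "q \<in> B n"
        then show "hinner G q ?z = 0" using ip[of q] orth1[OF q h] Bc[OF q] by simp
      qed
      ultimately have "?z = hzero G" using B(3)[of ?z n] by blast
      then show ?thesis using ip[OF r(1)] r by simp
    qed
    \<comment> \<open>The projection passes through \<open>D.S n X\<close> onto g and places it in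
      the copy of \<open>H\<close>, where orthogonality is known. Since the ranges of these
      projections are total, y itself must vanish.\<close>
    have P0: "\<sigma> (real n) D.P y = hzero G" for n
    proof (rule D.S_total[of "real n"])
      fix X g assume X: "X \<in> carr (D.E (real n))" and g: "g \<in> carr G"
      have "hinner G (D.S (real n) X g) (\<sigma> (real n) D.P y) = hinner G (D.S (real n) X (D.P g)) y"
      proof -
        have "hinner G (\<sigma> (real n) D.P (D.S (real n) X g)) y = hinner G (D.S (real n) X g) (\<sigma> (real n) D.P y)"
          using D.inner_sigma[of "real n" D.P "D.S (real n) X g" y] X g y by (simp add: D.P_star)
        moreover have "\<sigma> (real n) D.P (D.S (real n) X g) = D.S (real n) X (D.P g)"
          using X g by (intro D.S_intertwine) auto
        ultimately show ?thesis by simp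
      qed
      also have "\<dots> = 0"
        using orth2[OF D.E_h0[OF _ X], of "D.Js g"] g by (simp add: D.S_def)
      finally show "hinner G (D.S (real n) X g) (\<sigma> (real n) D.P y) = 0" .
    qed (use y in auto)
    show "y = hzero G"
    proof (rule D.rng_total[OF y])
      fix t x assume t: "t \<ge> (0::real)" and x: "x \<in> D.rng t"
      obtain n where n: "t \<le> real n" using real_arch_simple by blast
      have xc: "x \<in> carr G" using x by (simp add: D.rng_def)
      have "\<sigma> (real n) D.P x = x" using D.rng_P[of "real n" x] D.rng_mono[OF t n x] by simp
      then have "hinner G x y = hinner G (\<sigma> (real n) D.P x) y" by simp
      also have "\<dots> = hinner G x (\<sigma> (real n) D.P y)" using xc y by (simp add: D.inner_sigma D.P_star)
      finally show "hinner G x y = 0" using P0[of n] xc by simp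
    qed
  qed
  moreover have "countable ?C" using cB DH by (intro countable_UN countable_image countable_SIGMA) auto
  ultimately show ?thesis by blast
qed

lemma unitary_K_G: "\<exists>\<Omega>. unitary_op K G \<Omega>"
proof -
  obtain e :: "nat \<Rightarrow> 'k" where "inj e" "A.G.orthonormal (range e)" using infinite_K by blast
  moreover obtain e' :: "nat \<Rightarrow> 'g" where "inj e'" "D.G.orthonormal (range e')" using infinite_G by blast
  moreover obtain C where "countable C" "A.G.total C" using A.G.separable_countable_total[OF sepK] by blast
  moreover obtain C' where "countable C'" "D.G.total C'" using countable_total_G by blast
  ultimately show ?thesis using unitary_between_separable[OF A.hil(2) D.hil(2)] by blast
qed

end

lemma unitary_bop: "unitary_op H K U \<Longrightarrow> U \<in> bop H K"
  by (simp add: unitary_op_def isometry_def)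

section \<open>Convergence as time decreases to zero\<close>

context hilbert_space
begin

definition ftends :: "(real \<Rightarrow> 'a) \<Rightarrow> 'a \<Rightarrow> bool" where
  "ftends f x \<longleftrightarrow> ((\<lambda>t. hnorm H (hsub (f t) x)) \<longlongrightarrow> 0) (at_right 0)"

lemma ftends_bound:
  assumes "ftends f x" "ftends g y" "\<forall>\<^sub>F t in at_right 0. hnorm H (hsub (h t) z) \<le> hnorm H (hsub (f t) x) + hnorm H (hsub (g t) y)"
    "\<forall>\<^sub>F t in at_right 0. h t \<in> carr H" "z \<in> carr H"
  shows "ftends h z"
  unfolding ftends_def
proof (rule Lim_null_comparison)
  show "\<forall>\<^sub>F t in at_right 0. norm (hnorm H (hsub (h t) z)) \<le> hnorm H (hsub (f t) x) + hnorm H (hsub (g t) y)"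
    using assms(3,4) by eventually_elim (use assms(5) in simp)
  show "((\<lambda>t. hnorm H (hsub (f t) x) + hnorm H (hsub (g t) y)) \<longlongrightarrow> 0) (at_right 0)"
    using tendsto_add[OF assms(1)[unfolded ftends_def] assms(2)[unfolded ftends_def]] by simp
qed

lemma norm_hsub_sq: "x \<in> carr H \<Longrightarrow> y \<in> carr H \<Longrightarrow>
    (hnorm H (hsub x y))\<^sup>2 = (hnorm H x)\<^sup>2 - 2 * Re (hinner H y x) + (hnorm H y)\<^sup>2"
  using inner_commute[of y x] by (simp add: norm_sq[of "hsub x y"] norm_sq[of x] norm_sq[of y])

lemma ftends_sq:
  assumes "((\<lambda>t. (hnorm H (hsub (f t) x))\<^sup>2) \<longlongrightarrow> 0) (at_right 0)"
    and "\<forall>\<^sub>F t in at_right 0. f t \<in> carr H" "x \<in> carr H"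
  shows "ftends f x"
proof -
  have "((\<lambda>t. sqrt ((hnorm H (hsub (f t) x))\<^sup>2)) \<longlongrightarrow> sqrt 0) (at_right 0)"
    using assms(1) by (rule tendsto_real_sqrt)
  moreover have "\<forall>\<^sub>F t in at_right 0. sqrt ((hnorm H (hsub (f t) x))\<^sup>2) = hnorm H (hsub (f t) x)"
    using assms(2) by eventually_elim (use assms(3) in simp)
  ultimately show ?thesis unfolding ftends_def using tendsto_cong by fastforce
qed

end

context dilation
begin

lemma sigma_weak: "A \<in> BH G \<Longrightarrow> x \<in> carr G \<Longrightarrow> y \<in> carr G \<Longrightarrow>
    ((\<lambda>t. hinner G (\<sigma> t A x) y) \<longlongrightarrow> hinner G (A x) y) (at_right 0)"
proof -
  assume *: "A \<in> BH G" "x \<in> carr G" "y \<in> carr G"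
  have "continuous_on {0..} (\<lambda>t. hinner G (\<sigma> t A x) y)"
    using e0 * by (simp add: e0_semigroup_def cp0_semigroup_def)
  then have "((\<lambda>t. hinner G (\<sigma> t A x) y) \<longlongrightarrow> hinner G (\<sigma> 0 A x) y) (at 0 within {0..})"
    by (simp add: continuous_on_def)
  then have "((\<lambda>t. hinner G (\<sigma> t A x) y) \<longlongrightarrow> hinner G (\<sigma> 0 A x) y) (at_right 0)"
    by (rule tendsto_within_subset) auto
  then show ?thesis using * by simp
qed

lemma ev_pos: "\<forall>\<^sub>F t::real in at_right 0. t > 0"
  by (simp add: eventually_at_right_less)

text \<open>An approximate unit vector field for one vector is one for all vectors, because the rank one
  operators can be moved through the intertwiners.\<close>

lemma intertwiners_strongly_to_id:
  assumes R: "\<And>t. t \<ge> 0 \<Longrightarrow> R t \<in> BH G"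
    and int: "\<And>t A g. t \<ge> 0 \<Longrightarrow> A \<in> BH G \<Longrightarrow> g \<in> carr G \<Longrightarrow> \<sigma> t A (R t g) = R t (A g)"
    and norm: "\<And>t g. t \<ge> 0 \<Longrightarrow> g \<in> carr G \<Longrightarrow> (hnorm G (R t g))\<^sup>2 = c t * (hnorm G g)\<^sup>2"
    and c: "(c \<longlongrightarrow> 1) (at_right 0)"
    and d: "G.ftends (\<lambda>t. R t d0) d0" and k: "k \<in> carr G"
  shows "G.ftends (\<lambda>t. R t k) k"
proof (rule G.ftends_sq)
  have Rc: "R t g \<in> carr G" if "t \<ge> 0" "g \<in> carr G" for t g
    by (rule bop_carr[OF R[OF that(1)] that(2)])
  \<comment> \<open>Moving |k><d0| through the intertwiner turns \<langle>k, R t k\<rangle> into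
    \<langle>\<open>?v t\<close>, R t d0\<rangle>. The norms of \<open>?v t\<close> converge, hence
    stay bounded near 0, so convergence of \<open>R t d0\<close> alone controls the right
    side.\<close>
  let ?v = "\<lambda>t. \<sigma> t (rank_one G d0 k) k"
  have dk: "rank_one G d0 k k = hscale G (of_real ((hnorm G k)\<^sup>2)) d0" using k d0 by (simp add: G.inner_self)
  have v1: "((\<lambda>t. hinner G (?v t) d0) \<longlongrightarrow> of_real ((hnorm G k)\<^sup>2)) (at_right 0)"
    using sigma_weak[of "rank_one G d0 k" k d0] k d0 by (simp add: G.inner_self)
  have v2: "((\<lambda>t. (hnorm G (?v t))\<^sup>2) \<longlongrightarrow> Re (hinner G (rank_one G k k k) k)) (at_right 0)"
  proof -
    have kk: "rank_one G k d0 \<circ>\<^bsub>G\<^esub> rank_one G d0 k = rank_one G k k"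
      using k d0 by (simp add: G.rank_one_comp_rank_one) (auto intro!: arg_cong2[of _ _ _ _ "rank_one G"] G.vec_eqI)
    have skk: "star G (rank_one G k k) = rank_one G k k" using k by simp
    have "(hnorm G (?v t))\<^sup>2 = Re (hinner G (\<sigma> t (rank_one G k k) k) k)" if "t > 0" for t
    proof -
      have "(hnorm G (?v t))\<^sup>2 = Re (hinner G k (\<sigma> t (rank_one G k k) k))"
        using that k d0 by (simp add: G.norm_sq inner_sigma sigma_comp_apply kk)
      also have "hinner G k (\<sigma> t (rank_one G k k) k) = hinner G (\<sigma> t (rank_one G k k) k) k"
        using that k by (simp add: inner_sigma)
      finally show ?thesis .
    qed
    then have "\<forall>\<^sub>F t in at_right 0. (hnorm G (?v t))\<^sup>2 = Re (hinner G (\<sigma> t (rank_one G k k) k) k)"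
      using ev_pos by (auto elim: eventually_mono)
    then show ?thesis
      using tendsto_Re[OF sigma_weak[of "rank_one G k k" k k]] k tendsto_cong by fastforce
  qed
  then have v3: "((\<lambda>t. hnorm G (?v t)) \<longlongrightarrow> sqrt (Re (hinner G (rank_one G k k k) k))) (at_right 0)"
  proof -
    have "((\<lambda>t. sqrt ((hnorm G (?v t))\<^sup>2)) \<longlongrightarrow> sqrt (Re (hinner G (rank_one G k k k) k))) (at_right 0)"
      by (rule tendsto_real_sqrt[OF v2])
    moreover have "\<forall>\<^sub>F t in at_right 0. sqrt ((hnorm G (?v t))\<^sup>2) = hnorm G (?v t)"
      using ev_pos by eventually_elim (use k d0 in simp)
    ultimately show ?thesis using tendsto_cong by fastforce
  qed
  have z: "((\<lambda>t. hinner G (?v t) (G.hsub (R t d0) d0)) \<longlongrightarrow> 0) (at_right 0)"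
  proof (rule Lim_null_comparison)
    show "\<forall>\<^sub>F t in at_right 0. norm (hinner G (?v t) (G.hsub (R t d0) d0)) \<le> hnorm G (?v t) * hnorm G (G.hsub (R t d0) d0)"
      using ev_pos by eventually_elim (use k d0 Rc in \<open>intro G.cauchy_schwarz; simp\<close>)
    show "((\<lambda>t. hnorm G (?v t) * hnorm G (G.hsub (R t d0) d0)) \<longlongrightarrow> 0) (at_right 0)"
      using tendsto_mult[OF v3 d[unfolded G.ftends_def]] by simp
  qed
  have i: "((\<lambda>t. hinner G k (R t k)) \<longlongrightarrow> of_real ((hnorm G k)\<^sup>2)) (at_right 0)"
  proof -
    have "hinner G k (R t k) = hinner G (?v t) d0 + hinner G (?v t) (G.hsub (R t d0) d0)" if t: "t > 0" for t
    proof -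
      have "rank_one G k d0 d0 = k" using k d0 by (auto intro: G.vec_eqI)
      then have "hinner G k (R t k) = hinner G k (\<sigma> t (rank_one G k d0) (R t d0))"
        using int[of t "rank_one G k d0" d0] t k d0 by simp
      also have "\<dots> = hinner G (?v t) (R t d0)"
        using t k d0 Rc by (simp add: inner_sigma)
      finally show ?thesis using t k d0 Rc by simp
    qed
    then have "\<forall>\<^sub>F t in at_right 0. hinner G k (R t k) = hinner G (?v t) d0 + hinner G (?v t) (G.hsub (R t d0) d0)"
      using ev_pos by (auto elim: eventually_mono)
    then show ?thesis using tendsto_add[OF v1 z] tendsto_cong by fastforce
  qed
  have "\<forall>\<^sub>F t in at_right 0. (hnorm G (G.hsub (R t k) k))\<^sup>2 = c t * (hnorm G k)\<^sup>2 - 2 * Re (hinner G k (R t k)) + (hnorm G k)\<^sup>2"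
    using ev_pos by eventually_elim (use k Rc norm G.norm_hsub_sq in simp)
  moreover have "((\<lambda>t. c t * (hnorm G k)\<^sup>2 - 2 * Re (hinner G k (R t k)) + (hnorm G k)\<^sup>2) \<longlongrightarrow>
      1 * (hnorm G k)\<^sup>2 - 2 * Re (of_real ((hnorm G k)\<^sup>2)) + (hnorm G k)\<^sup>2) (at_right 0)"
    using c i by (intro tendsto_intros)
  ultimately show "((\<lambda>t. (hnorm G (G.hsub (R t k) k))\<^sup>2) \<longlongrightarrow> 0) (at_right 0)"
    using tendsto_cong by fastforce
  show "\<forall>\<^sub>F t in at_right 0. R t k \<in> carr G" using ev_pos by eventually_elim (use k Rc in simp)
qed (rule k)

lemma sigma_unitary_norm:
  assumes t: "t \<ge> 0" and U: "unitary_op G G U" and x: "x \<in> carr G"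
  shows "hnorm G (\<sigma> t U x) = hnorm G x"
proof -
  have UB: "U \<in> BH G" using U by (rule unitary_bop)
  have "star G U \<circ>\<^bsub>G\<^esub> U = op_id G" using U by (simp add: unitary_op_def isometry_def)
  then have "hinner G (\<sigma> t U x) (\<sigma> t U x) = hinner G x x"
    using t x UB by (simp add: inner_sigma sigma_comp_apply)
  then show ?thesis by (simp add: hnorm_def)
qed

end

section \<open>Construction of the cocycle\<close>

context cocycle_setup
begin

definition \<Omega> :: "'k \<Rightarrow> 'g" where "\<Omega> = (SOME \<Omega>. unitary_op K G \<Omega>)"

lemma Om: "unitary_op K G \<Omega>"
  unfolding \<Omega>_def using unitary_K_G by (rule someI_ex)

abbreviation Os where "Os \<equiv> adj K G \<Omega>"

lemma Om_bop [simp]: "\<Omega> \<in> bop K G" using Om by (rule unitary_bop)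
lemma Os_bop [simp]: "Os \<in> bop G K" using A.hil D.hil by simp
lemma Om_carr [simp]: "k \<in> carr K \<Longrightarrow> \<Omega> k \<in> carr G" by (rule bop_carr[OF Om_bop])
lemma Os_carr [simp]: "g \<in> carr G \<Longrightarrow> Os g \<in> carr K" by (rule bop_carr[OF Os_bop])
lemma Os_Om [simp]: "k \<in> carr K \<Longrightarrow> Os (\<Omega> k) = k" using unitary_adj_apply(1)[OF Om] .
lemma Om_Os [simp]: "g \<in> carr G \<Longrightarrow> \<Omega> (Os g) = g" using unitary_adj_apply(2)[OF Om] .

lemma inner_Om: "k \<in> carr K \<Longrightarrow> l \<in> carr K \<Longrightarrow> hinner G (\<Omega> k) (\<Omega> l) = hinner K k l"
  using Om isometry_iff[OF A.hil(2) D.hil(2)] by (simp add: unitary_op_def)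

lemma inner_Os: "g \<in> carr G \<Longrightarrow> g' \<in> carr G \<Longrightarrow> hinner K (Os g) (Os g') = hinner G g g'"
  using inner_Om[of "Os g" "Os g'"] by simp

lemma inner_Os_left: "g \<in> carr G \<Longrightarrow> k \<in> carr K \<Longrightarrow> hinner K (Os g) k = hinner G g (\<Omega> k)"
  using inner_Om[of "Os g" k] by simp

definition S' :: "real \<Rightarrow> 'h fib \<Rightarrow> 'k \<Rightarrow> 'k" where
  "S' t x = Os \<circ>\<^bsub>K\<^esub> (D.S t x \<circ>\<^bsub>K\<^esub> \<Omega>)"

lemma S'_apply [simp]: "k \<in> carr K \<Longrightarrow> S' t x k = Os (D.S t x (\<Omega> k))"
  by (simp add: S'_def)

lemma S'_carr: "t \<ge> 0 \<Longrightarrow> x \<in> carr (E t) \<Longrightarrow> k \<in> carr K \<Longrightarrow> S' t x k \<in> carr K"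
  by simp

lemma S'_total:
  assumes t: "t \<ge> 0" and y: "y \<in> carr K"
    and orth: "\<And>x k. x \<in> carr (E t) \<Longrightarrow> k \<in> carr K \<Longrightarrow> hinner K (S' t x k) y = 0"
  shows "y = hzero K"
proof -
  have "\<Omega> y = hzero G"
  proof (rule D.S_total[OF t])
    fix x g assume x: "x \<in> carr (E t)" and g: "g \<in> carr G"
    show "hinner G (D.S t x g) (\<Omega> y) = 0"
      using orth[OF x Os_carr[OF g]] x g y t by (simp add: inner_Os_left)
  qed (use y in simp)
  then have "Os (\<Omega> y) = hzero K" using bop_zero[OF Os_bop D.hil(2) A.hil(2)] by simp
  then show ?thesis using y by simp
qed

definition U :: "real \<Rightarrow> 'k \<Rightarrow> 'k" where
  "U t = (SOME T. isometry K K T \<and> (\<forall>(x, k)\<in>carr (E t) \<times> carr K. T (W t x k) = S' t x k))"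

lemma W_total_set: "t \<ge> 0 \<Longrightarrow> A.G.total ((\<lambda>(x, k). W t x k) ` (carr (E t) \<times> carr K))"
  using W_total by (fastforce simp: A.G.total_def)

lemma S'_total_set: "t \<ge> 0 \<Longrightarrow> A.G.total ((\<lambda>(x, k). S' t x k) ` (carr (E t) \<times> carr K))"
  using S'_total by (fastforce simp: A.G.total_def)

text \<open>The families \<open>W t x k\<close> and \<open>S' t x k\<close> have the same Gram
  matrix, the product of the inner products in \<open>E t\<close> and in \<open>K\<close>. This
  gives the isometry, and totality of the second family makes it unitary.\<close>

lemma U:
  assumes t: "t \<ge> 0"
  shows "unitary_op K K (U t)" and "x \<in> carr (E t) \<Longrightarrow> k \<in> carr K \<Longrightarrow> U t (W t x k) = S' t x k"
proof -
  have "\<exists>T. isometry K K T \<and> (\<forall>i\<in>carr (E t) \<times> carr K. T ((\<lambda>(x, k). W t x k) i) = (\<lambda>(x, k). S' t x k) i)"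
    by (rule gram_isometry[OF A.hil(2) A.hil(2) W_total_set[OF t]])
      (use t in \<open>auto simp: W_inner inner_Os D.S_inner inner_Om\<close>)
  then have "\<exists>T. isometry K K T \<and> (\<forall>(x, k)\<in>carr (E t) \<times> carr K. T (W t x k) = S' t x k)"
    by (simp add: case_prod_unfold)
  then have *: "isometry K K (U t) \<and> (\<forall>(x, k)\<in>carr (E t) \<times> carr K. U t (W t x k) = S' t x k)"
    unfolding U_def by (rule someI_ex)
  then show UW: "U t (W t x k) = S' t x k" if "x \<in> carr (E t)" "k \<in> carr K" for x k
    using that by blast
  show "unitary_op K K (U t)"
  proof (rule unitary_opI[OF A.hil(2) A.hil(2) conjunct1[OF *] S'_total_set[OF t]])
    show "(\<lambda>(x, k). S' t x k) ` (carr (E t) \<times> carr K) \<subseteq> U t ` carr K"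
    proof clarify
      fix x k assume "x \<in> carr (E t)" "k \<in> carr K"
      then show "S' t x k \<in> U t ` carr K"
        using UW[of x k] t by (intro image_eqI[of _ _ "W t x k"]) simp_all
    qed
  qed
qed

lemma U_bop [simp]: "t \<ge> 0 \<Longrightarrow> U t \<in> BH K"
  using U(1) unitary_bop by blast

lemma U_carr [simp]: "t \<ge> 0 \<Longrightarrow> k \<in> carr K \<Longrightarrow> U t k \<in> carr K"
  by (rule bop_carr[OF U_bop])

lemma U_norm: "t \<ge> 0 \<Longrightarrow> k \<in> carr K \<Longrightarrow> hnorm K (U t k) = hnorm K k"
  using isometry_norm[OF A.hil(2) A.hil(2)] U(1) by (simp add: unitary_op_def)

text \<open>On the total family \<open>W s x (W t y k)\<close> both sides equal
  \<open>S' s x (S' t y k)\<close>: the left because both representations are multiplicative, the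
  right because \<open>\<alpha> s (U t)\<close> passes through \<open>W s x\<close> as
  \<open>U t\<close>.\<close>

lemma U_cocycle:
  assumes s: "s \<ge> 0" and t: "t \<ge> 0"
  shows "U (s + t) = U s \<circ>\<^bsub>K\<^esub> \<alpha> s (U t)"
proof -
  let ?Z = "{W s x (W t y k) | x y k. x \<in> carr (E s) \<and> y \<in> carr (E t) \<and> k \<in> carr K}"
  have tot: "A.G.total ?Z"
    unfolding A.G.total_def
  proof (intro conjI ballI impI)
    show "?Z \<subseteq> carr K" using s t by auto
    fix z assume z: "z \<in> carr K" and orth: "\<forall>v\<in>?Z. hinner K v z = 0"
    show "z = hzero K"
    proof (rule W_total[OF s z])
      fix x k assume x: "x \<in> carr (E s)" and k: "k \<in> carr K"
      have WB: "W s x \<in> BH K" using s x by simp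
      have c: "star K (W s x) z \<in> carr K" using adj_carr[OF A.hil(2) A.hil(2) WB z] .
      have "star K (W s x) z = hzero K"
      proof (rule W_total[OF t c])
        fix y l assume yl: "y \<in> carr (E t)" "l \<in> carr K"
        have "hinner K (W t y l) (star K (W s x) z) = hinner K (W s x (W t y l)) z"
          using inner_adj[OF A.hil(2) A.hil(2) WB _ z, of "W t y l"] yl t by simp
        moreover have "hinner K (W s x (W t y l)) z = 0"
          by (rule bspec[OF orth], rule CollectI, rule exI[of _ x], rule exI[of _ y], rule exI[of _ l])
            (intro conjI refl x yl)
        ultimately show "hinner K (W t y l) (star K (W s x) z) = 0" by simp
      qed
      then show "hinner K (W s x k) z = 0"
        using inner_adj[OF A.hil(2) A.hil(2) WB k z] k by simp
    qed
  qed
  show ?thesis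
  proof (rule bop_total_eq[OF A.hil(2) A.hil(2) _ _ tot])
    show "U (s + t) \<in> BH K" "U s \<circ>\<^bsub>K\<^esub> \<alpha> s (U t) \<in> BH K" using s t by auto
    fix v assume "v \<in> ?Z"
    then obtain x y k where v: "v = W s x (W t y k)" "x \<in> carr (E s)" "y \<in> carr (E t)" "k \<in> carr K" by blast
    have mm: "ms_mult H \<phi> s t x y \<in> carr (E (s + t))" using D.ms_mult(1)[OF v(2) s v(3) t] .
    have "U (s + t) v = S' (s + t) (ms_mult H \<phi> s t x y) k"
      using v s t U(2)[of "s + t", OF _ mm v(4)] by (simp add: W_mult)
    also have "\<dots> = S' s x (S' t y k)"
      using D.ms_mult(2)[OF v(2) s v(3) t Om_carr[OF v(4)]] v s t by simp
    also have "\<dots> = U s (W s x (S' t y k))"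
      using U(2)[OF s v(2) S'_carr[OF t v(3,4)]] by simp
    also have "\<dots> = U s (W s x (U t (W t y k)))" using U(2)[OF t v(3,4)] by simp
    also have "\<dots> = U s (\<alpha> s (U t) v)"
      using v s t by (simp add: alpha_W)
    finally show "U (s + t) v = (U s \<circ>\<^bsub>K\<^esub> \<alpha> s (U t)) v" using v s t by simp
  qed
qed

section \<open>Strong continuity of the cocycle\<close>

definition near_unit :: "real \<Rightarrow> 'h fib" where
  "near_unit t = (SOME X. X \<in> carr (E t) \<and> D.gam t (X h0) = D.pt0 t D.d0)"

lemma pt0_idem: "t \<ge> 0 \<Longrightarrow> D.pt0 t (D.pt0 t D.d0) = D.pt0 t D.d0"
proof -
  assume t: "t \<ge> 0"
  have "rank_one G D.d0 D.d0 \<circ>\<^bsub>G\<^esub> rank_one G D.d0 D.d0 = rank_one G D.d0 D.d0"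
    using D.d0 by (simp add: D.G.rank_one_comp_rank_one) (auto intro!: arg_cong2[of _ _ _ _ "rank_one G"] D.G.vec_eqI)
  then show ?thesis using t D.d0 by (simp add: D.pt0_def D.sigma_comp_apply)
qed

text \<open>\<open>D.pt0 t D.d0\<close> is the projection of \<open>D.d0\<close> onto the space of
  all \<open>D.gam t (X h0)\<close>, so \<open>near_unit t\<close> is the best approximation of
  \<open>D.d0\<close> that the fibre offers. It is not normalised, but its norm tends to 1.\<close>

lemma near_unit:
  assumes t: "t \<ge> 0"
  shows "near_unit t \<in> carr (E t)" "D.gam t (near_unit t h0) = D.pt0 t D.d0"
proof -
  have "D.pt0 t D.d0 \<in> carr G" using t D.d0 by (simp add: D.pt0_def)
  then have "\<exists>X. X \<in> carr (E t) \<and> D.gam t (X h0) = D.pt0 t D.d0"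
    using D.E_surj[OF t _ pt0_idem[OF t]] by blast
  from someI_ex[OF this] show "near_unit t \<in> carr (E t)" "D.gam t (near_unit t h0) = D.pt0 t D.d0"
    by (auto simp: near_unit_def)
qed

definition near_unit_sq :: "real \<Rightarrow> real" where
  "near_unit_sq t = Re (hinner G D.d0 (D.pt0 t D.d0))"

text \<open>The squared norm of \<open>near_unit t\<close> and the overlap of its image with
  \<open>D.d0\<close> are the same number, because \<open>D.pt0 t\<close> is a projection. Weak
  continuity of \<sigma> therefore controls both.\<close>

lemma near_unit_sq:
  assumes t: "t \<ge> 0"
  shows "hinner (E t) (near_unit t) (near_unit t) = of_real (near_unit_sq t)" "hinner G D.d0 (D.pt0 t D.d0) = of_real (near_unit_sq t)"
proof -
  have pc: "D.pt0 t D.d0 \<in> carr G" using t D.d0 by (simp add: D.pt0_def)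
  have "hinner G (D.pt0 t D.d0) (D.pt0 t D.d0) = hinner G D.d0 (D.pt0 t (D.pt0 t D.d0))"
    using t D.d0 unfolding D.pt0_def by (simp add: D.inner_sigma)
  then have 1: "hinner G (D.pt0 t D.d0) (D.pt0 t D.d0) = hinner G D.d0 (D.pt0 t D.d0)" using pt0_idem[OF t] by simp
  then have "hinner G D.d0 (D.pt0 t D.d0) = of_real ((hnorm G (D.pt0 t D.d0))\<^sup>2)" using D.G.inner_self[OF pc] by simp
  then show 2: "hinner G D.d0 (D.pt0 t D.d0) = of_real (near_unit_sq t)" by (simp add: near_unit_sq_def)
  have "hinner (E t) (near_unit t) (near_unit t) = hinner G (D.gam t (near_unit t h0)) (D.gam t (near_unit t h0))"
    using D.E_inner[OF t near_unit(1)[OF t] near_unit(1)[OF t]] near_unit(1)[OF t] A.h0 by (simp add: D.gam_inner)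
  then show "hinner (E t) (near_unit t) (near_unit t) = of_real (near_unit_sq t)" using near_unit(2)[OF t] 1 2 by simp
qed

lemma near_unit_sq_tends: "(near_unit_sq \<longlongrightarrow> 1) (at_right 0)"
proof -
  have "((\<lambda>t. Re (hinner G (\<sigma> t (rank_one G D.d0 D.d0) D.d0) D.d0)) \<longlongrightarrow> Re (hinner G (rank_one G D.d0 D.d0 D.d0) D.d0)) (at_right 0)"
    using D.sigma_weak[of "rank_one G D.d0 D.d0" D.d0 D.d0] D.d0 by (intro tendsto_Re) simp
  moreover have "Re (hinner G (rank_one G D.d0 D.d0 D.d0) D.d0) = 1" using D.d0 by simp
  moreover have "\<forall>\<^sub>F t in at_right 0. Re (hinner G (\<sigma> t (rank_one G D.d0 D.d0) D.d0) D.d0) = near_unit_sq t"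
    using D.ev_pos
  proof eventually_elim
    fix t :: real assume "t > 0"
    then show "Re (hinner G (\<sigma> t (rank_one G D.d0 D.d0) D.d0) D.d0) = near_unit_sq t"
      using D.d0 by (simp add: near_unit_sq_def D.pt0_def D.inner_sigma)
  qed
  ultimately show ?thesis using tendsto_cong by fastforce
qed

lemma W_near_unit_norm: "t \<ge> 0 \<Longrightarrow> k \<in> carr K \<Longrightarrow> (hnorm K (W t (near_unit t) k))\<^sup>2 = near_unit_sq t * (hnorm K k)\<^sup>2"
proof -
  assume *: "t \<ge> 0" "k \<in> carr K"
  have "complex_of_real ((hnorm K (W t (near_unit t) k))\<^sup>2) = of_real (near_unit_sq t * (hnorm K k)\<^sup>2)"
    using W_inner[OF *(1) near_unit(1)[OF *(1)] near_unit(1)[OF *(1)] *(2,2)] * near_unit(1)[OF *(1)] by (simp add: A.G.inner_self near_unit_sq)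
  then show ?thesis by (simp only: of_real_eq_iff)
qed

lemma S_near_unit_norm: "t \<ge> 0 \<Longrightarrow> k \<in> carr G \<Longrightarrow> (hnorm G (D.S t (near_unit t) k))\<^sup>2 = near_unit_sq t * (hnorm G k)\<^sup>2"
proof -
  assume *: "t \<ge> 0" "k \<in> carr G"
  have "complex_of_real ((hnorm G (D.S t (near_unit t) k))\<^sup>2) = of_real (near_unit_sq t * (hnorm G k)\<^sup>2)"
    using D.S_inner[OF *(1) near_unit(1)[OF *(1)] near_unit(1)[OF *(1)] *(2,2)] * near_unit(1)[OF *(1)] by (simp add: D.G.inner_self near_unit_sq)
  then show ?thesis by (simp only: of_real_eq_iff)
qed

text \<open>With c = \<open>near_unit_sq t\<close>, the squared distance from the distinguished unit
  vector is c - 2c + 1 in both spaces, where -2c is the overlap term. Convergence at that one vector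
  then spreads to all vectors through the rank one operators.\<close>

lemma W_S_tends:
  shows "k \<in> carr K \<Longrightarrow> A.G.ftends (\<lambda>t. W t (near_unit t) k) k"
    and "g \<in> carr G \<Longrightarrow> D.G.ftends (\<lambda>t. D.S t (near_unit t) g) g"
proof -
  have lim: "((\<lambda>t. near_unit_sq t * 1 - 2 * near_unit_sq t + 1) \<longlongrightarrow> 0) (at_right 0)"
  proof -
    have "((\<lambda>t. near_unit_sq t * 1 - 2 * near_unit_sq t + 1) \<longlongrightarrow> 1 * 1 - 2 * 1 + 1) (at_right 0)"
      using near_unit_sq_tends by (intro tendsto_intros)
    then show ?thesis by simp
  qed
  have nK: "(hnorm K A.d0)\<^sup>2 = 1" using A.G.norm_sq[OF A.d0(1)] A.d0 by simp
  have nG: "(hnorm G D.d0)\<^sup>2 = 1" using D.G.norm_sq[OF D.d0(1)] D.d0 by simp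
  have SJ: "D.S t (near_unit t) D.d0 = D.pt0 t D.d0" if "t \<ge> 0" for t
    using D.S_J[OF that near_unit(1)[OF that] A.h0(1)] near_unit(2)[OF that] by simp
  \<comment> \<open>The overlap in \<open>K\<close> is a compression to \<open>H\<close>, determined
    by \<phi>, and therefore equals the overlap computed in \<open>G\<close>.\<close>
  have WJ: "hinner K A.d0 (W t (near_unit t) A.d0) = of_real (near_unit_sq t)" if t: "t \<ge> 0" for t
  proof -
    have "hinner K A.d0 (W t (near_unit t) A.d0) = hinner H h0 (ms_rep H \<phi> t (near_unit t) h0)"
      using W_compr[OF t near_unit(1)[OF t]] A.h0 by simp
    also have "\<dots> = hinner G D.d0 (D.S t (near_unit t) D.d0)"
      using D.inner_ms_rep(1)[OF t near_unit(1)[OF t]] A.h0 by simp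
    finally show ?thesis using SJ[OF t] near_unit_sq(2)[OF t] by simp
  qed
  have dK: "A.G.ftends (\<lambda>t. W t (near_unit t) A.d0) A.d0"
  proof (rule A.G.ftends_sq)
    have "\<forall>\<^sub>F t in at_right 0. (hnorm K (A.G.hsub (W t (near_unit t) A.d0) A.d0))\<^sup>2 = near_unit_sq t * 1 - 2 * near_unit_sq t + 1"
      using D.ev_pos
    proof eventually_elim
      fix t :: real assume "t > 0"
      then show "(hnorm K (A.G.hsub (W t (near_unit t) A.d0) A.d0))\<^sup>2 = near_unit_sq t * 1 - 2 * near_unit_sq t + 1"
        using A.G.norm_hsub_sq[of "W t (near_unit t) A.d0" A.d0] W_near_unit_norm[of t A.d0] WJ[of t] near_unit(1)[of t] A.d0 nK by simp
    qed
    then show "((\<lambda>t. (hnorm K (A.G.hsub (W t (near_unit t) A.d0) A.d0))\<^sup>2) \<longlongrightarrow> 0) (at_right 0)"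
      using lim tendsto_cong by fastforce
    show "\<forall>\<^sub>F t in at_right 0. W t (near_unit t) A.d0 \<in> carr K"
      using D.ev_pos by eventually_elim (use near_unit(1) A.d0 in auto)
  qed (use A.d0 in simp)
  have dG: "D.G.ftends (\<lambda>t. D.S t (near_unit t) D.d0) D.d0"
  proof (rule D.G.ftends_sq)
    have "\<forall>\<^sub>F t in at_right 0. (hnorm G (D.G.hsub (D.S t (near_unit t) D.d0) D.d0))\<^sup>2 = near_unit_sq t * 1 - 2 * near_unit_sq t + 1"
      using D.ev_pos
    proof eventually_elim
      fix t :: real assume t: "t > 0"
      have pc: "D.S t (near_unit t) D.d0 \<in> carr G" using t near_unit(1) D.d0 by simp
      show "(hnorm G (D.G.hsub (D.S t (near_unit t) D.d0) D.d0))\<^sup>2 = near_unit_sq t * 1 - 2 * near_unit_sq t + 1"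
        using D.G.norm_hsub_sq[OF pc D.d0(1)] S_near_unit_norm[of t D.d0] SJ[of t] near_unit_sq(2)[of t] t D.d0 nG by simp
    qed
    then show "((\<lambda>t. (hnorm G (D.G.hsub (D.S t (near_unit t) D.d0) D.d0))\<^sup>2) \<longlongrightarrow> 0) (at_right 0)"
      using lim tendsto_cong by fastforce
    show "\<forall>\<^sub>F t in at_right 0. D.S t (near_unit t) D.d0 \<in> carr G"
      using D.ev_pos by eventually_elim (use near_unit(1) D.d0 in auto)
  qed (use D.d0 in simp)
  show "A.G.ftends (\<lambda>t. W t (near_unit t) k) k" if "k \<in> carr K"
    by (rule A.intertwiners_strongly_to_id[OF _ _ W_near_unit_norm near_unit_sq_tends dK that]) (use near_unit(1) alpha_W in auto)
  show "D.G.ftends (\<lambda>t. D.S t (near_unit t) g) g" if "g \<in> carr G"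
    by (rule D.intertwiners_strongly_to_id[OF _ _ S_near_unit_norm near_unit_sq_tends dG that]) (use near_unit(1) D.S_intertwine in auto)
qed

text \<open>\<open>U t\<close> maps \<open>W t (near_unit t) k\<close>, which is close to k, to
  \<open>S' t (near_unit t) k\<close>, which is also close to k; unitarity transports the first
  error.\<close>

lemma U_tends:
  assumes k: "k \<in> carr K"
  shows "A.G.ftends (\<lambda>t. U t k) k"
proof -
  have S': "A.G.ftends (\<lambda>t. S' t (near_unit t) k) k"
    unfolding A.G.ftends_def
  proof (rule tendsto_cong[THEN iffD1])
    show "((\<lambda>t. hnorm G (D.G.hsub (D.S t (near_unit t) (\<Omega> k)) (\<Omega> k))) \<longlongrightarrow> 0) (at_right 0)"
      using W_S_tends(2)[OF Om_carr[OF k]] by (simp add: D.G.ftends_def)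
    show "\<forall>\<^sub>F t in at_right 0. hnorm G (D.G.hsub (D.S t (near_unit t) (\<Omega> k)) (\<Omega> k)) = hnorm K (A.G.hsub (S' t (near_unit t) k) k)"
      using D.ev_pos
    proof eventually_elim
      fix t :: real assume "t > 0"
      then have c: "D.S t (near_unit t) (\<Omega> k) \<in> carr G" using near_unit(1) k by simp
      have "A.G.hsub (S' t (near_unit t) k) k = Os (D.G.hsub (D.S t (near_unit t) (\<Omega> k)) (\<Omega> k))"
        using c k by (simp add: bop_add[OF Os_bop] bop_scale[OF Os_bop])
      then show "hnorm G (D.G.hsub (D.S t (near_unit t) (\<Omega> k)) (\<Omega> k)) = hnorm K (A.G.hsub (S' t (near_unit t) k) k)"
        using c k by (simp add: hnorm_def inner_Os del: D.G.inner_add D.G.inner_add_left)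
    qed
  qed
  show ?thesis
  proof (rule A.G.ftends_bound[OF W_S_tends(1)[OF k] S'])
    show "\<forall>\<^sub>F t in at_right 0. hnorm K (A.G.hsub (U t k) k) \<le>
        hnorm K (A.G.hsub (W t (near_unit t) k) k) + hnorm K (A.G.hsub (S' t (near_unit t) k) k)"
      using D.ev_pos
    proof eventually_elim
      fix t :: real assume t: "t > 0"
      have Wc: "W t (near_unit t) k \<in> carr K" and Sc: "S' t (near_unit t) k \<in> carr K" and Uc: "U t k \<in> carr K"
        using t near_unit(1) k by auto
      have UW: "U t (W t (near_unit t) k) = S' t (near_unit t) k" using U(2) t near_unit(1) k by simp
      have "hnorm K (A.G.hsub (U t k) (S' t (near_unit t) k)) = hnorm K (U t (A.G.hsub k (W t (near_unit t) k)))"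
        unfolding UW[symmetric] using t k Wc by (simp add: A.G.bop_sub)
      also have "\<dots> = hnorm K (A.G.hsub (W t (near_unit t) k) k)"
        using t k Wc A.G.hsub_commute[OF k Wc] by (simp add: U_norm)
      finally show "hnorm K (A.G.hsub (U t k) k) \<le> hnorm K (A.G.hsub (W t (near_unit t) k) k) + hnorm K (A.G.hsub (S' t (near_unit t) k) k)"
        using A.G.hsub_triangle[OF Uc Sc k] by simp
    qed
    show "\<forall>\<^sub>F t in at_right 0. U t k \<in> carr K" using D.ev_pos by eventually_elim (use k in simp)
  qed (rule k)
qed

text \<open>The vectors for which convergence holds form a subspace. It contains every
  \<open>W s x l\<close>, since there \<open>\<alpha> s (U t)\<close> acts as \<open>U t\<close> on
  l, and these are total. The operators preserve norms uniformly in t, so an approximation argument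
  with \<epsilon>/3 reaches every k.\<close>

lemma alpha_U_tends:
  assumes s: "s \<ge> 0" and k: "k \<in> carr K"
  shows "A.G.ftends (\<lambda>t. \<alpha> s (U t) k) k"
proof -
  have ac: "\<alpha> s (U t) x \<in> carr K" if "t > 0" "x \<in> carr K" for t x using that s by simp
  have aB: "\<alpha> s (U t) \<in> BH K" if "t > 0" for t using that s by simp
  have an: "hnorm K (\<alpha> s (U t) x) = hnorm K x" if "t > 0" "x \<in> carr K" for t x
    using A.sigma_unitary_norm[OF s U(1) that(2)] that by simp
  define C where "C = {x \<in> carr K. A.G.ftends (\<lambda>t. \<alpha> s (U t) x) x}"
  have C: "A.G.lin_subspace C"
    unfolding A.G.lin_subspace_def
  proof (intro conjI ballI allI)
    have "A.G.ftends (\<lambda>t. \<alpha> s (U t) (hzero K)) (hzero K)"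
      unfolding A.G.ftends_def
    proof (rule tendsto_cong[THEN iffD1, OF _ tendsto_const])
      show "\<forall>\<^sub>F t in at_right 0. 0 = hnorm K (A.G.hsub (\<alpha> s (U t) (hzero K)) (hzero K))"
        using D.ev_pos by eventually_elim (simp add: bop_zero[OF aB A.hil(2) A.hil(2)] A.G.hsub_zero_iff)
    qed
    then show "hzero K \<in> C" by (simp add: C_def)
    fix x y assume x: "x \<in> C" and y: "y \<in> C"
    then have xy: "x \<in> carr K" "y \<in> carr K" by (auto simp: C_def)
    have "A.G.ftends (\<lambda>t. \<alpha> s (U t) (hadd K x y)) (hadd K x y)"
    proof (rule A.G.ftends_bound)
      show "A.G.ftends (\<lambda>t. \<alpha> s (U t) x) x" "A.G.ftends (\<lambda>t. \<alpha> s (U t) y) y" using x y by (auto simp: C_def)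
      show "\<forall>\<^sub>F t in at_right 0. hnorm K (A.G.hsub (\<alpha> s (U t) (hadd K x y)) (hadd K x y)) \<le>
          hnorm K (A.G.hsub (\<alpha> s (U t) x) x) + hnorm K (A.G.hsub (\<alpha> s (U t) y) y)"
        using D.ev_pos
      proof eventually_elim
        fix t :: real assume t: "t > 0"
        have "A.G.hsub (\<alpha> s (U t) (hadd K x y)) (hadd K x y) = hadd K (A.G.hsub (\<alpha> s (U t) x) x) (A.G.hsub (\<alpha> s (U t) y) y)"
          using ac[OF t] xy by (intro A.G.vec_eqI) (auto simp: bop_add[OF aB[OF t]] algebra_simps)
        then show "hnorm K (A.G.hsub (\<alpha> s (U t) (hadd K x y)) (hadd K x y)) \<le>
            hnorm K (A.G.hsub (\<alpha> s (U t) x) x) + hnorm K (A.G.hsub (\<alpha> s (U t) y) y)"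
          using ac[OF t] xy by (simp add: A.G.norm_triangle)
      qed
      show "\<forall>\<^sub>F t in at_right 0. \<alpha> s (U t) (hadd K x y) \<in> carr K"
        using D.ev_pos by eventually_elim (use ac xy in simp)
    qed (use xy in simp)
    then show "hadd K x y \<in> C" using xy by (simp add: C_def)
  next
    fix c x assume x: "x \<in> C"
    then have xK: "x \<in> carr K" by (simp add: C_def)
    have "A.G.ftends (\<lambda>t. \<alpha> s (U t) (hscale K c x)) (hscale K c x)"
      unfolding A.G.ftends_def
    proof (rule tendsto_cong[THEN iffD1])
      show "((\<lambda>t. cmod c * hnorm K (A.G.hsub (\<alpha> s (U t) x) x)) \<longlongrightarrow> 0) (at_right 0)"
        using x by (intro tendsto_mult_right_zero) (simp add: C_def A.G.ftends_def)
      show "\<forall>\<^sub>F t in at_right 0. cmod c * hnorm K (A.G.hsub (\<alpha> s (U t) x) x) =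
          hnorm K (A.G.hsub (\<alpha> s (U t) (hscale K c x)) (hscale K c x))"
        using D.ev_pos
      proof eventually_elim
        fix t :: real assume t: "t > 0"
        have "A.G.hsub (\<alpha> s (U t) (hscale K c x)) (hscale K c x) = hscale K c (A.G.hsub (\<alpha> s (U t) x) x)"
          using ac[OF t] xK by (intro A.G.vec_eqI) (auto simp: bop_scale[OF aB[OF t]] algebra_simps)
        then show "cmod c * hnorm K (A.G.hsub (\<alpha> s (U t) x) x) = hnorm K (A.G.hsub (\<alpha> s (U t) (hscale K c x)) (hscale K c x))"
          using ac[OF t] xK by simp
      qed
    qed
    then show "hscale K c x \<in> C" using xK by (simp add: C_def)
  qed (auto simp: C_def)
  have "(\<lambda>(x, k). W s x k) ` (carr (E s) \<times> carr K) \<subseteq> C"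
  proof clarify
    fix x l assume x: "x \<in> carr (E s)" and l: "l \<in> carr K"
    have WB: "W s x \<in> BH K" using s x by simp
    obtain b where b: "b \<ge> 0" "\<And>v. v \<in> carr K \<Longrightarrow> hnorm K (W s x v) \<le> b * hnorm K v"
      using bop_bound[OF WB A.hil(2)] by blast
    have "A.G.ftends (\<lambda>t. \<alpha> s (U t) (W s x l)) (W s x l)"
      unfolding A.G.ftends_def
    proof (rule Lim_null_comparison)
      show "\<forall>\<^sub>F t in at_right 0. norm (hnorm K (A.G.hsub (\<alpha> s (U t) (W s x l)) (W s x l))) \<le> b * hnorm K (A.G.hsub (U t l) l)"
        using D.ev_pos
      proof eventually_elim
        fix t :: real assume t: "t > 0"
        have "A.G.hsub (\<alpha> s (U t) (W s x l)) (W s x l) = W s x (A.G.hsub (U t l) l)"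
          using t s x l alpha_W[OF s _ x l, of "U t"] A.G.bop_sub[OF WB, of "U t l" l] by simp
        then show "norm (hnorm K (A.G.hsub (\<alpha> s (U t) (W s x l)) (W s x l))) \<le> b * hnorm K (A.G.hsub (U t l) l)"
          using b(2)[of "A.G.hsub (U t l) l"] t l s x by simp
      qed
      show "((\<lambda>t. b * hnorm K (A.G.hsub (U t l) l)) \<longlongrightarrow> 0) (at_right 0)"
        using U_tends[OF l] by (intro tendsto_mult_right_zero) (simp add: A.G.ftends_def)
    qed
    then show "W s x l \<in> C" using s x l by (simp add: C_def)
  qed
  then obtain u where u: "\<And>n. u n \<in> C" "A.G.tends u k"
    using A.G.total_approx[OF W_total_set[OF s] _ C k] by blast
  have uK: "u n \<in> carr K" for n using u(1) by (simp add: C_def)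
  show ?thesis
    unfolding A.G.ftends_def tendsto_iff
  proof (intro allI impI)
    fix \<epsilon> :: real assume \<epsilon>: "\<epsilon> > 0"
    obtain n where n: "hnorm K (A.G.hsub (u n) k) < \<epsilon> / 3"
      using order_tendstoD(2)[OF u(2)[unfolded A.G.tends_def], of "\<epsilon> / 3"] \<epsilon>
      by (auto simp: eventually_sequentially)
    have "A.G.ftends (\<lambda>t. \<alpha> s (U t) (u n)) (u n)" using u(1) by (simp add: C_def)
    then have "\<forall>\<^sub>F t in at_right 0. hnorm K (A.G.hsub (\<alpha> s (U t) (u n)) (u n)) < \<epsilon> / 3"
      unfolding A.G.ftends_def using order_tendstoD(2) \<epsilon> by (metis divide_pos_pos zero_less_numeral)
    then show "\<forall>\<^sub>F t in at_right 0. dist (hnorm K (A.G.hsub (\<alpha> s (U t) k) k)) 0 < \<epsilon>"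
      using D.ev_pos
    proof eventually_elim
      fix t :: real assume *: "hnorm K (A.G.hsub (\<alpha> s (U t) (u n)) (u n)) < \<epsilon> / 3" and t: "t > 0"
      have c: "\<alpha> s (U t) k \<in> carr K" "\<alpha> s (U t) (u n) \<in> carr K" using ac[OF t] k uK by auto
      have "hnorm K (A.G.hsub (\<alpha> s (U t) k) (\<alpha> s (U t) (u n))) = hnorm K (A.G.hsub k (u n))"
        using an[OF t, of "A.G.hsub k (u n)"] k uK by (simp add: A.G.bop_sub[OF aB[OF t]])
      also have "\<dots> < \<epsilon> / 3" using n A.G.hsub_commute[OF k uK[of n]] by simp
      finally have "hnorm K (A.G.hsub (\<alpha> s (U t) k) k) < \<epsilon>"
        using A.G.hsub_triangle[OF c(1) c(2) k] A.G.hsub_triangle[OF c(2) uK[of n] k] * n by simp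
      then show "dist (hnorm K (A.G.hsub (\<alpha> s (U t) k) k)) 0 < \<epsilon>" using c k by simp
    qed
  qed
qed

lemma U_right:
  assumes s: "s \<ge> 0" and k: "k \<in> carr K"
  shows "((\<lambda>t. hnorm K (A.G.hsub (U (s + t) k) (U s k))) \<longlongrightarrow> 0) (at_right 0)"
proof (rule tendsto_cong[THEN iffD1, OF _ alpha_U_tends[OF s k, unfolded A.G.ftends_def]])
  show "\<forall>\<^sub>F t in at_right 0. hnorm K (A.G.hsub (\<alpha> s (U t) k) k) = hnorm K (A.G.hsub (U (s + t) k) (U s k))"
    using D.ev_pos
  proof eventually_elim
    fix t :: real assume t: "t > 0"
    have c: "\<alpha> s (U t) k \<in> carr K" using s t k by simp
    have "A.G.hsub (U (s + t) k) (U s k) = U s (A.G.hsub (\<alpha> s (U t) k) k)"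
      using s t k c A.G.bop_sub[OF U_bop[OF s] c k] by (simp add: U_cocycle)
    then show "hnorm K (A.G.hsub (\<alpha> s (U t) k) k) = hnorm K (A.G.hsub (U (s + t) k) (U s k))"
      using s c k by (simp add: U_norm)
  qed
qed

text \<open>As \<open>U\<^sub>s = U\<^bsub>s - t\<^esub> \<alpha>\<^bsub>s - t\<^esub>(U\<^sub>t)\<close>, it suffices that \<open>\<alpha>\<^bsub>s - t\<^esub>(U\<^sub>t) k \<rightarrow> k\<close>; the near-isometry \<open>W\<^sub>t(e\<^sub>t)\<close> carries
  \<open>\<alpha>\<^bsub>s - t\<^esub>(U\<^sub>t)\<close> to \<open>\<alpha>\<^sub>s(U\<^sub>t)\<close>, whose convergence is known.\<close>

lemma U_left:
  assumes s: "s > 0" and k: "k \<in> carr K"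
  shows "((\<lambda>t. hnorm K (A.G.hsub (U (s - t) k) (U s k))) \<longlongrightarrow> 0) (at_right 0)"
proof -
  let ?f = "\<lambda>t. hnorm K (A.G.hsub (\<alpha> s (U t) k) k) + 2 * hnorm K (A.G.hsub (W t (near_unit t) k) k)"
  have f: "(?f \<longlongrightarrow> 0 + 2 * 0) (at_right 0)"
    using alpha_U_tends[OF _ k, of s] s W_S_tends(1)[OF k] unfolding A.G.ftends_def by (intro tendsto_intros) auto
  \<comment> \<open>Eventually \<open>near_unit t\<close> has norm above 1/2, so
    \<open>W t (near_unit t)\<close> shrinks lengths by less than a factor 2 and can be inverted in
    the estimate.\<close>
  have ev: "\<forall>\<^sub>F t in at_right 0. 1/4 < near_unit_sq t" using order_tendstoD(1)[OF near_unit_sq_tends, of "1/4"] by simp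
  have ev2: "\<forall>\<^sub>F t in at_right (0::real). t < s" using s by (intro eventually_at_rightI[of 0 s]) auto
  show ?thesis
  proof (rule Lim_null_comparison)
    show "((\<lambda>t. 2 * ?f t) \<longlongrightarrow> 0) (at_right 0)" using tendsto_mult_right_zero[of ?f _ 2] f by simp
    show "\<forall>\<^sub>F t in at_right 0. norm (hnorm K (A.G.hsub (U (s - t) k) (U s k))) \<le> 2 * ?f t"
      using D.ev_pos ev ev2
    proof eventually_elim
      fix t :: real assume t: "t > 0" and ct: "1/4 < near_unit_sq t" and ts: "t < s"
      let ?W = "W t (near_unit t)" and ?Z = "\<alpha> (s - t) (U t)"
      have eE: "near_unit t \<in> carr (E t)" using near_unit(1) t by simp
      have WB: "?W \<in> BH K" using t eE by simp
      have ZB: "?Z \<in> BH K" using t ts by simp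
      have Zk: "?Z k \<in> carr K" using ZB k by simp
      have Wk: "?W k \<in> carr K" using WB k by simp
      have aW: "\<alpha> s (U t) \<in> BH K" using s t by simp
      have aWk: "\<alpha> s (U t) k \<in> carr K" "\<alpha> s (U t) (?W k) \<in> carr K" using aW k Wk by auto
      let ?d = "A.G.hsub (?Z k) k"
      have dc: "?d \<in> carr K" using Zk k by simp
      have "U (s - t + t) = U (s - t) \<circ>\<^bsub>K\<^esub> ?Z" using t ts by (intro U_cocycle) auto
      then have "U s k = U (s - t) (?Z k)" using k by simp
      then have "hnorm K (A.G.hsub (U (s - t) k) (U s k)) = hnorm K (U (s - t) (A.G.hsub k (?Z k)))"
        using k Zk ts A.G.bop_sub[OF U_bop, of "s - t" k "?Z k"] by simp
      also have "\<dots> = hnorm K ?d" using k Zk ts A.G.hsub_commute[OF k Zk] by (simp add: U_norm)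
      finally have 1: "hnorm K (A.G.hsub (U (s - t) k) (U s k)) = hnorm K ?d" .
      have "?W ?d = A.G.hsub (?W (?Z k)) (?W k)" by (rule A.G.bop_sub[OF WB Zk k])
      also have "?W (?Z k) = \<alpha> t ?Z (?W k)" using alpha_W[OF _ ZB eE k] t by simp
      also have "\<alpha> t ?Z = \<alpha> s (U t)" using t ts by (simp add: A.sigma_sigma)
      finally have Wd: "?W ?d = A.G.hsub (\<alpha> s (U t) (?W k)) (?W k)" .
      have 2: "hnorm K (A.G.hsub (\<alpha> s (U t) (?W k)) (\<alpha> s (U t) k)) = hnorm K (A.G.hsub (?W k) k)"
        using A.sigma_unitary_norm[of s "U t" "A.G.hsub (?W k) k"] s t k Wk U(1)[of t] A.G.bop_sub[OF aW Wk k] by simp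
      have "hnorm K (?W ?d) \<le> ?f t"
        unfolding Wd using A.G.hsub_triangle[OF aWk(2) aWk(1) Wk] A.G.hsub_triangle[OF aWk(1) k Wk] 2
          A.G.hsub_commute[OF k Wk] by simp
      moreover have "hnorm K ?d \<le> 2 * hnorm K (?W ?d)"
      proof -
        have "(hnorm K ?d)\<^sup>2 \<le> 4 * (near_unit_sq t * (hnorm K ?d)\<^sup>2)"
          using mult_right_mono[of "1/4" "near_unit_sq t" "(hnorm K ?d)\<^sup>2"] ct by simp
        then have "(hnorm K ?d)\<^sup>2 \<le> (2 * hnorm K (?W ?d))\<^sup>2"
          using W_near_unit_norm[of t ?d] t dc by (simp add: power_mult_distrib)
        moreover have "0 \<le> 2 * hnorm K (?W ?d)" using A.G.norm_nonneg[OF bop_carr[OF WB dc]] by simp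
        ultimately show ?thesis by (rule power2_le_imp_le)
      qed
      ultimately show "norm (hnorm K (A.G.hsub (U (s - t) k) (U s k))) \<le> 2 * ?f t"
        unfolding 1 using dc by simp
    qed
  qed
qed

lemma U_continuous:
  assumes k: "k \<in> carr K"
  shows "continuous_map (top_of_set {0..}) (htop K) (\<lambda>t. U t k)"
proof -
  interpret M: Metric_space "carr K" "hdist K" by (rule A.G.metric)
  show ?thesis
    unfolding htop_def M.continuous_map_to_metric
  proof (intro ballI allI impI)
    fix s \<epsilon> :: real assume "s \<in> topspace (top_of_set {0..})" and \<epsilon>: "\<epsilon> > 0"
    then have s: "s \<ge> 0" by simp
    have "\<forall>\<^sub>F t in at_right 0. hnorm K (A.G.hsub (U (s + t) k) (U s k)) < \<epsilon>"
      using order_tendstoD(2)[OF U_right[OF s k] \<epsilon>] .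
    then obtain d1 where d1: "d1 > 0" "\<And>t. t > 0 \<Longrightarrow> t < d1 \<Longrightarrow> hnorm K (A.G.hsub (U (s + t) k) (U s k)) < \<epsilon>"
      by (auto simp: eventually_at_right_field)
    have "\<exists>d2>0. \<forall>t>0. t < d2 \<longrightarrow> t \<le> s \<longrightarrow> hnorm K (A.G.hsub (U (s - t) k) (U s k)) < \<epsilon>"
    proof (cases "s = 0")
      case True
      then show ?thesis by (intro exI[of _ 1]) auto
    next
      case False
      then have "\<forall>\<^sub>F t in at_right 0. hnorm K (A.G.hsub (U (s - t) k) (U s k)) < \<epsilon>"
        using order_tendstoD(2)[OF U_left[OF _ k] \<epsilon>] s by simp
      then show ?thesis by (auto simp: eventually_at_right_field)
    qed
    then obtain d2 where d2: "d2 > 0" "\<And>t. t > 0 \<Longrightarrow> t < d2 \<Longrightarrow> t \<le> s \<Longrightarrow> hnorm K (A.G.hsub (U (s - t) k) (U s k)) < \<epsilon>"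
      by blast
    have "U t k \<in> M.mball (U s k) \<epsilon>" if t: "t \<ge> 0" "t < s + d1" "s - d2 < t" for t
    proof -
      have c: "U t k \<in> carr K" "U s k \<in> carr K" using t s k by auto
      have "hnorm K (A.G.hsub (U t k) (U s k)) < \<epsilon>"
      proof (cases "t = s")
        case True
        then show ?thesis using \<epsilon> c A.G.hsub_zero_iff[of "U s k" "U s k"] by simp
      next
        case False
        show ?thesis
        proof (cases "t > s")
          case True
          then show ?thesis using d1(2)[of "t - s"] t by simp
        next
          case False
          then show ?thesis using d2(2)[of "s - t"] t \<open>t \<noteq> s\<close> by simp
        qed
      qed
      then show ?thesis using c A.G.hsub_commute[OF c] by (simp add: M.in_mball hdist_def)
    qed
    then have "\<forall>y\<in>{0..} \<inter> {s - d2 <..< s + d1}. U y k \<in> M.mball (U s k) \<epsilon>" by auto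
    moreover have "openin (top_of_set {0..}) ({0..} \<inter> {s - d2 <..< s + d1})" by (intro openin_open_Int) auto
    moreover have "s \<in> {0..} \<inter> {s - d2 <..< s + d1}" using s d1 d2 by auto
    ultimately show "\<exists>O'. openin (top_of_set {0..}) O' \<and> s \<in> O' \<and> (\<forall>y\<in>O'. U y k \<in> M.mball (U s k) \<epsilon>)" by blast
  qed
qed

lemma cocycle_U: "cocycle K \<alpha> U"
  using U(1) U_continuous U_cocycle by (simp add: cocycle_def)

section \<open>Conjugacy with the perturbed semigroup\<close>

definition \<pi> :: "('g \<Rightarrow> 'g) \<Rightarrow> 'k \<Rightarrow> 'k" where
  "\<pi> B = Os \<circ>\<^bsub>K\<^esub> (B \<circ>\<^bsub>K\<^esub> \<Omega>)"

lemma pi_apply [simp]: "k \<in> carr K \<Longrightarrow> \<pi> B k = Os (B (\<Omega> k))"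
  by (simp add: \<pi>_def)

lemma pi_bop [simp]: "B \<in> BH G \<Longrightarrow> \<pi> B \<in> BH K"
proof -
  assume B: "B \<in> BH G"
  have "B \<circ>\<^bsub>K\<^esub> \<Omega> \<in> bop K G" by (rule comp_bop[OF A.hil(2) D.hil(2) Om_bop B])
  then show ?thesis unfolding \<pi>_def by (rule comp_bop[OF A.hil(2) D.hil(2) _ Os_bop])
qed

lemma pi_iso: "star_iso G K \<pi>"
proof (rule conjugation_star_iso[OF D.hil(2) A.hil(2)])
  show "unitary_op G K Os"
    using Om A.hil D.hil by (auto simp: unitary_op_def isometry_def coisometry_def)
qed (use A.hil D.hil in auto)

text \<open>Tested on the total family \<open>S' t x k\<close>: the adjoint of \<open>U t\<close>
  turns it into \<open>W t x k\<close>, the perturbed semigroup acts there on k alone, and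
  \<open>U t\<close> turns the result back, in agreement with \<sigma> passing through
  \<open>D.S\<close>.\<close>

lemma pi_conj:
  assumes t: "t \<ge> 0" and B: "B \<in> BH G"
  shows "\<pi> (\<sigma> t B) = U t \<circ>\<^bsub>K\<^esub> (\<alpha> t (\<pi> B) \<circ>\<^bsub>K\<^esub> star K (U t))"
proof (rule bop_total_eq[OF A.hil(2) A.hil(2) _ _ S'_total_set[OF t]])
  show "\<pi> (\<sigma> t B) \<in> BH K" "U t \<circ>\<^bsub>K\<^esub> (\<alpha> t (\<pi> B) \<circ>\<^bsub>K\<^esub> star K (U t)) \<in> BH K" using t B by auto
  fix v assume "v \<in> (\<lambda>(x, k). S' t x k) ` (carr (E t) \<times> carr K)"
  then obtain x k where v: "v = S' t x k" "x \<in> carr (E t)" "k \<in> carr K" by auto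
  have vc: "v \<in> carr K" using v t by simp
  have pk: "\<pi> B k \<in> carr K" using B v by (intro bop_carr[OF pi_bop])
  have "\<pi> (\<sigma> t B) v = S' t x (\<pi> B k)"
    using t B v pk vc by (simp add: D.S_intertwine)
  also have "\<dots> = U t (W t x (\<pi> B k))" using U(2)[OF t v(2) pk] by simp
  also have "W t x (\<pi> B k) = \<alpha> t (\<pi> B) (W t x k)" using alpha_W[OF t pi_bop[OF B] v(2,3)] by simp
  also have "W t x k = star K (U t) v"
    using unitary_adj_apply(1)[OF U(1)[OF t], of "W t x k"] U(2)[OF t v(2,3)] v t by simp
  finally show "\<pi> (\<sigma> t B) v = (U t \<circ>\<^bsub>K\<^esub> (\<alpha> t (\<pi> B) \<circ>\<^bsub>K\<^esub> star K (U t))) v" using vc by simp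
qed

lemma alpha_cocycle_conjugate_sigma: "cocycle_conjugate K \<alpha> G \<sigma>"
  unfolding cocycle_conjugate_def conjugate_def
  using cocycle_U pi_iso pi_conj by blast

end

theorem theorem4p5:
  fixes H :: "'h hilb" and K :: "'k hilb" and G :: "'g hilb"
    and \<phi> \<theta> :: "'h semigrp" and \<alpha> \<beta> :: "'k semigrp" and \<sigma> :: "'g semigrp"
    and m :: "real \<times> real \<Rightarrow> real \<times> real \<Rightarrow> 'h fib2 \<Rightarrow> 'h fib2 \<Rightarrow> 'h fib2"
    and T :: "real \<times> real \<Rightarrow> 'h fib2 \<Rightarrow> 'h \<Rightarrow> 'h"
    and V :: "real \<times> real \<Rightarrow> 'h fib2 \<Rightarrow> 'k \<Rightarrow> 'k"
    and J :: "'h \<Rightarrow> 'k" and J' :: "'h \<Rightarrow> 'g"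
  assumes "separable_hilbert_space H"
    and "cp0_semigroup H \<phi>" and "cp0_semigroup H \<theta>"
    and "strongly_commuting_semigroups H \<phi> \<theta>"
    and "product_system_e0_dilation H \<phi> \<theta> m T K J V \<alpha> \<beta>"
    and "\<not> (\<forall>t\<ge>0. star_automorphism H (\<phi> t))"
    and "minimal_e0_dilation H \<phi> G J' \<sigma>"
  shows "cocycle_conjugate K \<alpha> G \<sigma>"
proof -
  have hH: "hilbert_space H" "separable_space (htop H)" using assms(1) by (auto simp: separable_hilbert_space_def)
  interpret H: hilbert_space H by (rule hH(1))
  let ?e = "pt2 H \<phi> \<theta> 0 0 (ms_iota H \<phi> 0) (ms_iota H \<theta> 0)"
  note psd = assms(5)[unfolded product_system_e0_dilation_def Let_def]
  have "separable_hilbert_space K" using psd by (elim conjE)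
  then have hK: "hilbert_space K" "separable_space (htop K)" by (auto simp: separable_hilbert_space_def)
  have tp: "two_param_product_system H \<phi> \<theta> m" using psd by (elim conjE)
  have mid: "minimal_isometric_dilation Rplus2 (fibre2 H \<phi> \<theta>) ?e m H T K J V" using psd by (elim conjE)
  have coiso: "rep_fully_coisometric Rplus2 (fibre2 H \<phi> \<theta>) K V" using psd by (elim conjE)
  have e0a: "e0_semigroup K \<alpha>" using psd by (elim conjE)
  have e0b: "e0_semigroup K \<beta>" using psd by (elim conjE)
  note e0 = e0a e0b
  have "\<forall>s\<ge>0. \<forall>t\<ge>0. \<forall>A\<in>BH K. \<phi> s (\<theta> t (compr H K J A)) = compr H K J (\<alpha> s (\<beta> t A))"
    using psd by (elim conjE)
  then have dil: "\<phi> s (\<theta> t (compr H K J A)) = compr H K J (\<alpha> s (\<beta> t A))"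
    if "s \<ge> 0" "t \<ge> 0" "A \<in> BH K" for s t A
    using that by simp
  have "\<forall>t\<ge>0. \<forall>A\<in>BH K. \<alpha> t A = conj_semigroup (ms_fibre H \<phi>) K (\<lambda>t x. V (t, 0) (inE H \<phi> \<theta> t x)) t A"
    using psd by (elim conjE)
  then have al: "\<alpha> t A = conj_semigroup (ms_fibre H \<phi>) K (\<lambda>t x. V (t, 0) (inE H \<phi> \<theta> t x)) t A"
    if "t \<ge> 0" "A \<in> BH K" for t A
    using that by simp
  have "\<forall>s\<ge>0. \<forall>t\<ge>0. \<forall>x\<in>carr (ms_fibre H \<phi> s). \<forall>y\<in>carr (ms_fibre H \<theta> t).
      T (s, t) (pt2 H \<phi> \<theta> s t x y) = ms_rep H \<phi> s x \<circ>\<^bsub>H\<^esub> ms_rep H \<theta> t y"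
    using psd by (elim conjE)
  then have Tpt: "T (s, t) (pt2 H \<phi> \<theta> s t x y) = ms_rep H \<phi> s x \<circ>\<^bsub>H\<^esub> ms_rep H \<theta> t y"
    if "s \<ge> 0" "t \<ge> 0" "x \<in> carr (ms_fibre H \<phi> s)" "y \<in> carr (ms_fibre H \<theta> t)" for s t x y
    using that by simp
  have J: "isometry H K J" using mid by (simp add: minimal_isometric_dilation_def)
  have phi: "\<phi> t (op_id H) = op_id H" "\<theta> t (op_id H) = op_id H" if "t \<ge> 0" for t
    using assms(2,3) that by (auto simp: cp0_semigroup_def)
  have phi0: "\<phi> 0 A = A" "\<theta> 0 A = A" if "A \<in> BH H" for A
    using assms(2,3) that by (auto simp: cp0_semigroup_def)
  have JA: "compr H K J A \<in> BH H" if "A \<in> BH K" for A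
  proof -
    have "A \<circ>\<^bsub>H\<^esub> J \<in> bop H K" using comp_bop[OF hH(1) hK(1) isometry_bop[OF J] that] .
    then show ?thesis unfolding compr_def using adj_bop[OF hH(1) hK(1) isometry_bop[OF J]]
      by (rule comp_bop[OF hH(1) hK(1)])
  qed
  \<comment> \<open>On the zero space every \<open>\<phi> t\<close> is an automorphism, which the
    hypothesis excludes; so a unit vector is available.\<close>
  have "\<exists>h0\<in>carr H. hinner H h0 h0 = 1"
  proof (rule ccontr)
    assume no: "\<not> ?thesis"
    have z: "x = hzero H" if x: "x \<in> carr H" for x
    proof (rule ccontr)
      assume "x \<noteq> hzero H"
      then have "hnorm H x > 0" using H.norm_zero_iff[OF x] H.norm_nonneg[OF x] by linarith
      then show False using no x H.inner_normalized[OF x] H.scale_closed[OF x] by blast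
    qed
    have one: "A = op_id H" if "A \<in> BH H" for A
      using that hH z by (intro bop_eqI[of _ H H]) (auto, metis bop_carr)
    then have B1: "BH H = {op_id H}" using hH by auto
    have sid: "star H (op_id H) = op_id H" using hH by simp
    have cid: "op_id H \<circ>\<^bsub>H\<^esub> op_id H = op_id H" using hH by (intro one) auto
    have aid: "op_add H H (op_id H) (op_id H) = op_id H" using hH by (intro one) auto
    have scid: "op_scale H H c (op_id H) = op_id H" for c
    proof (rule extensionalityI[of _ "carr H"])
      fix x assume x: "x \<in> carr H"
      have "hscale H c x = x" using z[OF H.scale_closed[OF x]] z[OF x] by metis
      then show "op_scale H H c (op_id H) x = op_id H x" using x by (simp add: op_scale_def op_id_def)
    qed (auto simp: op_scale_def op_id_def)
    have "star_automorphism H (\<phi> t)" if "t \<ge> 0" for t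
      using phi(1)[OF that] by (simp add: star_automorphism_def star_iso_def star_hom_def op_linear_def B1 sid cid aid scid bij_betw_def)
    then show False using assms(6) by blast
  qed
  then obtain h0 where h0: "h0 \<in> carr H" "hinner H h0 h0 = 1" by blast
  interpret A: dilation H K J \<phi> \<alpha> h0
  proof (intro dilation.intro dilation_axioms.intro hH hK J e0 phi h0)
    fix t :: real and A assume t: "t \<ge> 0" and A: "A \<in> BH K"
    \<comment> \<open>The dilation property for \<phi> alone is the joint one at time 0 of \<theta>
      and \<beta>.\<close>
    have "\<beta> 0 A = A" using e0(2) A by (simp add: e0_semigroup_def cp0_semigroup_def)
    then show "\<phi> t (compr H K J A) = compr H K J (\<alpha> t A)" using dil[OF t order_refl A] phi0(2)[OF JA[OF A]] by simp
  qed
  interpret B: dilation H K J \<theta> \<beta> h0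
  proof (intro dilation.intro dilation_axioms.intro hH hK J e0 phi h0)
    fix t :: real and A assume t: "t \<ge> 0" and A: "A \<in> BH K"
    have b: "\<beta> t A \<in> BH K" using e0(2) t A unfolding e0_semigroup_def star_hom_def op_linear_def by blast
    have th: "\<theta> t (compr H K J A) \<in> BH H"
      using assms(3) t JA[OF A] unfolding cp0_semigroup_def completely_positive_def op_linear_def by blast
    have "\<alpha> 0 (\<beta> t A) = \<beta> t A" using e0(1) b by (simp add: e0_semigroup_def cp0_semigroup_def)
    then show "\<theta> t (compr H K J A) = compr H K J (\<beta> t A)" using dil[OF order_refl t A] phi0(1)[OF th] by simp
  qed
  note min = assms(7)[unfolded minimal_e0_dilation_def e0_dilation_def Let_def]
  have hG: "hilbert_space G" using min by (elim conjE)
  have J': "isometry H G J'" using min by (elim conjE)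
  have sE: "e0_semigroup G \<sigma>" using min by (elim conjE)
  interpret D: minimal_dilation H G J' \<phi> \<sigma> h0
  proof (intro minimal_dilation.intro minimal_dilation_axioms.intro dilation.intro dilation_axioms.intro hH hG J' sE phi h0)
    show "\<phi> t (compr H G J' A) = compr H G J' (\<sigma> t A)" if "t \<ge> 0" "A \<in> BH G" for t A
      using min that by simp
    show "vn_generated G (\<Union>t\<in>{0..}.
        {\<sigma> t ((J' \<circ>\<^bsub>G\<^esub> adj H G J') \<circ>\<^bsub>G\<^esub> (A \<circ>\<^bsub>G\<^esub> (J' \<circ>\<^bsub>G\<^esub> adj H G J'))) | A. A \<in> BH G}) = BH G"
      using min by (elim conjE)
  qed
  interpret P: product_dilation H K J \<phi> \<theta> \<alpha> \<beta> h0 m T V ?e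
  proof (intro product_dilation.intro product_dilation_axioms.intro A.dilation_axioms B.dilation_axioms coiso al Tpt)
    have "\<forall>s\<ge>0. \<forall>s'\<ge>0. \<forall>x\<in>carr (ms_fibre H \<phi> s). \<forall>x'\<in>carr (ms_fibre H \<phi> s').
        m (s, 0) (s', 0) (inE H \<phi> \<theta> s x) (inE H \<phi> \<theta> s' x') = inE H \<phi> \<theta> (s + s') (ms_mult H \<phi> s s' x x')"
      using tp[unfolded two_param_product_system_def] by (elim conjE)
    then show "m (s, 0) (s', 0) (inE H \<phi> \<theta> s x) (inE H \<phi> \<theta> s' x') = inE H \<phi> \<theta> (s + s') (ms_mult H \<phi> s s' x x')"
      if "s \<ge> 0" "s' \<ge> 0" "x \<in> carr (ms_fibre H \<phi> s)" "x' \<in> carr (ms_fibre H \<phi> s')" for s s' x x'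
      using that by simp
    have "\<forall>p\<in>Rplus2. \<forall>\<xi>\<in>carr (fibre2 H \<phi> \<theta> p). compr H K J (V p \<xi>) = T p \<xi>"
      using mid[unfolded minimal_isometric_dilation_def] by (elim conjE)
    then show "compr H K J (V p \<xi>) = T p \<xi>" if "p \<in> Rplus2" "\<xi> \<in> carr (fibre2 H \<phi> \<theta> p)" for p \<xi>
      using that by (blast dest: bspec)
    show "ps_representation Rplus2 (fibre2 H \<phi> \<theta>) ?e m K V"
      using mid[unfolded minimal_isometric_dilation_def] by (elim conjE)
    show "rep_isometric Rplus2 (fibre2 H \<phi> \<theta>) K V"
      using mid[unfolded minimal_isometric_dilation_def] by (elim conjE)
  qed
  interpret cocycle_setup H K J \<phi> \<theta> \<alpha> \<beta> h0 m T V ?e G J' \<sigma>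
    by (intro cocycle_setup.intro cocycle_setup_axioms.intro P.product_dilation_axioms D.minimal_dilation_axioms
        hH hK assms(6))
  show ?thesis by (rule alpha_cocycle_conjugate_sigma)
qed

end
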